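(* Let $\Omega\subset\mathbb{R}^n$ be open and bounded, $m>n$, $1<p<\infty$, $Y^m=[0,1)^m$, and let $\mathbf{R}\in\mathbb{R}^{m\times n}$ satisfy $\mathbf{R}^*k\neq0$ for all $k\in\mathbb{Z}^m\setminus\{0\}$. Then a function $v\in L^p(\Omega\times Y^m;\mathbb{R}^n)$ is the $\mathbf{R}$-two-scale limit of a sequence $\{\nabla v_\varepsilon\}_\varepsilon$ with $\{v_\varepsilon\}_\varepsilon$ bounded in $W^{1,p}(\Omega)$ if and only if there exist $v_0\in W^{1,p}(\Omega)$ and $v_1\in L^p(\Omega;\mathcal{G}^p_{\mathbf{R}})$ such that $v=\nabla v_0+v_1$, where $$\mathcal{G}^p_{\mathbf{R}}:=\{w\in L^p_\#(Y^m;\mathbb{R}^n):\ \hat w_k=\lambda_k\mathbf{R}^*k\ \text{for all } k\in\mathbb{Z}^m, \text{ for some } \{\lambda_k\}_{k\in\mathbb{Z}^m}\subset\mathbb{C} \text{ with } \lambda_0=0\},$$ with $\hat w_k:=\int_{Y^m}w(y)e^{-2\pi i k\cdot y}\,dy$.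
   Context: $\varepsilon$ ranges over a sequence of positive numbers converging to $0$. $L^p_\#(Y^m;\mathbb{R}^n)$ denotes the $Y^m$-periodic functions in $L^p_{\rm loc}(\mathbb{R}^m;\mathbb{R}^n)$; $C_\#(Y^m;\mathbb{R}^n)$ the continuous $Y^m$-periodic ones. A sequence $\{u_\varepsilon\}\subset L^p(\Omega;\mathbb{R}^n)$ $\mathbf{R}$-two-scale converges to $u\in L^p(\Omega\times Y^m;\mathbb{R}^n)$ if for all $\varphi\in L^{p'}(\Omega;C_\#(Y^m;\mathbb{R}^n))$ ($p'=p/(p-1)$), $\lim_{\varepsilon\to0^+}\int_\Omega u_\varepsilon(x)\cdot\varphi(x,\mathbf{R}x/\varepsilon)\,dx=\int_\Omega\int_{Y^m}u(x,y)\cdot\varphi(x,y)\,dy\,dx$ (here $\mathcal{L}^m(Y^m)=1$). *)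

theory Defs
  imports "HOL-Analysis.Analysis"
begin

definition int_vec :: "real^'m \<Rightarrow> bool" where
  "int_vec k \<longleftrightarrow> (\<forall>i. k $ i \<in> \<int>)"

definition unit_cell :: "(real^'m) set" where
  "unit_cell = {y. \<forall>i. 0 \<le> y $ i \<and> y $ i < 1}"

definition periodic_cell :: "(real^'m \<Rightarrow> 'b) \<Rightarrow> bool" where
  "periodic_cell w \<longleftrightarrow> (\<forall>y k. int_vec k \<longrightarrow> w (y + k) = w y)"

definition Lp_fun :: "'a measure \<Rightarrow> real \<Rightarrow> ('a \<Rightarrow> 'b::real_normed_vector) \<Rightarrow> bool" where
  "Lp_fun M p f \<longleftrightarrow> f \<in> borel_measurable M \<and> integrable M (\<lambda>x. norm (f x) powr p)"

definition partial_deriv :: "'n \<Rightarrow> (real^'n \<Rightarrow> real) \<Rightarrow> real^'n \<Rightarrow> real" where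
  "partial_deriv i f x = frechet_derivative f (at x) (axis i 1)"

fun iter_partial :: "'n list \<Rightarrow> (real^'n \<Rightarrow> real) \<Rightarrow> real^'n \<Rightarrow> real" where
  "iter_partial [] f = f"
| "iter_partial (i # is) f = partial_deriv i (iter_partial is f)"

definition smooth_fun :: "(real^'n \<Rightarrow> real) \<Rightarrow> bool" where
  "smooth_fun f \<longleftrightarrow> (\<forall>is x. iter_partial is f differentiable (at x))"

definition test_fun :: "(real^'n) set \<Rightarrow> (real^'n \<Rightarrow> real) \<Rightarrow> bool" where
  "test_fun \<Omega> \<phi> \<longleftrightarrow> smooth_fun \<phi> \<and> compact (closure {x. \<phi> x \<noteq> 0})
      \<and> closure {x. \<phi> x \<noteq> 0} \<subseteq> \<Omega>"

definition locally_integrable_on :: "(real^'n) set \<Rightarrow> (real^'n \<Rightarrow> 'b::{banach,second_countable_topology}) \<Rightarrow> bool" where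
  "locally_integrable_on \<Omega> f \<longleftrightarrow> (\<forall>K. compact K \<and> K \<subseteq> \<Omega> \<longrightarrow> integrable (lebesgue_on K) f)"

definition weak_gradient :: "(real^'n) set \<Rightarrow> (real^'n \<Rightarrow> real) \<Rightarrow> (real^'n \<Rightarrow> real^'n) \<Rightarrow> bool" where
  "weak_gradient \<Omega> u g \<longleftrightarrow> locally_integrable_on \<Omega> u \<and> locally_integrable_on \<Omega> g \<and>
     (\<forall>i \<phi>. test_fun \<Omega> \<phi> \<longrightarrow>
        (LINT x|lebesgue_on \<Omega>. u x * partial_deriv i \<phi> x) = - (LINT x|lebesgue_on \<Omega>. g x $ i * \<phi> x))"

definition W1p :: "(real^'n) set \<Rightarrow> real \<Rightarrow> (real^'n \<Rightarrow> real) \<Rightarrow> (real^'n \<Rightarrow> real^'n) \<Rightarrow> bool" where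
  "W1p \<Omega> p u g \<longleftrightarrow> Lp_fun (lebesgue_on \<Omega>) p u \<and> Lp_fun (lebesgue_on \<Omega>) p g \<and> weak_gradient \<Omega> u g"

definition W1p_norm_pow :: "(real^'n) set \<Rightarrow> real \<Rightarrow> (real^'n \<Rightarrow> real) \<Rightarrow> (real^'n \<Rightarrow> real^'n) \<Rightarrow> real" where
  "W1p_norm_pow \<Omega> p u g = (LINT x|lebesgue_on \<Omega>. \<bar>u x\<bar> powr p) + (LINT x|lebesgue_on \<Omega>. norm (g x) powr p)"

text \<open>Admissible test functions: L^{p'}(Omega; C_#(Y^m;R^n)), with C_# realised inside the
  Banach space of bounded continuous functions (sup norm).\<close>
definition two_scale_test :: "(real^'n) set \<Rightarrow> real \<Rightarrow> (real^'n \<Rightarrow> ((real^'m) \<Rightarrow>\<^sub>C (real^'n))) \<Rightarrow> bool" where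
  "two_scale_test \<Omega> q \<phi> \<longleftrightarrow> (\<forall>x. periodic_cell (apply_bcontfun (\<phi> x))) \<and> Lp_fun (lebesgue_on \<Omega>) q \<phi>"

definition R_two_scale_conv ::
  "(real^'n) set \<Rightarrow> real \<Rightarrow> real^'n^'m \<Rightarrow> (nat \<Rightarrow> real) \<Rightarrow> (nat \<Rightarrow> real^'n \<Rightarrow> real^'n)
     \<Rightarrow> (real^'n \<Rightarrow> real^'m \<Rightarrow> real^'n) \<Rightarrow> bool" where
  "R_two_scale_conv \<Omega> p R eps u v \<longleftrightarrow>
     (\<forall>\<phi>. two_scale_test \<Omega> (p / (p - 1)) \<phi> \<longrightarrow>
        (\<lambda>j. LINT x|lebesgue_on \<Omega>. u j x \<bullet> apply_bcontfun (\<phi> x) ((1 / eps j) *\<^sub>R (R *v x)))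
        \<longlonglongrightarrow> (LINT x|lebesgue_on \<Omega>. (LINT y|lebesgue_on unit_cell. v x y \<bullet> apply_bcontfun (\<phi> x) y)))"

definition fourier_coeff :: "(real^'m \<Rightarrow> real^'n) \<Rightarrow> real^'m \<Rightarrow> complex^'n" where
  "fourier_coeff w k = (\<chi> i. LINT y|lebesgue_on unit_cell.
      complex_of_real (w y $ i) * exp (- (2 * pi * \<i>) * complex_of_real (k \<bullet> y)))"

definition G_R :: "real \<Rightarrow> real^'n^'m \<Rightarrow> (real^'m \<Rightarrow> real^'n) set" where
  "G_R p R = {w. periodic_cell w \<and> w \<in> borel_measurable lebesgue \<and>
                 Lp_fun (lebesgue_on unit_cell) p w \<and>
                 (\<exists>lam::real^'m \<Rightarrow> complex. lam 0 = 0 \<and>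
                    (\<forall>k. int_vec k \<longrightarrow>
                       fourier_coeff w k = (\<chi> i. lam k * complex_of_real ((transpose R *v k) $ i))))}"

end

theory Submission
  imports Defs
begin

text \<open>
Necessity. Let \<open>v\<close> be the two-scale limit of the gradients and \<open>g0\<close> its mean over the cell. The
functions have convex combinations that converge in \<open>L\<^sup>1\<close>, so \<open>g0\<close> is the weak gradient of some
\<open>v\<^sub>0\<close>. For an integer vector \<open>k \<noteq> 0\<close> and a direction \<open>\<xi>\<close> orthogonal to \<open>R\<^sup>* k\<close>, testing with
\<open>\<eta>(x) e\<^sup>i\<^sup>\<theta> \<xi>\<close>, \<open>\<theta> = 2\<pi> k \<cdot> R x / \<epsilon>\<close>, and integrating by parts never differentiates
the phase; since the undifferentiated functions have no oscillating part in the limit (\<open>R\<^sup>* k \<noteq> 0\<close>),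
the \<open>k\<close>-th Fourier coefficient of \<open>v(x, \<cdot>)\<close> is orthogonal to \<open>\<xi>\<close>, hence parallel to \<open>R\<^sup>* k\<close>.

Sufficiency. Convolving \<open>v\<^sub>1(x, \<cdot>)\<close> with a trigonometric approximate identity and replacing the
coefficients by test functions of \<open>x\<close> approximates \<open>v\<^sub>1\<close> by finite sums of modes
\<open>\<lambda>\<^sub>k(x) R\<^sup>* k e\<^sup>i\<^sup>\<theta>\<close>. Each is, up to \<open>O(\<epsilon>)\<close>, the gradient of the potential
\<open>\<epsilon> \<lambda>\<^sub>k(x) e\<^sup>i\<^sup>\<theta> / (2\<pi>i)\<close>. As \<open>R\<^sup>* k \<noteq> 0\<close> for integer \<open>k \<noteq> 0\<close>, the Riemann-Lebesgue lemma
yields the mean value property for quasi-periodic oscillations, which identifies the two-scale limit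
of these gradients and bounds their \<open>L\<^sup>p\<close> norms; a diagonal choice of the approximation concludes.
\<close>

subsection \<open>Smooth functions and test functions\<close>

text \<open>Three obstacles shape the proof. Test fields are only measurable in \<open>x\<close> and
  continuous in the fast variable, so the mean value property is needed for Caratheodory integrands.
  It is reduced to single Fourier modes by convolution in \<open>y\<close>. Partial Fourier sums of
  continuous functions need not converge uniformly; the kernels are therefore nonnegative with
  integral one. Such a convolution contracts \<open>L^p\<close>, converges uniformly on continuous
  periodic functions, and still acts on each mode separately, so that the constraint in
  \<open>G_R\<close> survives it. Next, one diagonal sequence must serve all test fields. It is
  selected by \<open>L^p\<close> distances between gradients, never by testing; Young's inequality
  with a free parameter turns these distances into bounds for the pairings. Finally, fields on the
  product set are given up to Lebesgue null sets. A Borel representative vanishing off this set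
  gives meaning to slices and iterated integrals. Fourier analysis is done in real form, with cosine
  and sine moments in place of complex coefficients.\<close>

lemma smooth_fun_partial_deriv:
  assumes "smooth_fun f"
  shows "smooth_fun (partial_deriv i f)"
proof -
  have "iter_partial is (partial_deriv i f) = iter_partial (is @ [i]) f" for "is"
    by (induction "is") auto
  then show ?thesis using assms unfolding smooth_fun_def by metis
qed

lemma smooth_fun_differentiable: "smooth_fun f \<Longrightarrow> f differentiable (at x)"
  unfolding smooth_fun_def by (metis iter_partial.simps(1))

text \<open>Iterated derivatives are chains of single ones, so any invariant that implies
  differentiability and survives one derivative suffices; no formula for higher derivatives
  enters.\<close>

lemma smooth_fun_coinduct:
  assumes f: "P f"
    and diff: "\<And>g x. P g \<Longrightarrow> g differentiable (at x)"
    and step: "\<And>g i. P g \<Longrightarrow> P (partial_deriv i g)"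
  shows "smooth_fun f"
proof -
  have "P (iter_partial is f)" for "is"
    by (induction "is") (auto simp: f step)
  then show ?thesis unfolding smooth_fun_def using diff by blast
qed

lemma partial_derivI:
  assumes "(f has_derivative f') (at x)"
  shows "partial_deriv i f x = f' (axis i 1)"
  unfolding partial_deriv_def using frechet_derivative_at[OF assms] by simp

text \<open>The functions \<open>exp_tail k\<close> for varying \<open>k\<close> span a space closed under differentiation,
  which makes \<open>exp_tail 0\<close> smooth.\<close>

definition exp_tail :: "nat \<Rightarrow> real \<Rightarrow> real" where
  "exp_tail k t = (if t > 0 then exp (- 1 / t) / t ^ k else 0)"

lemma exp_tail_tendsto_0: "(exp_tail k \<longlongrightarrow> 0) (at 0)"
proof -
  have "((\<lambda>t. (inverse t) ^ k / exp (inverse t)) \<longlongrightarrow> (0::real)) (at_right 0)"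
    by (rule filterlim_compose[OF tendsto_power_div_exp_0 filterlim_inverse_at_top_right])
  then have "(exp_tail k \<longlongrightarrow> 0) (at_right 0)"
    by (rule Lim_transform_eventually)
       (auto simp: eventually_at_filter exp_tail_def field_simps exp_minus power_inverse)
  moreover have "(exp_tail k \<longlongrightarrow> 0) (at_left 0)"
    by (rule tendsto_eventually) (auto simp: eventually_at_filter exp_tail_def)
  ultimately show ?thesis by (simp add: filterlim_split_at)
qed

lemma exp_tail_has_derivative:
  "(exp_tail k has_real_derivative (exp_tail (k+2) t - real k * exp_tail (Suc k) t)) (at t)"
proof (cases "t > 0" "t = 0" rule: bool.exhaust[case_product bool.exhaust])
  case True_False
  have "((\<lambda>t. exp (- 1 / t) / t ^ k) has_real_derivative (exp_tail (k+2) t - real k * exp_tail (Suc k) t)) (at t)"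
    using True_False
    apply (auto intro!: derivative_eq_intros simp: exp_tail_def field_simps power2_eq_square)
    apply (cases k; simp add: field_simps)
    done
  moreover have "\<forall>\<^sub>F s in nhds t. exp_tail k s = exp (- 1 / s) / s ^ k"
    using True_False eventually_nhds_in_open[of "{0<..}" t] by (auto simp: exp_tail_def elim: eventually_mono)
  ultimately show ?thesis by (subst DERIV_cong_ev[OF refl _ refl])
next
  case False_True
  have "((\<lambda>h. exp_tail (Suc k) h) \<longlongrightarrow> 0) (at 0)" by (rule exp_tail_tendsto_0)
  \<comment> \<open>For \<open>h \<noteq> 0\<close> the difference quotient at 0 is
    \<open>exp_tail (Suc k) h\<close> itself: dividing by \<open>h\<close> raises the power in the
    denominator by one.\<close>
  then have "((\<lambda>h. (exp_tail k (0 + h) - exp_tail k 0) / h) \<longlongrightarrow> 0) (at 0)"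
    by (rule Lim_transform_eventually) (auto simp: eventually_at_filter exp_tail_def)
  then show ?thesis using False_True by (simp add: DERIV_def exp_tail_def)
next
  case False_False
  then have "t < 0" by simp
  have "((\<lambda>t. 0::real) has_real_derivative 0) (at t)" by simp
  moreover have "\<forall>\<^sub>F s in nhds t. exp_tail k s = 0"
    using \<open>t < 0\<close> eventually_nhds_in_open[of "{..<0}" t] by (auto simp: exp_tail_def elim: eventually_mono)
  ultimately have "(exp_tail k has_real_derivative 0) (at t)"
    by (subst DERIV_cong_ev[OF refl _ refl])
  then show ?thesis using \<open>t < 0\<close> by (simp add: exp_tail_def)
qed auto

text \<open>The rule \<open>base\<close> admits arbitrary smooth functions, so that a single
  induction yields both the smoothness of the explicit generators and the closure of smooth
  functions under sums and products. The generator \<open>tail\<close> carries every index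
  \<open>k\<close>, because differentiating a tail produces tails of higher index.\<close>

inductive smooth_alg :: "(real^'n \<Rightarrow> real) \<Rightarrow> bool" where
  base: "smooth_fun f \<Longrightarrow> smooth_alg f"
| const: "smooth_alg (\<lambda>x. c)"
| tail: "smooth_alg (\<lambda>x. exp_tail k (c * x $ i + d))"
| cos: "smooth_alg (\<lambda>x. cos (r \<bullet> x))"
| sin: "smooth_alg (\<lambda>x. sin (r \<bullet> x))"
| add: "smooth_alg f \<Longrightarrow> smooth_alg g \<Longrightarrow> smooth_alg (\<lambda>x. f x + g x)"
| mult: "smooth_alg f \<Longrightarrow> smooth_alg g \<Longrightarrow> smooth_alg (\<lambda>x. f x * g x)"

lemma exp_tail_coord_has_derivative:
  fixes x :: "real^'n"
  shows "((\<lambda>x. exp_tail k (c * x $ i + d)) has_derivative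
     (\<lambda>h. (exp_tail (k+2) (c * x $ i + d) - real k * exp_tail (Suc k) (c * x $ i + d)) * (c * h $ i))) (at x)"
proof -
  have "((\<lambda>x. c * x $ i + d) has_derivative (\<lambda>h. c * h $ i)) (at x)"
    by (auto intro!: derivative_eq_intros bounded_linear.has_derivative[OF bounded_linear_vec_nth])
  then show ?thesis
    using exp_tail_has_derivative[of k "c * x $ i + d", unfolded has_field_derivative_def]
    using has_derivative_compose by fastforce
qed

lemma smooth_alg_step:
  fixes f :: "real^'n \<Rightarrow> real"
  assumes "smooth_alg f"
  shows "(\<forall>x. f differentiable (at x)) \<and> (\<forall>i. smooth_alg (partial_deriv i f))"
  using assms
proof (induction)
  case (base f)
  then show ?case using smooth_fun_differentiable smooth_fun_partial_deriv smooth_alg.base by blast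
next
  case (const c)
  have "partial_deriv i (\<lambda>x::real^'n. c) = (\<lambda>x. 0)" for i
    by (rule ext, subst partial_derivI[of _ "\<lambda>h. 0"]) auto
  then show ?case using smooth_alg.const by auto
next
  case (tail k c i d)
  let ?f = "\<lambda>x::real^'n. exp_tail k (c * x $ i + d)"
  have "partial_deriv j ?f = (\<lambda>x. (exp_tail (k+2) (c * x $ i + d) + (- real k) * exp_tail (Suc k) (c * x $ i + d)) * (c * axis j 1 $ i))" for j
    by (rule ext, subst partial_derivI[OF exp_tail_coord_has_derivative]) simp
  moreover have "smooth_alg (\<lambda>x::real^'n. (exp_tail (k+2) (c * x $ i + d) + (- real k) * exp_tail (Suc k) (c * x $ i + d)) * (c * axis j 1 $ i))" for j :: 'n
    by (intro smooth_alg.intros)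
  moreover have "?f differentiable (at x)" for x
    using exp_tail_coord_has_derivative differentiableI by blast
  ultimately show ?case by (simp only: simp_thms)
next
  case (cos r)
  have d: "((\<lambda>x. cos (r \<bullet> x)) has_derivative (\<lambda>h. - sin (r \<bullet> x) * (r \<bullet> h))) (at x)" for x
    by (auto intro!: derivative_eq_intros)
  have "partial_deriv j (\<lambda>x. cos (r \<bullet> x)) = (\<lambda>x. sin (r \<bullet> x) * (- r $ j))" for j
    by (rule ext, subst partial_derivI[OF d]) (simp add: inner_axis)
  moreover have "smooth_alg (\<lambda>x. sin (r \<bullet> x) * (- r $ j))" for j
    by (intro smooth_alg.intros)
  moreover have "(\<lambda>x. cos (r \<bullet> x)) differentiable (at x)" for x
    using d differentiableI by blast
  ultimately show ?case by (simp only: simp_thms)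
next
  case (sin r)
  have d: "((\<lambda>x. sin (r \<bullet> x)) has_derivative (\<lambda>h. cos (r \<bullet> x) * (r \<bullet> h))) (at x)" for x
    by (auto intro!: derivative_eq_intros)
  have "partial_deriv j (\<lambda>x. sin (r \<bullet> x)) = (\<lambda>x. cos (r \<bullet> x) * (r $ j))" for j
    by (rule ext, subst partial_derivI[OF d]) (simp add: inner_axis)
  moreover have "smooth_alg (\<lambda>x. cos (r \<bullet> x) * (r $ j))" for j
    by (intro smooth_alg.intros)
  moreover have "(\<lambda>x. sin (r \<bullet> x)) differentiable (at x)" for x
    using d differentiableI by blast
  ultimately show ?case by (simp only: simp_thms)
next
  case (add f g)
  have "partial_deriv j (\<lambda>x. f x + g x) = (\<lambda>x. partial_deriv j f x + partial_deriv j g x)" for j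
  proof
    fix x
    obtain f' g' where "(f has_derivative f') (at x)" "(g has_derivative g') (at x)"
      using add.IH unfolding differentiable_def by blast
    then show "partial_deriv j (\<lambda>x. f x + g x) x = partial_deriv j f x + partial_deriv j g x"
      by (auto simp: partial_derivI partial_derivI[OF has_derivative_add])
  qed
  moreover have "smooth_alg (\<lambda>x. partial_deriv j f x + partial_deriv j g x)" for j
    using add by (auto intro!: smooth_alg.add)
  ultimately show ?case using add by (auto intro: differentiable_add)
next
  case (mult f g)
  have "partial_deriv j (\<lambda>x. f x * g x) = (\<lambda>x. f x * partial_deriv j g x + partial_deriv j f x * g x)" for j
  proof
    fix x
    obtain f' g' where "(f has_derivative f') (at x)" "(g has_derivative g') (at x)"
      using mult.IH unfolding differentiable_def by blast
    then show "partial_deriv j (\<lambda>x. f x * g x) x = f x * partial_deriv j g x + partial_deriv j f x * g x"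
      by (auto simp: partial_derivI partial_derivI[OF has_derivative_mult])
  qed
  moreover have "smooth_alg (\<lambda>x. f x * partial_deriv j g x + partial_deriv j f x * g x)" for j
    using mult by (auto intro!: smooth_alg.add smooth_alg.mult)
  ultimately show ?case using mult by (auto intro: differentiable_mult)
qed

lemma smooth_alg_imp_smooth_fun: "smooth_alg f \<Longrightarrow> smooth_fun f"
  by (rule smooth_fun_coinduct[where P = smooth_alg]) (use smooth_alg_step in blast)+

lemma smooth_fun_const: "smooth_fun (\<lambda>x. c)"
  by (intro smooth_alg_imp_smooth_fun smooth_alg.const)

lemma smooth_fun_exp_tail: "smooth_fun (\<lambda>x. exp_tail k (c * x $ i + d))"
  by (intro smooth_alg_imp_smooth_fun smooth_alg.tail)

lemma smooth_fun_cos: "smooth_fun (\<lambda>x. cos (r \<bullet> x))"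
  by (intro smooth_alg_imp_smooth_fun smooth_alg.cos)

lemma smooth_fun_sin: "smooth_fun (\<lambda>x. sin (r \<bullet> x))"
  by (intro smooth_alg_imp_smooth_fun smooth_alg.sin)

lemma smooth_fun_add: "smooth_fun f \<Longrightarrow> smooth_fun g \<Longrightarrow> smooth_fun (\<lambda>x. f x + g x)"
  by (simp add: smooth_alg_imp_smooth_fun smooth_alg.add smooth_alg.base)

lemma smooth_fun_mult: "smooth_fun f \<Longrightarrow> smooth_fun g \<Longrightarrow> smooth_fun (\<lambda>x. f x * g x)"
  by (simp add: smooth_alg_imp_smooth_fun smooth_alg.mult smooth_alg.base)

lemma smooth_fun_cmult: "smooth_fun f \<Longrightarrow> smooth_fun (\<lambda>x. c * f x)"
  by (intro smooth_fun_mult smooth_fun_const)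

lemma smooth_fun_diff: "smooth_fun f \<Longrightarrow> smooth_fun g \<Longrightarrow> smooth_fun (\<lambda>x. f x - g x)"
  using smooth_fun_add[OF _ smooth_fun_cmult[of g "-1"], of f] by simp

lemma smooth_fun_prod: "(\<And>i. i \<in> A \<Longrightarrow> smooth_fun (f i)) \<Longrightarrow> smooth_fun (\<lambda>x. \<Prod>i\<in>A. f i x)"
  by (induction A rule: infinite_finite_induct) (auto intro: smooth_fun_const smooth_fun_mult)

lemma smooth_fun_continuous_on: "smooth_fun f \<Longrightarrow> continuous_on S f"
  by (meson differentiable_imp_continuous_within continuous_at_imp_continuous_on smooth_fun_differentiable)

lemma smooth_fun_measurable: "smooth_fun f \<Longrightarrow> f \<in> borel_measurable borel"
  by (intro borel_measurable_continuous_onI smooth_fun_continuous_on)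

lemma partial_deriv_add:
  assumes "smooth_fun f" "smooth_fun g"
  shows "partial_deriv i (\<lambda>x. f x + g x) x = partial_deriv i f x + partial_deriv i g x"
proof -
  obtain f' g' where "(f has_derivative f') (at x)" "(g has_derivative g') (at x)"
    using assms smooth_fun_differentiable unfolding differentiable_def by metis
  then show ?thesis by (auto simp: partial_derivI partial_derivI[OF has_derivative_add])
qed

lemma partial_deriv_mult:
  assumes "smooth_fun f" "smooth_fun g"
  shows "partial_deriv i (\<lambda>x. f x * g x) x = f x * partial_deriv i g x + partial_deriv i f x * g x"
proof -
  obtain f' g' where "(f has_derivative f') (at x)" "(g has_derivative g') (at x)"
    using assms smooth_fun_differentiable unfolding differentiable_def by metis
  then show ?thesis by (auto simp: partial_derivI partial_derivI[OF has_derivative_mult])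
qed

lemma partial_deriv_const: "partial_deriv i (\<lambda>x. c) x = 0"
  by (subst partial_derivI[of _ "\<lambda>h. 0"]) auto

lemma partial_deriv_cmult:
  "smooth_fun f \<Longrightarrow> partial_deriv i (\<lambda>x. c * f x) x = c * partial_deriv i f x"
  by (simp add: partial_deriv_mult smooth_fun_const partial_deriv_const)

lemma partial_deriv_cos: "partial_deriv i (\<lambda>x. cos (r \<bullet> x)) x = - sin (r \<bullet> x) * r $ i"
proof -
  have "((\<lambda>x. cos (r \<bullet> x)) has_derivative (\<lambda>h. - sin (r \<bullet> x) * (r \<bullet> h))) (at x)"
    by (auto intro!: derivative_eq_intros)
  from partial_derivI[OF this] show ?thesis by (simp add: inner_axis)
qed

lemma partial_deriv_sin: "partial_deriv i (\<lambda>x. sin (r \<bullet> x)) x = cos (r \<bullet> x) * r $ i"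
proof -
  have "((\<lambda>x. sin (r \<bullet> x)) has_derivative (\<lambda>h. cos (r \<bullet> x) * (r \<bullet> h))) (at x)"
    by (auto intro!: derivative_eq_intros)
  from partial_derivI[OF this] show ?thesis by (simp add: inner_axis)
qed

lemma partial_deriv_eq_0_outside_support:
  assumes "x \<notin> closure {x. \<phi> x \<noteq> 0}"
  shows "partial_deriv i \<phi> x = 0"
proof -
  have "((\<lambda>x. 0) has_derivative (\<lambda>h. 0)) (at x)" by simp
  moreover have "\<forall>\<^sub>F y in nhds x. y \<in> - closure {x. \<phi> x \<noteq> 0}"
    using assms by (intro eventually_nhds_in_open) auto
  then have "\<forall>\<^sub>F y in nhds x. 0 = \<phi> y"
    by (rule eventually_mono) (use subsetD[OF closure_subset, of _ "{x. \<phi> x \<noteq> 0}"] in auto)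
  ultimately have "(\<phi> has_derivative (\<lambda>h. 0)) (at x)"
    by (intro has_derivative_transform_eventually[of "\<lambda>x. 0" "\<lambda>h. 0" x UNIV \<phi>])
       (auto simp: eventually_nhds_conv_at)
  from partial_derivI[OF this] show ?thesis .
qed

lemma test_funD:
  assumes "test_fun \<Omega> \<phi>"
  shows "smooth_fun \<phi>" "x \<notin> \<Omega> \<Longrightarrow> \<phi> x = 0" "x \<notin> \<Omega> \<Longrightarrow> partial_deriv i \<phi> x = 0"
proof -
  have a: "smooth_fun \<phi>" and b: "closure {x. \<phi> x \<noteq> 0} \<subseteq> \<Omega>"
    using assms unfolding test_fun_def by auto
  show "smooth_fun \<phi>" by (rule a)
  show "\<phi> x = 0" if "x \<notin> \<Omega>"
    using that subsetD[OF closure_subset, of x "{x. \<phi> x \<noteq> 0}"] subsetD[OF b, of x] by auto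
  show "partial_deriv i \<phi> x = 0" if "x \<notin> \<Omega>"
    by (rule partial_deriv_eq_0_outside_support) (use that b in auto)
qed

text \<open>Spares the computation of exact supports: the support is a closed subset of any compact
  set off which the function vanishes.\<close>

lemma test_fun_closed_support:
  assumes "smooth_fun \<phi>" "compact K" "K \<subseteq> \<Omega>" "\<And>x. x \<notin> K \<Longrightarrow> \<phi> x = 0"
  shows "test_fun \<Omega> \<phi>"
proof -
  have "closure {x. \<phi> x \<noteq> 0} \<subseteq> K"
    using assms by (intro closure_minimal) (auto intro: compact_imp_closed)
  moreover have "compact (K \<inter> closure {x. \<phi> x \<noteq> 0})"
    using assms by (intro compact_Int_closed) auto
  ultimately show ?thesis using assms unfolding test_fun_def by (simp add: inf.absorb2)
qed

lemma test_fun_obtain_compact: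
  assumes "test_fun \<Omega> \<phi>"
  obtains K where "compact K" "K \<subseteq> \<Omega>" "\<And>x. x \<notin> K \<Longrightarrow> \<phi> x = 0"
proof (rule that[of "closure {x. \<phi> x \<noteq> 0}"])
  show "\<phi> x = 0" if "x \<notin> closure {x. \<phi> x \<noteq> 0}" for x
    using that subsetD[OF closure_subset, of x "{x. \<phi> x \<noteq> 0}"] by auto
qed (use assms in \<open>auto simp: test_fun_def\<close>)

lemma test_fun_mult_smooth:
  assumes "test_fun \<Omega> \<phi>" "smooth_fun f"
  shows "test_fun \<Omega> (\<lambda>x. f x * \<phi> x)"
proof -
  obtain K where "compact K" "K \<subseteq> \<Omega>" "\<And>x. x \<notin> K \<Longrightarrow> \<phi> x = 0"
    using test_fun_obtain_compact[OF assms(1)] by metis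
  then show ?thesis
    using smooth_fun_mult[OF assms(2) test_funD(1)[OF assms(1)]]
    by (intro test_fun_closed_support[of _ K]) auto
qed

lemma test_fun_add:
  assumes "test_fun \<Omega> \<phi>" "test_fun \<Omega> \<psi>"
  shows "test_fun \<Omega> (\<lambda>x. \<phi> x + \<psi> x)"
proof -
  obtain K L where "compact K" "K \<subseteq> \<Omega>" "\<And>x. x \<notin> K \<Longrightarrow> \<phi> x = 0"
    "compact L" "L \<subseteq> \<Omega>" "\<And>x. x \<notin> L \<Longrightarrow> \<psi> x = 0"
    using test_fun_obtain_compact assms by metis
  then show ?thesis
    using smooth_fun_add[OF test_funD(1)[OF assms(1)] test_funD(1)[OF assms(2)]]
    by (intro test_fun_closed_support[of _ "K \<union> L"]) auto
qed

lemma test_fun_partial_deriv: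
  assumes "test_fun \<Omega> \<phi>"
  shows "test_fun \<Omega> (partial_deriv i \<phi>)"
  using assms
  by (intro test_fun_closed_support[of _ "closure {x. \<phi> x \<noteq> 0}"] smooth_fun_partial_deriv)
     (auto simp: test_fun_def partial_deriv_eq_0_outside_support)

lemma test_fun_0: "test_fun \<Omega> (\<lambda>x. 0)"
  by (intro test_fun_closed_support[of _ "{}"] smooth_fun_const) auto

lemma test_fun_bounded:
  assumes "test_fun \<Omega> \<phi>"
  obtains B where "B > 0" "\<And>x. \<bar>\<phi> x\<bar> \<le> B"
proof -
  obtain K where K: "compact K" "K \<subseteq> \<Omega>" "\<And>x. x \<notin> K \<Longrightarrow> \<phi> x = 0"
    using test_fun_obtain_compact assms by metis
  have "compact (\<phi> ` K)"
    using K assms by (intro compact_continuous_image smooth_fun_continuous_on test_funD(1))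
  then obtain B where B: "B > 0" "\<And>x. x \<in> K \<Longrightarrow> \<bar>\<phi> x\<bar> \<le> B"
    using compact_imp_bounded bounded_pos by (metis imageI real_norm_def)
  show thesis by (rule that[of B]) (use B K in \<open>metis abs_zero less_imp_le\<close>)+
qed

lemma test_fun_integrable:
  assumes "test_fun \<Omega> \<phi>"
  shows "integrable lborel \<phi>"
proof -
  obtain K where K: "compact K" "K \<subseteq> \<Omega>" "\<And>x. x \<notin> K \<Longrightarrow> \<phi> x = 0"
    using test_fun_obtain_compact assms by metis
  have "integrable lborel (\<lambda>x. indicator K x *\<^sub>R \<phi> x)"
    using borel_integrable_compact[OF K(1) smooth_fun_continuous_on[OF test_funD(1)[OF assms]]]
    by (simp add: set_integrable_def)
  moreover have "(\<lambda>x. indicator K x *\<^sub>R \<phi> x) = \<phi>" 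
  proof
    show "indicator K x *\<^sub>R \<phi> x = \<phi> x" for x by (cases "x \<in> K") (simp_all add: K(3))
  qed
  ultimately show ?thesis by simp
qed

text \<open>The integral of a difference quotient vanishes by translation invariance.\<close>

lemma integral_partial_deriv_eq_0:
  fixes \<phi> :: "real^'n \<Rightarrow> real"
  assumes "test_fun \<Omega> \<phi>"
  shows "(LINT x|lborel. partial_deriv i \<phi> x) = 0"
proof -
  obtain K where K: "compact K" "K \<subseteq> \<Omega>" "\<And>x. x \<notin> K \<Longrightarrow> \<phi> x = 0"
    using test_fun_obtain_compact assms by metis
  obtain B where B: "B > 0" "\<And>x. \<bar>partial_deriv i \<phi> x\<bar> \<le> B"
    using test_fun_bounded[OF test_fun_partial_deriv[OF assms]] by metis
  obtain r where r: "r > 0" "K \<subseteq> cball 0 r"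
    using compact_imp_bounded[OF K(1)] bounded_subset_ballD[of K 0] ball_subset_cball by blast
  define h where "h n = 1 / real (Suc n)" for n
  have h0: "h n > 0" "h n \<le> 1" for n by (auto simp: h_def)
  define q where "q n x = (\<phi> (x + h n *\<^sub>R axis i 1) - \<phi> x) / h n" for n x
  have line: "((\<lambda>t. \<phi> (x + t *\<^sub>R axis i 1)) has_real_derivative partial_deriv i \<phi> (x + t *\<^sub>R axis i 1)) (at t)" for x t
  proof -
    obtain f' where f': "(\<phi> has_derivative f') (at (x + t *\<^sub>R axis i 1))"
      using smooth_fun_differentiable[OF test_funD(1)[OF assms]] unfolding differentiable_def by blast
    have "((\<lambda>t. x + t *\<^sub>R axis i 1) has_derivative (\<lambda>s. s *\<^sub>R axis i 1)) (at t)"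
      by (auto intro!: derivative_eq_intros)
    from has_derivative_compose[OF this f']
    have "((\<lambda>t. \<phi> (x + t *\<^sub>R axis i 1)) has_derivative (\<lambda>s. f' (s *\<^sub>R axis i 1))) (at t)" .
    moreover have "(\<lambda>s. f' (s *\<^sub>R axis i 1)) = (\<lambda>s. f' (axis i 1) * s)"
      using has_derivative_linear[OF f'] by (auto simp: linear_scale)
    ultimately show ?thesis
      by (simp add: has_field_derivative_def partial_derivI[OF f'])
  qed
  have int_shift: "integrable lborel (\<lambda>x. \<phi> (x + c))" "(LINT x|lborel. \<phi> (x + c)) = (LINT x|lborel. \<phi> x)" for c
  proof -
    have e: "lborel = distr lborel borel ((+) c)" by (rule lborel_distr_plus[symmetric])
    have "integrable (distr lborel borel ((+) c)) \<phi>" using test_fun_integrable[OF assms] e by simp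
    then show "integrable lborel (\<lambda>x. \<phi> (x + c))"
      by (subst (asm) integrable_distr_eq) (auto simp: add.commute intro: smooth_fun_measurable test_funD(1)[OF assms])
    have "(LINT x|distr lborel borel ((+) c). \<phi> x) = (LINT x|lborel. \<phi> (x + c))"
      by (subst integral_distr) (auto simp: add.commute intro: smooth_fun_measurable test_funD(1)[OF assms])
    then show "(LINT x|lborel. \<phi> (x + c)) = (LINT x|lborel. \<phi> x)" using e by metis
  qed
  have q_int: "(LINT x|lborel. q n x) = 0" for n
    unfolding q_def using int_shift test_fun_integrable[OF assms] by simp
  \<comment> \<open>Steps of length at most one keep all difference quotients supported in the ball
    enlarged by one, and there the mean value theorem bounds them by \<open>B\<close>.\<close>
  have "(\<lambda>n. LINT x|lborel. q n x) \<longlonglongrightarrow> (LINT x|lborel. partial_deriv i \<phi> x)"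
  proof (rule integral_dominated_convergence[where w = "\<lambda>x. indicator (cball 0 (r + 1)) x *\<^sub>R B"])
    show "partial_deriv i \<phi> \<in> borel_measurable lborel"
      using smooth_fun_measurable[OF smooth_fun_partial_deriv[OF test_funD(1)[OF assms]]] by simp
    show "q n \<in> borel_measurable lborel" for n
      unfolding q_def using int_shift(1)[THEN borel_measurable_integrable] test_fun_integrable[OF assms]
      by (auto intro!: borel_measurable_divide borel_measurable_diff)
    show "integrable lborel (\<lambda>x. indicator (cball (0::real^'n) (r + 1)) x *\<^sub>R B)"
      using borel_integrable_compact[of "cball (0::real^'n) (r+1)" "\<lambda>x. B"] by (simp add: set_integrable_def)
    show "AE x in lborel. (\<lambda>n. q n x) \<longlonglongrightarrow> partial_deriv i \<phi> x"
    proof (rule AE_I2)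
      fix x
      have "((\<lambda>s. (\<phi> (x + s *\<^sub>R axis i 1) - \<phi> x) / s) \<longlongrightarrow> partial_deriv i \<phi> x) (at 0)"
        using line[of x 0] by (simp add: DERIV_def)
      moreover have "filterlim h (at 0) sequentially"
        unfolding h_def using LIMSEQ_inverse_real_of_nat
        by (auto simp: filterlim_at inverse_eq_divide)
      ultimately show "(\<lambda>n. q n x) \<longlonglongrightarrow> partial_deriv i \<phi> x"
        unfolding q_def by (rule filterlim_compose)
    qed
    show "AE x in lborel. norm (q n x) \<le> indicator (cball 0 (r + 1)) x *\<^sub>R B" for n
    proof (rule AE_I2)
      fix x
      show "norm (q n x) \<le> indicator (cball 0 (r + 1)) x *\<^sub>R B"
      proof (cases "x \<in> cball 0 (r + 1)")
        case True
        have "\<exists>z>0. z < h n \<and> \<phi> (x + h n *\<^sub>R axis i 1) - \<phi> (x + 0 *\<^sub>R axis i 1) = (h n - 0) * partial_deriv i \<phi> (x + z *\<^sub>R axis i 1)"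
          using MVT2[of 0 "h n" "\<lambda>t. \<phi> (x + t *\<^sub>R axis i 1)" "\<lambda>t. partial_deriv i \<phi> (x + t *\<^sub>R axis i 1)"] line h0 by blast
        then obtain z where "q n x = partial_deriv i \<phi> (x + z *\<^sub>R axis i 1)"
          unfolding q_def using h0(1)[of n] by auto
        then show ?thesis using B True by simp
      next
        case False
        have "norm (h n *\<^sub>R axis i (1::real)) \<le> 1" using h0[of n] by simp
        then have "r < norm (x + h n *\<^sub>R axis i 1)" "r < norm x"
          using False norm_diff_ineq[of x "h n *\<^sub>R axis i 1"] by (auto simp: dist_norm)
        then have "\<phi> (x + h n *\<^sub>R axis i 1) = 0" "\<phi> x = 0"
          using r(2) by (auto intro!: K(3))
        then show ?thesis using False by (simp add: q_def)
      qed
    qed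
  qed
  then show ?thesis using q_int by (simp add: LIMSEQ_unique)
qed

subsection \<open>Integrability to a power and density of test functions\<close>

text \<open>The norm of a sum is at most twice the larger norm. The constant is not optimal, but
  only monotonicity of the power is used, which allows every \<open>p \<ge> 0\<close>.\<close>

lemma powr_norm_add_le:
  fixes a b :: "'a::real_normed_vector"
  assumes "p \<ge> 0"
  shows "norm (a + b) powr p \<le> 2 powr p * (norm a powr p + norm b powr p)"
proof -
  have "norm (a + b) \<le> 2 * max (norm a) (norm b)"
    using norm_triangle_ineq[of a b] by auto
  then have "norm (a + b) powr p \<le> (2 * max (norm a) (norm b)) powr p"
    using assms by (intro powr_mono2) auto
  also have "\<dots> = 2 powr p * max (norm a) (norm b) powr p"
    by (simp add: powr_mult)
  also have "\<dots> \<le> 2 powr p * (norm a powr p + norm b powr p)"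
    by (intro mult_left_mono) (auto simp: max_def)
  finally show ?thesis .
qed

text \<open>Takes the place of Hoelder's inequality: the parameter \<open>t\<close> makes one of the
  two terms small at the expense of the other. For \<open>t = 1\<close> the product is at most the
  first term if \<open>b \<le> a powr (p - 1)\<close> and at most the second otherwise.\<close>

lemma Young_scaled:
  fixes a b p t :: real
  assumes "a \<ge> 0" "b \<ge> 0" "p > 1" "t > 0"
  shows "a * b \<le> t powr p * a powr p + t powr - (p / (p - 1)) * b powr (p / (p - 1))"
proof -
  have base: "x * y \<le> x powr p + y powr (p / (p - 1))" if "x > 0" "y > 0" for x y
  proof (cases "y \<le> x powr (p - 1)")
    case True
    have "x * y \<le> x powr 1 * x powr (p - 1)"
      using True that by (intro mult_mono) auto
    also have "\<dots> = x powr p" by (subst powr_add[symmetric]) simp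
    finally show ?thesis using powr_ge_zero[of y "p/(p-1)"] by linarith
  next
    case False
    then have "x = (x powr (p - 1)) powr (1 / (p - 1))" using assms that by (simp add: powr_powr)
    also have "\<dots> \<le> y powr (1 / (p - 1))" using False assms by (intro powr_mono2) auto
    finally have "x * y \<le> y powr (1 / (p - 1)) * y powr 1"
      using that by (intro mult_mono) auto
    also have "\<dots> = y powr (p / (p - 1))"
      using assms by (subst powr_add[symmetric]) (simp add: field_simps)
    finally show ?thesis using powr_ge_zero[of x p] by linarith
  qed
  show ?thesis
  proof (cases "a = 0 \<or> b = 0")
    case True
    then show ?thesis by auto
  next
    case False
    have "a * b = (t * a) * (b / t)" using assms by simp
    also have "\<dots> \<le> (t * a) powr p + (b / t) powr (p / (p - 1))"
      using False assms by (intro base) auto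
    also have "\<dots> = t powr p * a powr p + t powr - (p / (p - 1)) * b powr (p / (p - 1))"
      using assms by (simp add: powr_mult powr_divide powr_minus field_simps)
    finally show ?thesis .
  qed
qed

lemma Lp_fun_measurable: "Lp_fun M p f \<Longrightarrow> f \<in> borel_measurable M"
  by (simp add: Lp_fun_def)

lemma Lp_fun_integrable: "Lp_fun M p f \<Longrightarrow> integrable M (\<lambda>x. norm (f x) powr p)"
  by (simp add: Lp_fun_def)

lemma Lp_fun_mono:
  fixes f :: "'a \<Rightarrow> 'b::real_normed_vector" and g :: "'a \<Rightarrow> 'c::real_normed_vector"
  assumes "Lp_fun M p f" "g \<in> borel_measurable M" "AE x in M. norm (g x) \<le> norm (f x)" "p \<ge> 0"
  shows "Lp_fun M p g"
  unfolding Lp_fun_def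
proof (intro conjI assms(2))
  note [measurable] = assms(2)
  show "integrable M (\<lambda>x. norm (g x) powr p)"
    by (rule Bochner_Integration.integrable_bound[OF Lp_fun_integrable[OF assms(1)]])
       (use assms in \<open>auto elim!: eventually_mono intro!: powr_mono2\<close>)
qed

lemma Lp_fun_add:
  fixes f g :: "'a \<Rightarrow> 'b::euclidean_space"
  assumes "Lp_fun M p f" "Lp_fun M p g" "p \<ge> 0"
  shows "Lp_fun M p (\<lambda>x. f x + g x)"
  unfolding Lp_fun_def
proof
  have [measurable]: "f \<in> borel_measurable M" "g \<in> borel_measurable M"
    using assms Lp_fun_measurable by auto
  show "(\<lambda>x. f x + g x) \<in> borel_measurable M" by measurable
  have "integrable M (\<lambda>x. 2 powr p * (norm (f x) powr p + norm (g x) powr p))"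
    using Lp_fun_integrable[OF assms(1)] Lp_fun_integrable[OF assms(2)] by auto
  then show "integrable M (\<lambda>x. norm (f x + g x) powr p)"
    by (rule Bochner_Integration.integrable_bound) (auto intro!: order.trans[OF powr_norm_add_le[OF assms(3)]])
qed

lemma Lp_fun_scaleR:
  fixes f :: "'a \<Rightarrow> 'b::euclidean_space"
  assumes "Lp_fun M p f"
  shows "Lp_fun M p (\<lambda>x. c *\<^sub>R f x)"
  using assms unfolding Lp_fun_def by (auto simp: powr_mult)

lemma Lp_fun_diff:
  fixes f g :: "'a \<Rightarrow> 'b::euclidean_space"
  assumes "Lp_fun M p f" "Lp_fun M p g" "p \<ge> 0"
  shows "Lp_fun M p (\<lambda>x. f x - g x)"
  using Lp_fun_add[OF assms(1) Lp_fun_scaleR[OF assms(2), of "-1"] assms(3)] by simp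

lemma integral_powr_add_le:
  fixes f g :: "'a \<Rightarrow> 'b::euclidean_space"
  assumes "Lp_fun M p f" "Lp_fun M p g" "p \<ge> 0"
  shows "(LINT x|M. norm (f x + g x) powr p) \<le>
    2 powr p * ((LINT x|M. norm (f x) powr p) + (LINT x|M. norm (g x) powr p))"
proof -
  have "(LINT x|M. norm (f x + g x) powr p) \<le> (LINT x|M. 2 powr p * (norm (f x) powr p + norm (g x) powr p))"
    by (rule integral_mono[OF Lp_fun_integrable[OF Lp_fun_add[OF assms]]])
       (use Lp_fun_integrable[OF assms(1)] Lp_fun_integrable[OF assms(2)] powr_norm_add_le[OF assms(3)] in auto)
  also have "\<dots> = 2 powr p * ((LINT x|M. norm (f x) powr p) + (LINT x|M. norm (g x) powr p))"
    using Lp_fun_integrable[OF assms(1)] Lp_fun_integrable[OF assms(2)] by auto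
  finally show ?thesis .
qed

lemma Lp_fun_bounded:
  fixes f :: "'a \<Rightarrow> 'b::real_normed_vector"
  assumes "finite_measure M" "f \<in> borel_measurable M" "\<And>x. x \<in> space M \<Longrightarrow> norm (f x) \<le> B" "p \<ge> 0"
  shows "Lp_fun M p f"
proof -
  interpret finite_measure M by fact
  note [measurable] = assms(2)
  have "integrable M (\<lambda>x. norm (f x) powr p)"
    by (rule integrable_const_bound[of _ "B powr p"]) (use assms in \<open>auto intro!: powr_mono2\<close>)
  then show ?thesis using assms by (simp add: Lp_fun_def)
qed

lemma Lp_fun_imp_integrable:
  fixes f :: "'a \<Rightarrow> 'b::euclidean_space"
  assumes "finite_measure M" "Lp_fun M p f" "p \<ge> 1"
  shows "integrable M f"
proof -
  interpret finite_measure M by fact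
  have le: "norm (f x) \<le> norm (1 + norm (f x) powr p)" for x
  proof (cases "norm (f x) \<le> 1")
    case False
    then have "norm (f x) powr 1 \<le> norm (f x) powr p" using assms by (intro powr_mono) auto
    then show ?thesis by (auto simp: powr_one_gt_zero_iff)
  qed (auto intro: order.trans[where b=1])
  have "integrable M (\<lambda>x. 1 + norm (f x) powr p)"
    using Lp_fun_integrable[OF assms(2)] by simp
  then show ?thesis
    by (rule Bochner_Integration.integrable_bound) (use le Lp_fun_measurable[OF assms(2)] in blast)+
qed

lemma Lp_fun_mult:
  fixes f :: "'a \<Rightarrow> 'b::real_normed_vector" and g :: "'a \<Rightarrow> 'c::real_normed_vector"
  assumes "Lp_fun M p f" "Lp_fun M (p / (p - 1)) g" "p > 1"
  shows "integrable M (\<lambda>x. norm (f x) * norm (g x))"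
    and "t > 0 \<Longrightarrow> (LINT x|M. norm (f x) * norm (g x)) \<le>
      t powr p * (LINT x|M. norm (f x) powr p) + t powr - (p / (p - 1)) * (LINT x|M. norm (g x) powr (p / (p - 1)))"
proof -
  have [measurable]: "f \<in> borel_measurable M" "g \<in> borel_measurable M"
    using assms Lp_fun_measurable by auto
  note I = Lp_fun_integrable[OF assms(1)] Lp_fun_integrable[OF assms(2)]
  show int: "integrable M (\<lambda>x. norm (f x) * norm (g x))"
    by (rule Bochner_Integration.integrable_bound[OF Bochner_Integration.integrable_add[OF I]])
       (use Young_scaled[of _ _ p 1] assms in auto)
  assume t: "t > 0"
  have "(LINT x|M. norm (f x) * norm (g x)) \<le>
     (LINT x|M. t powr p * norm (f x) powr p + t powr - (p / (p - 1)) * norm (g x) powr (p / (p - 1)))"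
    by (rule integral_mono[OF int]) (use I Young_scaled assms t in auto)
  then show "(LINT x|M. norm (f x) * norm (g x)) \<le>
      t powr p * (LINT x|M. norm (f x) powr p) + t powr - (p / (p - 1)) * (LINT x|M. norm (g x) powr (p / (p - 1)))"
    using I by simp
qed

lemma borel_measurable_lebesgue_onI:
  "f \<in> borel_measurable borel \<Longrightarrow> f \<in> borel_measurable (lebesgue_on S)"
  by (intro measurable_restrict_space1 measurable_completion) simp

text \<open>The notions of the theorem integrate over \<open>lebesgue_on\<close>, while translations
  and iterated integrals are handled with \<open>lborel\<close>; for Borel functions that vanish off
  the set the two agree.\<close>

lemma
  fixes f :: "'a::euclidean_space \<Rightarrow> 'b::{banach, second_countable_topology}"
  assumes "f \<in> borel_measurable borel" "S \<in> sets lebesgue" "\<And>x. x \<notin> S \<Longrightarrow> f x = 0"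
  shows integrable_lebesgue_on_iff_lborel: "integrable (lebesgue_on S) f \<longleftrightarrow> integrable lborel f"
    and integral_lebesgue_on_eq_lborel: "integral\<^sup>L (lebesgue_on S) f = integral\<^sup>L lborel f"
proof -
  have e: "(\<lambda>x. indicator S x *\<^sub>R f x) = f"
  proof
    show "indicator S x *\<^sub>R f x = f x" for x by (cases "x \<in> S") (simp_all add: assms(3))
  qed
  show "integrable (lebesgue_on S) f \<longleftrightarrow> integrable lborel f"
    using assms by (subst integrable_restrict_space) (auto simp: e integrable_completion)
  show "integral\<^sup>L (lebesgue_on S) f = integral\<^sup>L lborel f"
    using assms by (subst integral_restrict_space) (auto simp: e integral_completion)
qed

lemma finite_measure_lebesgue_on_open:
  "open U \<Longrightarrow> bounded U \<Longrightarrow> finite_measure (lebesgue_on U)"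
  by (intro finite_measure_lebesgue_on bounded_set_imp_lmeasurable) auto

lemma test_fun_Lp_fun:
  assumes "test_fun U \<psi>" "open U" "bounded U" "p \<ge> 0"
  shows "Lp_fun (lebesgue_on U) p \<psi>"
proof -
  obtain B where "\<And>x. \<bar>\<psi> x\<bar> \<le> B" using test_fun_bounded[OF assms(1)] by metis
  then show ?thesis
    using assms by (intro Lp_fun_bounded[where B = B] finite_measure_lebesgue_on_open
      borel_measurable_lebesgue_onI smooth_fun_measurable test_funD(1)[of U]) auto
qed

section \<open>Smooth bumps and indicators of open sets\<close>

definition box_bump :: "real^'n \<Rightarrow> real^'n \<Rightarrow> real \<Rightarrow> real^'n \<Rightarrow> real" where
  "box_bump a b k x = (\<Prod>i\<in>UNIV. exp_tail 0 (k * x $ i + (- k * a $ i - 1)) * exp_tail 0 (- k * x $ i + (k * b $ i - 1)))"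

lemma exp_tail_0_bounds: "0 \<le> exp_tail 0 t" "exp_tail 0 t \<le> 1"
  by (auto simp: exp_tail_def)

lemma box_bump_bounds: "0 \<le> box_bump a b k x" "box_bump a b k x \<le> 1"
  unfolding box_bump_def
  by (auto intro!: prod_nonneg prod_le_1 mult_nonneg_nonneg mult_le_one exp_tail_0_bounds)

lemma smooth_fun_box_bump: "smooth_fun (box_bump a b k)"
  unfolding box_bump_def
  by (intro smooth_fun_prod smooth_fun_mult smooth_fun_exp_tail)

text \<open>A bump is nonzero only if all tails have positive arguments, and these read
  \<open>k * (x $ i - a $ i) > 1\<close> and \<open>k * (b $ i - x $ i) > 1\<close>. The subtracted
  one thus pushes the support into a closed box strictly inside the open one.\<close>

lemma box_bump_support:
  fixes a b :: "real^'n"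
  assumes "k > 0" "box_bump a b k x \<noteq> 0"
  shows "x \<in> cbox (\<chi> i. a $ i + 1 / k) (\<chi> i. b $ i - 1 / k)"
proof -
  have "exp_tail 0 (k * x $ i + (- k * a $ i - 1)) \<noteq> 0" "exp_tail 0 (- k * x $ i + (k * b $ i - 1)) \<noteq> 0" for i
    using assms(2) unfolding box_bump_def by auto
  then have "k * x $ i + (- k * a $ i - 1) > 0" "- k * x $ i + (k * b $ i - 1) > 0" for i
    unfolding exp_tail_def by metis+
  then show ?thesis using assms(1)
    by (auto simp: mem_box_cart field_simps less_imp_le)
qed

lemma cbox_shrink_subset_box:
  fixes a b :: "real^'n"
  assumes "k > 0"
  shows "cbox (\<chi> i. a $ i + 1 / k) (\<chi> i. b $ i - 1 / k) \<subseteq> box a b"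
proof
  fix x assume x: "x \<in> cbox (\<chi> i. a $ i + 1 / k) (\<chi> i. b $ i - 1 / k)"
  have "1 / k > 0" using assms by simp
  then have "a $ i < x $ i \<and> x $ i < b $ i" for i
    using x by (force simp: mem_box_cart simp del: zero_less_divide_iff divide_pos_pos zero_less_divide_1_iff dest!: spec[of _ i])
  then show "x \<in> box a b" by (auto simp: mem_box_cart)
qed

lemma exp_tail_0_tendsto_1:
  assumes "filterlim f at_top F"
  shows "((\<lambda>x. exp_tail 0 (f x)) \<longlongrightarrow> 1) F"
proof -
  have "((\<lambda>x. exp (- inverse (f x))) \<longlongrightarrow> exp (- 0)) F"
    by (intro tendsto_exp tendsto_minus filterlim_compose[OF tendsto_inverse_0_at_top[OF filterlim_ident]] assms)
  moreover have "\<forall>\<^sub>F x in F. exp (- inverse (f x)) = exp_tail 0 (f x)"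
    using filterlim_at_top_dense[THEN iffD1, OF assms, rule_format, of 0]
    by eventually_elim (auto simp: exp_tail_def inverse_eq_divide)
  ultimately show ?thesis using Lim_transform_eventually by fastforce
qed

lemma box_bump_tendsto_1:
  fixes a b x :: "real^'n"
  assumes "x \<in> box a b"
  shows "(\<lambda>k. box_bump a b (real (Suc k)) x) \<longlonglongrightarrow> 1"
proof -
  have lim: "filterlim (\<lambda>k. real (Suc k) * c + d) at_top sequentially" if "c > 0" for c d
  proof -
    have "filterlim (\<lambda>k. real (Suc k)) at_top sequentially"
      using filterlim_compose[OF filterlim_real_sequentially filterlim_Suc] by simp
    then have "filterlim (\<lambda>k. c * real (Suc k)) at_top sequentially"
      using that by (intro filterlim_tendsto_pos_mult_at_top[where c=c]) auto
    then have "filterlim (\<lambda>k. d + c * real (Suc k)) at_top sequentially"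
      by (intro filterlim_tendsto_add_at_top[where c=d]) auto
    then show ?thesis by (simp only: add.commute mult.commute)
  qed
  have "(\<lambda>k. \<Prod>i\<in>UNIV. exp_tail 0 (real (Suc k) * x $ i + (- real (Suc k) * a $ i - 1)) *
        exp_tail 0 (- real (Suc k) * x $ i + (real (Suc k) * b $ i - 1))) \<longlonglongrightarrow> (\<Prod>i\<in>(UNIV::'n set). 1 * 1)"
  proof (intro tendsto_prod tendsto_mult exp_tail_0_tendsto_1)
    fix i
    have "a $ i < x $ i" "x $ i < b $ i" using assms by (auto simp: mem_box_cart)
    then have 1: "filterlim (\<lambda>k. real (Suc k) * (x $ i - a $ i) + - 1) at_top sequentially"
      and 2: "filterlim (\<lambda>k. real (Suc k) * (b $ i - x $ i) + - 1) at_top sequentially"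
      by (intro lim; simp)+
    show "filterlim (\<lambda>k. real (Suc k) * x $ i + (- real (Suc k) * a $ i - 1)) at_top sequentially"
      using 1 by (rule filterlim_cong[THEN iffD1, rotated -1]) (auto simp: algebra_simps)
    show "filterlim (\<lambda>k. - real (Suc k) * x $ i + (real (Suc k) * b $ i - 1)) at_top sequentially"
      using 2 by (rule filterlim_cong[THEN iffD1, rotated -1]) (auto simp: algebra_simps)
  qed
  then show ?thesis by (simp add: box_bump_def)
qed

text \<open>An open set is a countable union of open boxes. The bumps of the first \<open>k\<close>
  boxes are joined by one minus the product of \<open>1 - \<beta>\<close>, a smooth substitute for
  their maximum: it stays between 0 and 1, dominates every bump, and vanishes where all bumps do.
  Only finitely many closed boxes enter for each \<open>k\<close>, whence the compact
  support.\<close>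

lemma open_indicator_limit_test_fun:
  fixes V :: "(real^'n) set"
  assumes "open V"
  obtains \<phi> where "\<And>k::nat. test_fun V (\<phi> k)" "\<And>k x. 0 \<le> \<phi> k x \<and> \<phi> k x \<le> 1"
    "\<And>x. (\<lambda>k. \<phi> k x) \<longlonglongrightarrow> indicator V x"
proof -
  obtain \<D> where D: "countable \<D>" "\<And>X. X \<in> \<D> \<Longrightarrow> \<exists>a b. X = box a b" "\<Union>\<D> = V"
    using open_countable_Union_open_box[OF assms] by metis
  have "\<exists>a b. (V::(real^'n) set) = (\<Union>n::nat. box (a n) (b n))"
  proof (cases "\<D> = {}")
    case True
    then have "V = (\<Union>n::nat. box 0 0)" using D by auto
    then show ?thesis by (intro exI[of _ "\<lambda>n. 0"])
  next
    case False
    have r: "range (from_nat_into \<D>) = \<D>" using False D(1) by (rule range_from_nat_into)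
    then have "\<forall>n. \<exists>a b. from_nat_into \<D> n = box a b" using D(2) by blast
    then obtain a b where "\<And>n. from_nat_into \<D> n = box (a n) (b n)" by metis
    then have "V = (\<Union>n. box (a n) (b n))" using D(3) r by (metis (no_types, lifting) SUP_cong)
    then show ?thesis by blast
  qed
  then obtain a b where V: "V = (\<Union>n::nat. box (a n) (b n))" by blast
  define \<beta> where "\<beta> n k x = box_bump (a n) (b n) (real (Suc k)) x" for n k x
  have \<beta>01: "0 \<le> \<beta> n k x" "\<beta> n k x \<le> 1" for n k x
    unfolding \<beta>_def by (auto simp: box_bump_bounds)
  define \<phi> where "\<phi> k x = 1 - (\<Prod>n<k. 1 - \<beta> n k x)" for k x
  have prod01: "0 \<le> (\<Prod>n<k. 1 - \<beta> n k x)" "(\<Prod>n<k. 1 - \<beta> n k x) \<le> 1" for k x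
    using \<beta>01 by (auto intro!: prod_nonneg prod_le_1)
  show thesis
  proof (rule that)
    show "0 \<le> \<phi> k x \<and> \<phi> k x \<le> 1" for k x
      using prod01[where k=k and x=x] by (auto simp: \<phi>_def)
    show "test_fun V (\<phi> k)" for k
    proof (rule test_fun_closed_support)
      show "smooth_fun (\<phi> k)"
        unfolding \<phi>_def \<beta>_def
        by (intro smooth_fun_diff smooth_fun_prod smooth_fun_const smooth_fun_box_bump)
      let ?K = "\<Union>n<k. cbox (\<chi> i. a n $ i + 1 / real (Suc k)) (\<chi> i. b n $ i - 1 / real (Suc k))"
      show "compact ?K" by (intro compact_UN) auto
      show "?K \<subseteq> V"
        unfolding V using cbox_shrink_subset_box[of "real (Suc k)"] by (force simp del: of_nat_Suc)
      show "\<phi> k x = 0" if "x \<notin> ?K" for x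
      proof -
        have "\<beta> n k x = 0" if "n < k" for n
          using box_bump_support[of "real (Suc k)" "a n" "b n" x] \<open>x \<notin> ?K\<close> that
          unfolding \<beta>_def by (auto simp del: of_nat_Suc)
        then show ?thesis by (simp add: \<phi>_def)
      qed
    qed
    show "(\<lambda>k. \<phi> k x) \<longlonglongrightarrow> indicator V x" for x
    proof (cases "x \<in> V")
      case False
      have "\<phi> k x = 0" for k
        using \<open>test_fun V (\<phi> k)\<close> False by (rule test_funD(2))
      then show ?thesis using False by simp
    next
      case True
      then obtain n where n: "x \<in> box (a n) (b n)" using V by blast
      have "(\<lambda>k. \<beta> n k x) \<longlonglongrightarrow> 1" unfolding \<beta>_def by (rule box_bump_tendsto_1[OF n])
      moreover have "\<beta> n k x \<le> \<phi> k x" if "k > n" for k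
      proof -
        have "(\<Prod>n<k. 1 - \<beta> n k x) = (1 - \<beta> n k x) * (\<Prod>n\<in>{..<k}-{n}. 1 - \<beta> n k x)"
          using that by (intro prod.remove) auto
        also have "\<dots> \<le> (1 - \<beta> n k x) * 1"
          using \<beta>01 by (intro mult_left_mono prod_le_1) auto
        finally show ?thesis by (simp add: \<phi>_def)
      qed
      then have "\<forall>\<^sub>F k in sequentially. \<beta> n k x \<le> \<phi> k x"
        by (auto intro: eventually_mono[OF eventually_gt_at_top[of n]])
      moreover have "\<forall>\<^sub>F k in sequentially. \<phi> k x \<le> 1"
        using prod01[where x=x] by (auto simp: \<phi>_def)
      ultimately show ?thesis
        using True tendsto_sandwich[of "\<lambda>k. \<beta> n k x" "\<lambda>k. \<phi> k x" sequentially "\<lambda>_. 1" 1] by simp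
    qed
  qed
qed

section \<open>Density of test functions in \<open>L^p\<close> of a bounded open set\<close>

definition test_approximable :: "(real^'n) set \<Rightarrow> real \<Rightarrow> (real^'n \<Rightarrow> real) \<Rightarrow> bool" where
  "test_approximable U p f \<longleftrightarrow> Lp_fun (lebesgue_on U) p f \<and>
     (\<forall>e>0. \<exists>\<psi>. test_fun U \<psi> \<and> (LINT x|lebesgue_on U. \<bar>f x - \<psi> x\<bar> powr p) < e)"

lemma test_approximable_closed:
  assumes U: "open U" "bounded U" and p: "p \<ge> 0"
    and f: "Lp_fun (lebesgue_on U) p f"
    and approx: "\<And>e. e > 0 \<Longrightarrow> \<exists>g. test_approximable U p g \<and> (LINT x|lebesgue_on U. \<bar>f x - g x\<bar> powr p) < e"
  shows "test_approximable U p f"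
  unfolding test_approximable_def
proof (intro conjI allI impI f)
  fix e :: real assume "e > 0"
  define d where "d = e / (2 * 2 powr p)"
  have d: "d > 0" using \<open>e > 0\<close> by (simp add: d_def)
  obtain g where g: "test_approximable U p g" "(LINT x|lebesgue_on U. \<bar>f x - g x\<bar> powr p) < d"
    using approx[OF d] by blast
  obtain \<psi> where \<psi>: "test_fun U \<psi>" "(LINT x|lebesgue_on U. \<bar>g x - \<psi> x\<bar> powr p) < d"
    using g(1) d unfolding test_approximable_def by blast
  have gL: "Lp_fun (lebesgue_on U) p g" using g(1) by (simp add: test_approximable_def)
  have "(LINT x|lebesgue_on U. \<bar>f x - \<psi> x\<bar> powr p) = (LINT x|lebesgue_on U. norm ((f x - g x) + (g x - \<psi> x)) powr p)"
    by simp
  also have "\<dots> \<le> 2 powr p * ((LINT x|lebesgue_on U. norm (f x - g x) powr p) + (LINT x|lebesgue_on U. norm (g x - \<psi> x) powr p))"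
    by (intro integral_powr_add_le Lp_fun_diff f gL test_fun_Lp_fun \<psi> U p)
  also have "\<dots> < 2 powr p * (d + d)"
    using g \<psi> by (intro mult_strict_left_mono) auto
  also have "\<dots> = e" by (simp add: d_def)
  finally show "\<exists>\<psi>. test_fun U \<psi> \<and> (LINT x|lebesgue_on U. \<bar>f x - \<psi> x\<bar> powr p) < e"
    using \<psi>(1) by blast
qed

lemma test_approximable_test_fun:
  "test_fun U \<psi> \<Longrightarrow> open U \<Longrightarrow> bounded U \<Longrightarrow> p \<ge> 0 \<Longrightarrow> test_approximable U p \<psi>"
  unfolding test_approximable_def by (auto intro!: test_fun_Lp_fun exI[of _ \<psi>])

lemma test_approximable_cmult:
  assumes "test_approximable U p f"
  shows "test_approximable U p (\<lambda>x. c * f x)"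
  unfolding test_approximable_def
proof (intro conjI allI impI)
  show "Lp_fun (lebesgue_on U) p (\<lambda>x. c * f x)"
    using Lp_fun_scaleR[of "lebesgue_on U" p f c] assms by (simp add: test_approximable_def)
  fix e :: real assume "e > 0"
  \<comment> \<open>The added one keeps the tolerance positive when \<open>c = 0\<close>.\<close>
  define d where "d = e / (\<bar>c\<bar> powr p + 1)"
  have pos: "\<bar>c\<bar> powr p + 1 > 0" by (simp add: add_nonneg_pos)
  have d: "d > 0" using \<open>e > 0\<close> pos by (simp add: d_def)
  obtain \<psi> where \<psi>: "test_fun U \<psi>" "(LINT x|lebesgue_on U. \<bar>f x - \<psi> x\<bar> powr p) < d"
    using assms d unfolding test_approximable_def by blast
  have "(LINT x|lebesgue_on U. \<bar>c * f x - c * \<psi> x\<bar> powr p) = \<bar>c\<bar> powr p * (LINT x|lebesgue_on U. \<bar>f x - \<psi> x\<bar> powr p)"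
    by (simp add: right_diff_distrib[symmetric] abs_mult powr_mult)
  also have "\<dots> \<le> \<bar>c\<bar> powr p * d"
    using \<psi> by (intro mult_left_mono) auto
  also have "\<dots> < (\<bar>c\<bar> powr p + 1) * d" using d by (simp add: algebra_simps)
  also have "\<dots> = e" using pos by (simp add: d_def)
  finally show "\<exists>\<psi>. test_fun U \<psi> \<and> (LINT x|lebesgue_on U. \<bar>c * f x - \<psi> x\<bar> powr p) < e"
    using test_fun_mult_smooth[OF \<psi>(1) smooth_fun_const[of c]] by blast
qed

lemma test_approximable_add:
  assumes f: "test_approximable U p f" and g: "test_approximable U p g"
    and U: "open U" "bounded U" and p: "p \<ge> 0"
  shows "test_approximable U p (\<lambda>x. f x + g x)"
  unfolding test_approximable_def
proof (intro conjI allI impI)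
  have fL: "Lp_fun (lebesgue_on U) p f" and gL: "Lp_fun (lebesgue_on U) p g"
    using f g by (auto simp: test_approximable_def)
  show "Lp_fun (lebesgue_on U) p (\<lambda>x. f x + g x)" using fL gL p by (rule Lp_fun_add)
  fix e :: real assume "e > 0"
  define d where "d = e / (2 * 2 powr p)"
  have d: "d > 0" using \<open>e > 0\<close> by (simp add: d_def)
  obtain \<psi> where \<psi>: "test_fun U \<psi>" "(LINT x|lebesgue_on U. \<bar>f x - \<psi> x\<bar> powr p) < d"
    using f d unfolding test_approximable_def by blast
  obtain \<eta> where \<eta>: "test_fun U \<eta>" "(LINT x|lebesgue_on U. \<bar>g x - \<eta> x\<bar> powr p) < d"
    using g d unfolding test_approximable_def by blast
  have "(LINT x|lebesgue_on U. \<bar>(f x + g x) - (\<psi> x + \<eta> x)\<bar> powr p) = (LINT x|lebesgue_on U. norm ((f x - \<psi> x) + (g x - \<eta> x)) powr p)"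
    by (simp add: algebra_simps)
  also have "\<dots> \<le> 2 powr p * ((LINT x|lebesgue_on U. norm (f x - \<psi> x) powr p) + (LINT x|lebesgue_on U. norm (g x - \<eta> x) powr p))"
    by (intro integral_powr_add_le Lp_fun_diff fL gL test_fun_Lp_fun \<psi> \<eta> U p)
  also have "\<dots> < 2 powr p * (d + d)"
    using \<eta> \<psi> by (intro mult_strict_left_mono) auto
  also have "\<dots> = e" by (simp add: d_def)
  finally show "\<exists>\<psi>. test_fun U \<psi> \<and> (LINT x|lebesgue_on U. \<bar>f x + g x - \<psi> x\<bar> powr p) < e"
    using test_fun_add[OF \<psi>(1) \<eta>(1)] by blast
qed

lemma test_approximable_open:
  assumes U: "open U" "bounded U" and p: "p > 0" and V: "open V" "V \<subseteq> U"
  shows "test_approximable U p (indicator V)"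
proof (rule test_approximable_closed[OF U])
  interpret finite_measure "lebesgue_on U" using U by (rule finite_measure_lebesgue_on_open)
  have m: "(indicator V :: _ \<Rightarrow> real) \<in> borel_measurable (lebesgue_on U)"
    using V by (intro borel_measurable_lebesgue_onI) auto
  show "Lp_fun (lebesgue_on U) p (indicator V :: _ \<Rightarrow> real)"
    by (intro Lp_fun_bounded[where B=1] m finite_measure_axioms) (use p in \<open>auto simp: indicator_def\<close>)
  fix e :: real assume "e > 0"
  obtain \<phi> where \<phi>: "\<And>k::nat. test_fun V (\<phi> k)" "\<And>k x. 0 \<le> \<phi> k x \<and> \<phi> k x \<le> 1"
    "\<And>x. (\<lambda>k. \<phi> k x) \<longlonglongrightarrow> indicator V x"
    using open_indicator_limit_test_fun[OF V(1)] by metis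
  have mphi: "\<phi> k \<in> borel_measurable (lebesgue_on U)" for k
    using smooth_fun_measurable test_funD(1)[OF \<phi>(1)] borel_measurable_lebesgue_onI by blast
  have "(\<lambda>k. LINT x|lebesgue_on U. \<bar>indicator V x - \<phi> k x\<bar> powr p) \<longlonglongrightarrow> (LINT x|lebesgue_on U. 0)"
  proof (rule integral_dominated_convergence[where w = "\<lambda>x. 1"])
    show "AE x in lebesgue_on U. (\<lambda>k. \<bar>indicator V x - \<phi> k x\<bar> powr p) \<longlonglongrightarrow> 0"
    proof (rule AE_I2)
      fix x
      have "(\<lambda>k. \<bar>indicator V x - \<phi> k x\<bar> powr p) \<longlonglongrightarrow> \<bar>indicator V x - indicator V x\<bar> powr p"
        using p by (intro tendsto_powr' tendsto_intros \<phi>(3)) auto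
      then show "(\<lambda>k. \<bar>indicator V x - \<phi> k x\<bar> powr p) \<longlonglongrightarrow> 0" by simp
    qed
    show "AE x in lebesgue_on U. norm (\<bar>indicator V x - \<phi> k x\<bar> powr p) \<le> 1" for k
      using \<phi>(2) p by (intro AE_I2) (auto intro!: powr_le1 simp: indicator_def)
    show "(\<lambda>x. \<bar>indicator V x - \<phi> k x\<bar> powr p) \<in> borel_measurable (lebesgue_on U)" for k
      using m mphi by measurable
  qed auto
  then have "\<forall>\<^sub>F k in sequentially. (LINT x|lebesgue_on U. \<bar>indicator V x - \<phi> k x\<bar> powr p) < e"
    using \<open>e > 0\<close> by (intro order_tendstoD(2)[where y=0]) auto
  then obtain k where k: "(LINT x|lebesgue_on U. \<bar>indicator V x - \<phi> k x\<bar> powr p) < e"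
    by (meson eventually_sequentially order_refl)
  have "test_fun U (\<phi> k)" using \<phi>(1)[of k] V(2) unfolding test_fun_def by auto
  then show "\<exists>g. test_approximable U p g \<and> (LINT x|lebesgue_on U. \<bar>indicator V x - g x\<bar> powr p) < e"
    using k test_approximable_test_fun U p by (metis less_imp_le)
qed (use p in auto)

text \<open>Outer regularity: an open superset exceeds \<open>A\<close> by little measure, and the
  p-th power of the difference of two such indicators is again an indicator, so its integral is that
  excess.\<close>

lemma test_approximable_set:
  assumes U: "open U" "bounded U" and p: "p > 0" and A: "A \<in> sets lebesgue" "A \<subseteq> U"
  shows "test_approximable U p (indicator A)"
proof (rule test_approximable_closed[OF U])
  interpret finite_measure "lebesgue_on U" using U by (rule finite_measure_lebesgue_on_open)
  have m: "(indicator A :: _ \<Rightarrow> real) \<in> borel_measurable (lebesgue_on U)"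
    using A by (intro measurable_restrict_space1) auto
  show "Lp_fun (lebesgue_on U) p (indicator A :: _ \<Rightarrow> real)"
    by (intro Lp_fun_bounded[where B=1] m finite_measure_axioms) (use p in \<open>auto simp: indicator_def\<close>)
  fix e :: real assume "e > 0"
  obtain T where T: "open T" "A \<subseteq> T" "T - A \<in> lmeasurable" "emeasure lebesgue (T - A) < ennreal e"
    using sets_lebesgue_outer_open[OF A(1) \<open>e > 0\<close>] by metis
  have "\<bar>indicator A x - indicator (T \<inter> U) x\<bar> powr p = indicator (T - A) x" if "x \<in> U" for x
    using T(2) that by (auto simp: indicator_def)
  then have "(LINT x|lebesgue_on U. \<bar>indicator A x - indicator (T \<inter> U) x\<bar> powr p) = (LINT x|lebesgue_on U. indicator (T - A) x)"
    by (intro Bochner_Integration.integral_cong) auto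
  also have "\<dots> = measure (lebesgue_on U) ((T - A) \<inter> U)"
    by simp
  also have "\<dots> = measure lebesgue ((T - A) \<inter> U)"
    using U by (intro measure_restrict_space) auto
  also have "\<dots> \<le> measure lebesgue (T - A)"
    using T(3) U by (intro measure_mono_fmeasurable) auto
  also have "\<dots> < e"
    using T(3,4) \<open>e > 0\<close> by (simp add: emeasure_eq_measure2 ennreal_less_iff)
  finally show "\<exists>g. test_approximable U p g \<and> (LINT x|lebesgue_on U. \<bar>indicator A x - g x\<bar> powr p) < e"
    using test_approximable_open[OF U p, of "T \<inter> U"] T(1) U(1) by blast
qed (use p in auto)

lemma test_approximable_sum:
  assumes "open U" "bounded U" "p \<ge> 0" "finite I" "\<And>i. i \<in> I \<Longrightarrow> test_approximable U p (f i)"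
  shows "test_approximable U p (\<lambda>x. \<Sum>i\<in>I. f i x)"
  using assms(4,5)
proof (induction I rule: finite_induct)
  case empty
  then show ?case using test_approximable_test_fun[OF test_fun_0] assms by simp
next
  case (insert i I)
  then show ?case using test_approximable_add[OF _ _ assms(1-3), of "f i" "\<lambda>x. \<Sum>i\<in>I. f i x"] by simp
qed

lemma test_approximable_cong:
  assumes "test_approximable U p f" "\<And>x. x \<in> U \<Longrightarrow> f x = g x"
  shows "test_approximable U p g"
proof -
  have 1: "Lp_fun (lebesgue_on U) p g \<longleftrightarrow> Lp_fun (lebesgue_on U) p f"
    unfolding Lp_fun_def using assms(2)
    by (intro conj_cong measurable_cong Bochner_Integration.integrable_cong) auto
  have 2: "(LINT x|lebesgue_on U. \<bar>g x - \<psi> x\<bar> powr p) = (LINT x|lebesgue_on U. \<bar>f x - \<psi> x\<bar> powr p)" for \<psi>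
    using assms(2) by (intro Bochner_Integration.integral_cong) auto
  show ?thesis using assms(1) unfolding test_approximable_def 1 2 .
qed

theorem test_fun_dense_Lp:
  assumes U: "open U" "bounded U" and p: "p > 0" and f: "Lp_fun (lebesgue_on U) p f"
  shows "test_approximable U p f"
proof (rule test_approximable_closed[OF U _ f])
  have [measurable]: "f \<in> borel_measurable (lebesgue_on U)" using f by (rule Lp_fun_measurable)
  \<comment> \<open>The simple functions are taken at distance at most twice that of
    \<open>f\<close> from the base point 0, so that \<open>3 * \<bar>f x\<bar>\<close> dominates all
    errors.\<close>
  obtain F where F: "\<And>i. simple_function (lebesgue_on U) (F i)"
    "\<And>x. x \<in> U \<Longrightarrow> (\<lambda>i. F i x) \<longlonglongrightarrow> f x" "\<And>i x. x \<in> U \<Longrightarrow> \<bar>F i x\<bar> \<le> 2 * \<bar>f x\<bar>"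
    using borel_measurable_implies_sequence_metric[of f "lebesgue_on U" 0]
    by (auto simp: dist_real_def intro: that)
  have Fm [measurable]: "F i \<in> borel_measurable (lebesgue_on U)" for i
    using F(1) by (rule borel_measurable_simple_function)
  have FA: "test_approximable U p (F i)" for i
  proof -
    have fin: "finite (F i ` U)" using F(1)[of i] by (simp add: simple_function_def)
    have "test_approximable U p (\<lambda>x. \<Sum>c\<in>F i ` U. c * indicator (F i -` {c} \<inter> U) x)"
    proof (intro test_approximable_sum test_approximable_cmult test_approximable_set U p fin)
      fix c
      have "F i -` {c} \<inter> space (lebesgue_on U) \<in> sets (lebesgue_on U)"
        by (rule measurable_sets[OF Fm]) simp
      then show "F i -` {c} \<inter> U \<in> sets lebesgue"
        using U(1) by (simp add: sets_restrict_space_iff)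
    qed (use p in auto)
    then show ?thesis
    proof (rule test_approximable_cong)
      fix x assume "x \<in> U"
      then have "(\<Sum>c\<in>F i ` U. c * indicator (F i -` {c} \<inter> U) x) = (\<Sum>c\<in>F i ` U. if c = F i x then c else 0)"
        by (intro sum.cong) (auto simp: indicator_def)
      also have "\<dots> = F i x" using fin \<open>x \<in> U\<close> by (subst sum.delta) auto
      finally show "(\<Sum>c\<in>F i ` U. c * indicator (F i -` {c} \<inter> U) x) = F i x" .
    qed
  qed
  fix e :: real assume "e > 0"
  have "(\<lambda>k. LINT x|lebesgue_on U. \<bar>f x - F k x\<bar> powr p) \<longlonglongrightarrow> (LINT x|lebesgue_on U. 0)"
  proof (rule integral_dominated_convergence[where w = "\<lambda>x. 3 powr p * \<bar>f x\<bar> powr p"])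
    show "AE x in lebesgue_on U. (\<lambda>k. \<bar>f x - F k x\<bar> powr p) \<longlonglongrightarrow> 0"
    proof (rule AE_I2)
      fix x assume "x \<in> space (lebesgue_on U)"
      then have "(\<lambda>k. \<bar>f x - F k x\<bar> powr p) \<longlonglongrightarrow> \<bar>f x - f x\<bar> powr p"
        using p by (intro tendsto_powr' tendsto_intros F(2)) auto
      then show "(\<lambda>k. \<bar>f x - F k x\<bar> powr p) \<longlonglongrightarrow> 0" by simp
    qed
    show "AE x in lebesgue_on U. norm (\<bar>f x - F k x\<bar> powr p) \<le> 3 powr p * \<bar>f x\<bar> powr p" for k
    proof (rule AE_I2)
      fix x assume "x \<in> space (lebesgue_on U)"
      then have "\<bar>f x - F k x\<bar> \<le> 3 * \<bar>f x\<bar>" using F(3)[of x k] by auto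
      then have "\<bar>f x - F k x\<bar> powr p \<le> (3 * \<bar>f x\<bar>) powr p" using p by (intro powr_mono2) auto
      then show "norm (\<bar>f x - F k x\<bar> powr p) \<le> 3 powr p * \<bar>f x\<bar> powr p" by (simp add: powr_mult)
    qed
    show "integrable (lebesgue_on U) (\<lambda>x. 3 powr p * \<bar>f x\<bar> powr p)"
      using Lp_fun_integrable[OF f] by simp
  qed auto
  then have "\<forall>\<^sub>F k in sequentially. (LINT x|lebesgue_on U. \<bar>f x - F k x\<bar> powr p) < e"
    using \<open>e > 0\<close> by (intro order_tendstoD(2)[where y=0]) auto
  then obtain k where k: "(LINT x|lebesgue_on U. \<bar>f x - F k x\<bar> powr p) < e"
    by (meson eventually_sequentially order_refl)
  then show "\<exists>g. test_approximable U p g \<and> (LINT x|lebesgue_on U. \<bar>f x - g x\<bar> powr p) < e"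
    using FA by blast
qed (use p in auto)

corollary test_fun_denseE:
  assumes "open U" "bounded U" "p > 0" "Lp_fun (lebesgue_on U) p f" "e > 0"
  obtains \<psi> where "test_fun U \<psi>" "(LINT x|lebesgue_on U. \<bar>f x - \<psi> x\<bar> powr p) < e"
  using test_fun_dense_Lp[OF assms(1-4)] assms(5) unfolding test_approximable_def by blast

text \<open>The function \<open>sgn h\<close> is bounded, hence lies in the space of the dual
  exponent and is approximated there by test functions, against which \<open>h\<close> integrates to
  zero. So the integral of \<open>\<bar>h\<bar>\<close>, which pairs \<open>h\<close> with
  \<open>sgn h\<close>, is arbitrarily small.\<close>

lemma fundamental_lemma_Lp:
  assumes U: "open U" "bounded U" and p: "p > 1" and h: "Lp_fun (lebesgue_on U) p h"
    and zero: "\<And>\<psi>. test_fun U \<psi> \<Longrightarrow> (LINT x|lebesgue_on U. h x * \<psi> x) = 0"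
  shows "AE x in lebesgue_on U. h x = 0"
proof -
  interpret finite_measure "lebesgue_on U" using U by (rule finite_measure_lebesgue_on_open)
  have [measurable]: "h \<in> borel_measurable (lebesgue_on U)" using h by (rule Lp_fun_measurable)
  let ?q = "p / (p - 1)"
  have q: "?q > 0" using p by simp
  have s: "Lp_fun (lebesgue_on U) ?q (\<lambda>x. sgn (h x))"
    by (rule Lp_fun_bounded[where B=1]) (use q in \<open>auto simp: sgn_if finite_measure_axioms\<close>)
  have hint: "integrable (lebesgue_on U) h"
    using Lp_fun_imp_integrable[OF finite_measure_axioms h] p by simp
  let ?A = "LINT x|lebesgue_on U. \<bar>h x\<bar> powr p"
  have A0: "?A \<ge> 0" by (intro integral_nonneg_AE) auto
  have "(LINT x|lebesgue_on U. \<bar>h x\<bar>) \<le> 0"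
  proof (rule field_le_epsilon)
    fix e :: real assume "e > 0"
    \<comment> \<open>This parameter bounds the Young term with the integral of
      \<open>\<bar>h\<bar> powr p\<close> by \<open>e / 2\<close>; the added one covers a vanishing
      integral. The tolerance \<open>d\<close> is then scaled so that the other Young term is at
      most \<open>e / 2\<close> as well.\<close>
    define t where "t = (e / (2 * (?A + 1))) powr (1 / p)"
    have t: "t > 0" "t powr p = e / (2 * (?A + 1))" using A0 p \<open>e > 0\<close> by (auto simp: t_def powr_powr add_nonneg_eq_0_iff)
    define d where "d = e / 2 * t powr ?q"
    have d: "d > 0" using t \<open>e > 0\<close> by (simp add: d_def)
    obtain \<psi> where \<psi>: "test_fun U \<psi>" "(LINT x|lebesgue_on U. \<bar>sgn (h x) - \<psi> x\<bar> powr ?q) < d"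
      using test_fun_denseE[OF U q s d] by metis
    have \<psi>L: "Lp_fun (lebesgue_on U) ?q \<psi>" using \<psi>(1) U q by (intro test_fun_Lp_fun) auto
    have D: "Lp_fun (lebesgue_on U) ?q (\<lambda>x. sgn (h x) - \<psi> x)" using s \<psi>L q by (intro Lp_fun_diff) auto
    have [measurable]: "\<psi> \<in> borel_measurable (lebesgue_on U)" using \<psi>L by (rule Lp_fun_measurable)
    have i1: "integrable (lebesgue_on U) (\<lambda>x. h x * \<psi> x)"
      by (rule Bochner_Integration.integrable_bound[OF Lp_fun_mult(1)[OF h \<psi>L p]]) (auto simp: abs_mult)
    have i2: "integrable (lebesgue_on U) (\<lambda>x. h x * (sgn (h x) - \<psi> x))"
      by (rule Bochner_Integration.integrable_bound[OF Lp_fun_mult(1)[OF h D p]]) (auto simp: abs_mult)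
    have "(LINT x|lebesgue_on U. \<bar>h x\<bar>) = (LINT x|lebesgue_on U. h x * (sgn (h x) - \<psi> x) + h x * \<psi> x)"
      by (intro Bochner_Integration.integral_cong) (auto simp: algebra_simps abs_sgn)
    also have "\<dots> = (LINT x|lebesgue_on U. h x * (sgn (h x) - \<psi> x))"
      using i1 i2 zero[OF \<psi>(1)] by simp
    also have "\<dots> \<le> (LINT x|lebesgue_on U. norm (h x) * norm (sgn (h x) - \<psi> x))"
      by (rule integral_mono[OF i2 Lp_fun_mult(1)[OF h D p]]) (simp add: abs_mult[symmetric])
    also have "\<dots> \<le> t powr p * (LINT x|lebesgue_on U. norm (h x) powr p) + t powr - ?q * (LINT x|lebesgue_on U. norm (sgn (h x) - \<psi> x) powr ?q)"
      by (rule Lp_fun_mult(2)[OF h D p t(1)])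
    also have "\<dots> \<le> t powr p * ?A + t powr - ?q * d"
      using \<psi>(2) by (intro add_mono mult_left_mono) auto
    also have "t powr p * ?A \<le> e / 2"
    proof -
      have "e / (2 * (A + 1)) * A \<le> e / 2" if "A \<ge> 0" for A :: real
      proof -
        have "e / (2 * (A + 1)) * A = e / 2 * (A / (A + 1))" using that by (simp add: field_simps)
        also have "\<dots> \<le> e / 2 * 1" using that \<open>e > 0\<close> by (intro mult_left_mono) auto
        finally show ?thesis by simp
      qed
      then show ?thesis using A0 unfolding t(2) by blast
    qed
    also have "t powr - ?q * d = e / 2" using t by (simp add: d_def powr_minus field_simps)
    finally show "(LINT x|lebesgue_on U. \<bar>h x\<bar>) \<le> 0 + e" by simp
  qed
  moreover have "(LINT x|lebesgue_on U. \<bar>h x\<bar>) \<ge> 0" by (intro integral_nonneg_AE) auto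
  ultimately have "(LINT x|lebesgue_on U. \<bar>h x\<bar>) = 0" by simp
  then show ?thesis using hint by (subst (asm) integral_nonneg_eq_0_iff_AE) auto
qed

section \<open>Oscillating integrals and the Riemann-Lebesgue lemma\<close>

lemma test_fun_oscillating_bound:
  fixes \<psi> :: "real^'n \<Rightarrow> real" and r :: "real^'n"
  assumes \<psi>: "test_fun U \<psi>" and r: "r \<noteq> 0"
  obtains C where "\<And>s. s > 0 \<Longrightarrow> \<bar>LINT x|lborel. cos (s *\<^sub>R r \<bullet> x) * \<psi> x\<bar> \<le> C / s"
    "\<And>s. s > 0 \<Longrightarrow> \<bar>LINT x|lborel. sin (s *\<^sub>R r \<bullet> x) * \<psi> x\<bar> \<le> C / s"
proof -
  obtain i where i: "r $ i \<noteq> 0" using r by (metis vec_eq_iff zero_index)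
  define I where "I = (LINT x|lborel. \<bar>partial_deriv i \<psi> x\<bar>)"
  note sm = test_funD(1)[OF \<psi>]
  have int: "integrable lborel (\<lambda>x. f x * \<eta> x)" if "test_fun U \<eta>" "smooth_fun f" for f \<eta>
    by (rule test_fun_integrable[OF test_fun_mult_smooth[OF that]])
  have bound: "\<bar>LINT x|lborel. f x * partial_deriv i \<psi> x\<bar> \<le> I" if "\<And>x. \<bar>f x\<bar> \<le> 1" "smooth_fun f" for f
  proof -
    have "\<bar>LINT x|lborel. f x * partial_deriv i \<psi> x\<bar> \<le> (LINT x|lborel. \<bar>f x * partial_deriv i \<psi> x\<bar>)"
      by (rule integral_abs_bound)
    also have "\<dots> \<le> I" unfolding I_def
      by (rule integral_mono[OF integrable_abs[OF int[OF test_fun_partial_deriv[OF \<psi>] that(2)]]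
            integrable_abs[OF test_fun_integrable[OF test_fun_partial_deriv[OF \<psi>]]]])
         (use that(1) in \<open>auto simp: abs_mult mult_left_le_one_le\<close>)
    finally show ?thesis .
  qed
  have cs: "\<bar>LINT x|lborel. cos (s *\<^sub>R r \<bullet> x) * \<psi> x\<bar> \<le> (I / \<bar>r $ i\<bar>) / s" if s: "s > 0" for s
  proof -
    \<comment> \<open>The derivative of this compactly supported product integrates to zero. Solving
      for the cosine integral gains the factor \<open>1 / (s * r $ i)\<close> and leaves a
      derivative of \<open>\<psi>\<close>, whose integral does not involve \<open>s\<close>.\<close>
    have "partial_deriv i (\<lambda>x. sin (s *\<^sub>R r \<bullet> x) * \<psi> x) x =
        sin (s *\<^sub>R r \<bullet> x) * partial_deriv i \<psi> x + s * r $ i * (cos (s *\<^sub>R r \<bullet> x) * \<psi> x)" for x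
      by (simp add: partial_deriv_mult[OF smooth_fun_sin sm] partial_deriv_sin del: inner_scaleR_left)
    then have "0 = (LINT x|lborel. sin (s *\<^sub>R r \<bullet> x) * partial_deriv i \<psi> x + s * r $ i * (cos (s *\<^sub>R r \<bullet> x) * \<psi> x))"
      using integral_partial_deriv_eq_0[OF test_fun_mult_smooth[OF \<psi> smooth_fun_sin[of "s *\<^sub>R r"]], of i]
      by (simp del: inner_scaleR_left)
    also have "\<dots> = (LINT x|lborel. sin (s *\<^sub>R r \<bullet> x) * partial_deriv i \<psi> x) + s * r $ i * (LINT x|lborel. cos (s *\<^sub>R r \<bullet> x) * \<psi> x)"
      using int[OF \<psi> smooth_fun_cos[of "s *\<^sub>R r"]] int[OF test_fun_partial_deriv[OF \<psi>] smooth_fun_sin[of "s *\<^sub>R r"]]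
      by (simp del: inner_scaleR_left)
    finally have "\<bar>s * r $ i * (LINT x|lborel. cos (s *\<^sub>R r \<bullet> x) * \<psi> x)\<bar> \<le> I"
      using bound[OF _ smooth_fun_sin[of "s *\<^sub>R r"]] abs_sin_le_one by (smt (verit))
    then show ?thesis using s i by (simp add: abs_mult field_simps)
  qed
  have sn: "\<bar>LINT x|lborel. sin (s *\<^sub>R r \<bullet> x) * \<psi> x\<bar> \<le> (I / \<bar>r $ i\<bar>) / s" if s: "s > 0" for s
  proof -
    have "partial_deriv i (\<lambda>x. cos (s *\<^sub>R r \<bullet> x) * \<psi> x) x =
        cos (s *\<^sub>R r \<bullet> x) * partial_deriv i \<psi> x - s * r $ i * (sin (s *\<^sub>R r \<bullet> x) * \<psi> x)" for x
      by (simp add: partial_deriv_mult[OF smooth_fun_cos sm] partial_deriv_cos del: inner_scaleR_left)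
    then have "0 = (LINT x|lborel. cos (s *\<^sub>R r \<bullet> x) * partial_deriv i \<psi> x - s * r $ i * (sin (s *\<^sub>R r \<bullet> x) * \<psi> x))"
      using integral_partial_deriv_eq_0[OF test_fun_mult_smooth[OF \<psi> smooth_fun_cos[of "s *\<^sub>R r"]], of i]
      by (simp del: inner_scaleR_left)
    also have "\<dots> = (LINT x|lborel. cos (s *\<^sub>R r \<bullet> x) * partial_deriv i \<psi> x) - s * r $ i * (LINT x|lborel. sin (s *\<^sub>R r \<bullet> x) * \<psi> x)"
      using int[OF \<psi> smooth_fun_sin[of "s *\<^sub>R r"]] int[OF test_fun_partial_deriv[OF \<psi>] smooth_fun_cos[of "s *\<^sub>R r"]]
      by (simp del: inner_scaleR_left)
    finally have "\<bar>s * r $ i * (LINT x|lborel. sin (s *\<^sub>R r \<bullet> x) * \<psi> x)\<bar> \<le> I"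
      using bound[OF _ smooth_fun_cos[of "s *\<^sub>R r"]] abs_cos_le_one by (smt (verit))
    then show ?thesis using s i by (simp add: abs_mult field_simps)
  qed
  show thesis by (rule that[OF cs sn])
qed

text \<open>Phrased for any bounded smooth family with a rate on test functions, so that cosine and
  sine share one proof. Density in \<open>L^1\<close> and the bound by one transfer the decay,
  though not its rate, to integrable \<open>G\<close>.\<close>

lemma Riemann_Lebesgue_aux:
  fixes G :: "real^'n \<Rightarrow> real"
  assumes U: "open U" "bounded U" and G: "integrable (lebesgue_on U) G"
    and eps: "\<And>j. eps j > 0" "eps \<longlonglongrightarrow> 0"
    and f: "\<And>j x. \<bar>f j x\<bar> \<le> 1" "\<And>j. smooth_fun (f j)"
    and osc: "\<And>\<psi>. test_fun U \<psi> \<Longrightarrow> \<exists>C. \<forall>j. \<bar>LINT x|lborel. f j x * \<psi> x\<bar> \<le> C * eps j"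
  shows "(\<lambda>j. LINT x|lebesgue_on U. G x * f j x) \<longlonglongrightarrow> 0"
proof (rule LIMSEQ_I)
  fix e :: real assume "e > 0"
  have [measurable]: "G \<in> borel_measurable (lebesgue_on U)" using G by auto
  have fm [measurable]: "f j \<in> borel_measurable (lebesgue_on U)" for j
    using f(2) smooth_fun_measurable borel_measurable_lebesgue_onI by blast
  have G1: "Lp_fun (lebesgue_on U) 1 G" using G by (simp add: Lp_fun_def)
  obtain \<psi> where \<psi>: "test_fun U \<psi>" "(LINT x|lebesgue_on U. \<bar>G x - \<psi> x\<bar> powr 1) < e / 2"
    using test_fun_denseE[OF U _ G1, of "e/2"] \<open>e > 0\<close> by auto
  obtain C where C: "\<And>j. \<bar>LINT x|lborel. f j x * \<psi> x\<bar> \<le> C * eps j" using osc[OF \<psi>(1)] by blast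
  have "(\<lambda>j. C * eps j) \<longlonglongrightarrow> C * 0" by (intro tendsto_intros eps)
  then have "\<forall>\<^sub>F j in sequentially. C * eps j < e / 2"
    using \<open>e > 0\<close> by (intro order_tendstoD(2)[where y=0]) auto
  then obtain N where N: "\<And>j. j \<ge> N \<Longrightarrow> C * eps j < e / 2" by (auto simp: eventually_sequentially)
  have \<psi>i: "integrable (lebesgue_on U) \<psi>"
    by (rule Lp_fun_imp_integrable[of _ 1]) (use U \<psi> in \<open>auto intro: finite_measure_lebesgue_on_open test_fun_Lp_fun\<close>)
  have "norm ((LINT x|lebesgue_on U. G x * f j x) - 0) < e" if "j \<ge> N" for j
  proof -
    have i0: "integrable (lebesgue_on U) (\<lambda>x. h x * f j x)" if "integrable (lebesgue_on U) h" for h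
      by (rule Bochner_Integration.integrable_bound[OF that]) (use that f(1) in \<open>auto simp: abs_mult mult_left_le\<close>)
    have "(LINT x|lebesgue_on U. G x * f j x) = (LINT x|lebesgue_on U. (G x - \<psi> x) * f j x + \<psi> x * f j x)"
      by (simp add: algebra_simps)
    also have "\<dots> = (LINT x|lebesgue_on U. (G x - \<psi> x) * f j x) + (LINT x|lebesgue_on U. \<psi> x * f j x)"
      by (intro Bochner_Integration.integral_add i0 Bochner_Integration.integrable_diff G \<psi>i)
    finally have 1: "(LINT x|lebesgue_on U. G x * f j x) = (LINT x|lebesgue_on U. (G x - \<psi> x) * f j x) + (LINT x|lebesgue_on U. \<psi> x * f j x)" .
    have "\<bar>LINT x|lebesgue_on U. (G x - \<psi> x) * f j x\<bar> \<le> (LINT x|lebesgue_on U. \<bar>(G x - \<psi> x) * f j x\<bar>)"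
      by (rule integral_abs_bound)
    also have "\<dots> \<le> (LINT x|lebesgue_on U. \<bar>G x - \<psi> x\<bar> powr 1)"
      by (rule integral_mono[OF integrable_abs[OF i0]]) (use G \<psi>i f(1) in \<open>auto simp: abs_mult mult_left_le\<close>)
    finally have 2: "\<bar>LINT x|lebesgue_on U. (G x - \<psi> x) * f j x\<bar> < e / 2" using \<psi>(2) by linarith
    have m: "(\<lambda>x. \<psi> x * f j x) \<in> borel_measurable borel"
      using smooth_fun_measurable[OF f(2)] smooth_fun_measurable[OF test_funD(1)[OF \<psi>(1)]] by measurable
    have "(LINT x|lebesgue_on U. \<psi> x * f j x) = (LINT x|lborel. f j x * \<psi> x)"
      by (subst integral_lebesgue_on_eq_lborel[OF m]) (use U test_funD(2)[OF \<psi>(1)] in \<open>auto simp: mult.commute\<close>)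
    then have "\<bar>LINT x|lebesgue_on U. \<psi> x * f j x\<bar> < e / 2" using C[of j] N[OF that] by linarith
    then show ?thesis using 1 2 by simp
  qed
  then show "\<exists>no. \<forall>j\<ge>no. norm ((LINT x|lebesgue_on U. G x * f j x) - 0) < e" by blast
qed

lemma Riemann_Lebesgue:
  fixes G :: "real^'n \<Rightarrow> real"
  assumes U: "open U" "bounded U" and G: "integrable (lebesgue_on U) G"
    and eps: "\<And>j. eps j > 0" "eps \<longlonglongrightarrow> 0" and r: "r \<noteq> 0"
  shows "(\<lambda>j. LINT x|lebesgue_on U. G x * cos ((1 / eps j) *\<^sub>R r \<bullet> x)) \<longlonglongrightarrow> 0"
    and "(\<lambda>j. LINT x|lebesgue_on U. G x * sin ((1 / eps j) *\<^sub>R r \<bullet> x)) \<longlonglongrightarrow> 0"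
proof -
  show "(\<lambda>j. LINT x|lebesgue_on U. G x * cos ((1 / eps j) *\<^sub>R r \<bullet> x)) \<longlonglongrightarrow> 0"
  proof (rule Riemann_Lebesgue_aux[OF U G eps])
    show "\<exists>C. \<forall>j. \<bar>LINT x|lborel. cos ((1 / eps j) *\<^sub>R r \<bullet> x) * \<psi> x\<bar> \<le> C * eps j" if \<psi>: "test_fun U \<psi>" for \<psi>
    proof -
      obtain C where "\<And>s. s > 0 \<Longrightarrow> \<bar>LINT x|lborel. cos (s *\<^sub>R r \<bullet> x) * \<psi> x\<bar> \<le> C / s"
        using test_fun_oscillating_bound[OF \<psi> r] by metis
      from this[of "1 / eps _"] eps(1) show ?thesis by auto
    qed
  qed (auto intro: smooth_fun_cos simp del: inner_scaleR_left)
  show "(\<lambda>j. LINT x|lebesgue_on U. G x * sin ((1 / eps j) *\<^sub>R r \<bullet> x)) \<longlonglongrightarrow> 0"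
  proof (rule Riemann_Lebesgue_aux[OF U G eps])
    show "\<exists>C. \<forall>j. \<bar>LINT x|lborel. sin ((1 / eps j) *\<^sub>R r \<bullet> x) * \<psi> x\<bar> \<le> C * eps j" if \<psi>: "test_fun U \<psi>" for \<psi>
    proof -
      obtain C where "\<And>s. s > 0 \<Longrightarrow> \<bar>LINT x|lborel. sin (s *\<^sub>R r \<bullet> x) * \<psi> x\<bar> \<le> C / s"
        using test_fun_oscillating_bound[OF \<psi> r] by metis
      from this[of "1 / eps _"] eps(1) show ?thesis by auto
    qed
  qed (auto intro: smooth_fun_sin simp del: inner_scaleR_left)
qed

subsection \<open>Periodic functions on the unit cell\<close>

text \<open>The Borel form of Lebesgue measure on the cell, used to form product measures and
  iterated integrals. For functions measurable here, integrals over
  \<open>lebesgue_on unit_cell\<close>, which the definitions of the theorem use, have the same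
  values.\<close>

abbreviation cell_measure :: "(real^'m) measure" where
  "cell_measure \<equiv> restrict_space lborel unit_cell"

lemma unit_cell_borel [measurable, simp]: "(unit_cell :: (real^'m) set) \<in> sets borel"
proof -
  have "(unit_cell :: (real^'m) set) = (\<Inter>i\<in>UNIV. {y. 0 \<le> y $ i} \<inter> {y. y $ i < 1})"
    by (auto simp: unit_cell_def)
  moreover have "{y::real^'m. 0 \<le> y $ i} \<inter> {y. y $ i < 1} \<in> sets borel" for i
    by (intro sets.Int borel_closed borel_open closed_halfspace_component_ge_cart open_halfspace_component_lt_cart)
  then have "(\<Inter>i\<in>UNIV. {y::real^'m. 0 \<le> y $ i} \<inter> {y. y $ i < 1}) \<in> sets borel"
    by (intro sets.finite_INT) auto
  ultimately show ?thesis by simp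
qed

lemma space_cell_measure [simp]: "space cell_measure = unit_cell"
  by (simp add: space_restrict_space)

lemma box_subset_unit_cell: "box 0 1 \<subseteq> (unit_cell :: (real^'m) set)"
  and unit_cell_subset_cbox: "unit_cell \<subseteq> (cbox 0 1 :: (real^'m) set)"
  by (auto simp: unit_cell_def mem_box_cart less_imp_le)

text \<open>The half-open cell lies between the open and the closed unit box, both of volume
  one.\<close>

lemma emeasure_unit_cell: "emeasure lborel (unit_cell :: (real^'m) set) = 1"
proof (rule antisym)
  have c: "emeasure lborel (cbox 0 (1::real^'m)) = 1"
    by (simp add: emeasure_lborel_cbox_eq Basis_vec_def inner_axis prod.neutral)
  have b: "emeasure lborel (box 0 (1::real^'m)) = 1"
    by (simp add: emeasure_lborel_box_eq Basis_vec_def inner_axis prod.neutral)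
  show "emeasure lborel (unit_cell :: (real^'m) set) \<le> 1"
    using emeasure_mono[of unit_cell "cbox 0 (1::real^'m)" lborel] unit_cell_subset_cbox c by auto
  show "1 \<le> emeasure lborel (unit_cell :: (real^'m) set)"
    using emeasure_mono[of "box 0 (1::real^'m)" unit_cell lborel] box_subset_unit_cell b by auto
qed

lemma finite_measure_cell: "finite_measure cell_measure"
  by (rule finite_measureI) (simp add: emeasure_restrict_space emeasure_unit_cell)

lemma measure_cell [simp]: "measure cell_measure (unit_cell :: (real^'m) set) = 1"
proof -
  have "emeasure cell_measure (unit_cell :: (real^'m) set) = 1"
    by (subst emeasure_restrict_space) (auto simp: emeasure_unit_cell)
  then show ?thesis by (simp add: measure_def)
qed

lemma cell_measurableI: "f \<in> borel_measurable borel \<Longrightarrow> f \<in> borel_measurable cell_measure"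
  by (rule measurable_restrict_space1) simp

lemma
  fixes f :: "real^'m \<Rightarrow> 'b::{banach, second_countable_topology}"
  assumes "f \<in> borel_measurable cell_measure"
  shows integrable_lebesgue_on_cell: "integrable (lebesgue_on unit_cell) f \<longleftrightarrow> integrable cell_measure f"
    and integral_lebesgue_on_cell: "integral\<^sup>L (lebesgue_on unit_cell) f = integral\<^sup>L cell_measure f"
proof -
  have m: "(\<lambda>x. indicator unit_cell x *\<^sub>R f x) \<in> borel_measurable lborel"
    using assms by (subst (asm) borel_measurable_restrict_space_iff) auto
  show "integrable (lebesgue_on unit_cell) f \<longleftrightarrow> integrable cell_measure f"
    by (simp add: integrable_restrict_space integrable_completion[OF m])
  show "integral\<^sup>L (lebesgue_on unit_cell) f = integral\<^sup>L cell_measure f"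
    by (simp add: integral_restrict_space integral_completion[OF m])
qed

lemma cell_integrable_bounded:
  fixes f :: "real^'m \<Rightarrow> real"
  assumes "f \<in> borel_measurable cell_measure" "\<And>y. y \<in> unit_cell \<Longrightarrow> \<bar>f y\<bar> \<le> B"
  shows "integrable cell_measure f"
  by (rule finite_measure.integrable_const_bound[OF finite_measure_cell, where B=B]) (use assms in auto)

lemma cell_integrable_mult:
  fixes f h :: "real^'m \<Rightarrow> real"
  assumes "f \<in> borel_measurable cell_measure" "\<And>y. y \<in> unit_cell \<Longrightarrow> \<bar>f y\<bar> \<le> B" "integrable cell_measure h"
  shows "integrable cell_measure (\<lambda>y. f y * h y)"
proof (rule Bochner_Integration.integrable_bound[where f = "\<lambda>y. B * h y"])
  show "AE y in cell_measure. norm (f y * h y) \<le> norm (B * h y)"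
  proof (rule AE_I2)
    fix y :: "real^'m" assume "y \<in> space cell_measure"
    then have "\<bar>f y\<bar> \<le> \<bar>B\<bar>" using assms(2)[of y] by auto
    then show "norm (f y * h y) \<le> norm (B * h y)" by (auto simp: abs_mult intro: mult_right_mono)
  qed
qed (use assms in auto)

lemma
  fixes g :: "real^'m \<Rightarrow> 'b::{banach, second_countable_topology}"
  assumes "g \<in> borel_measurable borel"
  shows integrable_lborel_shift: "integrable lborel (\<lambda>x. g (x + c)) \<longleftrightarrow> integrable lborel g"
    and integral_lborel_shift: "(LINT x|lborel. g (x + c)) = (LINT x|lborel. g x)"
proof -
  have e: "distr lborel borel ((+) c) = lborel" by (rule lborel_distr_plus)
  show "integrable lborel (\<lambda>x. g (x + c)) \<longleftrightarrow> integrable lborel g"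
    using integrable_distr_eq[of "(+) c" lborel borel g] assms by (simp add: e add.commute)
  show "(LINT x|lborel. g (x + c)) = (LINT x|lborel. g x)"
    using integral_distr[of "(+) c" lborel borel g] assms by (simp add: e add.commute)
qed

lemma axis_nth: "axis i c $ j = (if j = i then c else 0)"
  by (simp add: axis_def)

lemma int_vec_axis: "int_vec (axis i 1)" "int_vec (- axis i 1)"
  by (auto simp: int_vec_def axis_nth)

lemma int_vec_add: "int_vec k \<Longrightarrow> int_vec l \<Longrightarrow> int_vec (k + l)"
  and int_vec_diff: "int_vec k \<Longrightarrow> int_vec l \<Longrightarrow> int_vec (k - l)"
  and int_vec_0: "int_vec 0"
  by (auto simp: int_vec_def)

lemma countable_int_vec: "countable {k::real^'m. int_vec k}"
proof -
  have "{k::real^'m. int_vec k} \<subseteq> range (\<lambda>f::'m \<Rightarrow> int. \<chi> i. of_int (f i))"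
  proof
    fix k :: "real^'m" assume "k \<in> {k. int_vec k}"
    then have "k = (\<chi> i. of_int (\<lfloor>k $ i\<rfloor>))"
      by (auto simp: int_vec_def vec_eq_iff Ints_def)
    then show "k \<in> range (\<lambda>f::'m \<Rightarrow> int. \<chi> i. of_int (f i))" by (intro image_eqI[where x="\<lambda>i. \<lfloor>k $ i\<rfloor>"]) simp_all
  qed
  moreover have "countable (range (\<lambda>f::'m \<Rightarrow> int. (\<chi> i. of_int (f i)) :: real^'m))"
    by (intro countable_image countableI_type)
  ultimately show ?thesis by (rule countable_subset)
qed

text \<open>The shifted cell is cut along one hyperplane and the protruding slab is moved back by a period.\<close>

lemma cell_integral_axis_shift:
  fixes f :: "real^'m \<Rightarrow> real"
  assumes per: "periodic_cell f" and [measurable]: "f \<in> borel_measurable borel"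
    and bdd: "\<And>y. \<bar>f y\<bar> \<le> B" and s: "0 \<le> s" "s \<le> 1"
  shows "(LINT y|cell_measure. f (y + axis i s)) = (LINT y|cell_measure. f y)"
proof -
  have ii: "axis i s - axis i 1 = axis i (s - 1)" for s :: real
    by (simp add: vec_eq_iff axis_nth)
  \<comment> \<open>Translation by \<open>s\<close> in direction \<open>i\<close> carries
    \<open>A\<close> onto \<open>A2\<close>, translation by \<open>s - 1\<close> carries
    \<open>B'\<close> onto \<open>B2\<close>. Both pairs partition the cell, and the two translates
    differ by one period.\<close>
  define A where "A = (unit_cell :: (real^'m) set) \<inter> {y. y $ i < 1 - s}"
  define B' where "B' = (unit_cell :: (real^'m) set) \<inter> {y. 1 - s \<le> y $ i}"
  define A2 where "A2 = (unit_cell :: (real^'m) set) \<inter> {y. s \<le> y $ i}"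
  define B2 where "B2 = (unit_cell :: (real^'m) set) \<inter> {y. y $ i < s}"
  have half [measurable]: "{y::real^'m. y $ i < c} \<in> sets borel" "{y::real^'m. c \<le> y $ i} \<in> sets borel" for c
    using open_halfspace_component_lt_cart[of i c] closed_halfspace_component_ge_cart[of c i] by auto
  have m [measurable]: "A \<in> sets borel" "B' \<in> sets borel" "A2 \<in> sets borel" "B2 \<in> sets borel"
    unfolding A_def B'_def A2_def B2_def by measurable
  have int: "integrable lborel (\<lambda>y. indicator S y *\<^sub>R f y)" if "S \<subseteq> unit_cell" "S \<in> sets borel" for S
  proof (rule integrableI_bounded_set_indicator)
    show "emeasure lborel S < \<infinity>"
      using emeasure_mono[OF that(1), of lborel] emeasure_unit_cell[where 'm='m]
      by (metis (no_types, lifting) ennreal_one_less_top infinity_ennreal_def order_le_less_trans sets_lborel unit_cell_borel)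
    show "AE x in lborel. x \<in> S \<longrightarrow> norm (f x) \<le> B" using bdd by auto
  qed (use that in auto)
  have 1: "indicator unit_cell y *\<^sub>R f (y + axis i s) =
      indicator A2 (y + axis i s) *\<^sub>R f (y + axis i s) + indicator B2 (y + axis i (s - 1)) *\<^sub>R f (y + axis i (s - 1))" for y
  proof -
    have split: "u \<in> unit_cell \<longleftrightarrow> (\<forall>j. j \<noteq> i \<longrightarrow> 0 \<le> u $ j \<and> u $ j < 1) \<and> 0 \<le> u $ i \<and> u $ i < 1" for u :: "real^'m"
    proof
      assume r: "(\<forall>j. j \<noteq> i \<longrightarrow> 0 \<le> u $ j \<and> u $ j < 1) \<and> 0 \<le> u $ i \<and> u $ i < 1"
      have "0 \<le> u $ j \<and> u $ j < 1" for j by (cases "j = i") (use r in auto)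
      then show "u \<in> unit_cell" by (simp add: unit_cell_def)
    qed (simp add: unit_cell_def)
    have a: "y + axis i s \<in> A2 \<longleftrightarrow> y \<in> A"
      using s by (auto simp: A_def A2_def split axis_nth)
    have b: "y + axis i (s - 1) \<in> B2 \<longleftrightarrow> y \<in> B'"
      using s by (auto simp: B'_def B2_def split axis_nth)
    have c: "f (y + axis i (s - 1)) = f (y + axis i s)"
      using per int_vec_axis(2)[of i] unfolding periodic_cell_def ii[symmetric]
      by (metis (no_types, opaque_lifting) add_diff_eq diff_conv_add_uminus)
    have d: "indicator unit_cell y = (indicator A y + indicator B' y :: real)"
      by (auto simp: A_def B'_def indicator_def)
    show ?thesis unfolding c d using a b by (simp add: indicator_def)
  qed
  have "(LINT y|cell_measure. f (y + axis i s)) = (LINT y|lborel. indicator unit_cell y *\<^sub>R f (y + axis i s))"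
    by (simp add: integral_restrict_space)
  also have "\<dots> = (LINT y|lborel. indicator A2 (y + axis i s) *\<^sub>R f (y + axis i s)) + (LINT y|lborel. indicator B2 (y + axis i (s - 1)) *\<^sub>R f (y + axis i (s - 1)))"
    unfolding 1
    using integrable_lborel_shift[of "\<lambda>y. indicator A2 y *\<^sub>R f y"] integrable_lborel_shift[of "\<lambda>y. indicator B2 y *\<^sub>R f y"]
      int[of A2] int[of B2] m
    by (intro Bochner_Integration.integral_add) (auto simp: A2_def B2_def)
  also have "\<dots> = (LINT y|lborel. indicator A2 y *\<^sub>R f y) + (LINT y|lborel. indicator B2 y *\<^sub>R f y)"
    using integral_lborel_shift[of "\<lambda>y. indicator A2 y *\<^sub>R f y"] integral_lborel_shift[of "\<lambda>y. indicator B2 y *\<^sub>R f y"] by simp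
  also have "\<dots> = (LINT y|lborel. indicator A2 y *\<^sub>R f y + indicator B2 y *\<^sub>R f y)"
    using int[of A2] int[of B2] m by (intro Bochner_Integration.integral_add[symmetric]) (auto simp: A2_def B2_def)
  also have "\<dots> = (LINT y|lborel. indicator unit_cell y *\<^sub>R f y)"
    by (intro Bochner_Integration.integral_cong) (auto simp: A2_def B2_def indicator_def)
  also have "\<dots> = (LINT y|cell_measure. f y)" by (simp add: integral_restrict_space)
  finally show ?thesis .
qed

lemma int_vec_inner_Ints: "int_vec k \<Longrightarrow> int_vec l \<Longrightarrow> k \<bullet> l \<in> \<int>"
  by (auto simp: int_vec_def inner_vec_def intro: Ints_sum Ints_mult)

lemma periodic_cell_cos: "int_vec k \<Longrightarrow> periodic_cell (\<lambda>y. cos (2 * pi * (k \<bullet> y)))"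
  and periodic_cell_sin: "int_vec k \<Longrightarrow> periodic_cell (\<lambda>y. sin (2 * pi * (k \<bullet> y)))"
proof -
  assume k: "int_vec k"
  have "cos (2 * pi * (k \<bullet> (y + l))) = cos (2 * pi * (k \<bullet> y)) \<and> sin (2 * pi * (k \<bullet> (y + l))) = sin (2 * pi * (k \<bullet> y))"
    if "int_vec l" for y l
  proof -
    obtain n where "k \<bullet> l = of_int n" using int_vec_inner_Ints[OF k \<open>int_vec l\<close>] Ints_cases by blast
    then have "2 * pi * (k \<bullet> (y + l)) = 2 * pi * (k \<bullet> y) + 2 * pi * of_int n"
      by (simp add: inner_add_right distrib_left)
    then show ?thesis by (simp add: cos_add sin_add sin_int_2pin cos_int_2pin)
  qed
  then show "periodic_cell (\<lambda>y. cos (2 * pi * (k \<bullet> y)))" "periodic_cell (\<lambda>y. sin (2 * pi * (k \<bullet> y)))"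
    unfolding periodic_cell_def by blast+
qed

text \<open>A shift by half a period in a coordinate with \<open>k $ i \<noteq> 0\<close> preserves
  the integral and reverses the sign of the integrand. Its length
  \<open>1 / (2 * \<bar>k $ i\<bar>)\<close> is at most one because \<open>k $ i\<close> is a
  nonzero integer.\<close>

lemma cell_integral_cos:
  assumes k: "int_vec k" "k \<noteq> (0::real^'m)"
  shows "(LINT y|cell_measure. cos (2 * pi * (k \<bullet> y))) = 0"
    and cell_integral_sin: "(LINT y|cell_measure. sin (2 * pi * (k \<bullet> y))) = 0"
proof -
  obtain i where i: "k $ i \<noteq> 0" using k(2) by (metis vec_eq_iff zero_index)
  obtain n where n: "k $ i = of_int n" using k(1) unfolding int_vec_def by (metis Ints_cases)
  define s where "s = 1 / (2 * \<bar>k $ i\<bar>)"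
  have "\<bar>k $ i\<bar> \<ge> 1" using i n by simp
  then have s: "0 \<le> s" "s \<le> 1" by (auto simp: s_def field_simps)
  have shift: "2 * pi * (k \<bullet> (y + axis i s)) = 2 * pi * (k \<bullet> y) + sgn (k $ i) * pi" for y
    using i by (simp add: inner_add_right inner_axis s_def distrib_left sgn_if)
  have "(LINT y|cell_measure. cos (2 * pi * (k \<bullet> (y + axis i s)))) = (LINT y|cell_measure. cos (2 * pi * (k \<bullet> y)))"
    by (rule cell_integral_axis_shift[where B=1 and f="\<lambda>y. cos (2 * pi * (k \<bullet> y))"]) (use k s periodic_cell_cos in auto)
  moreover have "cos (2 * pi * (k \<bullet> (y + axis i s))) = - cos (2 * pi * (k \<bullet> y))" for y
    unfolding shift using i by (auto simp: sgn_if cos_diff)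
  ultimately show "(LINT y|cell_measure. cos (2 * pi * (k \<bullet> y))) = 0" by simp
  have "(LINT y|cell_measure. sin (2 * pi * (k \<bullet> (y + axis i s)))) = (LINT y|cell_measure. sin (2 * pi * (k \<bullet> y)))"
    by (rule cell_integral_axis_shift[where B=1 and f="\<lambda>y. sin (2 * pi * (k \<bullet> y))"]) (use k s periodic_cell_sin in auto)
  moreover have "sin (2 * pi * (k \<bullet> (y + axis i s))) = - sin (2 * pi * (k \<bullet> y))" for y
    unfolding shift using i by (auto simp: sgn_if sin_diff)
  ultimately show "(LINT y|cell_measure. sin (2 * pi * (k \<bullet> y))) = 0" by simp
qed

section \<open>Trigonometric polynomials and convolution on the cell\<close>

inductive trig_poly :: "(real^'m \<Rightarrow> real) \<Rightarrow> bool" where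
  cos: "int_vec k \<Longrightarrow> trig_poly (\<lambda>u. c * cos (2 * pi * (k \<bullet> u)))"
| sin: "int_vec k \<Longrightarrow> trig_poly (\<lambda>u. c * sin (2 * pi * (k \<bullet> u)))"
| add: "trig_poly f \<Longrightarrow> trig_poly g \<Longrightarrow> trig_poly (\<lambda>u. f u + g u)"

lemma trig_poly_const: "trig_poly (\<lambda>u. c)"
  using trig_poly.cos[OF int_vec_0, of c] by simp

lemma trig_poly_cmult: "trig_poly f \<Longrightarrow> trig_poly (\<lambda>u. a * f u)"
proof (induction rule: trig_poly.induct)
  case (cos k c)
  then show ?case using trig_poly.cos[of k "a * c"] by (simp add: mult.assoc)
next
  case (sin k c)
  then show ?case using trig_poly.sin[of k "a * c"] by (simp add: mult.assoc)
next
  case (add f g)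
  then show ?case using trig_poly.add by (simp add: distrib_left)
qed

lemma trig_poly_mult_monomials:
  assumes k: "int_vec k" and l: "int_vec l"
  shows "trig_poly (\<lambda>u. cos (2 * pi * (k \<bullet> u)) * cos (2 * pi * (l \<bullet> u)))"
    and "trig_poly (\<lambda>u. cos (2 * pi * (k \<bullet> u)) * sin (2 * pi * (l \<bullet> u)))"
    and "trig_poly (\<lambda>u. sin (2 * pi * (k \<bullet> u)) * sin (2 * pi * (l \<bullet> u)))"
proof -
  note i = int_vec_add[OF k l] int_vec_diff[OF k l] int_vec_diff[OF l k] int_vec_add[OF l k]
  have "trig_poly (\<lambda>u. 1/2 * cos (2 * pi * ((k - l) \<bullet> u)) + 1/2 * cos (2 * pi * ((k + l) \<bullet> u)))"
    by (intro trig_poly.intros i)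
  then show "trig_poly (\<lambda>u. cos (2 * pi * (k \<bullet> u)) * cos (2 * pi * (l \<bullet> u)))"
    by (simp add: cos_times_cos inner_add_left inner_diff_left distrib_left right_diff_distrib add_divide_distrib)
  have "trig_poly (\<lambda>u. 1/2 * sin (2 * pi * ((k + l) \<bullet> u)) + - 1/2 * sin (2 * pi * ((k - l) \<bullet> u)))"
    by (intro trig_poly.intros i)
  then show "trig_poly (\<lambda>u. cos (2 * pi * (k \<bullet> u)) * sin (2 * pi * (l \<bullet> u)))"
    by (simp add: cos_times_sin inner_add_left inner_diff_left distrib_left right_diff_distrib diff_divide_distrib)
  have "trig_poly (\<lambda>u. 1/2 * cos (2 * pi * ((k - l) \<bullet> u)) + - 1/2 * cos (2 * pi * ((k + l) \<bullet> u)))"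
    by (intro trig_poly.intros i)
  then show "trig_poly (\<lambda>u. sin (2 * pi * (k \<bullet> u)) * sin (2 * pi * (l \<bullet> u)))"
    by (simp add: sin_times_sin inner_add_left inner_diff_left distrib_left right_diff_distrib diff_divide_distrib)
qed

lemma trig_poly_mult:
  assumes "trig_poly f" "trig_poly g"
  shows "trig_poly (\<lambda>u. f u * g u)"
  using assms(1)
proof (induction rule: trig_poly.induct)
  case k: (cos k a)
  from assms(2) show ?case
  proof (induction rule: trig_poly.induct)
    case (cos l b)
    from trig_poly_cmult[OF trig_poly_mult_monomials(1)[OF k cos], of "a * b"] show ?case by (simp add: mult_ac)
  next
    case (sin l b)
    from trig_poly_cmult[OF trig_poly_mult_monomials(2)[OF k sin], of "a * b"] show ?case by (simp add: mult_ac)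
  next
    case (add f g)
    then show ?case using trig_poly.add by (simp add: distrib_left)
  qed
next
  case k: (sin k a)
  from assms(2) show ?case
  proof (induction rule: trig_poly.induct)
    case (cos l b)
    from trig_poly_cmult[OF trig_poly_mult_monomials(2)[OF cos k], of "a * b"] show ?case by (simp add: mult_ac)
  next
    case (sin l b)
    from trig_poly_cmult[OF trig_poly_mult_monomials(3)[OF k sin], of "a * b"] show ?case by (simp add: mult_ac)
  next
    case (add f g)
    then show ?case using trig_poly.add by (simp add: distrib_left)
  qed
next
  case (add f g)
  then show ?case using trig_poly.add by (simp add: distrib_right)
qed

lemma trig_poly_prod: "(\<And>i. i \<in> A \<Longrightarrow> trig_poly (f i)) \<Longrightarrow> trig_poly (\<lambda>u. \<Prod>i\<in>A. f i u)"
  by (induction A rule: infinite_finite_induct) (auto intro: trig_poly_const trig_poly_mult)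

lemma trig_poly_power: "trig_poly f \<Longrightarrow> trig_poly (\<lambda>u. f u ^ n)"
  by (induction n) (auto intro: trig_poly_const trig_poly_mult)

lemma trig_poly_continuous: "trig_poly f \<Longrightarrow> continuous_on S f"
  by (induction rule: trig_poly.induct) (auto intro!: continuous_intros)

lemma trig_poly_measurable: "trig_poly f \<Longrightarrow> f \<in> borel_measurable borel"
  by (intro borel_measurable_continuous_onI trig_poly_continuous)

lemma trig_poly_bounded:
  assumes "trig_poly f"
  obtains B where "B > 0" "\<And>u. \<bar>f u\<bar> \<le> B"
proof -
  from assms have "\<exists>B>0. \<forall>u. \<bar>f u\<bar> \<le> B"
  proof (induction rule: trig_poly.induct)
    case (cos k c)
    then show ?case by (intro exI[of _ "\<bar>c\<bar> + 1"]) (auto simp: abs_mult intro: order.trans[OF mult_left_le])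
  next
    case (sin k c)
    then show ?case by (intro exI[of _ "\<bar>c\<bar> + 1"]) (auto simp: abs_mult intro: order.trans[OF mult_left_le])
  next
    case (add f g)
    then obtain B C where "B > 0" "C > 0" "\<And>u. \<bar>f u\<bar> \<le> B" "\<And>u. \<bar>g u\<bar> \<le> C" by blast
    then show ?case by (intro exI[of _ "B + C"]) (auto intro: order.trans[OF abs_triangle_ineq add_mono])
  qed
  then show thesis using that by blast
qed

text \<open>Only the kernel is translated, so \<open>w\<close> enters through its values on the cell
  alone. The kernels in use are trigonometric polynomials, hence periodic, and this is convolution
  on the torus.\<close>

definition cell_conv :: "(real^'m \<Rightarrow> real) \<Rightarrow> (real^'m \<Rightarrow> real) \<Rightarrow> real^'m \<Rightarrow> real" where
  "cell_conv K w y = (LINT z|cell_measure. K (y - z) * w z)"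

text \<open>The real part of the \<open>k\<close>-th Fourier coefficient; \<open>fsin\<close> is
  minus its imaginary part, the exponential carrying a negative sign.\<close>

definition fcos :: "(real^'m \<Rightarrow> real) \<Rightarrow> real^'m \<Rightarrow> real" where
  "fcos w k = (LINT z|cell_measure. cos (2 * pi * (k \<bullet> z)) * w z)"

definition fsin :: "(real^'m \<Rightarrow> real) \<Rightarrow> real^'m \<Rightarrow> real" where
  "fsin w k = (LINT z|cell_measure. sin (2 * pi * (k \<bullet> z)) * w z)"

lemma integrable_cos_sin_mult:
  assumes "integrable cell_measure w"
  shows "integrable cell_measure (\<lambda>z. cos (2 * pi * (k \<bullet> z)) * w z)"
    and "integrable cell_measure (\<lambda>z. sin (2 * pi * (k \<bullet> z)) * w z)"
  by (rule cell_integrable_mult[where B=1]; use assms in \<open>auto intro!: cell_measurableI\<close>)+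

lemma trig_poly_conv_integrable:
  assumes "trig_poly K" "integrable cell_measure w"
  shows "integrable cell_measure (\<lambda>z. K (y - z) * w z)"
proof -
  obtain B where "\<And>u. \<bar>K u\<bar> \<le> B" using trig_poly_bounded[OF assms(1)] by metis
  then show ?thesis
    using assms trig_poly_measurable[OF assms(1)]
    by (intro cell_integrable_mult[where B=B]) (auto intro!: cell_measurableI measurable_compose[OF _ trig_poly_measurable[OF assms(1)]])
qed

lemma cell_conv_add:
  assumes "trig_poly f" "trig_poly g" "integrable cell_measure w"
  shows "cell_conv (\<lambda>u. f u + g u) w y = cell_conv f w y + cell_conv g w y"
  unfolding cell_conv_def distrib_right
  by (intro Bochner_Integration.integral_add trig_poly_conv_integrable assms)

lemma cell_conv_cos:
  assumes "integrable cell_measure w"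
  shows "cell_conv (\<lambda>u. c * cos (2 * pi * (k \<bullet> u))) w y =
    c * (cos (2 * pi * (k \<bullet> y)) * fcos w k + sin (2 * pi * (k \<bullet> y)) * fsin w k)"
proof -
  have "c * cos (2 * pi * (k \<bullet> (y - z))) * w z = c * cos (2 * pi * (k \<bullet> y)) * (cos (2 * pi * (k \<bullet> z)) * w z)
     + c * sin (2 * pi * (k \<bullet> y)) * (sin (2 * pi * (k \<bullet> z)) * w z)" for z
    by (simp add: inner_diff_right right_diff_distrib cos_diff algebra_simps)
  then have "cell_conv (\<lambda>u. c * cos (2 * pi * (k \<bullet> u))) w y = c * cos (2 * pi * (k \<bullet> y)) * fcos w k + c * sin (2 * pi * (k \<bullet> y)) * fsin w k"
    unfolding cell_conv_def fcos_def fsin_def using integrable_cos_sin_mult[OF assms, of k] by simp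
  then show ?thesis by (simp add: algebra_simps)
qed

lemma cell_conv_sin:
  assumes "integrable cell_measure w"
  shows "cell_conv (\<lambda>u. c * sin (2 * pi * (k \<bullet> u))) w y =
    c * (sin (2 * pi * (k \<bullet> y)) * fcos w k - cos (2 * pi * (k \<bullet> y)) * fsin w k)"
proof -
  have "c * sin (2 * pi * (k \<bullet> (y - z))) * w z = c * sin (2 * pi * (k \<bullet> y)) * (cos (2 * pi * (k \<bullet> z)) * w z)
     - c * cos (2 * pi * (k \<bullet> y)) * (sin (2 * pi * (k \<bullet> z)) * w z)" for z
    by (simp add: inner_diff_right right_diff_distrib sin_diff algebra_simps)
  then have "cell_conv (\<lambda>u. c * sin (2 * pi * (k \<bullet> u))) w y = c * sin (2 * pi * (k \<bullet> y)) * fcos w k - c * cos (2 * pi * (k \<bullet> y)) * fsin w k"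
    unfolding cell_conv_def fcos_def fsin_def using integrable_cos_sin_mult[OF assms, of k] by simp
  then show ?thesis by (simp add: algebra_simps)
qed

lemma cell_conv_trig_poly:
  assumes K: "trig_poly K" and w: "integrable cell_measure w"
  shows "trig_poly (cell_conv K w)"
  using K
proof (induction rule: trig_poly.induct)
  case (cos k c)
  have "trig_poly (\<lambda>y. (c * fcos w k) * cos (2 * pi * (k \<bullet> y)) + (c * fsin w k) * sin (2 * pi * (k \<bullet> y)))"
    by (intro trig_poly.intros cos)
  then show ?case by (subst cell_conv_cos[OF w, abs_def]) (simp add: algebra_simps)
next
  case (sin k c)
  have "trig_poly (\<lambda>y. (c * fcos w k) * sin (2 * pi * (k \<bullet> y)) + (- c * fsin w k) * cos (2 * pi * (k \<bullet> y)))"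
    by (intro trig_poly.intros sin)
  then show ?case by (subst cell_conv_sin[OF w, abs_def]) (simp add: algebra_simps)
next
  case (add f g)
  have "cell_conv (\<lambda>u. f u + g u) w = (\<lambda>y. cell_conv f w y + cell_conv g w y)"
    using cell_conv_add[OF add.hyps w] by auto
  then show ?case using trig_poly.add[OF add.IH] by (simp only:)
qed

lemma trig_poly_cell_integrable: "trig_poly f \<Longrightarrow> integrable cell_measure f"
  by (metis cell_integrable_bounded cell_measurableI trig_poly_bounded trig_poly_measurable)

text \<open>No exchange of integrals is involved. Convolving a monomial with \<open>w\<close> gives
  an explicit combination of cosine and sine of the same frequency, so both sides vanish for
  \<open>k \<noteq> 0\<close>; for \<open>k = 0\<close> the kernel is constant.\<close>

lemma cell_integral_trig_conv:
  assumes K: "trig_poly K" and w: "integrable cell_measure w"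
  shows "(LINT y|cell_measure. cell_conv K w y) = (LINT y|cell_measure. K y) * (LINT y|cell_measure. w y)"
  using K
proof (induction rule: trig_poly.induct)
  case (cos k c)
  show ?case
  proof (cases "k = 0")
    case True
    then show ?thesis by (simp add: cell_conv_def)
  next
    case False
    have "(LINT y|cell_measure. (c * fcos w k) * cos (2 * pi * (k \<bullet> y)) + (c * fsin w k) * sin (2 * pi * (k \<bullet> y))) = 0"
      using trig_poly_cell_integrable[OF trig_poly.cos[OF cos, of "c * fcos w k"]]
        trig_poly_cell_integrable[OF trig_poly.sin[OF cos, of "c * fsin w k"]]
      by (simp add: cell_integral_cos[OF cos False] cell_integral_sin[OF cos False])
    moreover have "cell_conv (\<lambda>u. c * cos (2 * pi * (k \<bullet> u))) w y =
        (c * fcos w k) * cos (2 * pi * (k \<bullet> y)) + (c * fsin w k) * sin (2 * pi * (k \<bullet> y))" for y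
      unfolding cell_conv_cos[OF w] by (simp add: algebra_simps)
    ultimately show ?thesis by (simp add: cell_integral_cos[OF cos False])
  qed
next
  case (sin k c)
  show ?case
  proof (cases "k = 0")
    case True
    then show ?thesis by (simp add: cell_conv_def)
  next
    case False
    have "(LINT y|cell_measure. (c * fcos w k) * sin (2 * pi * (k \<bullet> y)) - (c * fsin w k) * cos (2 * pi * (k \<bullet> y))) = 0"
      using trig_poly_cell_integrable[OF trig_poly.sin[OF sin, of "c * fcos w k"]]
        trig_poly_cell_integrable[OF trig_poly.cos[OF sin, of "c * fsin w k"]]
      by (simp add: cell_integral_cos[OF sin False] cell_integral_sin[OF sin False])
    moreover have "cell_conv (\<lambda>u. c * sin (2 * pi * (k \<bullet> u))) w y =
        (c * fcos w k) * sin (2 * pi * (k \<bullet> y)) - (c * fsin w k) * cos (2 * pi * (k \<bullet> y))" for y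
      unfolding cell_conv_sin[OF w] by (simp add: algebra_simps)
    ultimately show ?thesis by (simp add: cell_integral_sin[OF sin False])
  qed
next
  case (add f g)
  then show ?case
    using trig_poly_cell_integrable[OF cell_conv_trig_poly[OF add.hyps(1) w]] trig_poly_cell_integrable[OF add.hyps(1)]
      trig_poly_cell_integrable[OF cell_conv_trig_poly[OF add.hyps(2) w]] trig_poly_cell_integrable[OF add.hyps(2)]
    by (simp add: cell_conv_add[OF add.hyps w] distrib_right)
qed

text \<open>Translation and reflection invariance of the integral over the torus, read off from the
  explicit convolutions of monomials.\<close>

lemma cell_conv_one:
  assumes "trig_poly K"
  shows "cell_conv K (\<lambda>z. 1) y = (LINT z|cell_measure. K z)"
proof -
  have 1: "integrable cell_measure (\<lambda>z::real^'a. 1::real)" using trig_poly_cell_integrable[OF trig_poly_const] .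
  from assms show ?thesis
  proof (induction rule: trig_poly.induct)
    case (cos k c)
    show ?case
    proof (cases "k = 0")
      case True
      then show ?thesis by (simp add: cell_conv_def)
    next
      case False
      then show ?thesis by (simp add: cell_conv_cos[OF 1] fcos_def fsin_def cell_integral_cos[OF cos] cell_integral_sin[OF cos])
    qed
  next
    case (sin k c)
    show ?case
    proof (cases "k = 0")
      case True
      then show ?thesis by (simp add: cell_conv_def)
    next
      case False
      then show ?thesis by (simp add: cell_conv_sin[OF 1] fcos_def fsin_def cell_integral_cos[OF sin] cell_integral_sin[OF sin])
    qed
  next
    case (add f g)
    then show ?case by (simp add: cell_conv_add[OF add.hyps 1] trig_poly_cell_integrable)
  qed
qed

subsection \<open>An approximate identity of trigonometric polynomials\<close>

text \<open>The product of the squares of \<open>cos (pi * u $ i)\<close>: periodic, with values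
  between 0 and 1, and equal to one exactly at integer points. Its powers concentrate near the
  lattice and remain trigonometric polynomials; normalised, they are de la Vallee Poussin
  kernels.\<close>

definition peak :: "real^'m \<Rightarrow> real" where
  "peak u = (\<Prod>i\<in>UNIV. (1 + cos (2 * pi * u $ i)) / 2)"

lemma trig_poly_peak: "trig_poly peak"
proof -
  have "trig_poly (\<lambda>u::real^'a. 1/2 + 1/2 * cos (2 * pi * (axis i 1 \<bullet> u)))" for i
    by (intro trig_poly.add trig_poly_const trig_poly.cos int_vec_axis)
  then show ?thesis unfolding peak_def by (intro trig_poly_prod) (simp add: inner_axis' add_divide_distrib)
qed

lemma half_cos_bounds: "0 \<le> (1 + cos t) / (2::real)" "(1 + cos t) / 2 \<le> (1::real)"
proof -
  have "0 \<le> (1 + c) / 2 \<and> (1 + c) / 2 \<le> 1" if "-1 \<le> c" "c \<le> 1" for c :: real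
    using that by simp
  then show "0 \<le> (1 + cos t) / (2::real)" "(1 + cos t) / 2 \<le> (1::real)"
    using cos_ge_minus_one cos_le_one by blast+
qed

lemma peak_bounds: "0 \<le> peak u" "peak u \<le> 1"
  unfolding peak_def using half_cos_bounds by (auto intro!: prod_nonneg prod_le_1)

text \<open>Closeness to 0 on the torus, measured in the maximum norm.\<close>

definition near_int :: "real \<Rightarrow> real^'m \<Rightarrow> bool" where
  "near_int \<delta> u \<longleftrightarrow> (\<exists>k. int_vec k \<and> (\<forall>i. \<bar>u $ i - k $ i\<bar> < \<delta>))"

text \<open>Some coordinate is at least \<open>\<delta>\<close> away from its nearest integer, and
  at most 1/2. The cosine decreases on the corresponding range, which bounds the factor of this
  coordinate; all other factors are at most one.\<close>

lemma peak_far: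
  assumes "0 < \<delta>" "\<delta> \<le> 1/2" "\<not> near_int \<delta> u"
  shows "peak u \<le> (1 + cos (2 * pi * \<delta>)) / 2"
proof -
  have "int_vec (\<chi> i. real_of_int (round (u $ i)))" by (auto simp: int_vec_def)
  then obtain i where i: "\<bar>u $ i - of_int (round (u $ i))\<bar> \<ge> \<delta>"
    using assms(3) unfolding near_int_def by (metis not_less vec_lambda_beta)
  let ?d = "\<bar>u $ i - of_int (round (u $ i))\<bar>"
  have "?d \<le> 1/2" using of_int_round_abs_le[of "u $ i"] by (simp add: abs_minus_commute)
  have "cos (2 * pi * u $ i) = cos (2 * pi * (u $ i - of_int (round (u $ i))))"
    by (simp add: right_diff_distrib cos_diff cos_int_2pin sin_int_2pin)
  also have "\<dots> = cos (2 * pi * ?d)" by (metis abs_mult abs_of_pos cos_abs_real mult_pos_pos pi_gt_zero zero_less_numeral)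
  also have "\<dots> \<le> cos (2 * pi * \<delta>)"
    using \<open>?d \<le> 1/2\<close> i assms by (intro cos_monotone_0_pi_le) auto
  finally have 1: "(1 + cos (2 * pi * u $ i)) / 2 \<le> (1 + cos (2 * pi * \<delta>)) / 2" by simp
  have "peak u = (1 + cos (2 * pi * u $ i)) / 2 * (\<Prod>j\<in>UNIV - {i}. (1 + cos (2 * pi * u $ j)) / 2)"
    unfolding peak_def by (intro prod.remove) auto
  also have "\<dots> \<le> (1 + cos (2 * pi * u $ i)) / 2 * 1"
    using half_cos_bounds by (intro mult_left_mono prod_le_1) auto
  finally show ?thesis using 1 by simp
qed

text \<open>The bound comes from the open neighbourhood \<open>V\<close> of 0 on which
  \<open>peak\<close> exceeds \<open>s\<close>. The origin is only a corner of the cell, but it is a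
  limit of interior points, so the part of \<open>V\<close> inside the cell contains a nonempty open
  set. Its measure \<open>\<kappa>\<close> is positive and independent of \<open>N\<close>.\<close>

lemma peak_mass:
  assumes "s < 1"
  obtains \<kappa> where "\<kappa> > 0" "\<And>N. 0 \<le> s \<Longrightarrow> \<kappa> * s ^ N \<le> (LINT y|(cell_measure :: (real^'m) measure). peak y ^ N)"
proof -
  have cont: "continuous_on UNIV (peak :: real^'m \<Rightarrow> real)" by (rule trig_poly_continuous[OF trig_poly_peak])
  define V where "V = (peak -` {s<..} :: (real^'m) set)"
  have "open V" unfolding V_def using cont by (intro open_vimage) auto
  have "0 \<in> V" using assms by (simp add: V_def peak_def)
  have [measurable]: "V \<in> sets borel" using \<open>open V\<close> by auto
  define W where "W = V \<inter> box 0 (1::real^'m)"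
  have "0 \<in> closure (box 0 (1::real^'m))" by (subst closure_box) (auto simp: mem_box_cart interval_ne_empty_cart)
  then have "W \<noteq> {}" using \<open>open V\<close> \<open>0 \<in> V\<close> unfolding W_def by (metis closure_iff_nhds_not_empty order_refl inf_commute)
  moreover have "open W" using \<open>open V\<close> by (auto simp: W_def)
  ultimately have "\<not> negligible W" by (simp add: open_not_negligible)
  then have "emeasure lborel W \<noteq> 0" using \<open>open W\<close> by (simp add: negligible_iff_null_sets null_sets_def)
  have sub: "W \<subseteq> unit_cell \<inter> V" using box_subset_unit_cell by (auto simp: W_def)
  define \<kappa> where "\<kappa> = measure cell_measure (unit_cell \<inter> V)"
  have em: "emeasure cell_measure (unit_cell \<inter> V) = emeasure lborel (unit_cell \<inter> V)"
    by (intro emeasure_restrict_space) auto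
  have "emeasure lborel W \<le> emeasure lborel (unit_cell \<inter> V)"
    by (intro emeasure_mono sub) auto
  then have "emeasure cell_measure (unit_cell \<inter> V) \<noteq> 0" using em \<open>emeasure lborel W \<noteq> 0\<close> by auto
  then have "\<kappa> > 0"
    unfolding \<kappa>_def using finite_measure.emeasure_eq_measure[OF finite_measure_cell, of "unit_cell \<inter> V"]
    by (metis ennreal_0 measure_nonneg order_le_less)
  moreover have "\<kappa> * s ^ N \<le> (LINT y|(cell_measure :: (real^'m) measure). peak y ^ N)" if "0 \<le> s" for N
  proof -
    have "\<kappa> * s ^ N = (LINT y|(cell_measure :: (real^'m) measure). indicator V y * s ^ N)"
      by (simp add: \<kappa>_def Int_commute)
    also have "\<dots> \<le> (LINT y|(cell_measure :: (real^'m) measure). peak y ^ N)"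
    proof (rule integral_mono)
      show "integrable cell_measure (\<lambda>y. indicator V y * s ^ N)"
        by (rule cell_integrable_bounded[where B="s ^ N"]) (use that in \<open>auto intro!: cell_measurableI simp: indicator_def\<close>)
      show "integrable cell_measure (\<lambda>y::real^'m. peak y ^ N)"
        by (rule trig_poly_cell_integrable[OF trig_poly_power[OF trig_poly_peak]])
      show "indicator V y * s ^ N \<le> peak y ^ N" for y
        using that peak_bounds[of y] by (auto simp: indicator_def V_def intro!: power_mono)
    qed
    finally show ?thesis .
  qed
  ultimately show thesis by (rule that)
qed

definition peak_kernel :: "nat \<Rightarrow> real^'m \<Rightarrow> real" where
  "peak_kernel N u = peak u ^ N / (LINT y|(cell_measure :: (real^'m) measure). peak y ^ N)"

lemma peak_power_integral_pos: "(LINT y|(cell_measure :: (real^'m) measure). peak y ^ N) > 0"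
proof -
  obtain \<kappa> where \<kappa>: "\<kappa> > 0" "\<And>N. 0 \<le> (1/2::real) \<Longrightarrow> \<kappa> * (1/2) ^ N \<le> (LINT y|(cell_measure :: (real^'m) measure). peak y ^ N)"
    by (rule peak_mass[of "1/2", where 'm='m]) auto
  have "0 < \<kappa> * (1/2) ^ N" using \<kappa>(1) by simp
  also have "\<dots> \<le> (LINT y|(cell_measure :: (real^'m) measure). peak y ^ N)" by (rule \<kappa>(2)) simp
  finally show ?thesis .
qed

lemma trig_poly_peak_kernel: "trig_poly (peak_kernel N)"
  using trig_poly_cmult[OF trig_poly_power[OF trig_poly_peak, of N], of "1 / (LINT y|(cell_measure :: (real^'a) measure). peak y ^ N)"]
  by (simp add: peak_kernel_def[abs_def])

lemma peak_kernel_nonneg: "peak_kernel N u \<ge> 0"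
  unfolding peak_kernel_def using peak_power_integral_pos peak_bounds by (intro divide_nonneg_pos zero_le_power) auto

lemma peak_kernel_integral: "(LINT y|cell_measure. peak_kernel N y) = 1"
  unfolding peak_kernel_def 
  using peak_power_integral_pos[of N, where 'm='a] by (subst integral_divide_zero) simp

lemma peak_kernel_far:
  assumes "0 < \<delta>" "\<delta> \<le> 1/2"
  obtains \<omega> where "\<omega> \<longlonglongrightarrow> (0::real)" "\<And>N. \<omega> N \<ge> 0" "\<And>N (u::real^'m). \<not> near_int \<delta> u \<Longrightarrow> peak_kernel N u \<le> \<omega> N"
proof -
  define r where "r = (1 + cos (2 * pi * \<delta>)) / 2"
  have "cos (2 * pi * \<delta>) < cos 0" using assms by (intro cos_monotone_0_pi) auto
  then have r: "0 \<le> r" "r < 1" using half_cos_bounds[of "2 * pi * \<delta>"] by (auto simp: r_def)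
  \<comment> \<open>Any number strictly between the bound \<open>r\<close> away from the lattice and
    one would serve: the normalising integral is at least \<open>\<kappa> * s ^ N\<close>, so the
    kernel decays there like \<open>(r / s) ^ N\<close>.\<close>
  define s where "s = (1 + r) / 2"
  have s: "r < s" "s < 1" "0 < s" using r by (auto simp: s_def)
  obtain \<kappa> where \<kappa>: "\<kappa> > 0" "\<And>N. 0 \<le> s \<Longrightarrow> \<kappa> * s ^ N \<le> (LINT y|(cell_measure :: (real^'m) measure). peak y ^ N)"
    by (rule peak_mass[OF s(2), where 'm='m]) auto
  show thesis
  proof (rule that[of "\<lambda>N. (r / s) ^ N / \<kappa>"])
    have "(\<lambda>N. (r / s) ^ N / \<kappa>) \<longlonglongrightarrow> 0 / \<kappa>"
      using r s \<kappa> by (intro tendsto_divide LIMSEQ_realpow_zero) auto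
    then show "(\<lambda>N. (r / s) ^ N / \<kappa>) \<longlonglongrightarrow> 0" by simp
    show "0 \<le> (r / s) ^ N / \<kappa>" for N using r s \<kappa> by simp
    show "peak_kernel N u \<le> (r / s) ^ N / \<kappa>" if "\<not> near_int \<delta> u" for N and u :: "real^'m"
    proof -
      have "peak u \<le> r" using peak_far[OF assms that] by (simp add: r_def)
      then have "peak_kernel N u \<le> r ^ N / (LINT y|(cell_measure :: (real^'m) measure). peak y ^ N)"
        unfolding peak_kernel_def using peak_power_integral_pos peak_bounds
        by (intro divide_right_mono power_mono) (auto intro: less_imp_le)
      also have "\<dots> \<le> r ^ N / (\<kappa> * s ^ N)"
        using \<kappa> s r by (intro divide_left_mono) (auto intro!: mult_pos_pos peak_power_integral_pos)
      also have "\<dots> = (r / s) ^ N / \<kappa>" by (simp add: power_divide)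
      finally show ?thesis .
    qed
  qed
qed

text \<open>The error is an average of \<open>f z - f y\<close> with weights
  \<open>peak_kernel N (y - z)\<close> of total mass one. Near the lattice the oscillation
  \<open>\<eta>\<close> counts; elsewhere the difference is at most \<open>2 * B\<close> and the
  weight at most \<open>\<omega>\<close>.\<close>

lemma peak_kernel_uniform:
  fixes f :: "real^'m \<Rightarrow> real"
  assumes f: "f \<in> borel_measurable cell_measure" and B: "\<And>y. y \<in> unit_cell \<Longrightarrow> \<bar>f y\<bar> \<le> B"
    and near: "\<And>y z. y \<in> unit_cell \<Longrightarrow> z \<in> unit_cell \<Longrightarrow> near_int \<delta> (y - z) \<Longrightarrow> \<bar>f z - f y\<bar> \<le> \<eta>"
    and far: "\<And>u::real^'m. \<not> near_int \<delta> u \<Longrightarrow> peak_kernel N u \<le> \<omega>"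
    and pos: "\<omega> \<ge> 0" "\<eta> \<ge> 0" and y: "y \<in> unit_cell"
  shows "\<bar>cell_conv (peak_kernel N) f y - f y\<bar> \<le> \<eta> + 2 * B * \<omega>"
proof -
  let ?K = "peak_kernel N :: real^'m \<Rightarrow> real"
  have fi: "integrable cell_measure f" using f B by (rule cell_integrable_bounded)
  have 1: "integrable cell_measure (\<lambda>z::real^'m. 1::real)" using trig_poly_cell_integrable[OF trig_poly_const] .
  note Ki = trig_poly_conv_integrable[OF trig_poly_peak_kernel[of N], of _ y]
  have K1: "(LINT z|cell_measure. ?K (y - z)) = 1"
    using cell_conv_one[OF trig_poly_peak_kernel[of N], of y] peak_kernel_integral[of N] by (simp add: cell_conv_def)
  have Kint: "integrable cell_measure (\<lambda>z. ?K (y - z))" using Ki[OF 1] by simp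
  have "cell_conv ?K f y - f y = (LINT z|cell_measure. ?K (y - z) * f z) - (LINT z|cell_measure. ?K (y - z) * f y)"
    using K1 by (simp add: cell_conv_def)
  also have "\<dots> = (LINT z|cell_measure. ?K (y - z) * f z - ?K (y - z) * f y)"
    using Ki[OF fi] Kint by (intro Bochner_Integration.integral_diff[symmetric]) auto
  finally have "\<bar>cell_conv ?K f y - f y\<bar> = \<bar>LINT z|cell_measure. ?K (y - z) * f z - ?K (y - z) * f y\<bar>" by simp
  also have "\<dots> \<le> (LINT z|cell_measure. \<bar>?K (y - z) * f z - ?K (y - z) * f y\<bar>)" by (rule integral_abs_bound)
  also have "\<dots> \<le> (LINT z|cell_measure. ?K (y - z) * \<eta> + 2 * B * \<omega>)"
  proof (rule integral_mono)
    show "integrable cell_measure (\<lambda>z. \<bar>?K (y - z) * f z - ?K (y - z) * f y\<bar>)"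
      using Ki[OF fi] Kint by (intro integrable_abs Bochner_Integration.integrable_diff) auto
    show "integrable cell_measure (\<lambda>z. ?K (y - z) * \<eta> + 2 * B * \<omega>)"
      by (intro Bochner_Integration.integrable_add integrable_mult_left Kint
          finite_measure.integrable_const[OF finite_measure_cell])
    fix z :: "real^'m" assume "z \<in> space cell_measure"
    then have z: "z \<in> unit_cell" by simp
    have B0: "B \<ge> 0" using B[OF y] by linarith
    have e: "\<bar>?K (y - z) * f z - ?K (y - z) * f y\<bar> = ?K (y - z) * \<bar>f z - f y\<bar>"
      using peak_kernel_nonneg[of N "y - z"] by (simp add: right_diff_distrib[symmetric] abs_mult)
    show "\<bar>?K (y - z) * f z - ?K (y - z) * f y\<bar> \<le> ?K (y - z) * \<eta> + 2 * B * \<omega>"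
    proof (cases "near_int \<delta> (y - z)")
      case True
      then have "?K (y - z) * \<bar>f z - f y\<bar> \<le> ?K (y - z) * \<eta>"
        using near[OF y z] peak_kernel_nonneg by (intro mult_left_mono) auto
      then show ?thesis using e B0 pos by (smt (verit) mult_nonneg_nonneg)
    next
      case False
      have "?K (y - z) * \<bar>f z - f y\<bar> \<le> \<omega> * (2 * B)"
        using far[OF False] B[OF y] B[OF z] peak_kernel_nonneg pos by (intro mult_mono) auto
      then show ?thesis using e pos peak_kernel_nonneg[of N "y - z"] by (smt (verit) mult_nonneg_nonneg mult.commute)
    qed
  qed
  also have "\<dots> = \<eta> + 2 * B * \<omega>"
  proof -
    have "(LINT z|cell_measure. ?K (y - z) * \<eta> + 2 * B * \<omega>) = (LINT z|cell_measure. ?K (y - z) * \<eta>) + (LINT z|(cell_measure::(real^'m) measure). 2 * B * \<omega>)"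
      by (intro Bochner_Integration.integral_add integrable_mult_left Kint
          finite_measure.integrable_const[OF finite_measure_cell])
    then show ?thesis using K1 by simp
  qed
  finally show ?thesis .
qed

text \<open>The tangent at \<open>m\<close> of the convex function \<open>t powr p / p\<close> stays
  below it; this is Young's inequality with second factor \<open>m powr (p - 1)\<close>.\<close>

lemma powr_tangent_le:
  fixes t m p :: real
  assumes "t \<ge> 0" "m \<ge> 0" "p > 1"
  shows "m powr (p - 1) * t \<le> t powr p / p + (1 - 1 / p) * m powr p"
proof -
  define q where "q = p / (p - 1)"
  have q: "q > 1" "1 / p + 1 / q = 1" using assms by (auto simp: q_def field_simps)
  have "t * m powr (p - 1) \<le> t powr p / p + (m powr (p - 1)) powr q / q"
    by (rule Youngs_inequality) (use assms q in auto)
  moreover have "(m powr (p - 1)) powr q = m powr p" using assms by (simp add: powr_powr q_def)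
  moreover have "1 / q = 1 - 1 / p" using q by simp
  ultimately show ?thesis by (simp add: mult.commute divide_inverse)
qed

section \<open>Jensen's inequality and smoothing in \<open>L^p\<close>\<close>

lemma peak_kernel_conv_nonneg_mono:
  assumes "integrable cell_measure f" "integrable cell_measure g" "\<And>y. y \<in> unit_cell \<Longrightarrow> f y \<le> g y"
  shows "cell_conv (peak_kernel N) f y \<le> cell_conv (peak_kernel N) g y"
  unfolding cell_conv_def
  by (intro integral_mono trig_poly_conv_integrable trig_poly_peak_kernel assms mult_left_mono peak_kernel_nonneg) auto

lemma cell_conv_const: "cell_conv (peak_kernel N) (\<lambda>z. c) y = c"
proof -
  have "cell_conv (peak_kernel N) (\<lambda>z. c) y = c * cell_conv (peak_kernel N) (\<lambda>z. 1) y"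
    by (simp add: cell_conv_def)
  then show ?thesis by (simp add: cell_conv_one[OF trig_poly_peak_kernel] peak_kernel_integral)
qed

lemma cell_conv_diff:
  assumes "trig_poly K" "integrable cell_measure f" "integrable cell_measure g"
  shows "cell_conv K (\<lambda>z. f z - g z) y = cell_conv K f y - cell_conv K g y"
  unfolding cell_conv_def right_diff_distrib
  by (intro Bochner_Integration.integral_diff trig_poly_conv_integrable assms)

lemma cell_conv_abs_le:
  assumes "integrable cell_measure w"
  shows "\<bar>cell_conv (peak_kernel N) w y\<bar> \<le> cell_conv (peak_kernel N) (\<lambda>z. \<bar>w z\<bar>) y"
proof -
  have "\<bar>cell_conv (peak_kernel N) w y\<bar> \<le> (LINT z|cell_measure. \<bar>peak_kernel N (y - z) * w z\<bar>)"
    unfolding cell_conv_def by (rule integral_abs_bound)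
  then show ?thesis by (simp add: cell_conv_def abs_mult peak_kernel_nonneg)
qed

text \<open>The tangent inequality is averaged at the point \<open>m\<close>, the mean of
  \<open>\<bar>w\<bar>\<close> under the probability weights \<open>peak_kernel N (y - z)\<close>.
  Its left side becomes \<open>m powr p\<close>, part of which reappears on the right; solving
  leaves the mean of the p-th power.\<close>

lemma cell_conv_Jensen:
  fixes w :: "real^'m \<Rightarrow> real"
  assumes p: "p > 1" and w: "Lp_fun cell_measure p w"
  shows "\<bar>cell_conv (peak_kernel N) w y\<bar> powr p \<le> cell_conv (peak_kernel N) (\<lambda>z. \<bar>w z\<bar> powr p) y"
proof -
  let ?K = "peak_kernel N :: real^'m \<Rightarrow> real"
  have wi: "integrable cell_measure w"
    using Lp_fun_imp_integrable[OF finite_measure_cell w] p by simp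
  have wp: "integrable cell_measure (\<lambda>z. \<bar>w z\<bar> powr p)" using Lp_fun_integrable[OF w] by simp
  have one: "integrable cell_measure (\<lambda>z::real^'m. c::real)" for c
    using trig_poly_cell_integrable[OF trig_poly_const] .
  define m where "m = cell_conv ?K (\<lambda>z. \<bar>w z\<bar>) y"
  define A where "A = cell_conv ?K (\<lambda>z. \<bar>w z\<bar> powr p) y"
  have m0: "m \<ge> 0" unfolding m_def cell_conv_def by (intro integral_nonneg_AE) (auto simp: peak_kernel_nonneg)
  have "m powr (p - 1) * m = cell_conv ?K (\<lambda>z. m powr (p - 1) * \<bar>w z\<bar>) y"
  proof -
    have "c * m = cell_conv ?K (\<lambda>z. c * \<bar>w z\<bar>) y" for c
      unfolding m_def cell_conv_def by (simp add: mult.left_commute[of _ c])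
    then show ?thesis by blast
  qed
  also have "\<dots> \<le> cell_conv ?K (\<lambda>z. \<bar>w z\<bar> powr p / p + (1 - 1 / p) * m powr p) y"
  proof (rule peak_kernel_conv_nonneg_mono)
    show "integrable cell_measure (\<lambda>z. m powr (p - 1) * \<bar>w z\<bar>)" using wi by simp
    show "integrable cell_measure (\<lambda>z. \<bar>w z\<bar> powr p / p + (1 - 1 / p) * m powr p)"
      by (intro Bochner_Integration.integrable_add integrable_divide wp one)
    show "m powr (p - 1) * \<bar>w z\<bar> \<le> \<bar>w z\<bar> powr p / p + (1 - 1 / p) * m powr p" for z
      by (rule powr_tangent_le) (use m0 p in auto)
  qed
  also have "\<dots> = A / p + (1 - 1 / p) * m powr p"
  proof -
    have "cell_conv ?K (\<lambda>z. \<bar>w z\<bar> powr p / p + (1 - 1 / p) * m powr p) y =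
       (LINT z|cell_measure. ?K (y - z) * (\<bar>w z\<bar> powr p / p)) + (LINT z|cell_measure. ?K (y - z) * ((1 - 1 / p) * m powr p))"
      unfolding cell_conv_def distrib_left
      by (intro Bochner_Integration.integral_add trig_poly_conv_integrable trig_poly_peak_kernel integrable_divide wp one)
    also have "(LINT z|cell_measure. ?K (y - z) * ((1 - 1 / p) * m powr p)) = (1 - 1 / p) * m powr p"
      using cell_conv_const[of N "(1 - 1 / p) * m powr p" y] by (simp add: cell_conv_def)
    finally show ?thesis by (simp add: A_def cell_conv_def)
  qed
  finally have *: "m powr (p - 1) * m \<le> A / p + (1 - 1 / p) * m powr p" .
  have "m powr (p - 1) * m = m powr p"
  proof (cases "m = 0")
    case False
    then have "m powr (p - 1) * m powr 1 = m powr p" using m0 by (subst powr_add[symmetric]) simp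
    then show ?thesis using m0 False by simp
  qed (use p in simp)
  then have "m powr p * (1 / p) \<le> A * (1 / p)" using * by (simp add: algebra_simps)
  then have "m powr p \<le> A" using p by (simp add: mult_le_cancel_right divide_le_cancel)
  moreover have "\<bar>cell_conv ?K w y\<bar> powr p \<le> m powr p"
    unfolding m_def using cell_conv_abs_le[OF wi] p by (intro powr_mono2) auto
  ultimately show ?thesis by (simp add: A_def)
qed

text \<open>Jensen's inequality holds pointwise in \<open>y\<close>, and as the kernel has mass one,
  convolution does not change the integral of \<open>\<bar>w\<bar> powr p\<close>.\<close>

lemma cell_conv_Lp_contraction:
  fixes w :: "real^'m \<Rightarrow> real"
  assumes p: "p > 1" and w: "Lp_fun cell_measure p w"
  shows "Lp_fun cell_measure p (cell_conv (peak_kernel N) w)"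
    and "(LINT y|cell_measure. \<bar>cell_conv (peak_kernel N) w y\<bar> powr p) \<le> (LINT y|cell_measure. \<bar>w y\<bar> powr p)"
proof -
  have wi: "integrable cell_measure w"
    using Lp_fun_imp_integrable[OF finite_measure_cell w] p by simp
  have wp: "integrable cell_measure (\<lambda>z. \<bar>w z\<bar> powr p)" using Lp_fun_integrable[OF w] by simp
  note tp = cell_conv_trig_poly[OF trig_poly_peak_kernel wi, of N]
  note tp2 = cell_conv_trig_poly[OF trig_poly_peak_kernel wp, of N]
  obtain B where "\<And>u. \<bar>cell_conv (peak_kernel N) w u\<bar> \<le> B" using trig_poly_bounded[OF tp] by metis
  then show Lp: "Lp_fun cell_measure p (cell_conv (peak_kernel N) w)"
    using p by (intro Lp_fun_bounded[where B=B] finite_measure_cell cell_measurableI trig_poly_measurable tp) auto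
  have "(LINT y|cell_measure. \<bar>cell_conv (peak_kernel N) w y\<bar> powr p) \<le> (LINT y|cell_measure. cell_conv (peak_kernel N) (\<lambda>z. \<bar>w z\<bar> powr p) y)"
    by (rule integral_mono[OF _ trig_poly_cell_integrable[OF tp2]])
       (use Lp_fun_integrable[OF Lp] cell_conv_Jensen[OF p w] in auto)
  then show "(LINT y|cell_measure. \<bar>cell_conv (peak_kernel N) w y\<bar> powr p) \<le> (LINT y|cell_measure. \<bar>w y\<bar> powr p)"
    by (simp add: cell_integral_trig_conv[OF trig_poly_peak_kernel wp] peak_kernel_integral)
qed

text \<open>Uniform continuity on the torus. Moving \<open>y\<close> by the integer vector brings it
  within 1/2 of \<open>z\<close> in every coordinate, hence into the compact box \<open>C\<close>.
  Dividing \<open>d\<close> by one more than the dimension makes the sum of the coordinate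
  displacements strictly smaller than \<open>d\<close>.\<close>

lemma near_int_continuous_periodic:
  fixes f :: "real^'m \<Rightarrow> real"
  assumes cont: "continuous_on UNIV f" and per: "periodic_cell f" and "\<eta> > 0"
  obtains \<delta> where "0 < \<delta>" "\<delta> \<le> 1/2"
    "\<And>y z. y \<in> unit_cell \<Longrightarrow> z \<in> unit_cell \<Longrightarrow> near_int \<delta> (y - z) \<Longrightarrow> \<bar>f z - f y\<bar> \<le> \<eta>"
proof -
  define C where "C = cbox ((\<chi> i. -1)::real^'m) (\<chi> i. 2)"
  have "uniformly_continuous_on C f"
    unfolding C_def by (intro compact_uniformly_continuous continuous_on_subset[OF cont]) auto
  then obtain d where d: "d > 0" "\<And>x x'. x \<in> C \<Longrightarrow> x' \<in> C \<Longrightarrow> dist x' x < d \<Longrightarrow> dist (f x') (f x) < \<eta>"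
    unfolding uniformly_continuous_on_def using \<open>\<eta> > 0\<close> by blast
  define \<delta> where "\<delta> = min (1/2) (d / (real CARD('m) + 1))"
  have m: "real CARD('m) + 1 > 0" by (simp add: add_nonneg_pos)
  show thesis
  proof (rule that[of \<delta>])
    show "0 < \<delta>" using d m by (simp add: \<delta>_def)
    show "\<delta> \<le> 1/2" unfolding \<delta>_def by (rule min.cobounded1)
    fix y z :: "real^'m" assume y: "y \<in> unit_cell" and z: "z \<in> unit_cell" and n: "near_int \<delta> (y - z)"
    obtain k where k: "int_vec k" "\<And>i. \<bar>(y - z) $ i - k $ i\<bar> < \<delta>" using n unfolding near_int_def by blast
    define h where "h = y - z - k"
    have h: "\<bar>h $ i\<bar> < \<delta>" for i using k(2)[of i] by (simp add: h_def)
    have "f y = f (z + h + k)" by (simp add: h_def)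
    also have "\<dots> = f (z + h)" using per k(1) unfolding periodic_cell_def by blast
    finally have fy: "f y = f (z + h)" .
    have "z \<in> C"
      unfolding C_def mem_box_cart
    proof
      fix i
      have "0 \<le> z $ i" "z $ i < 1" using z by (auto simp: unit_cell_def)
      then show "(\<chi> i. -1) $ i \<le> z $ i \<and> z $ i \<le> (\<chi> i. 2) $ i" by simp
    qed
    have "z + h \<in> C"
      unfolding C_def mem_box_cart
    proof
      fix i
      have "\<bar>h $ i\<bar> < 1/2" using h[of i] by (simp add: \<delta>_def)
      moreover have "0 \<le> z $ i" "z $ i < 1" using z by (auto simp: unit_cell_def)
      ultimately show "(\<chi> i. -1) $ i \<le> (z + h) $ i \<and> (z + h) $ i \<le> (\<chi> i. 2) $ i" by (auto simp: abs_less_iff)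
    qed
    have "norm h \<le> (\<Sum>i\<in>UNIV. \<bar>h $ i\<bar>)" by (rule norm_le_l1_cart)
    also have "\<dots> \<le> (\<Sum>i\<in>(UNIV::'m set). \<delta>)" using h by (intro sum_mono) (auto intro: less_imp_le)
    also have "\<dots> = real CARD('m) * \<delta>" by simp
    also have "\<dots> < (real CARD('m) + 1) * \<delta>" using \<open>0 < \<delta>\<close> by (simp add: distrib_right)
    also have "\<dots> \<le> (real CARD('m) + 1) * (d / (real CARD('m) + 1))" using m by (intro mult_left_mono) (auto simp: \<delta>_def)
    also have "\<dots> = d" using m by simp
    finally have "dist z (z + h) < d" by (simp add: dist_norm)
    from d(2)[OF \<open>z + h \<in> C\<close> \<open>z \<in> C\<close> this]
    show "\<bar>f z - f y\<bar> \<le> \<eta>" unfolding fy by (simp add: dist_real_def)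
  qed
qed

text \<open>Uniform continuity modulo integers is the hypothesis, so that the result covers
  continuous periodic functions and also test functions on the open cell, which become periodic only
  after extension.\<close>

lemma peak_kernel_conv_tendsto_uniform:
  fixes f :: "real^'m \<Rightarrow> real"
  assumes f: "f \<in> borel_measurable cell_measure" and B: "\<And>y. y \<in> unit_cell \<Longrightarrow> \<bar>f y\<bar> \<le> B"
    and near: "\<And>\<eta>. \<eta> > 0 \<Longrightarrow> \<exists>\<delta>>0. \<delta> \<le> 1/2 \<and> (\<forall>y\<in>unit_cell. \<forall>z\<in>unit_cell. near_int \<delta> (y - z) \<longrightarrow> \<bar>f z - f y\<bar> \<le> \<eta>)"
    and "e > 0"
  shows "\<exists>N0. \<forall>N\<ge>N0. \<forall>y\<in>unit_cell. \<bar>cell_conv (peak_kernel N) f y - f y\<bar> \<le> e"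
proof -
  obtain \<delta> where \<delta>: "\<delta> > 0" "\<delta> \<le> 1/2" "\<And>y z. y \<in> unit_cell \<Longrightarrow> z \<in> unit_cell \<Longrightarrow> near_int \<delta> (y - z) \<Longrightarrow> \<bar>f z - f y\<bar> \<le> e / 2"
    using near[of "e/2"] \<open>e > 0\<close> by auto
  obtain \<omega> where \<omega>: "\<omega> \<longlonglongrightarrow> 0" "\<And>N. \<omega> N \<ge> 0" "\<And>N (u::real^'m). \<not> near_int \<delta> u \<Longrightarrow> peak_kernel N u \<le> \<omega> N"
    using peak_kernel_far[OF \<delta>(1,2), where 'm='m] by metis
  have "(\<lambda>N. 2 * B * \<omega> N) \<longlonglongrightarrow> 2 * B * 0" by (intro tendsto_intros \<omega>(1))
  then have "\<forall>\<^sub>F N in sequentially. 2 * B * \<omega> N < e / 2"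
    using \<open>e > 0\<close> by (intro order_tendstoD(2)[where y=0]) auto
  then obtain N0 where N0: "\<And>N. N \<ge> N0 \<Longrightarrow> 2 * B * \<omega> N < e / 2" by (auto simp: eventually_sequentially)
  have "\<bar>cell_conv (peak_kernel N) f y - f y\<bar> \<le> e" if "N \<ge> N0" "y \<in> unit_cell" for N y
    using peak_kernel_uniform[OF f B \<delta>(3) \<omega>(3)[of _ N] \<omega>(2) _ that(2)] N0[OF that(1)] \<open>e > 0\<close> by fastforce
  then show ?thesis by blast
qed

lemma norm_axis_real: "norm (axis i (c::real)) = \<bar>c\<bar>"
proof -
  have "axis i c = c *\<^sub>R axis i (1::real)" by (simp add: vec_eq_iff axis_nth)
  then show ?thesis by simp
qed

text \<open>Two points of the cell that are close modulo a nonzero integer vector lie near opposite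
  faces. With \<open>\<delta>\<close> at most the distance \<open>d\<close> from \<open>K\<close> to
  the complement of the open cell, both points are off \<open>K\<close>, where \<open>\<psi>\<close>
  vanishes.\<close>

lemma near_int_test_fun:
  fixes \<psi> :: "real^'m \<Rightarrow> real"
  assumes \<psi>: "test_fun (box 0 1) \<psi>" and "\<eta> > 0"
  shows "\<exists>\<delta>>0. \<delta> \<le> 1/2 \<and> (\<forall>y\<in>unit_cell. \<forall>z\<in>unit_cell. near_int \<delta> (y - z) \<longrightarrow> \<bar>\<psi> z - \<psi> y\<bar> \<le> \<eta>)"
proof -
  obtain K where K: "compact K" "K \<subseteq> box 0 (1::real^'m)" "\<And>x. x \<notin> K \<Longrightarrow> \<psi> x = 0"
    using test_fun_obtain_compact[OF \<psi>] by metis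
  obtain d where d: "d > 0" "\<And>x y. x \<in> K \<Longrightarrow> y \<in> - box 0 1 \<Longrightarrow> d \<le> dist x y"
    using separate_compact_closed[OF K(1), of "- box 0 (1::real^'m)"] K(2) by blast
  have Kd: "d \<le> x $ i" "x $ i \<le> 1 - d" if x: "x \<in> K" for x i
  proof -
    have xi: "0 < x $ i" "x $ i < 1" using x K(2) by (auto simp: mem_box_cart subset_iff)
    have "x - axis i (x $ i) \<in> - box 0 1" by (auto simp: mem_box_cart axis_nth intro!: exI[of _ i])
    from d(2)[OF x this] show "d \<le> x $ i" using xi by (simp add: dist_norm norm_axis_real)
    have "x + axis i (1 - x $ i) \<in> - box 0 1" by (auto simp: mem_box_cart axis_nth intro!: exI[of _ i])
    from d(2)[OF x this] show "x $ i \<le> 1 - d" using xi by (simp add: dist_norm norm_axis_real)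
  qed
  have "uniformly_continuous_on (cbox 0 1) \<psi>"
    by (intro compact_uniformly_continuous smooth_fun_continuous_on test_funD(1)[OF \<psi>]) auto
  then obtain d' where d': "d' > 0" "\<And>x x'. x \<in> cbox 0 1 \<Longrightarrow> x' \<in> cbox 0 1 \<Longrightarrow> dist x' x < d' \<Longrightarrow> dist (\<psi> x') (\<psi> x) < \<eta>"
    unfolding uniformly_continuous_on_def using \<open>\<eta> > 0\<close> by blast
  have m: "real CARD('m) + 1 > 0" by (simp add: add_nonneg_pos)
  define \<delta> where "\<delta> = min (min (1/2) d) (d' / (real CARD('m) + 1))"
  have \<delta>: "\<delta> > 0" "\<delta> \<le> 1/2" "\<delta> \<le> d"
    using d d' m by (simp add: \<delta>_def, (simp only: \<delta>_def min.coboundedI1 min.cobounded1 min.cobounded2)+)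
  have "\<bar>\<psi> z - \<psi> y\<bar> \<le> \<eta>" if y: "y \<in> unit_cell" and z: "z \<in> unit_cell" and n: "near_int \<delta> (y - z)" for y z
  proof -
    obtain k where k: "int_vec k" "\<And>i. \<bar>(y - z) $ i - k $ i\<bar> < \<delta>" using n unfolding near_int_def by blast
    show ?thesis
    proof (cases "k = 0")
      case True
      have "norm (y - z) \<le> (\<Sum>i\<in>UNIV. \<bar>(y - z) $ i\<bar>)" by (rule norm_le_l1_cart)
      also have "\<dots> \<le> (\<Sum>i\<in>(UNIV::'m set). \<delta>)" using k(2) True by (intro sum_mono) (auto intro: less_imp_le)
      also have "\<dots> = real CARD('m) * \<delta>" by simp
      also have "\<dots> < (real CARD('m) + 1) * \<delta>" using \<delta> by (simp add: distrib_right)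
      also have "\<dots> \<le> (real CARD('m) + 1) * (d' / (real CARD('m) + 1))" using m by (intro mult_left_mono) (auto simp: \<delta>_def)
      also have "\<dots> = d'" using m by simp
      finally have "dist z y < d'" by (simp add: dist_norm norm_minus_commute)
      moreover have "y \<in> cbox 0 1" "z \<in> cbox 0 1" using y z unit_cell_subset_cbox by auto
      ultimately show ?thesis using d'(2)[of y z] by (simp add: dist_real_def)
    next
      case False
      then obtain i where i: "k $ i \<noteq> 0" by (metis vec_eq_iff zero_index)
      obtain n where n: "k $ i = of_int n" using k(1) unfolding int_vec_def by (metis Ints_cases)
      have yz: "0 \<le> y $ i" "y $ i < 1" "0 \<le> z $ i" "z $ i < 1" using y z by (auto simp: unit_cell_def)
      have b: "\<bar>y $ i - z $ i - of_int n\<bar> < \<delta>" using k(2)[of i] n by simp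
      then have "\<bar>real_of_int n\<bar> < 2" using yz \<delta>(2) by linarith
      then have "n = 1 \<or> n = -1" using i n by auto
      then have "(y $ i > 1 - d \<and> z $ i < d) \<or> (y $ i < d \<and> z $ i > 1 - d)"
        using b yz \<delta>(3) by (elim disjE) (auto simp: abs_less_iff)
      then have "y \<notin> K" "z \<notin> K" using Kd(1)[of y i] Kd(2)[of y i] Kd(1)[of z i] Kd(2)[of z i] by auto
      then show ?thesis using K(3) \<open>\<eta> > 0\<close> by simp
    qed
  qed
  then show ?thesis using \<delta> by blast
qed

text \<open>Density of test functions is available on open sets only; the open box differs from the
  half-open cell by a null set.\<close>

lemma
  fixes f :: "real^'m \<Rightarrow> real"
  assumes f: "f \<in> borel_measurable cell_measure"
  shows integrable_lebesgue_on_box_cell: "integrable (lebesgue_on (box 0 1)) f \<longleftrightarrow> integrable cell_measure f"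
    and integral_lebesgue_on_box_cell: "integral\<^sup>L (lebesgue_on (box 0 1)) f = integral\<^sup>L cell_measure f"
    and measurable_lebesgue_on_box_cell: "f \<in> borel_measurable (lebesgue_on (box 0 1))"
proof -
  define g where "g = (\<lambda>x. indicator unit_cell x *\<^sub>R f x)"
  have g [measurable]: "g \<in> borel_measurable borel"
    using f unfolding g_def by (subst (asm) borel_measurable_restrict_space_iff) auto
  have e: "(\<lambda>x. indicator (box 0 1) x *\<^sub>R f x) = (\<lambda>x. indicator (box 0 1) x *\<^sub>R g x)"
    using box_subset_unit_cell by (auto simp: g_def indicator_def fun_eq_iff)
  have b1: "emeasure lborel (box 0 (1::real^'m)) = 1"
    by (simp add: emeasure_lborel_box_eq Basis_vec_def inner_axis prod.neutral)
  have "emeasure lborel (unit_cell - box 0 (1::real^'m)) = emeasure lborel (unit_cell :: (real^'m) set) - emeasure lborel (box 0 (1::real^'m))"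
    by (intro emeasure_Diff box_subset_unit_cell) (auto simp: b1)
  then have "emeasure lborel (unit_cell - box 0 (1::real^'m)) = 0"
    by (simp add: b1 emeasure_unit_cell)
  then have "AE x in lborel. x \<notin> unit_cell - box 0 (1::real^'m)"
    by (intro AE_not_in) (auto simp: null_sets_def)
  then have ae: "AE x in lborel. indicator (box 0 1) x *\<^sub>R g x = g x"
    by eventually_elim (auto simp: g_def indicator_def)
  have m: "(\<lambda>x. indicator (box 0 1) x *\<^sub>R g x) \<in> borel_measurable lborel" by measurable
  show "integrable (lebesgue_on (box 0 1)) f \<longleftrightarrow> integrable cell_measure f"
  proof -
    have "integrable (lebesgue_on (box 0 1)) f \<longleftrightarrow> integrable lebesgue (\<lambda>x. indicator (box 0 1) x *\<^sub>R f x)"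
      by (intro integrable_restrict_space) auto
    also have "\<dots> \<longleftrightarrow> integrable lborel (\<lambda>x. indicator (box 0 1) x *\<^sub>R g x)"
      unfolding e by (rule integrable_completion[OF m])
    also have "\<dots> \<longleftrightarrow> integrable lborel g" by (intro integrable_cong_AE m ae) auto
    also have "\<dots> \<longleftrightarrow> integrable cell_measure f"
      unfolding g_def by (intro integrable_restrict_space[symmetric]) auto
    finally show ?thesis .
  qed
  show "integral\<^sup>L (lebesgue_on (box 0 1)) f = integral\<^sup>L cell_measure f"
  proof -
    have "integral\<^sup>L (lebesgue_on (box 0 1)) f = integral\<^sup>L lebesgue (\<lambda>x. indicator (box 0 1) x *\<^sub>R f x)"
      by (intro integral_restrict_space) auto
    also have "\<dots> = integral\<^sup>L lborel (\<lambda>x. indicator (box 0 1) x *\<^sub>R g x)"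
      unfolding e by (rule integral_completion[OF m])
    also have "\<dots> = integral\<^sup>L lborel g" by (intro integral_cong_AE m ae) auto
    also have "\<dots> = integral\<^sup>L cell_measure f"
      unfolding g_def by (intro integral_restrict_space[symmetric]) auto
    finally show ?thesis .
  qed
  show "f \<in> borel_measurable (lebesgue_on (box 0 1))"
    unfolding borel_measurable_restrict_space_iff[of "box 0 1" lebesgue f, simplified] e[unfolded real_scaleR_def]
    using measurable_completion[OF m] by simp
qed

text \<open>A test function \<open>\<psi>\<close> on the open cell approximates \<open>w\<close>.
  The contraction property controls the smoothed difference \<open>w - \<psi>\<close> for all
  \<open>N\<close> at once, and for \<open>\<psi>\<close> itself the convergence is uniform.\<close>

lemma cell_conv_Lp_tendsto:
  fixes w :: "real^'m \<Rightarrow> real"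
  assumes p: "p > 1" and w: "Lp_fun cell_measure p w"
  shows "(\<lambda>N. LINT y|cell_measure. \<bar>cell_conv (peak_kernel N) w y - w y\<bar> powr p) \<longlonglongrightarrow> 0"
proof (rule LIMSEQ_I)
  fix e :: real assume "e > 0"
  have p0: "p \<ge> 0" "p > 0" using p by auto
  define c where "c = 2 powr p * (2 powr p * 2 + 1)"
  have c: "c > 0" by (simp add: c_def add_nonneg_pos)
  define d where "d = e / (2 * c)"
  have d: "d > 0" using c \<open>e > 0\<close> by (simp add: d_def)
  have [measurable]: "w \<in> borel_measurable cell_measure" using w by (rule Lp_fun_measurable)
  have "Lp_fun (lebesgue_on (box 0 1)) p w"
    using Lp_fun_integrable[OF w] unfolding Lp_fun_def
    by (subst integrable_lebesgue_on_box_cell) (auto intro: measurable_lebesgue_on_box_cell)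
  from test_fun_denseE[OF open_box bounded_box p0(2) this d]
  obtain \<psi> where \<psi>: "test_fun (box 0 1) \<psi>" "(LINT x|lebesgue_on (box 0 1). \<bar>w x - \<psi> x\<bar> powr p) < d" .
  have \<psi>m [measurable]: "\<psi> \<in> borel_measurable cell_measure"
    using smooth_fun_measurable[OF test_funD(1)[OF \<psi>(1)]] by (rule cell_measurableI)
  obtain B where B: "\<And>x. \<bar>\<psi> x\<bar> \<le> B" using test_fun_bounded[OF \<psi>(1)] by metis
  have wpsi: "(LINT x|cell_measure. \<bar>w x - \<psi> x\<bar> powr p) < d"
    using \<psi>(2) by (subst (asm) integral_lebesgue_on_box_cell) auto
  have \<psi>L: "Lp_fun cell_measure p \<psi>"
    using p B by (intro Lp_fun_bounded[where B=B] finite_measure_cell) auto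
  have dL: "Lp_fun cell_measure p (\<lambda>x. w x - \<psi> x)" using w \<psi>L p0(1) by (rule Lp_fun_diff)
  have wi: "integrable cell_measure w" using Lp_fun_imp_integrable[OF finite_measure_cell w] p by simp
  have \<psi>i: "integrable cell_measure \<psi>" using Lp_fun_imp_integrable[OF finite_measure_cell \<psi>L] p by simp
  \<comment> \<open>The uniform tolerance \<open>d powr (1 / p)\<close> has p-th power
    \<open>d\<close>, which is also its integral over a cell of measure one.\<close>
  obtain N0 where N0: "\<And>N y. N \<ge> N0 \<Longrightarrow> y \<in> unit_cell \<Longrightarrow> \<bar>cell_conv (peak_kernel N) \<psi> y - \<psi> y\<bar> \<le> d powr (1 / p)"
    using peak_kernel_conv_tendsto_uniform[OF \<psi>m B near_int_test_fun[OF \<psi>(1)], of "d powr (1/p)"] d by auto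
  have "norm ((LINT y|cell_measure. \<bar>cell_conv (peak_kernel N) w y - w y\<bar> powr p) - 0) < e" if "N \<ge> N0" for N
  proof -
    let ?K = "peak_kernel N :: real^'m \<Rightarrow> real"
    define f1 where "f1 = cell_conv ?K (\<lambda>x. w x - \<psi> x)"
    define f2 where "f2 = (\<lambda>y. cell_conv ?K \<psi> y - \<psi> y)"
    define f3 where "f3 = (\<lambda>y. \<psi> y - w y)"
    have L1: "Lp_fun cell_measure p f1" "(LINT y|cell_measure. \<bar>f1 y\<bar> powr p) < d"
      using cell_conv_Lp_contraction[OF p dL, of N] wpsi unfolding f1_def by auto
    have L2: "Lp_fun cell_measure p f2"
      unfolding f2_def by (intro Lp_fun_diff cell_conv_Lp_contraction(1) p \<psi>L p0)
    have "(LINT y|cell_measure. \<bar>f2 y\<bar> powr p) \<le> (LINT y|(cell_measure::(real^'m) measure). d)"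
    proof (rule integral_mono)
      show "integrable cell_measure (\<lambda>y. \<bar>f2 y\<bar> powr p)" using Lp_fun_integrable[OF L2] by simp
      show "integrable cell_measure (\<lambda>y::real^'m. d)" by (rule finite_measure.integrable_const[OF finite_measure_cell])
      fix y :: "real^'m" assume "y \<in> space cell_measure"
      then have "\<bar>f2 y\<bar> powr p \<le> (d powr (1 / p)) powr p"
        unfolding f2_def using N0[OF that] p by (intro powr_mono2) auto
      then show "\<bar>f2 y\<bar> powr p \<le> d" using d p by (simp add: powr_powr)
    qed
    then have I2: "(LINT y|cell_measure. \<bar>f2 y\<bar> powr p) \<le> d" by simp
    have L3: "Lp_fun cell_measure p f3" unfolding f3_def using \<psi>L w p0(1) by (rule Lp_fun_diff)
    have I3: "(LINT y|cell_measure. \<bar>f3 y\<bar> powr p) < d" using wpsi by (simp add: f3_def abs_minus_commute)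
    have split: "cell_conv ?K w y - w y = (f1 y + f2 y) + f3 y" for y
      by (simp add: f1_def f2_def f3_def cell_conv_diff[OF trig_poly_peak_kernel wi \<psi>i])
    have L12: "Lp_fun cell_measure p (\<lambda>y. f1 y + f2 y)" using L1(1) L2 p0(1) by (rule Lp_fun_add)
    have I12: "(LINT y|cell_measure. \<bar>f1 y + f2 y\<bar> powr p) \<le> 2 powr p * (d + d)"
    proof -
      have "(LINT y|cell_measure. \<bar>f1 y + f2 y\<bar> powr p) \<le> 2 powr p * ((LINT y|cell_measure. \<bar>f1 y\<bar> powr p) + (LINT y|cell_measure. \<bar>f2 y\<bar> powr p))"
        using integral_powr_add_le[OF L1(1) L2 p0(1)] by simp
      also have "\<dots> \<le> 2 powr p * (d + d)" using L1(2) I2 by (intro mult_left_mono) auto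
      finally show ?thesis .
    qed
    have "(LINT y|cell_measure. \<bar>cell_conv ?K w y - w y\<bar> powr p) \<le> 2 powr p * ((LINT y|cell_measure. \<bar>f1 y + f2 y\<bar> powr p) + (LINT y|cell_measure. \<bar>f3 y\<bar> powr p))"
      unfolding split using integral_powr_add_le[OF L12 L3 p0(1)] by simp
    also have "\<dots> \<le> 2 powr p * (2 powr p * (d + d) + d)"
      using I12 I3 by (intro mult_left_mono) auto
    also have "\<dots> = c * d" by (simp add: c_def algebra_simps)
    also have "\<dots> = e / 2" using c by (simp add: d_def)
    finally have "(LINT y|cell_measure. \<bar>cell_conv ?K w y - w y\<bar> powr p) < e" using \<open>e > 0\<close> by simp
    moreover have "(LINT y|cell_measure. \<bar>cell_conv ?K w y - w y\<bar> powr p) \<ge> 0" by (intro integral_nonneg_AE) auto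
    ultimately show ?thesis by simp
  qed
  then show "\<exists>N0. \<forall>N\<ge>N0. norm ((LINT y|cell_measure. \<bar>cell_conv (peak_kernel N) w y - w y\<bar> powr p) - 0) < e" by blast
qed

text \<open>Uniform in \<open>N\<close>, it provides the majorant when the convergence in
  \<open>y\<close> is integrated over \<open>x\<close>.\<close>

lemma cell_conv_Lp_bound:
  fixes w :: "real^'m \<Rightarrow> real"
  assumes p: "p > 1" and w: "Lp_fun cell_measure p w"
  shows "(LINT y|cell_measure. \<bar>cell_conv (peak_kernel N) w y - w y\<bar> powr p) \<le> 2 powr p * 2 * (LINT y|cell_measure. \<bar>w y\<bar> powr p)"
proof -
  have "(LINT y|cell_measure. norm (cell_conv (peak_kernel N) w y + (-1) *\<^sub>R w y) powr p) \<le>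
     2 powr p * ((LINT y|cell_measure. norm (cell_conv (peak_kernel N) w y) powr p) + (LINT y|cell_measure. norm ((-1) *\<^sub>R w y) powr p))"
    using p w by (intro integral_powr_add_le cell_conv_Lp_contraction(1) Lp_fun_scaleR) auto
  also have "\<dots> \<le> 2 powr p * ((LINT y|cell_measure. \<bar>w y\<bar> powr p) + (LINT y|cell_measure. \<bar>w y\<bar> powr p))"
    using cell_conv_Lp_contraction(2)[OF p w, of N] by (intro mult_left_mono add_mono) auto
  finally show ?thesis by simp
qed

subsection \<open>Mean value property of quasi-periodic oscillations\<close>

text \<open>Simple functions approximate \<open>g\<close>. Along a simple function the composition
  is glued from finitely many measurable sections, and continuity in the second argument carries
  measurability to the limit.\<close>

lemma Caratheodory_measurable:
  fixes F :: "'a \<Rightarrow> 'b::{metric_space, second_countable_topology} \<Rightarrow> 'c::metric_space"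
  assumes F: "\<And>v. (\<lambda>x. F x v) \<in> borel_measurable M"
    and cont: "\<And>x. x \<in> space M \<Longrightarrow> continuous_on UNIV (F x)"
    and g: "g \<in> borel_measurable M"
  shows "(\<lambda>x. F x (g x)) \<in> borel_measurable M"
proof -
  obtain G where G: "\<And>i. simple_function M (G i)" "\<And>x. x \<in> space M \<Longrightarrow> (\<lambda>i. G i x) \<longlonglongrightarrow> g x"
    using borel_measurable_implies_sequence_metric[OF g, of undefined] by blast
  show ?thesis
  proof (rule borel_measurable_LIMSEQ_metric)
    show "(\<lambda>x. F x (G i x)) \<in> borel_measurable M" for i
    proof (rule measurable_compose_countable'[where f = "\<lambda>v x. F x v" and I = "G i ` space M"])
      have fin: "finite (G i ` space M)" using G(1)[of i] by (simp add: simple_function_def)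
      then show "countable (G i ` space M)" by (rule countable_finite)
      show "G i \<in> measurable M (count_space (G i ` space M))"
        using G(1)[of i] fin by (subst measurable_count_space_eq2) (auto simp: simple_function_def)
    qed (rule F)
    show "(\<lambda>i. F x (G i x)) \<longlonglongrightarrow> F x (g x)" if "x \<in> space M" for x
      using continuous_on_tendsto_compose[OF cont[OF that] G(2)[OF that]] by simp
  qed
qed

lemma inner_scaled_matrix_vector:
  fixes R :: "real^'n^'m"
  shows "k \<bullet> (c *\<^sub>R (R *v x)) = c *\<^sub>R (transpose R *v k) \<bullet> x"
  by (metis dot_lmul_matrix inner_scaleR_left inner_scaleR_right transpose_matrix_vector)

lemma trig_poly_periodic: "trig_poly f \<Longrightarrow> periodic_cell f"
proof (induction rule: trig_poly.induct)
  case (cos k c)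
  then show ?case using periodic_cell_cos[of k] by (simp add: periodic_cell_def)
next
  case (sin k c)
  then show ?case using periodic_cell_sin[of k] by (simp add: periodic_cell_def)
qed (auto simp: periodic_cell_def)

lemma exists_unit_cell_representative:
  fixes y :: "real^'m"
  shows "\<exists>k. int_vec k \<and> y + k \<in> unit_cell"
proof (intro exI conjI)
  show "int_vec (\<chi> i. - real_of_int \<lfloor>y $ i\<rfloor>)" by (auto simp: int_vec_def)
  show "y + (\<chi> i. - real_of_int \<lfloor>y $ i\<rfloor>) \<in> unit_cell"
    by (auto simp: unit_cell_def) linarith
qed

locale oscillation =
  fixes \<Omega> :: "(real^'n) set" and R :: "real^'n^'m" and eps :: "nat \<Rightarrow> real"
  assumes \<Omega>: "open \<Omega>" "bounded \<Omega>"
    and nonres: "\<And>k::real^'m. int_vec k \<Longrightarrow> k \<noteq> 0 \<Longrightarrow> transpose R *v k \<noteq> 0"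
    and eps: "\<And>j. eps j > 0" "eps \<longlonglongrightarrow> 0"
begin

abbreviation (input) MO :: "(real^'n) measure" where "MO \<equiv> lebesgue_on \<Omega>"

definition fast :: "nat \<Rightarrow> real^'n \<Rightarrow> real^'m" where
  "fast j x = (1 / eps j) *\<^sub>R (R *v x)"

lemma finite_measure_MO: "finite_measure MO"
  using \<Omega> by (rule finite_measure_lebesgue_on_open)

lemma fast_measurable: "fast j \<in> borel_measurable MO"
  unfolding fast_def
  by (intro borel_measurable_lebesgue_onI borel_measurable_continuous_onI continuous_intros
      linear_continuous_on matrix_vector_mul_bounded_linear)

lemma cos_sin_fast:
  "cos (2 * pi * (k \<bullet> fast j x)) = cos ((1 / eps j) *\<^sub>R ((2 * pi) *\<^sub>R (transpose R *v k)) \<bullet> x)"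
  "sin (2 * pi * (k \<bullet> fast j x)) = sin ((1 / eps j) *\<^sub>R ((2 * pi) *\<^sub>R (transpose R *v k)) \<bullet> x)"
  unfolding fast_def inner_scaled_matrix_vector by (simp_all add: mult_ac)

lemma Riemann_Lebesgue_fast:
  assumes G: "integrable MO G" and k: "int_vec k" "k \<noteq> 0"
  shows "(\<lambda>j. LINT x|MO. G x * cos (2 * pi * (k \<bullet> fast j x))) \<longlonglongrightarrow> 0"
    and "(\<lambda>j. LINT x|MO. G x * sin (2 * pi * (k \<bullet> fast j x))) \<longlonglongrightarrow> 0"
  unfolding cos_sin_fast
  by (intro Riemann_Lebesgue \<Omega> G eps; use nonres[OF k] in simp)+

text \<open>Continuity and periodicity are asked for each slow point separately, without uniformity
  in \<open>x\<close>; the integrable majorant \<open>h\<close> makes up for this in limit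
  passages.\<close>

definition caratheodory :: "(real^'n \<Rightarrow> real^'m \<Rightarrow> real) \<Rightarrow> (real^'n \<Rightarrow> real) \<Rightarrow> bool" where
  "caratheodory F h \<longleftrightarrow> (\<forall>y. (\<lambda>x. F x y) \<in> borel_measurable MO) \<and>
     (\<forall>x\<in>\<Omega>. continuous_on UNIV (F x) \<and> periodic_cell (F x) \<and> (\<forall>y. \<bar>F x y\<bar> \<le> h x)) \<and> integrable MO h"

context
  fixes F h assumes F: "caratheodory F h"
begin

lemma F_facts:
  shows "\<And>y. (\<lambda>x. F x y) \<in> borel_measurable MO" "\<And>x. x \<in> \<Omega> \<Longrightarrow> continuous_on UNIV (F x)"
    "\<And>x. x \<in> \<Omega> \<Longrightarrow> periodic_cell (F x)" "\<And>x y. x \<in> \<Omega> \<Longrightarrow> \<bar>F x y\<bar> \<le> h x" "integrable MO h"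
  using F unfolding caratheodory_def by auto

lemma F_fast_measurable: "(\<lambda>x. F x (fast j x)) \<in> borel_measurable MO"
  by (rule Caratheodory_measurable) (use F_facts fast_measurable in auto)

lemma F_fast_integrable: "integrable MO (\<lambda>x. F x (fast j x))"
proof (rule Bochner_Integration.integrable_bound[OF F_facts(5) F_fast_measurable], rule AE_I2)
  fix x assume "x \<in> space MO"
  then show "norm (F x (fast j x)) \<le> norm (h x)" using F_facts(4)[of x "fast j x"] by simp
qed

lemma F_joint_measurable: "(\<lambda>z. F (fst z) (snd z)) \<in> borel_measurable (MO \<Otimes>\<^sub>M cell_measure)"
proof (rule Caratheodory_measurable[where F="\<lambda>z. F (fst z)" and g=snd])
  show "(\<lambda>x. F (fst x) v) \<in> borel_measurable (MO \<Otimes>\<^sub>M cell_measure)" for v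
    by (rule measurable_compose[OF measurable_fst F_facts(1)])
  show "continuous_on UNIV (F (fst x))" if "x \<in> space (MO \<Otimes>\<^sub>M cell_measure)" for x :: "(real^'n) \<times> (real^'m)"
    using that F_facts(2) by (auto simp: space_pair_measure)
  show "snd \<in> borel_measurable (MO \<Otimes>\<^sub>M cell_measure)"
    by (rule measurable_compose[OF measurable_snd]) (auto intro: cell_measurableI)
qed

lemma F_cell_measurable: "x \<in> \<Omega> \<Longrightarrow> F x \<in> borel_measurable cell_measure"
  by (intro cell_measurableI borel_measurable_continuous_onI F_facts)

lemma F_cell_integrable: "x \<in> \<Omega> \<Longrightarrow> integrable cell_measure (F x)"
  by (rule cell_integrable_bounded[where B="h x"]) (auto simp: F_facts F_cell_measurable)

lemma F_integral_measurable:
  assumes "f \<in> borel_measurable borel"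
  shows "(\<lambda>x. LINT y|cell_measure. f y * F x y) \<in> borel_measurable MO"
proof (rule sigma_finite_measure.borel_measurable_lebesgue_integral)
  show "sigma_finite_measure (cell_measure :: (real^'m) measure)"
    by (rule finite_measure.axioms(1)[OF finite_measure_cell])
  have "(\<lambda>z. f (snd z) * F (fst z) (snd z)) \<in> borel_measurable (MO \<Otimes>\<^sub>M cell_measure)"
    by (intro borel_measurable_times F_joint_measurable measurable_compose[OF measurable_snd] cell_measurableI assms)
  then show "(\<lambda>(x, y). f y * F x y) \<in> borel_measurable (MO \<Otimes>\<^sub>M cell_measure)"
    by (simp add: case_prod_beta)
qed

lemma F_integral_integrable:
  assumes f: "f \<in> borel_measurable borel" "\<And>y. \<bar>f y\<bar> \<le> 1"
  shows "integrable MO (\<lambda>x. LINT y|cell_measure. f y * F x y)"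
proof (rule Bochner_Integration.integrable_bound[OF F_facts(5) F_integral_measurable[OF f(1)]], rule AE_I2)
  fix x assume "x \<in> space MO"
  then have x: "x \<in> \<Omega>" by simp
  have i: "integrable cell_measure (\<lambda>y. f y * F x y)"
    by (rule cell_integrable_mult[where B=1]) (auto simp: F_cell_integrable[OF x] f cell_measurableI)
  have "\<bar>LINT y|cell_measure. f y * F x y\<bar> \<le> (LINT y|cell_measure. \<bar>f y * F x y\<bar>)" by (rule integral_abs_bound)
  also have "\<dots> \<le> (LINT y|(cell_measure :: (real^'m) measure). h x)"
  proof (rule integral_mono[OF integrable_abs[OF i] finite_measure.integrable_const[OF finite_measure_cell]])
    show "\<bar>f y * F x y\<bar> \<le> h x" for y
      using mult_mono[OF f(2)[of y] F_facts(4)[OF x, of y]] by (simp add: abs_mult)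
  qed
  finally show "norm (LINT y|cell_measure. f y * F x y) \<le> norm (h x)" by simp
qed

text \<open>After convolution the integrand is a finite sum of integrable coefficients, the Fourier
  moments of \<open>F x\<close>, times cosines and sines of \<open>k \<bullet> fast j x\<close>.
  Since \<open>transpose R *v k \<noteq> 0\<close> for \<open>k \<noteq> 0\<close>, the
  Riemann-Lebesgue lemma removes every frequency except zero, which yields the mean.\<close>

lemma mean_trig_conv:
  assumes "trig_poly K"
  shows "(\<lambda>j. LINT x|MO. cell_conv K (F x) (fast j x)) \<longlonglongrightarrow> (LINT y|cell_measure. K y) * (LINT x|MO. LINT y|cell_measure. F x y)
     \<and> (\<forall>j. integrable MO (\<lambda>x. cell_conv K (F x) (fast j x)))"
proof -
  have cI: "integrable MO (\<lambda>x. fcos (F x) k)" and sI: "integrable MO (\<lambda>x. fsin (F x) k)" for k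
    unfolding fcos_def fsin_def by (intro F_integral_integrable; simp)+
  have trI: "integrable MO (\<lambda>x. G x * cos (2 * pi * (k \<bullet> fast j x)))" "integrable MO (\<lambda>x. G x * sin (2 * pi * (k \<bullet> fast j x)))"
    if "integrable MO G" for G k j
    by (rule Bochner_Integration.integrable_bound[OF that];
        use that fast_measurable[of j] in \<open>auto simp: abs_mult mult_left_le\<close>)+
  have mono_cos: "(\<lambda>j. LINT x|MO. G1 x * cos (2 * pi * (k \<bullet> fast j x)) + G2 x * sin (2 * pi * (k \<bullet> fast j x))) \<longlonglongrightarrow> 0"
    if "integrable MO G1" "integrable MO G2" "int_vec k" "k \<noteq> 0" for G1 G2 k
    using tendsto_add[OF Riemann_Lebesgue_fast(1)[OF that(1,3,4)] Riemann_Lebesgue_fast(2)[OF that(2,3,4)]] trI that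
    by simp
  from assms show ?thesis
  proof (induction rule: trig_poly.induct)
    case (cos k c)
    have eq: "cell_conv (\<lambda>u. c * cos (2 * pi * (k \<bullet> u))) (F x) (fast j x) =
       (c * fcos (F x) k) * cos (2 * pi * (k \<bullet> fast j x)) + (c * fsin (F x) k) * sin (2 * pi * (k \<bullet> fast j x))" if "x \<in> \<Omega>" for x j
      unfolding cell_conv_cos[OF F_cell_integrable[OF that]] by (simp add: algebra_simps)
    have int: "integrable MO (\<lambda>x. (c * fcos (F x) k) * cos (2 * pi * (k \<bullet> fast j x)) + (c * fsin (F x) k) * sin (2 * pi * (k \<bullet> fast j x)))" for j
      by (intro Bochner_Integration.integrable_add trI integrable_mult_right cI sI)
    have int': "integrable MO (\<lambda>x. cell_conv (\<lambda>u. c * cos (2 * pi * (k \<bullet> u))) (F x) (fast j x))" for j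
      using int[of j] by (subst Bochner_Integration.integrable_cong[OF refl eq]) auto
    have eqI: "(LINT x|MO. cell_conv (\<lambda>u. c * cos (2 * pi * (k \<bullet> u))) (F x) (fast j x)) =
      (LINT x|MO. (c * fcos (F x) k) * cos (2 * pi * (k \<bullet> fast j x)) + (c * fsin (F x) k) * sin (2 * pi * (k \<bullet> fast j x)))" for j
      using eq by (intro Bochner_Integration.integral_cong) auto
    show ?case
    proof (cases "k = 0")
      case True
      then show ?thesis using int' by (simp add: cell_conv_def)
    next
      case False
      have z: "(LINT y|cell_measure. c * cos (2 * pi * (k \<bullet> y))) = 0" by (simp add: cell_integral_cos[OF cos False])
      show ?thesis unfolding eqI z mult_zero_left
        by (intro conjI allI int' mono_cos integrable_mult_right cI sI cos False)
    qed
  next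
    case (sin k c)
    have eq: "cell_conv (\<lambda>u. c * sin (2 * pi * (k \<bullet> u))) (F x) (fast j x) =
       (- c * fsin (F x) k) * cos (2 * pi * (k \<bullet> fast j x)) + (c * fcos (F x) k) * sin (2 * pi * (k \<bullet> fast j x))" if "x \<in> \<Omega>" for x j
      unfolding cell_conv_sin[OF F_cell_integrable[OF that]] by (simp add: algebra_simps)
    have int: "integrable MO (\<lambda>x. (- c * fsin (F x) k) * cos (2 * pi * (k \<bullet> fast j x)) + (c * fcos (F x) k) * sin (2 * pi * (k \<bullet> fast j x)))" for j
      by (intro Bochner_Integration.integrable_add trI integrable_mult_right cI sI)
    have int': "integrable MO (\<lambda>x. cell_conv (\<lambda>u. c * sin (2 * pi * (k \<bullet> u))) (F x) (fast j x))" for j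
      using int[of j] by (subst Bochner_Integration.integrable_cong[OF refl eq]) auto
    have eqI: "(LINT x|MO. cell_conv (\<lambda>u. c * sin (2 * pi * (k \<bullet> u))) (F x) (fast j x)) =
      (LINT x|MO. (- c * fsin (F x) k) * cos (2 * pi * (k \<bullet> fast j x)) + (c * fcos (F x) k) * sin (2 * pi * (k \<bullet> fast j x)))" for j
      using eq by (intro Bochner_Integration.integral_cong) auto
    show ?case
    proof (cases "k = 0")
      case True
      then show ?thesis using int' by (simp add: cell_conv_def)
    next
      case False
      have z: "(LINT y|cell_measure. c * sin (2 * pi * (k \<bullet> y))) = 0" by (simp add: cell_integral_sin[OF sin False])
      show ?thesis unfolding eqI z mult_zero_left
        by (intro conjI allI int' mono_cos integrable_mult_right cI sI sin False)
    qed
  next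
    case (add f g)
    have eq: "cell_conv (\<lambda>u. f u + g u) (F x) (fast j x) = cell_conv f (F x) (fast j x) + cell_conv g (F x) (fast j x)" if "x \<in> \<Omega>" for x j
      by (rule cell_conv_add[OF add.hyps F_cell_integrable[OF that]])
    have int': "integrable MO (\<lambda>x. cell_conv (\<lambda>u. f u + g u) (F x) (fast j x))" for j
      using add.IH by (subst Bochner_Integration.integrable_cong[OF refl eq]) auto
    have eqI: "(LINT x|MO. cell_conv (\<lambda>u. f u + g u) (F x) (fast j x)) =
      (LINT x|MO. cell_conv f (F x) (fast j x)) + (LINT x|MO. cell_conv g (F x) (fast j x))" for j
      using add.IH by (subst Bochner_Integration.integral_cong[OF refl eq]) auto
    have "(LINT y|cell_measure. f y + g y) = (LINT y|cell_measure. f y) + (LINT y|cell_measure. g y)"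
      by (intro Bochner_Integration.integral_add trig_poly_cell_integrable add.hyps)
    then show ?case
      using int' tendsto_add[OF conjunct1[OF add.IH(1)] conjunct1[OF add.IH(2)]]
      unfolding eqI by (simp add: distrib_right)
  qed
qed

text \<open>The uniform error in the fast variable. A countable dense index set makes the supremum
  measurable in \<open>x\<close>; by continuity it still bounds the error at every
  \<open>y\<close>.\<close>

definition conv_error :: "nat \<Rightarrow> real^'n \<Rightarrow> real" where
  "conv_error N x = (SUP y\<in>(SOME D. countable D \<and> D \<noteq> {} \<and> closure D = UNIV). \<bar>cell_conv (peak_kernel N) (F x) y - F x y\<bar>)"

lemma conv_le_h: "x \<in> \<Omega> \<Longrightarrow> \<bar>cell_conv (peak_kernel N) (F x) y\<bar> \<le> h x"
  using cell_conv_abs_le[OF F_cell_integrable, of x N y] cell_conv_const[of N "h x" y]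
    peak_kernel_conv_nonneg_mono[of "\<lambda>z. \<bar>F x z\<bar>" "\<lambda>z. h x" N y] F_facts(4)[of x] F_cell_integrable[of x]
    finite_measure.integrable_const[OF finite_measure_cell, of "h x"]
  by fastforce

lemma conv_error:
  shows "conv_error N \<in> borel_measurable MO"
    and "x \<in> \<Omega> \<Longrightarrow> \<bar>cell_conv (peak_kernel N) (F x) y - F x y\<bar> \<le> conv_error N x"
    and "x \<in> \<Omega> \<Longrightarrow> conv_error N x \<le> 2 * h x"
    and "x \<in> \<Omega> \<Longrightarrow> (\<lambda>N. conv_error N x) \<longlonglongrightarrow> 0"
proof -
  define D where "D = (SOME D :: (real^'m) set. countable D \<and> D \<noteq> {} \<and> closure D = UNIV)"
  obtain D0 :: "(real^'m) set" where D0: "countable D0" "\<And>X. open X \<Longrightarrow> X \<noteq> {} \<Longrightarrow> \<exists>d\<in>D0. d \<in> X"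
    by (rule countable_dense_setE) blast
  have "x \<in> closure D0" for x
    unfolding closure_iff_nhds_not_empty using D0(2) by (metis disjoint_iff empty_iff subsetD)
  then have "countable D0 \<and> D0 \<noteq> {} \<and> closure D0 = UNIV" using D0 by fastforce
  then have D: "countable D" "D \<noteq> {}" "closure D = UNIV"
    unfolding D_def by (metis (mono_tags, lifting) someI_ex)+
  have E: "conv_error N x = (SUP y\<in>D. \<bar>cell_conv (peak_kernel N) (F x) y - F x y\<bar>)" for N x
    by (simp add: conv_error_def D_def)
  have le2: "\<bar>cell_conv (peak_kernel N) (F x) y - F x y\<bar> \<le> 2 * h x" if "x \<in> \<Omega>" for N x y
    using conv_le_h[OF that, of N y] F_facts(4)[OF that, of y] by linarith
  have bdd: "bdd_above ((\<lambda>y. \<bar>cell_conv (peak_kernel N) (F x) y - F x y\<bar>) ` D)" if "x \<in> \<Omega>" for N x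
    using le2[OF that] by (intro bdd_aboveI2[where M="2 * h x"])
  show "conv_error N \<in> borel_measurable MO"
    unfolding E
  proof (rule borel_measurable_cSUP[OF D(1)])
    fix y
    have "(\<lambda>x. LINT z|cell_measure. peak_kernel N (y - z) * F x z) \<in> borel_measurable MO"
      by (rule F_integral_measurable) (auto intro!: measurable_compose[OF _ trig_poly_measurable[OF trig_poly_peak_kernel]])
    then show "(\<lambda>x. \<bar>cell_conv (peak_kernel N) (F x) y - F x y\<bar>) \<in> borel_measurable MO"
      unfolding cell_conv_def using F_facts(1)[of y] by measurable
  qed (use bdd in auto)
  have ub: "\<bar>cell_conv (peak_kernel N) (F x) y - F x y\<bar> \<le> conv_error N x" if x: "x \<in> \<Omega>" for N x y
  proof -
    have cont: "continuous_on UNIV (\<lambda>y. \<bar>cell_conv (peak_kernel N) (F x) y - F x y\<bar>)"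
      by (intro continuous_intros trig_poly_continuous cell_conv_trig_poly trig_poly_peak_kernel F_cell_integrable x F_facts(2))
    have "closed {y. \<bar>cell_conv (peak_kernel N) (F x) y - F x y\<bar> \<le> conv_error N x}"
      using closed_Collect_le[OF cont continuous_on_const] .
    moreover have "D \<subseteq> {y. \<bar>cell_conv (peak_kernel N) (F x) y - F x y\<bar> \<le> conv_error N x}"
      unfolding E using bdd[OF x] by (auto intro!: cSUP_upper)
    ultimately show ?thesis using D(3) closure_minimal by blast
  qed
  show "\<bar>cell_conv (peak_kernel N) (F x) y - F x y\<bar> \<le> conv_error N x" if "x \<in> \<Omega>"
    by (rule ub[OF that])
  show "conv_error N x \<le> 2 * h x" if x: "x \<in> \<Omega>"
    unfolding E using D(2) le2[OF x] by (intro cSUP_least)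
  show "(\<lambda>N. conv_error N x) \<longlonglongrightarrow> 0" if x: "x \<in> \<Omega>"
  proof (rule LIMSEQ_I)
    fix e :: real assume "e > 0"
    have near: "\<exists>\<delta>>0. \<delta> \<le> 1/2 \<and> (\<forall>y\<in>unit_cell. \<forall>z\<in>unit_cell. near_int \<delta> (y - z) \<longrightarrow> \<bar>F x z - F x y\<bar> \<le> \<eta>)" if "\<eta> > 0" for \<eta>
      by (rule near_int_continuous_periodic[OF F_facts(2)[OF x] F_facts(3)[OF x] that]) blast
    obtain N0 where N0: "\<And>N y. N \<ge> N0 \<Longrightarrow> y \<in> unit_cell \<Longrightarrow> \<bar>cell_conv (peak_kernel N) (F x) y - F x y\<bar> \<le> e / 2"
      using peak_kernel_conv_tendsto_uniform[OF F_cell_measurable[OF x] F_facts(4)[OF x] near half_gt_zero[OF \<open>e > 0\<close>]] by blast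
    have "norm (conv_error N x - 0) < e" if "N \<ge> N0" for N
    proof -
      have "\<bar>cell_conv (peak_kernel N) (F x) y - F x y\<bar> \<le> e / 2" for y
      proof -
        obtain k where k: "int_vec k" "y + k \<in> unit_cell" using exists_unit_cell_representative by blast
        have "cell_conv (peak_kernel N) (F x) (y + k) = cell_conv (peak_kernel N) (F x) y" "F x (y + k) = F x y"
          using k(1) F_facts(3)[OF x] trig_poly_periodic[OF cell_conv_trig_poly[OF trig_poly_peak_kernel F_cell_integrable[OF x]]]
          unfolding periodic_cell_def by blast+
        then show ?thesis using N0[OF that k(2)] by simp
      qed
      then have "conv_error N x \<le> e / 2" unfolding E using D(2) by (intro cSUP_least)
      moreover have "conv_error N x \<ge> 0"
        using ub[OF x, of N 0] by linarith
      ultimately show ?thesis using \<open>e > 0\<close> by simp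
    qed
    then show "\<exists>no. \<forall>n\<ge>no. norm (conv_error n x - 0) < e" by blast
  qed
qed

text \<open>The index \<open>N\<close> is fixed first: the uniform errors converge to 0 under the
  majorant \<open>2 * h\<close>, so replacing \<open>F\<close> by its convolution costs little for
  all \<open>j\<close> simultaneously. Only then does \<open>j\<close> tend to infinity.\<close>

lemma mean_value_tendsto:
  "(\<lambda>j. LINT x|MO. F x (fast j x)) \<longlonglongrightarrow> (LINT x|MO. LINT y|cell_measure. F x y)"
proof (rule LIMSEQ_I)
  fix e :: real assume "e > 0"
  note ce = conv_error
  have ce_int: "integrable MO (conv_error N)" for N
  proof (rule Bochner_Integration.integrable_bound[of _ "\<lambda>x. 2 * h x"])
    show "AE x in MO. norm (conv_error N x) \<le> norm (2 * h x)"
    proof (rule AE_I2)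
      fix x assume "x \<in> space MO"
      then show "norm (conv_error N x) \<le> norm (2 * h x)" using ce(2)[of x N 0] ce(3)[of x N] by auto
    qed
  qed (use F_facts(5) ce(1) in auto)
  have "(\<lambda>N. LINT x|MO. conv_error N x) \<longlonglongrightarrow> (LINT x|MO. 0)"
  proof (rule integral_dominated_convergence[where w="\<lambda>x. 2 * h x"])
    show "AE x in MO. norm (conv_error N x) \<le> 2 * h x" for N
    proof (rule AE_I2)
      fix x assume "x \<in> space MO"
      then show "norm (conv_error N x) \<le> 2 * h x" using ce(2)[of x N 0] ce(3)[of x N] by auto
    qed
  qed (use F_facts(5) ce in auto)
  then have "\<forall>\<^sub>F N in sequentially. (LINT x|MO. conv_error N x) < e / 2"
    using \<open>e > 0\<close> by (intro order_tendstoD(2)[where y=0]) auto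
  then obtain N where N: "(LINT x|MO. conv_error N x) < e / 2"
    by (meson eventually_sequentially order_refl)
  have lim: "(\<lambda>j. LINT x|MO. cell_conv (peak_kernel N) (F x) (fast j x)) \<longlonglongrightarrow> (LINT x|MO. LINT y|cell_measure. F x y)"
    and int: "\<And>j. integrable MO (\<lambda>x. cell_conv (peak_kernel N) (F x) (fast j x))"
    using mean_trig_conv[OF trig_poly_peak_kernel[of N]] by (auto simp: peak_kernel_integral)
  obtain j0 where j0: "\<And>j. j \<ge> j0 \<Longrightarrow> norm ((LINT x|MO. cell_conv (peak_kernel N) (F x) (fast j x)) - (LINT x|MO. LINT y|cell_measure. F x y)) < e / 2"
    using LIMSEQ_D[OF lim, of "e/2"] \<open>e > 0\<close> by auto
  have "norm ((LINT x|MO. F x (fast j x)) - (LINT x|MO. LINT y|cell_measure. F x y)) < e" if "j \<ge> j0" for j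
  proof -
    have "\<bar>(LINT x|MO. cell_conv (peak_kernel N) (F x) (fast j x)) - (LINT x|MO. F x (fast j x))\<bar> =
        \<bar>LINT x|MO. cell_conv (peak_kernel N) (F x) (fast j x) - F x (fast j x)\<bar>"
      using int F_fast_integrable by simp
    also have "\<dots> \<le> (LINT x|MO. \<bar>cell_conv (peak_kernel N) (F x) (fast j x) - F x (fast j x)\<bar>)"
      by (rule integral_abs_bound)
    also have "\<dots> \<le> (LINT x|MO. conv_error N x)"
      using int F_fast_integrable ce_int ce(2) by (intro integral_mono) auto
    finally show ?thesis using j0[OF that] N unfolding real_norm_def by linarith
  qed
  then show "\<exists>j0. \<forall>j\<ge>j0. norm ((LINT x|MO. F x (fast j x)) - (LINT x|MO. LINT y|cell_measure. F x y)) < e" by blast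
qed

end

end

subsection \<open>Weak limits of bounded sequences\<close>

text \<open>A strictly convex function of linear growth: its integral is finite for integrable
  arguments on a finite measure space, and its midpoint gap gives quantitative control of
  \<open>a - b\<close>.\<close>

abbreviation hyp :: "real \<Rightarrow> real" where
  "hyp t \<equiv> sqrt (1 + t\<^sup>2)"

text \<open>Cauchy-Schwarz inequality for the plane vectors \<open>(1, a)\<close> and
  \<open>(1, b)\<close>.\<close>

lemma hyp_product_ge: "1 + a * b \<le> hyp a * hyp b"
proof -
  have "(1 + a * b)\<^sup>2 \<le> (1 + a\<^sup>2) * (1 + b\<^sup>2)"
  proof -
    have "(1 + a\<^sup>2) * (1 + b\<^sup>2) - (1 + a * b)\<^sup>2 = (a - b)\<^sup>2" by (simp add: power2_eq_square algebra_simps)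
    then show ?thesis using zero_le_power2[of "a - b"] by linarith
  qed
  then have "1 + a * b \<le> sqrt ((1 + a\<^sup>2) * (1 + b\<^sup>2))" by (rule real_le_rsqrt)
  then show ?thesis by (simp add: real_sqrt_mult)
qed

lemma hyp_square_gap:
  "((hyp a + hyp b) / 2)\<^sup>2 - (hyp ((a + b) / 2))\<^sup>2 = (hyp a * hyp b - (1 + a * b)) / 2"
proof -
  have "(hyp a)\<^sup>2 = 1 + a\<^sup>2" "(hyp b)\<^sup>2 = 1 + b\<^sup>2" "(hyp ((a + b) / 2))\<^sup>2 = 1 + ((a + b) / 2)\<^sup>2"
    by (simp_all add: add_nonneg_nonneg)
  then show ?thesis by (simp add: power2_eq_square field_simps)
qed

lemma hyp_midpoint: "hyp ((a + b) / 2) \<le> (hyp a + hyp b) / 2"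
proof (rule power2_le_imp_le)
  show "(hyp ((a + b) / 2))\<^sup>2 \<le> ((hyp a + hyp b) / 2)\<^sup>2"
  proof -
    have "((hyp a + hyp b) / 2)\<^sup>2 - (hyp ((a + b) / 2))\<^sup>2 \<ge> 0"
      unfolding hyp_square_gap using hyp_product_ge[of a b] by simp
    then show ?thesis by (simp only: diff_ge_0_iff_ge)
  qed
qed (auto intro!: add_nonneg_nonneg)

text \<open>Let \<open>S\<close> be the mean of the two values, \<open>c\<close> the value at the
  midpoint and \<open>P\<close> the product of the values. Then \<open>S\<^sup>2 - c\<^sup>2\<close>
  is half of \<open>P - (1 + a * b)\<close>, and \<open>P\<^sup>2 - (1 + a * b)\<^sup>2\<close> is
  \<open>(a - b)\<^sup>2\<close>. Factoring both differences of squares leaves the cofactors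
  \<open>S + c\<close> and \<open>P + (1 + a * b)\<close>, each at most \<open>2 * Q\<close>; with
  the factor 2 this makes \<open>8 * Q\<^sup>2\<close>.\<close>

lemma hyp_strict_gap:
  assumes "\<bar>a\<bar> \<le> M" "\<bar>b\<bar> \<le> M"
  shows "(a - b)\<^sup>2 / (8 * (1 + M\<^sup>2)\<^sup>2) \<le> (hyp a + hyp b) / 2 - hyp ((a + b) / 2)"
proof -
  define Q where "Q = 1 + M\<^sup>2"
  have Q1: "Q \<ge> 1" by (simp add: Q_def)
  have sq: "a\<^sup>2 \<le> M\<^sup>2" "b\<^sup>2 \<le> M\<^sup>2" using assms by (auto simp: abs_le_square_iff[symmetric])
  have le: "hyp t \<le> Q" if "\<bar>t\<bar> \<le> M" for t
  proof -
    have "t\<^sup>2 \<le> M\<^sup>2" using that by (auto simp: abs_le_square_iff[symmetric])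
    then have "1 + t\<^sup>2 \<le> Q" by (simp add: Q_def)
    also have "Q \<le> Q\<^sup>2" using Q1 by (simp add: power2_eq_square)
    finally show ?thesis using Q1 by (intro real_le_lsqrt) auto
  qed
  have ab: "\<bar>(a + b) / 2\<bar> \<le> M" using assms by (auto simp: abs_le_iff)
  define P where "P = hyp a * hyp b"
  define S where "S = (hyp a + hyp b) / 2"
  define c where "c = hyp ((a + b) / 2)"
  have P: "P \<le> Q"
  proof -
    have "P = sqrt ((1 + a\<^sup>2) * (1 + b\<^sup>2))" by (simp add: P_def real_sqrt_mult)
    also have "\<dots> \<le> sqrt (Q * Q)" using sq Q1 by (intro real_sqrt_le_mono mult_mono) (auto simp: Q_def)
    finally show ?thesis using Q1 by simp
  qed
  have Pab: "1 + a * b \<le> P" unfolding P_def by (rule hyp_product_ge)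
  have "2 * \<bar>a * b\<bar> \<le> a\<^sup>2 + b\<^sup>2" using sum_squares_bound[of "\<bar>a\<bar>" "\<bar>b\<bar>"] by (simp add: abs_mult)
  then have abQ: "1 + a * b \<le> Q" using sq unfolding Q_def by linarith
  have "P\<^sup>2 = (1 + a\<^sup>2) * (1 + b\<^sup>2)" unfolding P_def by (simp add: power_mult_distrib add_nonneg_nonneg)
  then have prod: "(P - (1 + a * b)) * (P + (1 + a * b)) = (a - b)\<^sup>2"
    by (simp add: power2_eq_square algebra_simps)
  have "(a - b)\<^sup>2 \<le> (P - (1 + a * b)) * (2 * Q)"
    unfolding prod[symmetric] using Pab P abQ by (intro mult_left_mono) auto
  also have "P - (1 + a * b) = 2 * (S\<^sup>2 - c\<^sup>2)"
    using hyp_square_gap[of a b] by (simp add: P_def S_def c_def)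
  also have "S\<^sup>2 - c\<^sup>2 = (S - c) * (S + c)" by (simp add: power2_eq_square algebra_simps)
  finally have 1: "(a - b)\<^sup>2 \<le> 4 * Q * ((S - c) * (S + c))" by (simp add: algebra_simps)
  have "S + c \<le> (Q + Q) / 2 + Q"
    unfolding S_def c_def by (intro add_mono divide_right_mono le assms ab) auto
  then have "S + c \<le> 2 * Q" by simp
  moreover have "S - c \<ge> 0" using hyp_midpoint[of a b] by (simp add: S_def c_def)
  ultimately have "(S - c) * (S + c) \<le> (S - c) * (2 * Q)" by (intro mult_left_mono)
  then have "4 * Q * ((S - c) * (S + c)) \<le> 4 * Q * ((S - c) * (2 * Q))" 
    using Q1 by (intro mult_left_mono[of "(S - c) * (S + c)" "(S - c) * (2 * Q)" "4 * Q"]) simp_all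
  then have "(a - b)\<^sup>2 \<le> (S - c) * (8 * Q\<^sup>2)" using 1 by (simp add: power2_eq_square algebra_simps)
  then have "(a - b)\<^sup>2 / (8 * Q\<^sup>2) \<le> S - c" using Q1 by (simp add: field_simps)
  then show ?thesis by (simp add: Q_def S_def c_def)
qed

text \<open>Convexity is quantitative on bounded values only, so the estimate splits at height
  \<open>M\<close>. Below it, \<open>\<bar>a - b\<bar>\<close> is at most
  \<open>\<eta> + (a - b)\<^sup>2 / \<eta>\<close>. Otherwise the larger absolute value
  \<open>m\<close> exceeds \<open>M\<close> and is at most
  \<open>M powr (1 - p) * m powr p\<close>.\<close>

lemma abs_diff_le_hyp_gap:
  assumes "M \<ge> 1" "\<eta> > 0" "p > 1"
  shows "\<bar>a - b\<bar> \<le> \<eta> + (8 * (1 + M\<^sup>2)\<^sup>2 / \<eta>) * ((hyp a + hyp b) / 2 - hyp ((a + b) / 2))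
     + 2 * M powr (1 - p) * (\<bar>a\<bar> powr p + \<bar>b\<bar> powr p)"
proof -
  define D where "D = (hyp a + hyp b) / 2 - hyp ((a + b) / 2)"
  have D0: "D \<ge> 0" using hyp_midpoint[of a b] by (simp add: D_def)
  define k where "k = 8 * (1 + M\<^sup>2)\<^sup>2"
  have k0: "k > 0"
    unfolding k_def by (intro mult_pos_pos zero_less_power add_pos_nonneg) auto
  have t1: "k / \<eta> * D \<ge> 0" using D0 k0 assms by simp
  have t2: "2 * M powr (1 - p) * (\<bar>a\<bar> powr p + \<bar>b\<bar> powr p) \<ge> 0" by (intro mult_nonneg_nonneg add_nonneg_nonneg) auto
  show ?thesis
  proof (cases "\<bar>a\<bar> \<le> M \<and> \<bar>b\<bar> \<le> M")
    case True
    then have "(a - b)\<^sup>2 / k \<le> D" using hyp_strict_gap[of a M b] by (simp add: k_def D_def)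
    then have "(a - b)\<^sup>2 \<le> k * D" using k0 by (simp add: field_simps)
    then have "(a - b)\<^sup>2 / \<eta> \<le> k / \<eta> * D" using assms by (simp add: divide_right_mono)
    moreover have "\<bar>a - b\<bar> \<le> \<eta> + (a - b)\<^sup>2 / \<eta>"
    proof (cases "\<bar>a - b\<bar> \<le> \<eta>")
      case False
      then have "\<bar>a - b\<bar> * \<eta> \<le> \<bar>a - b\<bar> * \<bar>a - b\<bar>" by (intro mult_left_mono) auto
      then have "\<bar>a - b\<bar> \<le> (a - b)\<^sup>2 / \<eta>" using assms by (simp add: field_simps power2_eq_square)
      then show ?thesis using assms by linarith
    qed (use assms in \<open>simp add: add_increasing2\<close>)
    ultimately show ?thesis using t2 unfolding k_def[symmetric] D_def[symmetric] by linarith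
  next
    case False
    define m where "m = max \<bar>a\<bar> \<bar>b\<bar>"
    have m: "m > M" "m > 0" using False assms by (auto simp: m_def)
    have "m powr 1 = m powr (1 - p) * m powr p" by (subst powr_add[symmetric]) simp
    also have "\<dots> \<le> M powr (1 - p) * m powr p"
      using m assms by (intro mult_right_mono powr_mono2') auto
    also have "\<dots> \<le> M powr (1 - p) * (\<bar>a\<bar> powr p + \<bar>b\<bar> powr p)"
      by (intro mult_left_mono) (auto simp: m_def max_def)
    finally have "m \<le> M powr (1 - p) * (\<bar>a\<bar> powr p + \<bar>b\<bar> powr p)" using m by simp
    moreover have "\<bar>a - b\<bar> \<le> 2 * m" by (auto simp: m_def)
    ultimately show ?thesis using t1 assms unfolding k_def[symmetric] D_def[symmetric] by linarith
  qed
qed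

lemma powr_midpoint:
  fixes a b p :: real
  assumes "p > 1"
  shows "\<bar>(a + b) / 2\<bar> powr p \<le> (\<bar>a\<bar> powr p + \<bar>b\<bar> powr p) / 2"
proof -
  define m where "m = (\<bar>a\<bar> + \<bar>b\<bar>) / 2"
  have m0: "m \<ge> 0" by (simp add: m_def)
  have "m powr (p - 1) * \<bar>a\<bar> + m powr (p - 1) * \<bar>b\<bar> \<le> (\<bar>a\<bar> powr p / p + (1 - 1 / p) * m powr p) + (\<bar>b\<bar> powr p / p + (1 - 1 / p) * m powr p)"
    using m0 assms by (intro add_mono powr_tangent_le) auto
  moreover have "m powr (p - 1) * \<bar>a\<bar> + m powr (p - 1) * \<bar>b\<bar> = 2 * (m powr (p - 1) * m)"
    by (simp add: m_def algebra_simps)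
  moreover have "m powr (p - 1) * m = m powr p"
  proof (cases "m = 0")
    case False
    then have "m powr (p - 1) * m powr 1 = m powr p" using m0 by (subst powr_add[symmetric]) simp
    then show ?thesis using m0 False by simp
  qed (use assms in simp)
  ultimately have "(2 / p) * m powr p \<le> (\<bar>a\<bar> powr p + \<bar>b\<bar> powr p) / p"
    by (simp add: algebra_simps add_divide_distrib)
  then have "m powr p \<le> (\<bar>a\<bar> powr p + \<bar>b\<bar> powr p) / 2"
    using assms by (simp add: field_simps)
  moreover have "\<bar>(a + b) / 2\<bar> powr p \<le> m powr p"
    using assms by (intro powr_mono2) (auto simp: m_def)
  ultimately show ?thesis by linarith
qed

text \<open>Midpoints suffice, since the Cauchy argument averages only two members at a time.
  Restricting to indices from \<open>n\<close> on makes limits of linear functionals along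
  \<open>u\<close> pass to averages as \<open>n\<close> grows.\<close>

inductive midhull :: "(nat \<Rightarrow> 'a \<Rightarrow> real) \<Rightarrow> nat \<Rightarrow> ('a \<Rightarrow> real) \<Rightarrow> bool" for u n where
  base: "n \<le> j \<Longrightarrow> midhull u n (u j)"
| mid: "midhull u n f \<Longrightarrow> midhull u n g \<Longrightarrow> midhull u n (\<lambda>x. (f x + g x) / 2)"

lemma midhull_mono: "midhull u n f \<Longrightarrow> m \<le> n \<Longrightarrow> midhull u m f"
  by (induction rule: midhull.induct) (auto intro: midhull.intros)

text \<open>A substitute for weak compactness of balls in \<open>L\<^sup>p\<close>: near-minimisers of the strictly convex
  functional \<open>\<integral>\<surd>(1 + f\<^sup>2)\<close> over the tail convex hulls form a Cauchy sequence in \<open>L\<^sup>1\<close>.\<close>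

locale bounded_Lp_seq = finite_measure M for M :: "'a measure" +
  fixes u :: "nat \<Rightarrow> 'a \<Rightarrow> real" and p C :: real
  assumes p: "p > 1" and u: "\<And>j. Lp_fun M p (u j)" and C: "\<And>j. (LINT x|M. \<bar>u j x\<bar> powr p) \<le> C"
begin

lemma hull_Lp: "midhull u n f \<Longrightarrow> Lp_fun M p f \<and> (LINT x|M. \<bar>f x\<bar> powr p) \<le> C"
proof (induction rule: midhull.induct)
  case (base j)
  then show ?case using u C by simp
next
  case (mid f g)
  have Lp: "Lp_fun M p (\<lambda>x. (f x + g x) / 2)"
    using Lp_fun_scaleR[OF Lp_fun_add[of M p f g], of "1/2"] mid.IH p by simp
  have "(LINT x|M. \<bar>(f x + g x) / 2\<bar> powr p) \<le> (LINT x|M. (\<bar>f x\<bar> powr p + \<bar>g x\<bar> powr p) / 2)"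
    using Lp_fun_integrable[OF Lp] Lp_fun_integrable[OF conjunct1[OF mid.IH(1)]] Lp_fun_integrable[OF conjunct1[OF mid.IH(2)]]
    by (intro integral_mono powr_midpoint p) auto
  also have "\<dots> = ((LINT x|M. \<bar>f x\<bar> powr p) + (LINT x|M. \<bar>g x\<bar> powr p)) / 2"
    using Lp_fun_integrable[OF conjunct1[OF mid.IH(1)]] Lp_fun_integrable[OF conjunct1[OF mid.IH(2)]] by simp
  finally show ?case using Lp mid.IH by simp
qed

lemma hull_integrable: "midhull u n f \<Longrightarrow> integrable M f"
  using Lp_fun_imp_integrable[OF finite_measure_axioms] hull_Lp p by (metis less_imp_le)

lemma hyp_integrable: "integrable M f \<Longrightarrow> integrable M (\<lambda>x. hyp (f x))"
proof (rule Bochner_Integration.integrable_bound[where f="\<lambda>x. 1 + \<bar>f x\<bar>"])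
  show "AE x in M. norm (hyp (f x)) \<le> norm (1 + \<bar>f x\<bar>)"
  proof (rule AE_I2)
    fix x
    have "hyp (f x) \<le> 1 + \<bar>f x\<bar>" by (intro real_le_lsqrt) (auto simp: power2_eq_square algebra_simps)
    then show "norm (hyp (f x)) \<le> norm (1 + \<bar>f x\<bar>)" by simp
  qed
qed auto

definition energy :: "('a \<Rightarrow> real) \<Rightarrow> real" where "energy f = (LINT x|M. hyp (f x))"

text \<open>These infima increase as the tails shrink and are bounded, so they converge; this is
  what forces near-minimisers together.\<close>

definition level :: "nat \<Rightarrow> real" where "level n = Inf (energy ` {f. midhull u n f})"

lemma energy_nonneg: "energy f \<ge> 0"
  unfolding energy_def by (intro integral_nonneg_AE) (auto intro!: add_nonneg_nonneg)

lemma level_le: "midhull u n f \<Longrightarrow> level n \<le> energy f"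
  unfolding level_def by (intro cInf_lower) (auto intro!: bdd_belowI[of _ 0] energy_nonneg)

lemma hull_nonempty: "{f. midhull u n f} \<noteq> {}"
  using midhull.base[of n n u] by blast

lemma level_mono: "m \<le> n \<Longrightarrow> level m \<le> level n"
  unfolding level_def using hull_nonempty[of n]
  by (intro cInf_superset_mono) (auto intro!: bdd_belowI[of _ 0] energy_nonneg midhull_mono)

lemma level_bounded: "level n \<le> 2 * measure M (space M) + C"
proof -
  have i: "integrable M (u n)" by (rule hull_integrable[of n]) (auto intro: midhull.base)
  have "level n \<le> energy (u n)" by (intro level_le midhull.base) simp
  also have "\<dots> \<le> (LINT x|M. 2 + \<bar>u n x\<bar> powr p)"
    unfolding energy_def
  proof (rule integral_mono[OF hyp_integrable[OF i]])
    show "integrable M (\<lambda>x. 2 + \<bar>u n x\<bar> powr p)" using Lp_fun_integrable[OF u, of n] by simp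
    fix x
    have "hyp (u n x) \<le> 1 + \<bar>u n x\<bar>" by (intro real_le_lsqrt) (auto simp: power2_eq_square algebra_simps)
    also have "\<bar>u n x\<bar> \<le> 1 + \<bar>u n x\<bar> powr p"
    proof (cases "\<bar>u n x\<bar> \<le> 1")
      case False
      then have "\<bar>u n x\<bar> powr 1 \<le> \<bar>u n x\<bar> powr p" using p by (intro powr_mono) auto
      then show ?thesis by simp
    qed (auto intro: order.trans[where b=1])
    finally show "hyp (u n x) \<le> 2 + \<bar>u n x\<bar> powr p" by simp
  qed
  also have "\<dots> = 2 * measure M (space M) + (LINT x|M. \<bar>u n x\<bar> powr p)"
    using Lp_fun_integrable[OF u, of n] by (simp add: mult.commute)
  finally show ?thesis using C[of n] by linarith
qed

definition minimiser :: "nat \<Rightarrow> 'a \<Rightarrow> real" where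
  "minimiser n = (SOME f. midhull u n f \<and> energy f < level n + 1 / real (Suc n))"

lemma minimiser: "midhull u n (minimiser n)" "energy (minimiser n) < level n + 1 / real (Suc n)"
proof -
  have "\<exists>e\<in>energy ` {f. midhull u n f}. e < level n + 1 / real (Suc n)"
    unfolding level_def using hull_nonempty
    by (subst cInf_less_iff[symmetric]) (auto intro!: bdd_belowI[of _ 0] energy_nonneg)
  then have "\<exists>f. midhull u n f \<and> energy f < level n + 1 / real (Suc n)" by auto
  then show "midhull u n (minimiser n)" "energy (minimiser n) < level n + 1 / real (Suc n)"
    unfolding minimiser_def by (metis (mono_tags, lifting) someI_ex)+
qed

text \<open>For \<open>n \<le> m\<close> the midpoint of the two near-minimisers lies in the hull of
  the \<open>n\<close>-th tail and has energy at least \<open>level n\<close>. Hence the integrated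
  convexity gap is at most what the levels still gain after \<open>n\<close>, plus
  \<open>1 / real (Suc n)\<close>. The pointwise gap estimate turns this into an \<open>L^1\<close>
  distance.\<close>

lemma minimiser_Cauchy:
  assumes "e > 0"
  obtains N where "\<And>m n. N \<le> n \<Longrightarrow> n \<le> m \<Longrightarrow> (LINT x|M. \<bar>minimiser n x - minimiser m x\<bar>) < e"
proof -
  let ?w = minimiser
  note wi = hull_integrable[OF minimiser(1)]
  define V where "V = measure M (space M)"
  have V0: "V \<ge> 0" by (simp add: V_def)
  define \<eta> where "\<eta> = (e / 4) / (V + 1)"
  have \<eta>: "\<eta> > 0" using assms V0 by (simp add: \<eta>_def)
  \<comment> \<open>The height \<open>B\<close> obtained here makes the contribution of large values
    smaller than \<open>e / 4\<close>. It precedes the choice of \<open>N\<close>, because the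
    factor \<open>k\<close> of the convexity gap depends on it.\<close>
  have "((\<lambda>M. 4 * C * M powr (1 - p)) \<longlongrightarrow> 4 * C * 0) at_top"
    using p by (intro tendsto_intros tendsto_neg_powr filterlim_ident) auto
  then have "\<forall>\<^sub>F M in at_top. 4 * C * M powr (1 - p) < e / 4"
    using assms by (intro order_tendstoD(2)[where y=0]) auto
  from eventually_conj[OF this eventually_ge_at_top[of 1]]
  obtain B where B: "B \<ge> 1" "4 * C * B powr (1 - p) < e / 4"
    by (metis (mono_tags, lifting) eventually_happens trivial_limit_at_top_linorder)
  define k where "k = 8 * (1 + B\<^sup>2)\<^sup>2 / \<eta>"
  have k0: "k > 0"
    unfolding k_def using \<eta> by (intro divide_pos_pos mult_pos_pos zero_less_power add_pos_nonneg) auto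
  have "bdd_above (range level)" using level_bounded by (intro bdd_aboveI2)
  then have lim: "level \<longlonglongrightarrow> (SUP n. level n)" by (intro LIMSEQ_incseq_SUP) (auto simp: incseq_def level_mono)
  have sup: "level n \<le> (SUP n. level n)" for n by (intro cSUP_upper \<open>bdd_above (range level)\<close>) auto
  have "(\<lambda>n. k * (((SUP n. level n) - level n) + 1 / real (Suc n))) \<longlonglongrightarrow> k * (((SUP n. level n) - (SUP n. level n)) + 0)"
    by (intro tendsto_intros lim LIMSEQ_Suc lim_1_over_n)
  then have "\<forall>\<^sub>F n in sequentially. k * (((SUP n. level n) - level n) + 1 / real (Suc n)) < e / 4"
    using assms by (intro order_tendstoD(2)[where y=0]) auto
  then obtain N where N: "\<And>n. n \<ge> N \<Longrightarrow> k * (((SUP n. level n) - level n) + 1 / real (Suc n)) < e / 4"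
    by (auto simp: eventually_sequentially)
  show thesis
  proof (rule that)
    fix m n assume nm: "N \<le> n" "n \<le> m"
    define D where "D x = (hyp (?w n x) + hyp (?w m x)) / 2 - hyp ((?w n x + ?w m x) / 2)" for x
    have hm: "midhull u n (\<lambda>x. (?w n x + ?w m x) / 2)"
      using nm midhull_mono[OF minimiser(1)[of m]] by (intro midhull.mid minimiser) auto
    have Di: "integrable M D"
      unfolding D_def using hyp_integrable[OF wi[of n]] hyp_integrable[OF wi[of m]] hyp_integrable[OF hull_integrable[OF hm]] by simp
    have "(LINT x|M. D x) = (energy (?w n) + energy (?w m)) / 2 - energy (\<lambda>x. (?w n x + ?w m x) / 2)"
      unfolding D_def energy_def
      using hyp_integrable[OF wi[of n]] hyp_integrable[OF wi[of m]] hyp_integrable[OF hull_integrable[OF hm]] by simp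
    also have "\<dots> \<le> (energy (?w n) + energy (?w m)) / 2 - level n" using level_le[OF hm] by simp
    also have "\<dots> \<le> ((SUP n. level n) - level n) + 1 / real (Suc n)"
    proof -
      have "1 / real (Suc m) \<le> 1 / real (Suc n)" using nm by (simp add: field_simps)
      moreover have "level n \<le> level m" using nm level_mono by simp
      moreover have "(x + y) / 2 - l \<le> S - l + a" if "a' \<le> a" "l \<le> l'" "x < l + a" "y < l' + a'" "l' \<le> S" for x y l l' a a' S :: real
        using that by simp
      ultimately show ?thesis using minimiser(2)[of n] minimiser(2)[of m] sup[of m] by blast
    qed
    finally have "k * (LINT x|M. D x) \<le> k * (((SUP n. level n) - level n) + 1 / real (Suc n))"
      using k0 by (intro mult_left_mono) auto
    then have ID: "k * (LINT x|M. D x) < e / 4" using N[OF nm(1)] by linarith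
    note pi = Lp_fun_integrable[OF conjunct1[OF hull_Lp[OF minimiser(1)]], unfolded real_norm_def]
    have "(LINT x|M. \<bar>?w n x - ?w m x\<bar>) \<le> (LINT x|M. \<eta> + k * D x + 2 * B powr (1 - p) * (\<bar>?w n x\<bar> powr p + \<bar>?w m x\<bar> powr p))"
    proof (rule integral_mono)
      show "integrable M (\<lambda>x. \<bar>?w n x - ?w m x\<bar>)" using wi by simp
      show "integrable M (\<lambda>x. \<eta> + k * D x + 2 * B powr (1 - p) * (\<bar>?w n x\<bar> powr p + \<bar>?w m x\<bar> powr p))"
        by (intro Bochner_Integration.integrable_add integrable_mult_right Di pi integrable_const)
      show "\<bar>?w n x - ?w m x\<bar> \<le> \<eta> + k * D x + 2 * B powr (1 - p) * (\<bar>?w n x\<bar> powr p + \<bar>?w m x\<bar> powr p)" for x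
        unfolding k_def D_def by (rule abs_diff_le_hyp_gap[OF B(1) \<eta> p])
    qed
    also have "\<dots> = \<eta> * V + k * (LINT x|M. D x) + 2 * B powr (1 - p) * ((LINT x|M. \<bar>?w n x\<bar> powr p) + (LINT x|M. \<bar>?w m x\<bar> powr p))"
      using Di pi[of n] pi[of m] by (simp add: V_def mult.commute)
    also have "2 * B powr (1 - p) * ((LINT x|M. \<bar>?w n x\<bar> powr p) + (LINT x|M. \<bar>?w m x\<bar> powr p)) \<le> 2 * B powr (1 - p) * (C + C)"
      using hull_Lp[OF minimiser(1)] by (intro mult_left_mono add_mono) auto
    also have "\<eta> * V \<le> e / 4"
    proof -
      have "\<eta> * V \<le> \<eta> * (V + 1)" using \<eta> by simp
      also have "\<dots> = e / 4"
      proof -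
        have "V + 1 \<noteq> 0" using V0 by linarith
        then show ?thesis using nonzero_eq_divide_eq[of "V + 1" \<eta> "e / 4"] \<eta>_def by blast
      qed
      finally show ?thesis .
    qed
    finally show "(LINT x|M. \<bar>?w n x - ?w m x\<bar>) < e" using ID B(2) assms by (simp add: algebra_simps)
  qed
qed

text \<open>An interval around \<open>L\<close> is convex, so it contains the value of the
  functional at any average once it contains those of the tail.\<close>

lemma hull_functional:
  assumes b: "b \<in> borel_measurable M" "\<And>x. x \<in> space M \<Longrightarrow> \<bar>b x\<bar> \<le> B"
    and close: "\<And>j. j \<ge> n \<Longrightarrow> \<bar>(LINT x|M. u j x * b x) - L\<bar> \<le> \<eta>"
    and f: "midhull u n f"
  shows "\<bar>(LINT x|M. f x * b x) - L\<bar> \<le> \<eta>"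
proof -
  have int: "integrable M (\<lambda>x. f x * b x)" if "integrable M f" for f
  proof (rule Bochner_Integration.integrable_bound[where f="\<lambda>x. B * f x"])
    show "AE x in M. norm (f x * b x) \<le> norm (B * f x)"
    proof (rule AE_I2)
      fix x assume "x \<in> space M"
      then have "\<bar>b x\<bar> \<le> \<bar>B\<bar>" using b(2)[of x] by linarith
      then have "\<bar>f x\<bar> * \<bar>b x\<bar> \<le> \<bar>f x\<bar> * \<bar>B\<bar>" by (intro mult_left_mono) auto
      then show "norm (f x * b x) \<le> norm (B * f x)" by (simp add: abs_mult mult.commute)
    qed
  qed (use that b in auto)
  from f show ?thesis
  proof (induction rule: midhull.induct)
    case (base j)
    then show ?case using close by simp
  next
    case (mid f g)
    have "(LINT x|M. (f x + g x) / 2 * b x) = (LINT x|M. (f x * b x + g x * b x) / 2)"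
      by (simp add: algebra_simps add_divide_distrib)
    also have "\<dots> = ((LINT x|M. f x * b x) + (LINT x|M. g x * b x)) / 2"
      using int[OF hull_integrable[OF mid.hyps(1)]] int[OF hull_integrable[OF mid.hyps(2)]] by simp
    finally show ?case using mid.IH by (auto simp: abs_le_iff field_simps)
  qed
qed

text \<open>A fast subsequence of near-minimisers converges almost everywhere under an integrable
  majorant, and Fatou's lemma puts the limit into \<open>L^p\<close>. A bounded weight whose
  pairings with \<open>u\<close> converge has the same limit on tail averages, and dominated
  convergence identifies it with the pairing with \<open>v\<close>.\<close>

theorem weak_limit:
  obtains v where "Lp_fun M p v"
    "\<And>b B L. b \<in> borel_measurable M \<Longrightarrow> (\<And>x. x \<in> space M \<Longrightarrow> \<bar>b x\<bar> \<le> B) \<Longrightarrow>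
       (\<lambda>j. LINT x|M. u j x * b x) \<longlonglongrightarrow> L \<Longrightarrow> (LINT x|M. v x * b x) = L"
proof -
  let ?w = minimiser
  note wi = hull_integrable[OF minimiser(1)]
  have wm [measurable]: "?w n \<in> borel_measurable M" for n using wi by auto
  have "\<exists>r0. \<forall>n m. r0 \<le> n \<longrightarrow> n \<le> m \<longrightarrow> (LINT x|M. \<bar>?w n x - ?w m x\<bar>) < (1/2) ^ k" for k :: nat
    using minimiser_Cauchy[of "(1/2)^k"] by (metis zero_less_divide_1_iff zero_less_numeral zero_less_power)
  then obtain r0 where r0: "\<And>k n m. r0 k \<le> n \<Longrightarrow> n \<le> m \<Longrightarrow> (LINT x|M. \<bar>?w n x - ?w m x\<bar>) < (1/2::real) ^ k"
    by metis
  \<comment> \<open>Partial sums make the indices increasing; the summand \<open>k\<close> ensures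
    that \<open>s k\<close> averages only functions \<open>u j\<close> with
    \<open>j \<ge> k\<close>.\<close>
  define r where "r k = (\<Sum>i\<le>k. r0 i) + k" for k
  have r_ge: "r0 k \<le> r k" for k unfolding r_def
    by (intro trans_le_add1 member_le_sum) auto
  have r_k: "k \<le> r k" for k by (simp add: r_def)
  have r_Suc: "r k \<le> r (Suc k)" for k by (simp add: r_def)
  define s where "s k = ?w (r k)" for k
  define f where "f k x = s (Suc k) x - s k x" for k x
  have si: "integrable M (s k)" for k unfolding s_def by (rule wi)
  have fi: "integrable M (f k)" for k unfolding f_def using si by simp
  have f_small: "(LINT x|M. norm (f k x)) < (1/2) ^ k" for k
    using r0[OF r_ge r_Suc, of k] by (simp add: f_def s_def abs_minus_commute)
  have sumI: "summable (\<lambda>k. LINT x|M. norm (f k x))"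
  proof (rule summable_comparison_test'[where N=0])
    show "summable (\<lambda>k. (1/2::real) ^ k)" by (rule summable_geometric) simp
    show "norm (LINT x|M. norm (f k x)) \<le> (1/2) ^ k" for k
      using f_small[of k] by (simp add: less_imp_le)
  qed
  have AEsum: "AE x in M. summable (\<lambda>k. norm (f k x))"
  proof -
    have "(\<integral>\<^sup>+ x. (\<Sum>k. ennreal (norm (f k x))) \<partial>M) = (\<Sum>k. \<integral>\<^sup>+ x. ennreal (norm (f k x)) \<partial>M)"
      by (intro nn_integral_suminf) (use fi in auto)
    also have "\<dots> = (\<Sum>k. ennreal (LINT x|M. norm (f k x)))"
      using fi by (subst nn_integral_eq_integral) auto
    also have "\<dots> = ennreal (\<Sum>k. LINT x|M. norm (f k x))"
      by (intro suminf_ennreal2 sumI) auto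
    finally have "(\<integral>\<^sup>+ x. (\<Sum>k. ennreal (norm (f k x))) \<partial>M) \<noteq> \<infinity>" by simp
    then have "AE x in M. (\<Sum>k. ennreal (norm (f k x))) \<noteq> \<infinity>"
      by (intro nn_integral_noteq_infinite) (use fi in auto)
    then show ?thesis by eventually_elim (auto intro: summable_suminf_not_top)
  qed
  have s_sum: "s n x = s 0 x + (\<Sum>k<n. f k x)" for n x
    by (induction n) (auto simp: f_def)
  define v where "v x = lim (\<lambda>k. s k x)" for x
  have vm [measurable]: "v \<in> borel_measurable M" unfolding v_def s_def by measurable
  have AElim: "AE x in M. (\<lambda>k. s k x) \<longlonglongrightarrow> v x"
    using AEsum
  proof eventually_elim
    case (elim x)
    then have "summable (\<lambda>k. f k x)" by (rule summable_norm_cancel)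
    then have "(\<lambda>n. s 0 x + (\<Sum>k<n. f k x)) \<longlonglongrightarrow> s 0 x + (\<Sum>k. f k x)"
      by (intro tendsto_intros summable_LIMSEQ)
    then have "convergent (\<lambda>k. s k x)" unfolding s_sum[symmetric] by (auto simp: convergent_def)
    then show ?case by (simp add: v_def convergent_LIMSEQ_iff)
  qed
  have dom: "AE x in M. norm (s n x) \<le> \<bar>s 0 x\<bar> + (\<Sum>k. norm (f k x))" for n
    using AEsum
  proof eventually_elim
    case (elim x)
    have "\<bar>s n x\<bar> \<le> \<bar>s 0 x\<bar> + \<bar>\<Sum>k<n. f k x\<bar>" unfolding s_sum[of n] by (rule abs_triangle_ineq)
    also have "\<bar>\<Sum>k<n. f k x\<bar> \<le> (\<Sum>k<n. norm (f k x))" by (simp add: sum_abs)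
    also have "\<dots> \<le> (\<Sum>k. norm (f k x))" using elim by (intro sum_le_suminf) auto
    finally show ?case by simp
  qed
  have Gi: "integrable M (\<lambda>x. \<bar>s 0 x\<bar> + (\<Sum>k. norm (f k x)))"
    using si[of 0] integrable_suminf[of M "\<lambda>k x. norm (f k x)"] fi AEsum sumI by simp
  show thesis
  proof (rule that[of v])
    show "Lp_fun M p v"
      unfolding Lp_fun_def
    proof (intro conjI vm integrableI_nonneg)
      have "AE x in M. ennreal (\<bar>v x\<bar> powr p) = liminf (\<lambda>k. ennreal (\<bar>s k x\<bar> powr p))"
        using AElim
      proof eventually_elim
        case (elim x)
        have "(\<lambda>k. \<bar>s k x\<bar> powr p) \<longlonglongrightarrow> \<bar>v x\<bar> powr p"
          using p by (intro tendsto_powr' tendsto_intros elim) auto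
        then have "(\<lambda>k. ennreal (\<bar>s k x\<bar> powr p)) \<longlonglongrightarrow> ennreal (\<bar>v x\<bar> powr p)" by (intro tendsto_ennrealI)
        then show ?case by (metis lim_imp_Liminf sequentially_bot)
      qed
      then have "(\<integral>\<^sup>+ x. ennreal (\<bar>v x\<bar> powr p) \<partial>M) = (\<integral>\<^sup>+ x. liminf (\<lambda>k. ennreal (\<bar>s k x\<bar> powr p)) \<partial>M)"
        by (rule nn_integral_cong_AE)
      also have "\<dots> \<le> liminf (\<lambda>k. \<integral>\<^sup>+ x. ennreal (\<bar>s k x\<bar> powr p) \<partial>M)"
        by (intro nn_integral_liminf) (auto simp: s_def)
      also have "\<dots> \<le> ennreal C"
      proof -
        have "(\<integral>\<^sup>+ x. ennreal (\<bar>s k x\<bar> powr p) \<partial>M) \<le> ennreal C" for k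
          using hull_Lp[OF minimiser(1)[of "r k"]]
          by (subst nn_integral_eq_integral) (auto simp: s_def Lp_fun_def intro!: ennreal_leI)
        then have "liminf (\<lambda>k. \<integral>\<^sup>+ x. ennreal (\<bar>s k x\<bar> powr p) \<partial>M) \<le> liminf (\<lambda>k::nat. ennreal C)"
          by (intro Liminf_mono) auto
        then show ?thesis by (simp add: Liminf_const)
      qed
      finally show "(\<integral>\<^sup>+ x. ennreal (norm (v x) powr p) \<partial>M) < \<infinity>"
        by (simp add: order_le_less_trans)
    qed auto
    fix b B L assume b: "b \<in> borel_measurable M" "\<And>x. x \<in> space M \<Longrightarrow> \<bar>b x\<bar> \<le> B"
      and L: "(\<lambda>j. LINT x|M. u j x * b x) \<longlonglongrightarrow> L"
    note [measurable] = b(1)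
    have "(\<lambda>k. LINT x|M. s k x * b x) \<longlonglongrightarrow> (LINT x|M. v x * b x)"
    proof (rule integral_dominated_convergence[where w="\<lambda>x. (\<bar>s 0 x\<bar> + (\<Sum>k. norm (f k x))) * \<bar>B\<bar>"])
      show "integrable M (\<lambda>x. (\<bar>s 0 x\<bar> + (\<Sum>k. norm (f k x))) * \<bar>B\<bar>)" using Gi by simp
      show "AE x in M. (\<lambda>k. s k x * b x) \<longlonglongrightarrow> v x * b x"
        using AElim by eventually_elim (intro tendsto_intros)
      show "AE x in M. norm (s k x * b x) \<le> (\<bar>s 0 x\<bar> + (\<Sum>k. norm (f k x))) * \<bar>B\<bar>" for k
        using dom[of k] AE_space
      proof eventually_elim
        case (elim x)
        have "\<bar>b x\<bar> \<le> \<bar>B\<bar>" using b(2)[OF elim(2)] by linarith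
        then have "norm (s k x) * \<bar>b x\<bar> \<le> (\<bar>s 0 x\<bar> + (\<Sum>k. norm (f k x))) * \<bar>B\<bar>"
          using elim(1) by (intro mult_mono) (auto intro: order.trans[OF norm_ge_zero])
        then show ?case by (simp add: abs_mult)
      qed
    qed (auto simp: s_def)
    moreover have "(\<lambda>k. LINT x|M. s k x * b x) \<longlonglongrightarrow> L"
    proof (rule LIMSEQ_I)
      fix e :: real assume "e > 0"
      then obtain j0 where j0: "\<And>j. j \<ge> j0 \<Longrightarrow> norm ((LINT x|M. u j x * b x) - L) < e / 2"
        using LIMSEQ_D[OF L, of "e/2"] by auto
      have "norm ((LINT x|M. s k x * b x) - L) < e" if "k \<ge> j0" for k
      proof -
        have "\<bar>(LINT x|M. s k x * b x) - L\<bar> \<le> e / 2"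
        proof (rule hull_functional[OF b])
          show "\<bar>(LINT x|M. u j x * b x) - L\<bar> \<le> e / 2" if "j \<ge> r k" for j
            using j0[of j] that r_k[of k] \<open>k \<ge> j0\<close> by auto
          show "midhull u (r k) (s k)" unfolding s_def by (rule minimiser)
        qed
        then show ?thesis using \<open>e > 0\<close> by simp
      qed
      then show "\<exists>no. \<forall>k\<ge>no. norm ((LINT x|M. s k x * b x) - L) < e" by blast
    qed
    ultimately show "(LINT x|M. v x * b x) = L" by (rule LIMSEQ_unique)
  qed
qed

end

subsection \<open>Functions of a slow and a fast variable\<close>

text \<open>Rests on completeness of Lebesgue measure. It supplies measurability for functions known
  only up to null sets, such as integrals over slices of a given field.\<close>

lemma borel_measurable_lebesgue_cong_AE:
  fixes f g :: "'a::euclidean_space \<Rightarrow> 'b::topological_space"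
  assumes g: "g \<in> borel_measurable lebesgue" and ae: "AE x in lebesgue. f x = g x"
  shows "f \<in> borel_measurable lebesgue"
proof (rule measurableI)
  fix A :: "'b set" assume "A \<in> sets borel"
  then have 1: "g -` A \<inter> space lebesgue \<in> sets lebesgue" using g by (rule measurable_sets[rotated])
  have 2: "AE x in lebesgue. x \<in> g -` A \<inter> space lebesgue \<longleftrightarrow> x \<in> f -` A \<inter> space lebesgue"
    using ae by eventually_elim auto
  show "f -` A \<inter> space lebesgue \<in> sets lebesgue"
    by (rule completion.in_sets_AE[OF 2 1]) simp
qed simp

lemma borel_measurable_lebesgue_on_cong_AE:
  fixes f g :: "'a::euclidean_space \<Rightarrow> 'b::real_normed_vector"
  assumes S: "S \<in> sets lebesgue" and g: "g \<in> borel_measurable (lebesgue_on S)"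
    and ae: "AE x in lebesgue_on S. f x = g x"
  shows "f \<in> borel_measurable (lebesgue_on S)"
proof -
  have "(\<lambda>x. indicator S x *\<^sub>R f x) \<in> borel_measurable lebesgue"
  proof (rule borel_measurable_lebesgue_cong_AE)
    show "(\<lambda>x. indicator S x *\<^sub>R g x) \<in> borel_measurable lebesgue"
      using g S by (subst (asm) borel_measurable_restrict_space_iff) auto
    show "AE x in lebesgue. indicator S x *\<^sub>R f x = indicator S x *\<^sub>R g x"
      using ae S by (subst (asm) AE_restrict_space_iff) (auto simp: indicator_def elim: eventually_mono)
  qed
  then show ?thesis using S by (subst borel_measurable_restrict_space_iff) auto
qed

lemma AE_lborel_imp_lebesgue_on:
  assumes "AE x in lborel. P x" "S \<in> sets lebesgue"
  shows "AE x in lebesgue_on S. P x"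
  using AE_completion[OF assms(1)] assms(2)
  by (subst AE_restrict_space_iff) (auto elim: eventually_mono)

lemma borel_measurable_vecI:
  fixes f :: "'a \<Rightarrow> real^'n"
  assumes "\<And>i. (\<lambda>x. f x $ i) \<in> borel_measurable M"
  shows "f \<in> borel_measurable M"
  using assms by (subst borel_measurable_euclidean_space) (auto simp: Basis_vec_def inner_axis)

lemma borel_measurable_vec_nth:
  fixes f :: "'a \<Rightarrow> real^'n"
  assumes "f \<in> borel_measurable M"
  shows "(\<lambda>x. f x $ i) \<in> borel_measurable M"
  using borel_measurable_inner[OF assms borel_measurable_const[of "axis i 1"]] by (simp add: inner_axis)

lemma ex_borel_representative_vec:
  fixes f :: "'a::euclidean_space \<Rightarrow> real^'n"
  assumes "f \<in> borel_measurable lebesgue"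
  obtains g where "g \<in> borel_measurable borel" "AE x in lborel. f x = g x"
proof -
  have "\<exists>g'\<in>borel_measurable lborel. (AE x in lborel. f x $ i = g' x)" for i
    by (rule completion_ex_borel_measurable_real[OF borel_measurable_vec_nth[OF assms]])
  then obtain g' where g': "\<And>i. g' i \<in> borel_measurable lborel" "\<And>i. AE x in lborel. f x $ i = g' i x" by metis
  have "(\<lambda>x. \<chi> i. g' i x) \<in> borel_measurable borel"
    by (rule borel_measurable_vecI) (use g'(1) in simp)
  moreover have "AE x in lborel. \<forall>i. f x $ i = g' i x"
    using g'(2) by (subst AE_all_countable) auto
  then have "AE x in lborel. f x = (\<chi> i. g' i x)" by eventually_elim (simp add: vec_eq_iff)
  ultimately show thesis by (rule that)
qed

lemma borel_measurable_pairI: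
  fixes w :: "'a::euclidean_space \<times> 'b::euclidean_space \<Rightarrow> 'c::topological_space"
  assumes "w \<in> borel_measurable borel" "f \<in> borel_measurable M" "g \<in> borel_measurable M"
  shows "(\<lambda>x. w (f x, g x)) \<in> borel_measurable M"
proof -
  have "(\<lambda>x. (f x, g x)) \<in> M \<rightarrow>\<^sub>M borel" using assms(2,3) by (rule borel_measurable_Pair)
  from measurable_compose[OF this assms(1)] show ?thesis .
qed

locale oscillation_Lp = oscillation \<Omega> R eps
  for \<Omega> :: "(real^'n) set" and R :: "real^'n^'m" and eps :: "nat \<Rightarrow> real" +
  fixes p :: real
  assumes p: "p > 1"
begin

abbreviation (input) q :: real where "q \<equiv> p / (p - 1)"

abbreviation (input) S :: "((real^'n) \<times> (real^'m)) set" where "S \<equiv> \<Omega> \<times> unit_cell"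

lemma p0: "p \<ge> 0" "p > 0" "p \<ge> 1" and q0: "q > 0" "q \<ge> 0"
  using p by auto

lemma S_borel: "S \<in> sets borel" and S_lebesgue: "S \<in> sets lebesgue" and \<Omega>_lebesgue: "\<Omega> \<in> sets lebesgue"
  using \<Omega> by (auto intro!: borel_Times sets_completionI_sets simp: borel_open)

text \<open>All slices of a Borel function are Borel, whereas a Lebesgue measurable field may have
  non-measurable slices over a null set of \<open>x\<close>. Extension by zero makes the iterated
  integrals with respect to \<open>lborel\<close> directly available.\<close>

definition product_Lp :: "((real^'n) \<times> (real^'m) \<Rightarrow> real^'n) \<Rightarrow> bool" where
  "product_Lp w \<longleftrightarrow> w \<in> borel_measurable borel \<and> (\<forall>z. z \<notin> S \<longrightarrow> w z = 0) \<and> integrable lborel (\<lambda>z. norm (w z) powr p)"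

lemma product_Lp_representative:
  assumes V: "Lp_fun (lebesgue_on S) p (\<lambda>z. V (fst z) (snd z))"
  obtains w where "product_Lp w" "AE z in lebesgue_on S. V (fst z) (snd z) = w z"
    "AE x in MO. AE y in lebesgue_on unit_cell. V x y = w (x, y)"
proof -
  let ?V = "\<lambda>z. indicator S z *\<^sub>R V (fst z) (snd z)"
  have "?V \<in> borel_measurable lebesgue"
    using Lp_fun_measurable[OF V] S_lebesgue by (subst (asm) borel_measurable_restrict_space_iff) auto
  then obtain g where g: "g \<in> borel_measurable borel" "AE z in lborel. ?V z = g z"
    by (rule ex_borel_representative_vec)
  define w where "w z = indicator S z *\<^sub>R g z" for z
  have wm: "w \<in> borel_measurable borel" unfolding w_def using g(1) S_borel by measurable
  have ae: "AE z in lborel. z \<in> S \<longrightarrow> V (fst z) (snd z) = w z"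
    using g(2) by eventually_elim (auto simp: w_def)
  have aeS: "AE z in lebesgue_on S. V (fst z) (snd z) = w z"
    using AE_completion[OF ae] S_lebesgue by (subst AE_restrict_space_iff) auto
  have nm: "(\<lambda>z. norm (w z) powr p) \<in> borel_measurable borel" using wm by measurable
  have "integrable (lebesgue_on S) (\<lambda>z. norm (w z) powr p)"
  proof (rule integrable_cong_AE_imp[OF Lp_fun_integrable[OF V]])
    show "(\<lambda>z. norm (w z) powr p) \<in> borel_measurable (lebesgue_on S)" by (rule borel_measurable_lebesgue_onI[OF nm])
    show "AE z in lebesgue_on S. norm (V (fst z) (snd z)) powr p = norm (w z) powr p"
      using aeS by eventually_elim simp
  qed
  then have "integrable lborel (\<lambda>z. norm (w z) powr p)"
    using integrable_lebesgue_on_iff_lborel[OF nm S_lebesgue] by (simp add: w_def)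
  then have "product_Lp w" using wm by (auto simp: product_Lp_def w_def)
  moreover have "AE x in lborel. AE y in lborel. (x, y) \<in> S \<longrightarrow> V x y = w (x, y)"
  proof -
    have "AE z in lborel \<Otimes>\<^sub>M lborel. z \<in> S \<longrightarrow> V (fst z) (snd z) = w z" unfolding lborel_prod by (rule ae)
    from lborel_pair.AE_pair[OF this] show ?thesis by simp
  qed
  then have "AE x in MO. AE y in lborel. (x, y) \<in> S \<longrightarrow> V x y = w (x, y)"
    by (intro AE_lborel_imp_lebesgue_on \<Omega>_lebesgue)
  then have "AE x in MO. AE y in lebesgue_on unit_cell. V x y = w (x, y)"
    using AE_space
  proof eventually_elim
    case (elim x)
    from AE_completion[OF elim(1)] elim(2) show ?case
      by (subst AE_restrict_space_iff) auto
  qed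
  ultimately show thesis using aeS that by blast
qed

lemma integral_lborel_supported_cell:
  fixes f :: "real^'m \<Rightarrow> 'b::{banach, second_countable_topology}"
  assumes "\<And>y. y \<notin> unit_cell \<Longrightarrow> f y = 0"
  shows "integral\<^sup>L cell_measure f = integral\<^sup>L lborel f" "integrable cell_measure f \<longleftrightarrow> integrable lborel f"
proof -
  have e: "(\<lambda>x. indicator unit_cell x *\<^sub>R f x) = f"
  proof
    show "indicator unit_cell x *\<^sub>R f x = f x" for x by (cases "x \<in> unit_cell") (simp_all add: assms)
  qed
  show "integral\<^sup>L cell_measure f = integral\<^sup>L lborel f"
    by (subst integral_restrict_space) (auto simp: e)
  show "integrable cell_measure f \<longleftrightarrow> integrable lborel f"
    by (subst integrable_restrict_space) (auto simp: e)
qed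

lemma product_Fubini:
  fixes F :: "(real^'n) \<times> (real^'m) \<Rightarrow> real"
  assumes F: "F \<in> borel_measurable borel" "\<And>z. z \<notin> S \<Longrightarrow> F z = 0" "integrable lborel F"
  shows "integrable MO (\<lambda>x. LINT y|cell_measure. F (x, y))"
    and "(LINT x|MO. LINT y|cell_measure. F (x, y)) = (LINT z|lborel. F z)"
    and "AE x in MO. integrable cell_measure (\<lambda>y. F (x, y))"
proof -
  have Fi: "integrable (lborel \<Otimes>\<^sub>M lborel) F" using F(3) by (simp add: lborel_prod)
  note 1 = lborel_pair.integrable_fst'[OF Fi] and 2 = lborel_pair.integral_fst'[OF Fi] and 3 = lborel_pair.AE_integrable_fst'[OF Fi]
  have c: "(LINT y|cell_measure. F (x, y)) = (LINT y|lborel. F (x, y))" "integrable cell_measure (\<lambda>y. F (x, y)) \<longleftrightarrow> integrable lborel (\<lambda>y. F (x, y))" for x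
    by (intro integral_lborel_supported_cell; simp add: F(2))+
  have m: "(\<lambda>x. LINT y|lborel. F (x, y)) \<in> borel_measurable borel" using borel_measurable_integrable[OF 1] by simp
  have z: "x \<notin> \<Omega> \<Longrightarrow> (LINT y|lborel. F (x, y)) = 0" for x using F(2) by simp
  show "integrable MO (\<lambda>x. LINT y|cell_measure. F (x, y))"
    unfolding c using 1 by (subst integrable_lebesgue_on_iff_lborel[OF m \<Omega>_lebesgue z]) auto
  show "(LINT x|MO. LINT y|cell_measure. F (x, y)) = (LINT z|lborel. F z)"
    unfolding c using 2 by (subst integral_lebesgue_on_eq_lborel[OF m \<Omega>_lebesgue z]) (auto simp: lborel_prod)
  show "AE x in MO. integrable cell_measure (\<lambda>y. F (x, y))"
    unfolding c by (rule AE_lborel_imp_lebesgue_on[OF 3 \<Omega>_lebesgue])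
qed

text \<open>The kernel \<open>peak_kernel 0\<close> is constantly one, so convolution with it is the
  mean over the cell and the inequality is a special case of the one for convolutions.\<close>

lemma cell_Jensen:
  assumes f: "Lp_fun cell_measure p f"
  shows "\<bar>LINT y|cell_measure. f y\<bar> powr p \<le> (LINT y|cell_measure. \<bar>f y\<bar> powr p)"
proof -
  have "peak_kernel 0 u = 1" for u :: "real^'a" by (simp add: peak_kernel_def)
  then show ?thesis using cell_conv_Jensen[OF p f, of 0 0] by (simp add: cell_conv_def)
qed

context
  fixes w assumes w: "product_Lp w"
begin

lemma w_facts:
  shows w_meas: "w \<in> borel_measurable borel" and w_supp: "\<And>z. z \<notin> S \<Longrightarrow> w z = 0"
    and w_int: "integrable lborel (\<lambda>z. norm (w z) powr p)"
  using w by (auto simp: product_Lp_def)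

lemma w_slice_measurable: "(\<lambda>y. w (x, y)) \<in> borel_measurable cell_measure"
  by (rule borel_measurable_pairI[OF w_meas]) (auto intro: cell_measurableI)

lemma w_slice_Lp: "AE x in MO. Lp_fun cell_measure p (\<lambda>y. w (x, y))"
proof -
  have "AE x in MO. integrable cell_measure (\<lambda>y. norm (w (x, y)) powr p)"
    by (rule product_Fubini(3)[where F="\<lambda>z. norm (w z) powr p"]) (use w_facts in auto)
  then show ?thesis by eventually_elim (simp add: Lp_fun_def w_slice_measurable)
qed

lemma w_slice_integrable:
  "integrable MO (\<lambda>x. LINT y|cell_measure. norm (w (x, y)) powr p)"
  by (rule product_Fubini(1)[where F="\<lambda>z. norm (w z) powr p"]) (use w_facts in auto)

lemma w_joint_measurable: "(\<lambda>z. w (fst z, snd z)) \<in> borel_measurable (MO \<Otimes>\<^sub>M cell_measure)"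
proof (rule borel_measurable_pairI[OF w_meas])
  show "fst \<in> borel_measurable (MO \<Otimes>\<^sub>M cell_measure)"
    by (rule measurable_compose[OF measurable_fst]) (auto intro: borel_measurable_lebesgue_onI)
  show "snd \<in> borel_measurable (MO \<Otimes>\<^sub>M cell_measure)"
    by (rule measurable_compose[OF measurable_snd]) (auto intro: cell_measurableI)
qed

lemma inner_integral_measurable:
  fixes F :: "real^'n \<Rightarrow> real^'m \<Rightarrow> real"
  assumes "(\<lambda>z. F (fst z) (snd z)) \<in> borel_measurable (MO \<Otimes>\<^sub>M cell_measure)"
  shows "(\<lambda>x. LINT y|cell_measure. F x y) \<in> borel_measurable MO"
proof (rule sigma_finite_measure.borel_measurable_lebesgue_integral)
  show "sigma_finite_measure (cell_measure :: (real^'m) measure)"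
    by (rule finite_measure.axioms(1)[OF finite_measure_cell])
qed (use assms in \<open>simp add: case_prod_beta\<close>)

text \<open>Jensen's inequality in \<open>y\<close> bounds the p-th power of the moment by the
  integral of \<open>norm (w (x, y)) powr p\<close>, which is integrable in
  \<open>x\<close>.\<close>

lemma w_moment_Lp:
  fixes f :: "real^'m \<Rightarrow> real"
  assumes f: "f \<in> borel_measurable borel" "\<And>y. \<bar>f y\<bar> \<le> 1"
  shows "Lp_fun MO p (\<lambda>x. LINT y|cell_measure. f y * w (x, y) $ i)"
  unfolding Lp_fun_def
proof
  show m: "(\<lambda>x. LINT y|cell_measure. f y * w (x, y) $ i) \<in> borel_measurable MO"
    by (rule inner_integral_measurable)
       (intro borel_measurable_times borel_measurable_vec_nth[OF w_joint_measurable]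
         measurable_compose[OF measurable_snd] cell_measurableI f)
  show "integrable MO (\<lambda>x. norm (LINT y|cell_measure. f y * w (x, y) $ i) powr p)"
  proof (rule Bochner_Integration.integrable_bound[OF w_slice_integrable])
    show "(\<lambda>x. norm (LINT y|cell_measure. f y * w (x, y) $ i) powr p) \<in> borel_measurable MO"
      using m by measurable
    show "AE x in MO. norm (norm (LINT y|cell_measure. f y * w (x, y) $ i) powr p) \<le> norm (LINT y|cell_measure. norm (w (x, y)) powr p)"
      using w_slice_Lp
    proof eventually_elim
      case (elim x)
      have le: "\<bar>f y * w (x, y) $ i\<bar> \<le> norm (w (x, y))" for y
        using mult_mono[OF f(2)[of y] component_le_norm_cart[of "w (x, y)" i]] by (simp add: abs_mult)
      have L: "Lp_fun cell_measure p (\<lambda>y. f y * w (x, y) $ i)"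
      proof (rule Lp_fun_mono[OF elim])
        show "(\<lambda>y. f y * w (x, y) $ i) \<in> borel_measurable cell_measure"
          by (intro borel_measurable_times borel_measurable_vec_nth[OF w_slice_measurable] cell_measurableI f)
        show "AE y in cell_measure. norm (f y * w (x, y) $ i) \<le> norm (w (x, y))"
          using le by (intro AE_I2) simp
      qed (rule p0)
      have "\<bar>LINT y|cell_measure. f y * w (x, y) $ i\<bar> powr p \<le> (LINT y|cell_measure. \<bar>f y * w (x, y) $ i\<bar> powr p)"
        by (rule cell_Jensen[OF L])
      also have "\<dots> \<le> (LINT y|cell_measure. norm (w (x, y)) powr p)"
        using Lp_fun_integrable[OF L] Lp_fun_integrable[OF elim] le p0
        by (intro integral_mono powr_mono2) auto
      finally show ?case by simp
    qed
  qed
qed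

text \<open>Two-scale convergence is defined with Lebesgue integrals of the given field, which
  equals \<open>w\<close> on almost every slice almost everywhere; completeness provides the
  measurability needed to replace it in both integrals.\<close>

lemma two_scale_limit_representative:
  fixes \<Phi> :: "real^'n \<Rightarrow> real^'m \<Rightarrow> real^'n"
  assumes V: "AE x in MO. AE y in lebesgue_on unit_cell. V x y = w (x, y)"
    and \<Phi>: "(\<lambda>z. \<Phi> (fst z) (snd z)) \<in> borel_measurable (MO \<Otimes>\<^sub>M cell_measure)"
      "\<And>x. x \<in> \<Omega> \<Longrightarrow> \<Phi> x \<in> borel_measurable cell_measure"
  shows "(LINT x|MO. LINT y|lebesgue_on unit_cell. V x y \<bullet> \<Phi> x y) = (LINT x|MO. LINT y|cell_measure. w (x, y) \<bullet> \<Phi> x y)"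
proof -
  have ae: "AE x in MO. (LINT y|lebesgue_on unit_cell. V x y \<bullet> \<Phi> x y) = (LINT y|cell_measure. w (x, y) \<bullet> \<Phi> x y)"
    using V AE_space
  proof eventually_elim
    case (elim x)
    have m: "(\<lambda>y. w (x, y) \<bullet> \<Phi> x y) \<in> borel_measurable cell_measure"
      using \<Phi>(2)[of x] elim(2) by (intro borel_measurable_inner w_slice_measurable) auto
    have m': "(\<lambda>y. w (x, y) \<bullet> \<Phi> x y) \<in> borel_measurable (lebesgue_on unit_cell)"
      using m unfolding borel_measurable_restrict_space_iff[of unit_cell lborel, simplified]
      by (subst borel_measurable_restrict_space_iff) (auto intro: measurable_completion)
    have eq: "AE y in lebesgue_on unit_cell. V x y \<bullet> \<Phi> x y = w (x, y) \<bullet> \<Phi> x y"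
      using elim(1) by eventually_elim simp
    have "(LINT y|lebesgue_on unit_cell. V x y \<bullet> \<Phi> x y) = (LINT y|lebesgue_on unit_cell. w (x, y) \<bullet> \<Phi> x y)"
      by (rule integral_cong_AE[OF borel_measurable_lebesgue_on_cong_AE[OF _ m' eq] m' eq]) auto
    then show ?case by (simp add: integral_lebesgue_on_cell[OF m])
  qed
  have m: "(\<lambda>x. LINT y|cell_measure. w (x, y) \<bullet> \<Phi> x y) \<in> borel_measurable MO"
    by (rule inner_integral_measurable) (intro borel_measurable_inner w_joint_measurable \<Phi>(1))
  show ?thesis
    by (rule integral_cong_AE[OF borel_measurable_lebesgue_on_cong_AE[OF \<Omega>_lebesgue m ae] m ae])
qed

end

lemma fast_eq: "(1 / eps j) *\<^sub>R (R *v x) = fast j x"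
  by (simp add: fast_def)

lemma two_scale_test_measurable:
  fixes \<phi> :: "real^'n \<Rightarrow> ((real^'m) \<Rightarrow>\<^sub>C (real^'n))"
  assumes \<phi>: "two_scale_test \<Omega> q' \<phi>"
  shows "(\<lambda>x. apply_bcontfun (\<phi> x) y) \<in> borel_measurable MO"
    and "(\<lambda>z. apply_bcontfun (\<phi> (fst z)) (snd z)) \<in> borel_measurable (MO \<Otimes>\<^sub>M cell_measure)"
    and "apply_bcontfun (\<phi> x) \<in> borel_measurable cell_measure"
proof -
  have \<phi>m: "\<phi> \<in> borel_measurable MO" using \<phi> by (simp add: two_scale_test_def Lp_fun_def)
  show 1: "(\<lambda>x. apply_bcontfun (\<phi> x) y) \<in> borel_measurable MO" for y
  proof (rule measurable_compose[OF \<phi>m])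
    \<comment> \<open>Evaluation at a point does not increase distances in the supremum norm, so
      measurability of \<open>\<phi>\<close> as a map into the function space gives measurable
      sections.\<close>
    have "continuous_on UNIV (\<lambda>h :: (real^'m) \<Rightarrow>\<^sub>C (real^'n). apply_bcontfun h y)"
    proof (rule continuous_on_iff[THEN iffD2], intro ballI allI impI)
      fix h :: "(real^'m) \<Rightarrow>\<^sub>C (real^'n)" and e :: real assume "e > 0"
      then show "\<exists>d>0. \<forall>h'\<in>UNIV. dist h' h < d \<longrightarrow> dist (apply_bcontfun h' y) (apply_bcontfun h y) < e"
        by (intro exI[of _ e]) (auto intro: order.strict_trans1[OF dist_bounded])
    qed
    then show "(\<lambda>h :: (real^'m) \<Rightarrow>\<^sub>C (real^'n). apply_bcontfun h y) \<in> borel_measurable borel"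
      by (rule borel_measurable_continuous_onI)
  qed
  have cont: "continuous_on UNIV (apply_bcontfun (\<phi> x))" for x
    using apply_bcontfun[of "\<phi> x"] by (simp add: bcontfun_def)
  show "(\<lambda>z. apply_bcontfun (\<phi> (fst z)) (snd z)) \<in> borel_measurable (MO \<Otimes>\<^sub>M cell_measure)"
  proof (rule Caratheodory_measurable[where F="\<lambda>z. apply_bcontfun (\<phi> (fst z))" and g=snd])
    show "(\<lambda>z. apply_bcontfun (\<phi> (fst z)) v) \<in> borel_measurable (MO \<Otimes>\<^sub>M cell_measure)" for v
      by (rule measurable_compose[OF measurable_fst 1])
    show "snd \<in> borel_measurable (MO \<Otimes>\<^sub>M cell_measure)"
      by (rule measurable_compose[OF measurable_snd]) (auto intro: cell_measurableI)
  qed (rule cont)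
  show "apply_bcontfun (\<phi> x) \<in> borel_measurable cell_measure"
    by (intro cell_measurableI borel_measurable_continuous_onI cont)
qed

lemma R_two_scale_conv_representative:
  assumes w: "product_Lp w" and V: "AE x in MO. AE y in lebesgue_on unit_cell. V x y = w (x, y)"
  shows "R_two_scale_conv \<Omega> p R eps g V \<longleftrightarrow>
    (\<forall>\<phi>. two_scale_test \<Omega> q \<phi> \<longrightarrow>
       (\<lambda>j. LINT x|MO. g j x \<bullet> apply_bcontfun (\<phi> x) (fast j x)) \<longlonglongrightarrow>
       (LINT x|MO. LINT y|cell_measure. w (x, y) \<bullet> apply_bcontfun (\<phi> x) y))"
proof -
  have "(LINT x|MO. LINT y|lebesgue_on unit_cell. V x y \<bullet> apply_bcontfun (\<phi> x) y) =
      (LINT x|MO. LINT y|cell_measure. w (x, y) \<bullet> apply_bcontfun (\<phi> x) y)" if "two_scale_test \<Omega> q \<phi>" for \<phi>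
    by (rule two_scale_limit_representative[OF w V two_scale_test_measurable(2)[OF that] two_scale_test_measurable(3)[OF that]])
  then show ?thesis unfolding R_two_scale_conv_def fast_eq by (simp only: simp_thms cong: imp_cong)
qed

end

subsection \<open>Two-scale limits of gradients\<close>

lemma Lp_fun_sum:
  fixes f :: "'i \<Rightarrow> 'a \<Rightarrow> real"
  assumes "finite I" "\<And>i. i \<in> I \<Longrightarrow> Lp_fun M p (f i)" "p > 0"
  shows "Lp_fun M p (\<lambda>x. \<Sum>i\<in>I. f i x)"
  using assms(1,2)
proof (induction I rule: finite_induct)
  case empty
  then show ?case using assms(3) by (simp add: Lp_fun_def)
next
  case (insert i I)
  then show ?case using Lp_fun_add[of M p "f i" "\<lambda>x. \<Sum>i\<in>I. f i x"] assms(3) by simp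
qed

lemma Lp_fun_vecI:
  fixes f :: "'a \<Rightarrow> real^'n"
  assumes "\<And>i. Lp_fun M p (\<lambda>x. f x $ i)" "p > 0"
  shows "Lp_fun M p f"
proof (rule Lp_fun_mono[where f="\<lambda>x. \<Sum>i\<in>UNIV. \<bar>f x $ i\<bar>"])
  have "Lp_fun M p (\<lambda>x. \<bar>f x $ i\<bar>)" for i
    using assms(1)[of i] by (auto simp: Lp_fun_def intro: borel_measurable_abs)
  then show "Lp_fun M p (\<lambda>x. \<Sum>i\<in>UNIV. \<bar>f x $ i\<bar>)"
    using assms(2) by (intro Lp_fun_sum) auto
  show "f \<in> borel_measurable M" by (intro borel_measurable_vecI Lp_fun_measurable[OF assms(1)])
  show "AE x in M. norm (f x) \<le> norm (\<Sum>i\<in>UNIV. \<bar>f x $ i\<bar>)"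
    using norm_le_l1_cart by (intro AE_I2) (auto simp: sum_nonneg)
qed (use assms in simp)

lemma Lp_fun_vec_nth:
  fixes f :: "'a \<Rightarrow> real^'n"
  assumes "Lp_fun M p f" "p \<ge> 0"
  shows "Lp_fun M p (\<lambda>x. f x $ i)"
proof (rule Lp_fun_mono[OF assms(1)])
  show "(\<lambda>x. f x $ i) \<in> borel_measurable M"
    by (rule borel_measurable_vec_nth[OF Lp_fun_measurable[OF assms(1)]])
  show "AE x in M. norm (f x $ i) \<le> norm (f x)"
    using component_le_norm_cart by (intro AE_I2) auto
qed (rule assms)

lemma fourier_coeff_eq:
  fixes h :: "real^'m \<Rightarrow> real^'n"
  assumes h: "\<And>i. integrable cell_measure (\<lambda>y. h y $ i)"
  shows "fourier_coeff h k = (\<chi> i. Complex (fcos (\<lambda>y. h y $ i) k) (- fsin (\<lambda>y. h y $ i) k))"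
proof (rule vec_eq_iff[THEN iffD2], rule allI)
  fix i
  let ?f = "\<lambda>y. complex_of_real (h y $ i) * exp (- (2 * pi * \<i>) * complex_of_real (k \<bullet> y))"
  have eq: "?f y = complex_of_real (cos (2 * pi * (k \<bullet> y)) * h y $ i) - \<i> * complex_of_real (sin (2 * pi * (k \<bullet> y)) * h y $ i)" for y
  proof -
    have "exp (- (2 * pi * \<i>) * complex_of_real (k \<bullet> y)) = cis (- (2 * pi * (k \<bullet> y)))"
      unfolding cis_conv_exp by (simp add: mult_ac)
    then show ?thesis by (simp add: complex_eq_iff)
  qed
  note I = integrable_cos_sin_mult[OF h[of i], of k]
  have m: "?f \<in> borel_measurable cell_measure"
    unfolding eq using borel_measurable_integrable[OF I(1)] borel_measurable_integrable[OF I(2)] by measurable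
  have "fourier_coeff h k $ i = (LINT y|cell_measure. ?f y)"
    unfolding fourier_coeff_def vec_lambda_beta by (rule integral_lebesgue_on_cell[OF m])
  also have "\<dots> = complex_of_real (fcos (\<lambda>y. h y $ i) k) - \<i> * complex_of_real (fsin (\<lambda>y. h y $ i) k)"
  proof -
    have "(LINT y|M. complex_of_real (a y) - \<i> * complex_of_real (b y)) = complex_of_real (LINT y|M. a y) - \<i> * complex_of_real (LINT y|M. b y)"
      if "integrable M a" "integrable M b" for a b and M :: "(real^'m) measure"
      using that by simp
    from this[OF I] show ?thesis unfolding eq fcos_def fsin_def .
  qed
  finally show "fourier_coeff h k $ i = (\<chi> i. Complex (fcos (\<lambda>y. h y $ i) k) (- fsin (\<lambda>y. h y $ i) k)) $ i"
    by (simp add: complex_eq_iff)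
qed

text \<open>Composition with it replaces a function by the periodic extension of its restriction to
  the cell.\<close>

definition frac_vec :: "real^'m \<Rightarrow> real^'m" where
  "frac_vec y = (\<chi> i. frac (y $ i))"

lemma frac_vec_unit_cell: "y \<in> unit_cell \<Longrightarrow> frac_vec y = y"
  by (auto simp: frac_vec_def unit_cell_def vec_eq_iff frac_eq)

lemma frac_vec_measurable: "frac_vec \<in> borel_measurable borel"
proof (rule borel_measurable_vecI)
  have "(\<lambda>y::real^'a. y $ i) \<in> borel_measurable borel" for i by (rule borel_measurable_vec_nth) simp
  then show "(\<lambda>y. frac_vec y $ i) \<in> borel_measurable borel" for i
    unfolding frac_vec_def frac_def by simp
qed

lemma frac_vec_periodic: "int_vec k \<Longrightarrow> frac_vec (y + k) = frac_vec y"
  unfolding frac_vec_def int_vec_def frac_def by (auto simp: vec_eq_iff elim!: Ints_cases allE)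

lemma integral_norm_le_powr:
  fixes f :: "'a \<Rightarrow> 'b::euclidean_space"
  assumes "finite_measure M" "Lp_fun M p f" "p \<ge> 1"
  shows "(LINT x|M. norm (f x)) \<le> measure M (space M) + (LINT x|M. norm (f x) powr p)"
proof -
  interpret finite_measure M by fact
  have "(LINT x|M. norm (f x)) \<le> (LINT x|M. 1 + norm (f x) powr p)"
  proof (rule integral_mono)
    show "integrable M (\<lambda>x. norm (f x))" using Lp_fun_imp_integrable[OF assms] by simp
    show "integrable M (\<lambda>x. 1 + norm (f x) powr p)" using Lp_fun_integrable[OF assms(2)] by simp
    show "norm (f x) \<le> 1 + norm (f x) powr p" for x
    proof (cases "norm (f x) \<le> 1")
      case False
      then have "norm (f x) powr 1 \<le> norm (f x) powr p" using assms by (intro powr_mono) auto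
      then show ?thesis using False by simp
    qed (auto intro: order.trans[where b=1])
  qed
  then show ?thesis using Lp_fun_integrable[OF assms(2)] by simp
qed

context oscillation_Lp
begin

lemma test_fun_measurable_MO:
  assumes "test_fun \<Omega> \<psi>"
  shows "\<psi> \<in> borel_measurable MO"
  using assms borel_measurable_lebesgue_onI smooth_fun_measurable test_funD(1) by blast

lemma integrable_mult_bounded:
  fixes f b :: "real^'n \<Rightarrow> real"
  assumes "integrable MO f" "b \<in> borel_measurable MO" "\<And>x. \<bar>b x\<bar> \<le> B"
  shows "integrable MO (\<lambda>x. f x * b x)" "\<bar>LINT x|MO. f x * b x\<bar> \<le> B * (LINT x|MO. \<bar>f x\<bar>)"
proof -
  have le: "\<bar>f x * b x\<bar> \<le> B * \<bar>f x\<bar>" for x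
    using mult_left_mono[OF assms(3)[of x] abs_ge_zero[of "f x"]] by (simp add: abs_mult mult.commute)
  have "B \<ge> 0" using assms(3)[of 0] by linarith
  show i: "integrable MO (\<lambda>x. f x * b x)"
    by (rule Bochner_Integration.integrable_bound[where f="\<lambda>x. B * f x"])
       (use assms le \<open>B \<ge> 0\<close> in \<open>auto simp: abs_mult[of B]\<close>)
  have "\<bar>LINT x|MO. f x * b x\<bar> \<le> (LINT x|MO. \<bar>f x * b x\<bar>)" by (rule integral_abs_bound)
  also have "\<dots> \<le> (LINT x|MO. B * \<bar>f x\<bar>)"
    by (rule integral_mono[OF integrable_abs[OF i]]) (use assms(1) le in auto)
  finally show "\<bar>LINT x|MO. f x * b x\<bar> \<le> B * (LINT x|MO. \<bar>f x\<bar>)" by simp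
qed

lemma locally_integrable_onI:
  fixes f :: "real^'n \<Rightarrow> 'b::{banach, second_countable_topology}"
  assumes "integrable MO f"
  shows "locally_integrable_on \<Omega> f"
  unfolding locally_integrable_on_def
proof (intro allI impI)
  fix K assume K: "compact K \<and> K \<subseteq> \<Omega>"
  have "K \<in> sets lebesgue" using K by (auto intro: lmeasurable_compact fmeasurableD)
  moreover have "integrable lebesgue (\<lambda>x. indicator \<Omega> x *\<^sub>R f x)"
    using assms \<Omega>_lebesgue by (subst (asm) integrable_restrict_space) auto
  ultimately have "integrable lebesgue (\<lambda>x. indicator K x *\<^sub>R (indicator \<Omega> x *\<^sub>R f x))"
    by (rule integrable_mult_indicator)
  moreover have "(\<lambda>x. indicator K x *\<^sub>R (indicator \<Omega> x *\<^sub>R f x)) = (\<lambda>x. indicator K x *\<^sub>R f x)"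
    by (rule ext) (use K in \<open>auto simp: indicator_def\<close>)
  ultimately have "integrable lebesgue (\<lambda>x. indicator K x *\<^sub>R f x)" by (simp only:)
  then show "integrable (lebesgue_on K) f"
    using K by (subst integrable_restrict_space) (auto intro: lmeasurable_compact fmeasurableD)
qed

text \<open>Necessity tests only with such separated fields: a cutoff in \<open>x\<close>, a bounded
  periodic function of \<open>y\<close>, and a fixed direction.\<close>

lemma product_test:
  fixes f :: "real^'m \<Rightarrow> real" and \<xi> :: "real^'n"
  assumes \<psi>: "test_fun \<Omega> \<psi>" and f: "continuous_on UNIV f" "\<And>y. \<bar>f y\<bar> \<le> 1" "periodic_cell f"
  obtains \<phi> where "two_scale_test \<Omega> q \<phi>" "\<And>x y. apply_bcontfun (\<phi> x) y = (\<psi> x * f y) *\<^sub>R \<xi>"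
proof -
  have mem: "(\<lambda>y. f y *\<^sub>R \<xi>) \<in> bcontfun"
    using f by (intro bcontfun_normI[where b="norm \<xi>"] continuous_intros) (auto simp: mult_left_le_one_le)
  define B where "B = Bcontfun (\<lambda>y. f y *\<^sub>R \<xi>)"
  have B: "apply_bcontfun B y = f y *\<^sub>R \<xi>" for y using mem by (simp add: B_def Bcontfun_inverse)
  define \<phi> where "\<phi> x = \<psi> x *\<^sub>R B" for x
  have \<phi>: "apply_bcontfun (\<phi> x) y = (\<psi> x * f y) *\<^sub>R \<xi>" for x y by (simp add: \<phi>_def B)
  obtain C where C: "\<And>x. \<bar>\<psi> x\<bar> \<le> C" using test_fun_bounded[OF \<psi>] by metis
  have m: "\<phi> \<in> borel_measurable MO"
    unfolding \<phi>_def
    by (rule measurable_compose[OF test_fun_measurable_MO[OF \<psi>]])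
       (intro borel_measurable_continuous_onI continuous_intros)
  have "Lp_fun MO q \<phi>"
    by (rule Lp_fun_bounded[OF finite_measure_MO m, where B="C * norm B"])
       (use C q0 in \<open>auto simp: \<phi>_def intro!: mult_right_mono\<close>)
  moreover have "periodic_cell (apply_bcontfun (\<phi> x))" for x
    using f(3) unfolding periodic_cell_def \<phi> by simp
  ultimately have "two_scale_test \<Omega> q \<phi>" by (simp add: two_scale_test_def)
  then show thesis using \<phi> that by blast
qed

context
  fixes u g C w
  assumes W: "\<And>j. W1p \<Omega> p (u j) (g j)"
    and bound: "\<And>j. W1p_norm_pow \<Omega> p (u j) (g j) \<le> C"
    and w: "product_Lp w"
    and conv: "\<And>\<phi>. two_scale_test \<Omega> q \<phi> \<Longrightarrow>
       (\<lambda>j. LINT x|MO. g j x \<bullet> apply_bcontfun (\<phi> x) (fast j x)) \<longlonglongrightarrow>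
       (LINT x|MO. LINT y|cell_measure. w (x, y) \<bullet> apply_bcontfun (\<phi> x) y)"
begin

lemma u_Lp: "Lp_fun MO p (u j)" and g_Lp: "Lp_fun MO p (g j)"
  using W[of j] by (auto simp: W1p_def)

lemma u_integrable: "integrable MO (u j)" and g_integrable: "integrable MO (\<lambda>x. g j x $ i)"
  using Lp_fun_imp_integrable[OF finite_measure_MO u_Lp p0(3)]
    Lp_fun_imp_integrable[OF finite_measure_MO Lp_fun_vec_nth[OF g_Lp p0(1)] p0(3)] by auto

lemma gradient_identity:
  "test_fun \<Omega> \<psi> \<Longrightarrow> (LINT x|MO. u j x * partial_deriv i \<psi> x) = - (LINT x|MO. g j x $ i * \<psi> x)"
  using W[of j] by (auto simp: W1p_def weak_gradient_def)

lemma u_pow_bound: "(LINT x|MO. \<bar>u j x\<bar> powr p) \<le> C" and g_pow_bound: "(LINT x|MO. norm (g j x) powr p) \<le> C"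
proof -
  have "a \<le> C \<and> b \<le> C" if "a \<ge> 0" "b \<ge> 0" "a + b \<le> C" for a b using that by linarith
  moreover have "(LINT x|MO. \<bar>u j x\<bar> powr p) \<ge> 0" "(LINT x|MO. norm (g j x) powr p) \<ge> 0"
    by (intro integral_nonneg_AE; simp)+
  ultimately show "(LINT x|MO. \<bar>u j x\<bar> powr p) \<le> C" "(LINT x|MO. norm (g j x) powr p) \<le> C"
    using bound[of j] unfolding W1p_norm_pow_def by blast+
qed

definition L1_bound :: real where "L1_bound = measure MO (space MO) + C"

lemma u_L1: "(LINT x|MO. \<bar>u j x\<bar>) \<le> L1_bound"
  using integral_norm_le_powr[OF finite_measure_MO u_Lp p0(3), of j] u_pow_bound[of j]
  by (simp add: L1_bound_def)

lemma g_L1: "(LINT x|MO. \<bar>g j x $ i\<bar>) \<le> L1_bound"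
proof -
  have "(LINT x|MO. \<bar>g j x $ i\<bar>) \<le> (LINT x|MO. norm (g j x))"
    using g_integrable Lp_fun_imp_integrable[OF finite_measure_MO g_Lp p0(3)] component_le_norm_cart
    by (intro integral_mono) auto
  also have "\<dots> \<le> L1_bound"
    using integral_norm_le_powr[OF finite_measure_MO g_Lp p0(3), of j] g_pow_bound[of j]
    by (simp add: L1_bound_def)
  finally show ?thesis .
qed

text \<open>Integrating by parts in a direction where the phase is not stationary trades one power of
  \<open>eps j\<close> for a derivative, which falls on \<open>u j\<close> or on the test function.\<close>

lemma oscillating_potential_tendsto_0:
  assumes \<eta>: "test_fun \<Omega> \<eta>" and k: "int_vec k" "k \<noteq> 0"
  shows "(\<lambda>j. LINT x|MO. u j x * (cos (2 * pi * (k \<bullet> fast j x)) * \<eta> x)) \<longlonglongrightarrow> 0"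
    and "(\<lambda>j. LINT x|MO. u j x * (sin (2 * pi * (k \<bullet> fast j x)) * \<eta> x)) \<longlonglongrightarrow> 0"
proof -
  define \<rho> where "\<rho> = transpose R *v k"
  obtain i where i: "\<rho> $ i \<noteq> 0" using nonres[OF k] unfolding \<rho>_def by (metis vec_eq_iff zero_index)
  define r where "r j = (1 / eps j) *\<^sub>R ((2 * pi) *\<^sub>R \<rho>)" for j
  have cs: "cos (2 * pi * (k \<bullet> fast j x)) = cos (r j \<bullet> x)" "sin (2 * pi * (k \<bullet> fast j x)) = sin (r j \<bullet> x)" for j x
    unfolding r_def \<rho>_def by (rule cos_sin_fast)+
  have ri: "r j $ i = 2 * pi * \<rho> $ i / eps j" for j by (simp add: r_def)
  obtain B1 where B1: "B1 > 0" "\<And>x. \<bar>\<eta> x\<bar> \<le> B1" using test_fun_bounded[OF \<eta>] by metis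
  obtain B2 where B2: "B2 > 0" "\<And>x. \<bar>partial_deriv i \<eta> x\<bar> \<le> B2"
    using test_fun_bounded[OF test_fun_partial_deriv[OF \<eta>]] by metis
  have tm: "(\<lambda>x. f x * \<theta> x) \<in> borel_measurable MO" if "smooth_fun f" "test_fun \<Omega> \<theta>" for f \<theta>
    using test_fun_measurable_MO[OF test_fun_mult_smooth[OF that(2,1)]] .
  have tb: "\<bar>f x * \<theta> x\<bar> \<le> B" if "\<And>x. \<bar>f x\<bar> \<le> 1" "\<And>x. \<bar>\<theta> x\<bar> \<le> B" for f \<theta> :: "real^'n \<Rightarrow> real" and B x
    using mult_mono[OF that(1)[of x] that(2)[of x]] by (simp add: abs_mult)
  have uI: "integrable MO (\<lambda>x. u j x * (f x * \<theta> x))" "\<bar>LINT x|MO. u j x * (f x * \<theta> x)\<bar> \<le> B * L1_bound"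
    if "smooth_fun f" "\<And>x. \<bar>f x\<bar> \<le> 1" "test_fun \<Omega> \<theta>" "\<And>x. \<bar>\<theta> x\<bar> \<le> B" "B > 0" for f \<theta> B j
  proof -
    have le: "\<bar>f x * \<theta> x\<bar> \<le> B" for x using tb[of f \<theta> B] that by blast
    note * = integrable_mult_bounded[where b="\<lambda>x. f x * \<theta> x", OF u_integrable[of j] tm[OF that(1,3)] le]
    show "integrable MO (\<lambda>x. u j x * (f x * \<theta> x))" by (rule *)
    show "\<bar>LINT x|MO. u j x * (f x * \<theta> x)\<bar> \<le> B * L1_bound"
      using *(2) mult_left_mono[OF u_L1[of j] less_imp_le[OF that(5)]] by linarith
  qed
  have gI: "\<bar>LINT x|MO. g j x $ i * (f x * \<theta> x)\<bar> \<le> B * L1_bound"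
    if "smooth_fun f" "\<And>x. \<bar>f x\<bar> \<le> 1" "test_fun \<Omega> \<theta>" "\<And>x. \<bar>\<theta> x\<bar> \<le> B" "B > 0" for f \<theta> B j
  proof -
    have le: "\<bar>f x * \<theta> x\<bar> \<le> B" for x using tb[of f \<theta> B] that by blast
    show ?thesis
      using integrable_mult_bounded(2)[where b="\<lambda>x. f x * \<theta> x", OF g_integrable[of j i] tm[OF that(1,3)] le]
        mult_left_mono[OF g_L1[of j i] less_imp_le[OF that(5)]] by linarith
  qed
  \<comment> \<open>Results from dividing by \<open>r j $ i\<close>, which is
    \<open>2 * pi * \<rho> $ i / eps j\<close> and so gains a power of \<open>eps j\<close>.
    \<open>B1\<close> accounts for the term with \<open>g j\<close>, and \<open>B2\<close> for the
    derivative falling on \<open>\<eta>\<close>.\<close>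
  define K where "K = (B1 + B2) * L1_bound / (2 * pi * \<bar>\<rho> $ i\<bar>)"
  have lim: "(\<lambda>j. K * eps j) \<longlonglongrightarrow> 0" using tendsto_mult_right_zero[OF eps(2)] by simp
  have fin: "\<bar>X\<bar> \<le> K * eps j" if "\<bar>r j $ i * X\<bar> \<le> (B1 + B2) * L1_bound" for X j
  proof -
    have "\<bar>r j $ i\<bar> = 2 * pi * \<bar>\<rho> $ i\<bar> / eps j" using eps(1)[of j] by (simp add: ri abs_mult)
    moreover have "x \<le> d / a * e" if "a / e * x \<le> d" "a > 0" "e > 0" for a e x d :: real
      using that by (simp add: field_simps)
    ultimately show ?thesis using that i eps(1)[of j] unfolding K_def abs_mult by simp
  qed
  show "(\<lambda>j. LINT x|MO. u j x * (cos (2 * pi * (k \<bullet> fast j x)) * \<eta> x)) \<longlonglongrightarrow> 0"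
  proof (rule Lim_null_comparison[OF _ lim], rule always_eventually, rule allI)
    fix j
    let ?s = "\<lambda>x. sin (r j \<bullet> x)" and ?c = "\<lambda>x. cos (r j \<bullet> x)"
    have pd: "partial_deriv i (\<lambda>x. ?s x * \<eta> x) x = ?s x * partial_deriv i \<eta> x + r j $ i * (?c x * \<eta> x)" for x
      by (simp add: partial_deriv_mult[OF smooth_fun_sin test_funD(1)[OF \<eta>]] partial_deriv_sin)
    have "- (LINT x|MO. g j x $ i * (?s x * \<eta> x)) = (LINT x|MO. u j x * (?s x * partial_deriv i \<eta> x) + r j $ i * (u j x * (?c x * \<eta> x)))"
      using gradient_identity[OF test_fun_mult_smooth[OF \<eta> smooth_fun_sin[of "r j"]], of j i]
      unfolding pd by (simp add: algebra_simps)
    also have "\<dots> = (LINT x|MO. u j x * (?s x * partial_deriv i \<eta> x)) + r j $ i * (LINT x|MO. u j x * (?c x * \<eta> x))"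
      using uI(1)[OF smooth_fun_sin _ test_fun_partial_deriv[OF \<eta>] B2(2,1)] uI(1)[OF smooth_fun_cos _ \<eta> B1(2,1)]
      by simp
    finally have "r j $ i * (LINT x|MO. u j x * (?c x * \<eta> x)) = - (LINT x|MO. g j x $ i * (?s x * \<eta> x)) - (LINT x|MO. u j x * (?s x * partial_deriv i \<eta> x))"
      by simp
    moreover have "\<bar>LINT x|MO. g j x $ i * (?s x * \<eta> x)\<bar> \<le> B1 * L1_bound"
      by (rule gI[OF smooth_fun_sin _ \<eta> B1(2,1)]) simp
    moreover have "\<bar>LINT x|MO. u j x * (?s x * partial_deriv i \<eta> x)\<bar> \<le> B2 * L1_bound"
      by (rule uI(2)[OF smooth_fun_sin _ test_fun_partial_deriv[OF \<eta>] B2(2,1)]) simp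
    ultimately have "\<bar>r j $ i * (LINT x|MO. u j x * (?c x * \<eta> x))\<bar> \<le> (B1 + B2) * L1_bound"
      by (simp only: distrib_right)
    from fin[OF this] show "norm (LINT x|MO. u j x * (cos (2 * pi * (k \<bullet> fast j x)) * \<eta> x)) \<le> K * eps j"
      unfolding cs by simp
  qed
  show "(\<lambda>j. LINT x|MO. u j x * (sin (2 * pi * (k \<bullet> fast j x)) * \<eta> x)) \<longlonglongrightarrow> 0"
  proof (rule Lim_null_comparison[OF _ lim], rule always_eventually, rule allI)
    fix j
    let ?s = "\<lambda>x. sin (r j \<bullet> x)" and ?c = "\<lambda>x. cos (r j \<bullet> x)"
    have pd: "partial_deriv i (\<lambda>x. ?c x * \<eta> x) x = ?c x * partial_deriv i \<eta> x - r j $ i * (?s x * \<eta> x)" for x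
      by (simp add: partial_deriv_mult[OF smooth_fun_cos test_funD(1)[OF \<eta>]] partial_deriv_cos)
    have "- (LINT x|MO. g j x $ i * (?c x * \<eta> x)) = (LINT x|MO. u j x * (?c x * partial_deriv i \<eta> x) - r j $ i * (u j x * (?s x * \<eta> x)))"
      using gradient_identity[OF test_fun_mult_smooth[OF \<eta> smooth_fun_cos[of "r j"]], of j i]
      unfolding pd by (simp add: algebra_simps)
    also have "\<dots> = (LINT x|MO. u j x * (?c x * partial_deriv i \<eta> x)) - r j $ i * (LINT x|MO. u j x * (?s x * \<eta> x))"
      using uI(1)[OF smooth_fun_cos _ test_fun_partial_deriv[OF \<eta>] B2(2,1)] uI(1)[OF smooth_fun_sin _ \<eta> B1(2,1)]
      by simp
    finally have "r j $ i * (LINT x|MO. u j x * (?s x * \<eta> x)) = (LINT x|MO. g j x $ i * (?c x * \<eta> x)) + (LINT x|MO. u j x * (?c x * partial_deriv i \<eta> x))"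
      by simp
    moreover have "\<bar>LINT x|MO. g j x $ i * (?c x * \<eta> x)\<bar> \<le> B1 * L1_bound"
      by (rule gI[OF smooth_fun_cos _ \<eta> B1(2,1)]) simp
    moreover have "\<bar>LINT x|MO. u j x * (?c x * partial_deriv i \<eta> x)\<bar> \<le> B2 * L1_bound"
      by (rule uI(2)[OF smooth_fun_cos _ test_fun_partial_deriv[OF \<eta>] B2(2,1)]) simp
    ultimately have "\<bar>r j $ i * (LINT x|MO. u j x * (?s x * \<eta> x))\<bar> \<le> (B1 + B2) * L1_bound"
      by (simp only: distrib_right)
    from fin[OF this] show "norm (LINT x|MO. u j x * (sin (2 * pi * (k \<bullet> fast j x)) * \<eta> x)) \<le> K * eps j"
      unfolding cs by simp
  qed
qed

lemma component_conv:
  assumes \<psi>: "test_fun \<Omega> \<psi>" and f: "continuous_on UNIV f" "\<And>y. \<bar>f y\<bar> \<le> 1" "periodic_cell f"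
  shows "(\<lambda>j. LINT x|MO. g j x $ i * (f (fast j x) * \<psi> x)) \<longlonglongrightarrow> (LINT x|MO. (LINT y|cell_measure. f y * w (x, y) $ i) * \<psi> x)"
proof -
  obtain \<phi> where \<phi>: "two_scale_test \<Omega> q \<phi>" "\<And>x y. apply_bcontfun (\<phi> x) y = (\<psi> x * f y) *\<^sub>R axis i 1"
    by (rule product_test[OF \<psi> f, where \<xi>="axis i 1"]) blast
  have "(LINT y|cell_measure. w (x, y) \<bullet> apply_bcontfun (\<phi> x) y) = (LINT y|cell_measure. f y * w (x, y) $ i) * \<psi> x" for x
  proof -
    have "w (x, y) \<bullet> apply_bcontfun (\<phi> x) y = \<psi> x * (f y * w (x, y) $ i)" for y
      by (simp add: \<phi>(2) inner_axis)
    then show ?thesis by (simp add: mult.commute)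
  qed
  moreover have "g j x \<bullet> apply_bcontfun (\<phi> x) (fast j x) = g j x $ i * (f (fast j x) * \<psi> x)" for j x
    by (simp add: \<phi>(2) inner_axis)
  ultimately show ?thesis using conv[OF \<phi>(1)] by simp
qed

text \<open>In a single coordinate, integration by parts does differentiate the phase and produces
  the factor \<open>r j $ i\<close> of order \<open>1 / eps j\<close>. The integral multiplying it
  is the same for all coordinates, so these terms cancel in the sum weighted by
  \<open>\<xi>\<close>.\<close>

lemma moment_orthogonal:
  assumes \<psi>: "test_fun \<Omega> \<psi>" and k: "int_vec k" "k \<noteq> 0" and \<xi>: "\<xi> \<bullet> (transpose R *v k) = 0"
  shows "(\<Sum>i\<in>UNIV. \<xi> $ i * (LINT x|MO. fcos (\<lambda>y. w (x, y) $ i) k * \<psi> x)) = 0"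
    and "(\<Sum>i\<in>UNIV. \<xi> $ i * (LINT x|MO. fsin (\<lambda>y. w (x, y) $ i) k * \<psi> x)) = 0"
proof -
  define r where "r j = (1 / eps j) *\<^sub>R ((2 * pi) *\<^sub>R (transpose R *v k))" for j
  have cs: "cos (2 * pi * (k \<bullet> fast j x)) = cos (r j \<bullet> x)" "sin (2 * pi * (k \<bullet> fast j x)) = sin (r j \<bullet> x)" for j x
    unfolding r_def by (rule cos_sin_fast)+
  have \<xi>r: "(\<Sum>i\<in>UNIV. \<xi> $ i * r j $ i) = 0" for j
  proof -
    have "(\<Sum>i\<in>UNIV. \<xi> $ i * r j $ i) = \<xi> \<bullet> r j" by (simp add: inner_vec_def)
    also have "\<dots> = 0" unfolding r_def using \<xi> by simp
    finally show ?thesis .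
  qed
  have uI: "integrable MO (\<lambda>x. u j x * (f x * \<theta> x))"
    if sm: "smooth_fun f" and f1: "\<And>x. \<bar>f x\<bar> \<le> 1" and \<theta>: "test_fun \<Omega> \<theta>" for f \<theta> j
  proof -
    obtain B where B: "\<And>x. \<bar>\<theta> x\<bar> \<le> B" using test_fun_bounded[OF \<theta>] by metis
    have le: "\<bar>f x * \<theta> x\<bar> \<le> B" for x using mult_mono[OF f1[of x] B[of x]] by (simp add: abs_mult)
    show ?thesis
      by (rule integrable_mult_bounded(1)[OF u_integrable test_fun_measurable_MO[OF test_fun_mult_smooth[OF \<theta> sm]] le])
  qed
  note pt = test_fun_partial_deriv[OF \<psi>]
  have c1: "(\<lambda>j. \<Sum>i\<in>UNIV. \<xi> $ i * (LINT x|MO. g j x $ i * (cos (2 * pi * (k \<bullet> fast j x)) * \<psi> x))) \<longlonglongrightarrow>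
     (\<Sum>i\<in>UNIV. \<xi> $ i * (LINT x|MO. fcos (\<lambda>y. w (x, y) $ i) k * \<psi> x))"
    unfolding fcos_def
    by (intro tendsto_intros component_conv[OF \<psi>, where f="\<lambda>y. cos (2 * pi * (k \<bullet> y))"] periodic_cell_cos k continuous_intros) simp
  have "(\<Sum>i\<in>UNIV. \<xi> $ i * (LINT x|MO. g j x $ i * (cos (2 * pi * (k \<bullet> fast j x)) * \<psi> x))) =
      - (\<Sum>i\<in>UNIV. \<xi> $ i * (LINT x|MO. u j x * (cos (2 * pi * (k \<bullet> fast j x)) * partial_deriv i \<psi> x)))" for j
  proof -
    have "(LINT x|MO. g j x $ i * (cos (r j \<bullet> x) * \<psi> x)) = - (LINT x|MO. u j x * (cos (r j \<bullet> x) * partial_deriv i \<psi> x)) + r j $ i * (LINT x|MO. u j x * (sin (r j \<bullet> x) * \<psi> x))" for i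
    proof -
      have "- (LINT x|MO. g j x $ i * (cos (r j \<bullet> x) * \<psi> x)) = (LINT x|MO. u j x * partial_deriv i (\<lambda>x. cos (r j \<bullet> x) * \<psi> x) x)"
        using gradient_identity[OF test_fun_mult_smooth[OF \<psi> smooth_fun_cos[of "r j"]], of j i] by simp
      also have "\<dots> = (LINT x|MO. u j x * (cos (r j \<bullet> x) * partial_deriv i \<psi> x) - r j $ i * (u j x * (sin (r j \<bullet> x) * \<psi> x)))"
      proof -
        have "partial_deriv i (\<lambda>x. cos (r j \<bullet> x) * \<psi> x) x = cos (r j \<bullet> x) * partial_deriv i \<psi> x - r j $ i * (sin (r j \<bullet> x) * \<psi> x)" for x
          by (simp add: partial_deriv_mult[OF smooth_fun_cos test_funD(1)[OF \<psi>]] partial_deriv_cos)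
        then show ?thesis by (simp add: right_diff_distrib mult.left_commute)
      qed
      also have "\<dots> = (LINT x|MO. u j x * (cos (r j \<bullet> x) * partial_deriv i \<psi> x)) - r j $ i * (LINT x|MO. u j x * (sin (r j \<bullet> x) * \<psi> x))"
        using uI[OF smooth_fun_cos _ pt] uI[OF smooth_fun_sin _ \<psi>] by simp
      finally show ?thesis by simp
    qed
    then have "(\<Sum>i\<in>UNIV. \<xi> $ i * (LINT x|MO. g j x $ i * (cos (r j \<bullet> x) * \<psi> x))) =
        - (\<Sum>i\<in>UNIV. \<xi> $ i * (LINT x|MO. u j x * (cos (r j \<bullet> x) * partial_deriv i \<psi> x))) + (\<Sum>i\<in>UNIV. \<xi> $ i * r j $ i) * (LINT x|MO. u j x * (sin (r j \<bullet> x) * \<psi> x))"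
      by (simp add: right_diff_distrib sum_subtractf sum_negf sum_distrib_right mult.assoc)
    then show ?thesis unfolding cs \<xi>r by simp
  qed
  moreover have "(\<lambda>j. - (\<Sum>i\<in>UNIV. \<xi> $ i * (LINT x|MO. u j x * (cos (2 * pi * (k \<bullet> fast j x)) * partial_deriv i \<psi> x)))) \<longlonglongrightarrow> - (\<Sum>i\<in>UNIV. \<xi> $ i * 0)"
    by (intro tendsto_intros oscillating_potential_tendsto_0 pt k)
  ultimately show "(\<Sum>i\<in>UNIV. \<xi> $ i * (LINT x|MO. fcos (\<lambda>y. w (x, y) $ i) k * \<psi> x)) = 0"
    using LIMSEQ_unique[OF c1] by simp
  have s1: "(\<lambda>j. \<Sum>i\<in>UNIV. \<xi> $ i * (LINT x|MO. g j x $ i * (sin (2 * pi * (k \<bullet> fast j x)) * \<psi> x))) \<longlonglongrightarrow>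
     (\<Sum>i\<in>UNIV. \<xi> $ i * (LINT x|MO. fsin (\<lambda>y. w (x, y) $ i) k * \<psi> x))"
    unfolding fsin_def
    by (intro tendsto_intros component_conv[OF \<psi>, where f="\<lambda>y. sin (2 * pi * (k \<bullet> y))"] periodic_cell_sin k continuous_intros) simp
  have "(\<Sum>i\<in>UNIV. \<xi> $ i * (LINT x|MO. g j x $ i * (sin (2 * pi * (k \<bullet> fast j x)) * \<psi> x))) =
      - (\<Sum>i\<in>UNIV. \<xi> $ i * (LINT x|MO. u j x * (sin (2 * pi * (k \<bullet> fast j x)) * partial_deriv i \<psi> x)))" for j
  proof -
    have "(LINT x|MO. g j x $ i * (sin (r j \<bullet> x) * \<psi> x)) = - (LINT x|MO. u j x * (sin (r j \<bullet> x) * partial_deriv i \<psi> x)) - r j $ i * (LINT x|MO. u j x * (cos (r j \<bullet> x) * \<psi> x))" for i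
    proof -
      have "- (LINT x|MO. g j x $ i * (sin (r j \<bullet> x) * \<psi> x)) = (LINT x|MO. u j x * partial_deriv i (\<lambda>x. sin (r j \<bullet> x) * \<psi> x) x)"
        using gradient_identity[OF test_fun_mult_smooth[OF \<psi> smooth_fun_sin[of "r j"]], of j i] by simp
      also have "\<dots> = (LINT x|MO. u j x * (sin (r j \<bullet> x) * partial_deriv i \<psi> x) + r j $ i * (u j x * (cos (r j \<bullet> x) * \<psi> x)))"
      proof -
        have "partial_deriv i (\<lambda>x. sin (r j \<bullet> x) * \<psi> x) x = sin (r j \<bullet> x) * partial_deriv i \<psi> x + r j $ i * (cos (r j \<bullet> x) * \<psi> x)" for x
          by (simp add: partial_deriv_mult[OF smooth_fun_sin test_funD(1)[OF \<psi>]] partial_deriv_sin)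
        then show ?thesis by (simp add: distrib_left mult.left_commute)
      qed
      also have "\<dots> = (LINT x|MO. u j x * (sin (r j \<bullet> x) * partial_deriv i \<psi> x)) + r j $ i * (LINT x|MO. u j x * (cos (r j \<bullet> x) * \<psi> x))"
        using uI[OF smooth_fun_sin _ pt] uI[OF smooth_fun_cos _ \<psi>] by simp
      finally show ?thesis by simp
    qed
    then have "(\<Sum>i\<in>UNIV. \<xi> $ i * (LINT x|MO. g j x $ i * (sin (r j \<bullet> x) * \<psi> x))) =
        - (\<Sum>i\<in>UNIV. \<xi> $ i * (LINT x|MO. u j x * (sin (r j \<bullet> x) * partial_deriv i \<psi> x))) - (\<Sum>i\<in>UNIV. \<xi> $ i * r j $ i) * (LINT x|MO. u j x * (cos (r j \<bullet> x) * \<psi> x))"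
      by (simp add: right_diff_distrib sum_subtractf sum_negf sum_distrib_right mult.assoc)
    then show ?thesis unfolding cs \<xi>r by simp
  qed
  moreover have "(\<lambda>j. - (\<Sum>i\<in>UNIV. \<xi> $ i * (LINT x|MO. u j x * (sin (2 * pi * (k \<bullet> fast j x)) * partial_deriv i \<psi> x)))) \<longlonglongrightarrow> - (\<Sum>i\<in>UNIV. \<xi> $ i * 0)"
    by (intro tendsto_intros oscillating_potential_tendsto_0 pt k)
  ultimately show "(\<Sum>i\<in>UNIV. \<xi> $ i * (LINT x|MO. fsin (\<lambda>y. w (x, y) $ i) k * \<psi> x)) = 0"
    using LIMSEQ_unique[OF s1] by simp
qed

lemma fcos_Lp: "Lp_fun MO p (\<lambda>x. fcos (\<lambda>y. w (x, y) $ i) k)" and fsin_Lp: "Lp_fun MO p (\<lambda>x. fsin (\<lambda>y. w (x, y) $ i) k)"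
  unfolding fcos_def fsin_def by (intro w_moment_Lp[OF w]; simp)+

lemma moment_combination_AE_0:
  assumes k: "int_vec k" "k \<noteq> 0" and \<xi>: "\<xi> \<bullet> (transpose R *v k) = 0"
  shows "AE x in MO. (\<Sum>i\<in>UNIV. \<xi> $ i * fcos (\<lambda>y. w (x, y) $ i) k) = 0 \<and> (\<Sum>i\<in>UNIV. \<xi> $ i * fsin (\<lambda>y. w (x, y) $ i) k) = 0"
proof -
  have aux: "AE x in MO. (\<Sum>i\<in>UNIV. \<xi> $ i * a i x) = 0"
    if a: "\<And>i. Lp_fun MO p (a i)" and z: "\<And>\<psi>. test_fun \<Omega> \<psi> \<Longrightarrow> (\<Sum>i\<in>UNIV. \<xi> $ i * (LINT x|MO. a i x * \<psi> x)) = 0"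
    for a :: "'n \<Rightarrow> real^'n \<Rightarrow> real"
  proof (rule fundamental_lemma_Lp[OF \<Omega> p])
    show "Lp_fun MO p (\<lambda>x. \<Sum>i\<in>UNIV. \<xi> $ i * a i x)"
      using Lp_fun_scaleR[OF a] p0 by (intro Lp_fun_sum) auto
    fix \<psi> assume \<psi>: "test_fun \<Omega> \<psi>"
    obtain B where B: "\<And>x. \<bar>\<psi> x\<bar> \<le> B" using test_fun_bounded[OF \<psi>] by metis
    have i: "integrable MO (\<lambda>x. a i x * \<psi> x)" for i
      by (rule integrable_mult_bounded(1)[OF Lp_fun_imp_integrable[OF finite_measure_MO a p0(3)] test_fun_measurable_MO[OF \<psi>] B])
    have "(LINT x|MO. (\<Sum>i\<in>UNIV. \<xi> $ i * a i x) * \<psi> x) = (LINT x|MO. (\<Sum>i\<in>UNIV. \<xi> $ i * (a i x * \<psi> x)))"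
      by (simp add: sum_distrib_right mult.assoc)
    also have "\<dots> = (\<Sum>i\<in>UNIV. \<xi> $ i * (LINT x|MO. a i x * \<psi> x))"
      using i by (subst Bochner_Integration.integral_sum) auto
    finally show "(LINT x|MO. (\<Sum>i\<in>UNIV. \<xi> $ i * a i x) * \<psi> x) = 0" using z[OF \<psi>] by simp
  qed
  have "AE x in MO. (\<Sum>i\<in>UNIV. \<xi> $ i * fcos (\<lambda>y. w (x, y) $ i) k) = 0"
    by (rule aux[of "\<lambda>i x. fcos (\<lambda>y. w (x, y) $ i) k"]) (auto intro: fcos_Lp moment_orthogonal(1)[OF _ k \<xi>])
  moreover have "AE x in MO. (\<Sum>i\<in>UNIV. \<xi> $ i * fsin (\<lambda>y. w (x, y) $ i) k) = 0"
    by (rule aux[of "\<lambda>i x. fsin (\<lambda>y. w (x, y) $ i) k"]) (auto intro: fsin_Lp moment_orthogonal(2)[OF _ k \<xi>])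
  ultimately show ?thesis by eventually_elim simp
qed

text \<open>Orthogonality to the complement of \<open>\<rho>\<close> is tested with finitely many
  vectors for each \<open>k\<close>. As the integer vectors are countable, a single null set of
  \<open>x\<close> serves all frequencies.\<close>

lemma moments_parallel_AE:
  "AE x in MO. \<forall>k\<in>{k. int_vec k \<and> k \<noteq> 0}. \<forall>i.
     (let \<rho> = transpose R *v k in
       (\<rho> \<bullet> \<rho>) * fcos (\<lambda>y. w (x, y) $ i) k = \<rho> $ i * (\<Sum>l\<in>UNIV. \<rho> $ l * fcos (\<lambda>y. w (x, y) $ l) k) \<and>
       (\<rho> \<bullet> \<rho>) * fsin (\<lambda>y. w (x, y) $ i) k = \<rho> $ i * (\<Sum>l\<in>UNIV. \<rho> $ l * fsin (\<lambda>y. w (x, y) $ l) k))"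
proof -
  have cnt: "countable {k::real^'m. int_vec k \<and> k \<noteq> 0}"
    by (rule countable_subset[OF _ countable_int_vec]) auto
  have "AE x in MO. (let \<rho> = transpose R *v k in
       (\<rho> \<bullet> \<rho>) * fcos (\<lambda>y. w (x, y) $ i) k = \<rho> $ i * (\<Sum>l\<in>UNIV. \<rho> $ l * fcos (\<lambda>y. w (x, y) $ l) k) \<and>
       (\<rho> \<bullet> \<rho>) * fsin (\<lambda>y. w (x, y) $ i) k = \<rho> $ i * (\<Sum>l\<in>UNIV. \<rho> $ l * fsin (\<lambda>y. w (x, y) $ l) k))"
    if k: "int_vec k" "k \<noteq> 0" for k i
  proof -
    define \<rho> where "\<rho> = transpose R *v k"
    \<comment> \<open>Up to the factor \<open>\<rho> \<bullet> \<rho>\<close>, the projection of the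
      \<open>i\<close>-th unit vector to the complement of \<open>\<rho>\<close>. Pairing with it
      isolates the \<open>i\<close>-th component of a moment vector minus its projection to
      \<open>\<rho>\<close>.\<close>
    define \<xi> where "\<xi> = (\<rho> \<bullet> \<rho>) *\<^sub>R axis i 1 - \<rho> $ i *\<^sub>R \<rho>"
    have \<xi>0: "\<xi> \<bullet> \<rho> = 0" by (simp add: \<xi>_def inner_diff_left inner_axis' mult.commute)
    have sum: "(\<Sum>l\<in>UNIV. \<xi> $ l * a l) = (\<rho> \<bullet> \<rho>) * a i - \<rho> $ i * (\<Sum>l\<in>UNIV. \<rho> $ l * a l)" for a :: "'n \<Rightarrow> real"
    proof -
      have "\<xi> $ l * a l = (if l = i then (\<rho> \<bullet> \<rho>) * a l else 0) - \<rho> $ i * (\<rho> $ l * a l)" for l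
        by (simp add: \<xi>_def axis_nth algebra_simps)
      then show ?thesis by (simp add: sum_subtractf sum_distrib_left)
    qed
    show ?thesis
      using moment_combination_AE_0[OF k \<xi>0[unfolded \<rho>_def]] unfolding sum
      by eventually_elim (simp add: Let_def \<rho>_def)
  qed
  then show ?thesis
    using cnt by (subst AE_ball_countable) (auto simp: AE_all_countable)
qed

text \<open>The gradient of the limit potential. The factor one presents it as a moment with
  constant weight, the form in which integrability and convergence of moments are available.\<close>

definition cell_mean :: "real^'n \<Rightarrow> real^'n" where
  "cell_mean x = (\<chi> i. LINT y|cell_measure. 1 * w (x, y) $ i)"

lemma cell_mean_borel: "cell_mean \<in> borel_measurable borel"
proof (rule borel_measurable_vecI)
  fix i
  have "(\<lambda>z. w z $ i) \<in> borel_measurable (lborel \<Otimes>\<^sub>M lborel)"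
    unfolding lborel_prod using borel_measurable_vec_nth[OF w_meas[OF w]] by simp
  then have "(\<lambda>x. LINT y|lborel. w (x, y) $ i) \<in> borel_measurable lborel"
    by (intro lborel.borel_measurable_lebesgue_integral) simp
  moreover have "(LINT y|cell_measure. 1 * w (x, y) $ i) = (LINT y|lborel. w (x, y) $ i)" for x
    using integral_lborel_supported_cell(1)[of "\<lambda>y. w (x, y) $ i"] w_supp[OF w] by simp
  ultimately show "(\<lambda>x. cell_mean x $ i) \<in> borel_measurable borel" by (simp add: cell_mean_def)
qed

lemma cell_mean_Lp: "Lp_fun MO p cell_mean"
  by (rule Lp_fun_vecI) (unfold cell_mean_def vec_lambda_beta, intro w_moment_Lp[OF w], use p in auto)

text \<open>Test fields independent of \<open>y\<close> show that \<open>g j\<close> converges to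
  \<open>cell_mean\<close> in the sense of distributions. Derivatives of test functions are bounded
  weights, so the weak limit of the potentials inherits the gradient identity.\<close>

lemma ex_limit_potential: "\<exists>v0. W1p \<Omega> p v0 cell_mean"
proof -
  interpret bounded_Lp_seq MO u p C
    by (intro bounded_Lp_seq.intro finite_measure_MO bounded_Lp_seq_axioms.intro p u_Lp u_pow_bound)
  obtain v where v: "Lp_fun MO p v"
    "\<And>b B L. b \<in> borel_measurable MO \<Longrightarrow> (\<And>x. x \<in> space MO \<Longrightarrow> \<bar>b x\<bar> \<le> B) \<Longrightarrow>
       (\<lambda>j. LINT x|MO. u j x * b x) \<longlonglongrightarrow> L \<Longrightarrow> (LINT x|MO. v x * b x) = L"
    using weak_limit by blast
  have "(LINT x|MO. v x * partial_deriv i \<phi> x) = - (LINT x|MO. cell_mean x $ i * \<phi> x)" if \<phi>: "test_fun \<Omega> \<phi>" for i \<phi>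
  proof -
    obtain B where B: "\<And>x. \<bar>partial_deriv i \<phi> x\<bar> \<le> B" using test_fun_bounded[OF test_fun_partial_deriv[OF \<phi>]] by metis
    have "(\<lambda>j. LINT x|MO. g j x $ i * (1 * \<phi> x)) \<longlonglongrightarrow> (LINT x|MO. (LINT y|cell_measure. 1 * w (x, y) $ i) * \<phi> x)"
      by (rule component_conv[OF \<phi>, where f="\<lambda>y. 1"]) (auto simp: periodic_cell_def)
    then have "(\<lambda>j. - (LINT x|MO. g j x $ i * \<phi> x)) \<longlonglongrightarrow> - (LINT x|MO. cell_mean x $ i * \<phi> x)"
      by (intro tendsto_minus) (simp add: cell_mean_def)
    then have "(\<lambda>j. LINT x|MO. u j x * partial_deriv i \<phi> x) \<longlonglongrightarrow> - (LINT x|MO. cell_mean x $ i * \<phi> x)"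
      by (simp add: gradient_identity[OF \<phi>])
    then show ?thesis
      by (intro v(2)[OF test_fun_measurable_MO[OF test_fun_partial_deriv[OF \<phi>]] B])
  qed
  then have "weak_gradient \<Omega> v cell_mean"
    unfolding weak_gradient_def
    using locally_integrable_onI[OF Lp_fun_imp_integrable[OF finite_measure_MO v(1) p0(3)]] locally_integrable_onI[OF Lp_fun_imp_integrable[OF finite_measure_MO cell_mean_Lp p0(3)]]
    by blast
  then show ?thesis using v(1) cell_mean_Lp unfolding W1p_def by blast
qed

text \<open>\<open>G_R\<close> consists of periodic functions on the whole space, while
  \<open>w\<close> vanishes off the cell; hence the reduction modulo integers.\<close>

definition osc_part :: "real^'n \<Rightarrow> real^'m \<Rightarrow> real^'n" where
  "osc_part x y = w (x, frac_vec y) - cell_mean x"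

lemma osc_part_in_G_R: "AE x in MO. osc_part x \<in> G_R p R"
  using w_slice_Lp[OF w] moments_parallel_AE
proof eventually_elim
  case (elim x)
  have osc_part_cell: "osc_part x y = w (x, y) - cell_mean x" if "y \<in> unit_cell" for y
    by (simp add: osc_part_def frac_vec_unit_cell[OF that])
  have v1m: "osc_part x \<in> borel_measurable borel"
    unfolding osc_part_def
    by (intro borel_measurable_diff borel_measurable_const borel_measurable_pairI[OF w_meas[OF w]] frac_vec_measurable)
  have gc: "Lp_fun cell_measure p (\<lambda>y::real^'m. cell_mean x)"
    using p0 by (intro Lp_fun_bounded[where B="norm (cell_mean x)"] finite_measure_cell) auto
  have L: "Lp_fun cell_measure p (\<lambda>y. w (x, y) - cell_mean x)"
    using elim(1) gc p0(1) by (rule Lp_fun_diff)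
  have L1: "Lp_fun cell_measure p (osc_part x)"
    by (rule Lp_fun_mono[OF L cell_measurableI[OF v1m]]) (use osc_part_cell p0 in \<open>auto intro!: AE_I2\<close>)
  have vi: "integrable cell_measure (\<lambda>y. osc_part x y $ i)" and wi: "integrable cell_measure (\<lambda>y. w (x, y) $ i)" for i
    using Lp_fun_imp_integrable[OF finite_measure_cell Lp_fun_vec_nth[OF L1 p0(1)] p0(3)]
      Lp_fun_imp_integrable[OF finite_measure_cell Lp_fun_vec_nth[OF elim(1) p0(1)] p0(3)] by auto
  have fc: "fcos (\<lambda>y. osc_part x y $ i) k = fcos (\<lambda>y. w (x, y) $ i) k - cell_mean x $ i * (LINT y|cell_measure. cos (2 * pi * (k \<bullet> y)))"
    and fs: "fsin (\<lambda>y. osc_part x y $ i) k = fsin (\<lambda>y. w (x, y) $ i) k - cell_mean x $ i * (LINT y|cell_measure. sin (2 * pi * (k \<bullet> y)))" for i k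
  proof -
    have one: "integrable cell_measure (\<lambda>y::real^'m. 1::real)" using trig_poly_cell_integrable[OF trig_poly_const] .
    have "fcos (\<lambda>y. osc_part x y $ i) k = (LINT y|cell_measure. cos (2 * pi * (k \<bullet> y)) * w (x, y) $ i - cell_mean x $ i * (cos (2 * pi * (k \<bullet> y)) * 1))"
      unfolding fcos_def by (intro Bochner_Integration.integral_cong) (simp_all add: osc_part_cell right_diff_distrib mult.commute)
    also have "\<dots> = fcos (\<lambda>y. w (x, y) $ i) k - cell_mean x $ i * (LINT y|cell_measure. cos (2 * pi * (k \<bullet> y)))"
      using integrable_cos_sin_mult[OF wi, of k i] integrable_cos_sin_mult[OF one, of k] by (simp add: fcos_def)
    finally show "fcos (\<lambda>y. osc_part x y $ i) k = fcos (\<lambda>y. w (x, y) $ i) k - cell_mean x $ i * (LINT y|cell_measure. cos (2 * pi * (k \<bullet> y)))" .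
    have "fsin (\<lambda>y. osc_part x y $ i) k = (LINT y|cell_measure. sin (2 * pi * (k \<bullet> y)) * w (x, y) $ i - cell_mean x $ i * (sin (2 * pi * (k \<bullet> y)) * 1))"
      unfolding fsin_def by (intro Bochner_Integration.integral_cong) (simp_all add: osc_part_cell right_diff_distrib mult.commute)
    also have "\<dots> = fsin (\<lambda>y. w (x, y) $ i) k - cell_mean x $ i * (LINT y|cell_measure. sin (2 * pi * (k \<bullet> y)))"
      using integrable_cos_sin_mult[OF wi, of k i] integrable_cos_sin_mult[OF one, of k] by (simp add: fsin_def)
    finally show "fsin (\<lambda>y. osc_part x y $ i) k = fsin (\<lambda>y. w (x, y) $ i) k - cell_mean x $ i * (LINT y|cell_measure. sin (2 * pi * (k \<bullet> y)))" .
  qed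
  \<comment> \<open>The coefficient of the projection of the \<open>k\<close>-th Fourier vector to
    \<open>transpose R *v k\<close>. At \<open>k = 0\<close> this Fourier vector vanishes because
    the mean was subtracted.\<close>
  define lam where "lam k = (if k = 0 then 0 else
      Complex (\<Sum>l\<in>UNIV. (transpose R *v k) $ l * fcos (\<lambda>y. w (x, y) $ l) k) (- (\<Sum>l\<in>UNIV. (transpose R *v k) $ l * fsin (\<lambda>y. w (x, y) $ l) k))
        / complex_of_real ((transpose R *v k) \<bullet> (transpose R *v k)))" for k
  have lam: "fourier_coeff (osc_part x) k = (\<chi> i. lam k * complex_of_real ((transpose R *v k) $ i))" if k: "int_vec k" for k
  proof (cases "k = 0")
    case True
    have "fcos (\<lambda>y. osc_part x y $ i) 0 = 0" "fsin (\<lambda>y. osc_part x y $ i) 0 = 0" for i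
      by (auto simp: fc fs) (auto simp: fcos_def fsin_def cell_mean_def)
    then show ?thesis unfolding True fourier_coeff_eq[OF vi] by (simp add: lam_def complex_eq_iff fun_eq_iff)
  next
    case False
    define \<rho> where "\<rho> = transpose R *v k"
    have \<rho>: "\<rho> \<bullet> \<rho> \<noteq> 0" using nonres[OF k False] by (simp add: \<rho>_def)
    have e: "(\<rho> \<bullet> \<rho>) * fcos (\<lambda>y. w (x, y) $ i) k = \<rho> $ i * (\<Sum>l\<in>UNIV. \<rho> $ l * fcos (\<lambda>y. w (x, y) $ l) k)"
       "(\<rho> \<bullet> \<rho>) * fsin (\<lambda>y. w (x, y) $ i) k = \<rho> $ i * (\<Sum>l\<in>UNIV. \<rho> $ l * fsin (\<lambda>y. w (x, y) $ l) k)" for i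
      using elim(2) k False by (auto simp: Let_def \<rho>_def)
    have e': "fcos (\<lambda>y. w (x, y) $ i) k = (\<Sum>l\<in>UNIV. \<rho> $ l * fcos (\<lambda>y. w (x, y) $ l) k) / (\<rho> \<bullet> \<rho>) * \<rho> $ i"
       "fsin (\<lambda>y. w (x, y) $ i) k = (\<Sum>l\<in>UNIV. \<rho> $ l * fsin (\<lambda>y. w (x, y) $ l) k) / (\<rho> \<bullet> \<rho>) * \<rho> $ i" for i
      using e[of i] \<rho> by (simp_all add: field_simps)
    have "fcos (\<lambda>y. osc_part x y $ i) k = fcos (\<lambda>y. w (x, y) $ i) k" "fsin (\<lambda>y. osc_part x y $ i) k = fsin (\<lambda>y. w (x, y) $ i) k" for i
      by (simp_all add: fc fs cell_integral_cos[OF k False] cell_integral_sin[OF k False])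
    moreover have "Complex (fcos (\<lambda>y. w (x, y) $ i) k) (- fsin (\<lambda>y. w (x, y) $ i) k) = lam k * complex_of_real (\<rho> $ i)" for i
      using False e'[of i] unfolding lam_def \<rho>_def[symmetric] by (simp add: complex_eq_iff)
    ultimately show ?thesis by (simp add: fourier_coeff_eq[OF vi] \<rho>_def)
  qed
  have "Lp_fun (lebesgue_on unit_cell) p (osc_part x)"
    using Lp_fun_integrable[OF L1] integrable_lebesgue_on_cell[of "\<lambda>y. norm (osc_part x y) powr p"] v1m
    by (auto simp: Lp_fun_def intro!: borel_measurable_lebesgue_onI dest: borel_measurable_integrable)
  moreover have "periodic_cell (osc_part x)" unfolding periodic_cell_def osc_part_def by (simp add: frac_vec_periodic)
  moreover have "osc_part x \<in> borel_measurable lebesgue" using v1m by (intro measurable_completion) simp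
  moreover have "lam 0 = 0" by (simp add: lam_def)
  ultimately show ?case unfolding G_R_def using lam by blast
qed

text \<open>On the product set this is \<open>w\<close> minus the mean. The mean, constant in
  \<open>y\<close> and extended by zero, is the Borel function \<open>G\<close>; Fubini's theorem
  and the unit measure of the cell give its p-integrability.\<close>

lemma osc_part_product_Lp: "Lp_fun (lebesgue_on S) p (\<lambda>z. osc_part (fst z) (snd z))"
proof -
  define G where "G z = indicator S z *\<^sub>R cell_mean (fst z)" for z :: "(real^'n) \<times> (real^'m)"
  have f: "(fst :: (real^'n) \<times> (real^'m) \<Rightarrow> _) \<in> borel_measurable borel"
    by (intro borel_measurable_continuous_onI continuous_on_fst continuous_on_id)
  have Gm: "G \<in> borel_measurable borel"
    unfolding G_def using S_borel measurable_compose[OF f cell_mean_borel] by measurable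
  have e: "norm (G (x, y)) powr p = indicator \<Omega> x * (indicator unit_cell y * norm (cell_mean x) powr p)" for x y
    using p0 by (auto simp: G_def indicator_def)
  have Gpm: "(\<lambda>z. norm (G z) powr p) \<in> borel_measurable (lborel \<Otimes>\<^sub>M lborel)" unfolding lborel_prod using Gm by measurable
  have inner: "integrable lborel (\<lambda>y. norm (G (x, y)) powr p)" "(LINT y|lborel. norm (norm (G (x, y)) powr p)) = indicator \<Omega> x *\<^sub>R norm (cell_mean x) powr p" for x
  proof -
    have i: "integrable lborel (indicator unit_cell :: real^'m \<Rightarrow> real)"
      by (simp add: emeasure_unit_cell)
    show "integrable lborel (\<lambda>y. norm (G (x, y)) powr p)"
      unfolding e using i by simp
    have "measure lborel (unit_cell :: (real^'m) set) = 1" by (simp add: measure_def emeasure_unit_cell)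
    then show "(LINT y|lborel. norm (norm (G (x, y)) powr p)) = indicator \<Omega> x *\<^sub>R norm (cell_mean x) powr p"
      by (simp add: e)
  qed
  have "integrable lebesgue (\<lambda>x. indicator \<Omega> x *\<^sub>R norm (cell_mean x) powr p)"
    using Lp_fun_integrable[OF cell_mean_Lp] \<Omega>_lebesgue by (subst (asm) integrable_restrict_space) auto
  moreover have "(\<lambda>x. indicator \<Omega> x *\<^sub>R norm (cell_mean x) powr p) \<in> borel_measurable lborel"
  proof -
    have [measurable]: "\<Omega> \<in> sets borel" "cell_mean \<in> borel_measurable borel" using \<Omega>(1) cell_mean_borel by auto
    show ?thesis by measurable
  qed
  ultimately have "integrable lborel (\<lambda>x. indicator \<Omega> x *\<^sub>R norm (cell_mean x) powr p)"
    by (simp only: integrable_completion)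
  then have "integrable (lborel \<Otimes>\<^sub>M lborel) (\<lambda>z. norm (G z) powr p)"
    by (intro lborel_pair.Fubini_integrable[OF Gpm]) (use inner in auto)
  then have Gi: "integrable lborel (\<lambda>z. norm (G z) powr p)" by (simp add: lborel_prod)
  have toS: "Lp_fun (lebesgue_on S) p h" if "h \<in> borel_measurable borel" "integrable lborel (\<lambda>z. norm (h z) powr p)" "\<And>z. z \<notin> S \<Longrightarrow> h z = 0" for h :: "(real^'n) \<times> (real^'m) \<Rightarrow> real^'n"
  proof -
    have "(\<lambda>z. norm (h z) powr p) \<in> borel_measurable borel" using that(1) by measurable
    then show ?thesis
      using that integrable_lebesgue_on_iff_lborel[of "\<lambda>z. norm (h z) powr p" S] S_lebesgue borel_measurable_lebesgue_onI
      by (auto simp: Lp_fun_def)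
  qed
  have GL: "Lp_fun (lebesgue_on S) p G" by (rule toS[OF Gm Gi]) (simp add: G_def)
  have wL: "Lp_fun (lebesgue_on S) p w" by (rule toS[OF w_meas[OF w] w_int[OF w] w_supp[OF w]])
  have wGL: "Lp_fun (lebesgue_on S) p (\<lambda>z. w z - G z)" using wL GL p0(1) by (rule Lp_fun_diff)
  have eq: "osc_part (fst z) (snd z) = w z - G z" if "z \<in> S" for z
    using that by (auto simp: osc_part_def G_def frac_vec_unit_cell)
  show ?thesis
  proof (rule Lp_fun_mono[OF wGL])
    have "(\<lambda>z. osc_part (fst z) (snd z)) \<in> borel_measurable (lebesgue_on S) \<longleftrightarrow> (\<lambda>z. w z - G z) \<in> borel_measurable (lebesgue_on S)"
      by (rule measurable_cong) (use eq in simp)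
    then show "(\<lambda>z. osc_part (fst z) (snd z)) \<in> borel_measurable (lebesgue_on S)"
      using Lp_fun_measurable[OF wGL] by blast
    show "AE z in lebesgue_on S. norm (osc_part (fst z) (snd z)) \<le> norm (w z - G z)"
      by (rule AE_I2) (use eq in simp)
  qed (rule p0)
qed

theorem necessity:
  "\<exists>v0 g0 v1. W1p \<Omega> p v0 g0 \<and> Lp_fun (lebesgue_on S) p (\<lambda>z. v1 (fst z) (snd z))
     \<and> (AE x in MO. v1 x \<in> G_R p R) \<and> (\<forall>z\<in>S. w z = g0 (fst z) + v1 (fst z) (snd z))"
proof -
  obtain v0 where "W1p \<Omega> p v0 cell_mean" using ex_limit_potential by blast
  moreover have "\<forall>z\<in>S. w z = cell_mean (fst z) + osc_part (fst z) (snd z)"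
    by (auto simp: osc_part_def frac_vec_unit_cell)
  ultimately show ?thesis using osc_part_in_G_R osc_part_product_Lp by blast
qed

end

end

text \<open>The norm is at most the dimension times the largest component, whose p-th power is one
  of the summands.\<close>

lemma norm_powr_le_sum:
  fixes v :: "real^'n"
  assumes "p \<ge> 0"
  shows "norm v powr p \<le> real CARD('n) powr p * (\<Sum>i\<in>UNIV. \<bar>v $ i\<bar> powr p)"
proof -
  define m where "m = Max (range (\<lambda>i. \<bar>v $ i\<bar>))"
  have m: "\<bar>v $ i\<bar> \<le> m" for i unfolding m_def by (intro Max_ge) auto
  have "m \<in> range (\<lambda>i. \<bar>v $ i\<bar>)" unfolding m_def by (intro Max_in) auto
  then obtain i where i: "m = \<bar>v $ i\<bar>" by blast
  have "norm v \<le> (\<Sum>i\<in>UNIV. \<bar>v $ i\<bar>)" by (rule norm_le_l1_cart)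
  also have "\<dots> \<le> (\<Sum>i\<in>(UNIV::'n set). m)" by (intro sum_mono m)
  finally have "norm v \<le> real CARD('n) * m" by simp
  then have "norm v powr p \<le> (real CARD('n) * m) powr p" using assms by (intro powr_mono2) auto
  also have "\<dots> = real CARD('n) powr p * m powr p" using i by (simp add: powr_mult)
  also have "\<dots> \<le> real CARD('n) powr p * (\<Sum>i\<in>UNIV. \<bar>v $ i\<bar> powr p)"
    unfolding i by (intro mult_left_mono member_le_sum) auto
  finally show ?thesis .
qed

section \<open>Product measure and Sobolev functions built from test functions\<close>

context oscillation_Lp
begin

abbreviation (input) PM :: "((real^'n) \<times> (real^'m)) measure" where "PM \<equiv> MO \<Otimes>\<^sub>M cell_measure"

lemma pair_PM: "pair_sigma_finite MO (cell_measure :: (real^'m) measure)"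
  by (intro pair_sigma_finite.intro finite_measure.axioms(1) finite_measure_MO finite_measure_cell)

lemma sigma_finite_cell: "sigma_finite_measure (cell_measure :: (real^'m) measure)"
  by (rule finite_measure.axioms(1)[OF finite_measure_cell])

lemma finite_measure_PM: "finite_measure PM"
  by (intro finite_measure_pair_measure finite_measure_MO finite_measure_cell)

lemma fst_PM: "fst \<in> PM \<rightarrow>\<^sub>M MO"
  by (rule measurable_fst)

lemma snd_PM: "snd \<in> borel_measurable PM"
  by (rule measurable_compose[OF measurable_snd]) (auto intro: cell_measurableI)

lemma AE_PM_fst:
  assumes "AE x in MO. P x"
  shows "AE z in PM. P (fst z)"
proof -
  obtain N where N': "\<And>x. x \<in> space MO - N \<Longrightarrow> P x" and N: "N \<in> null_sets MO"
    using AE_E3[OF assms] by blast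
  have "(unit_cell :: (real^'m) set) \<in> sets cell_measure" using sets.top[of "cell_measure :: (real^'m) measure"] by simp
  then have "N \<times> unit_cell \<in> null_sets PM"
    using N sigma_finite_measure.emeasure_pair_measure_Times[OF sigma_finite_cell, of N MO unit_cell]
    by (auto simp: null_sets_def)
  then show ?thesis
  proof (rule AE_I')
    show "{z \<in> space PM. \<not> P (fst z)} \<subseteq> N \<times> unit_cell"
    proof
      fix z assume "z \<in> {z \<in> space PM. \<not> P (fst z)}"
      then show "z \<in> N \<times> unit_cell" using N'[of "fst z"] by (cases z) (auto simp: space_pair_measure)
    qed
  qed
qed

lemma PM_fst:
  fixes f :: "real^'n \<Rightarrow> real"
  assumes f: "integrable MO f"
  shows "integrable PM (\<lambda>z. f (fst z))" "(LINT z|PM. f (fst z)) = (LINT x|MO. f x)"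
proof -
  interpret pair_sigma_finite MO "cell_measure :: (real^'m) measure" by (rule pair_PM)
  show i: "integrable PM (\<lambda>z. f (fst z))"
  proof (rule Fubini_integrable)
    show "(\<lambda>z. f (fst z)) \<in> borel_measurable PM" using f by (intro measurable_compose[OF fst_PM]) auto
    show "AE x in MO. integrable cell_measure (\<lambda>y::real^'m. f (fst (x, y)))"
      by (intro AE_I2) (simp add: finite_measure.integrable_const[OF finite_measure_cell])
  qed (use f in simp)
  show "(LINT z|PM. f (fst z)) = (LINT x|MO. f x)" using integral_fst'[OF i] by simp
qed

lemma Lp_fun_product_Lp:
  assumes w: "product_Lp w"
  shows "Lp_fun PM p w"
proof -
  interpret pair_sigma_finite MO "cell_measure :: (real^'m) measure" by (rule pair_PM)
  have m: "w \<in> borel_measurable PM" using w_joint_measurable[OF w] by simp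
  have "integrable PM (\<lambda>z. norm (w z) powr p)"
  proof (rule Fubini_integrable)
    show "(\<lambda>z. norm (w z) powr p) \<in> borel_measurable PM" using m by measurable
    show "integrable MO (\<lambda>x. LINT y|cell_measure. norm (norm (w (x, y)) powr p))"
      using w_slice_integrable[OF w] by simp
    show "AE x in MO. integrable cell_measure (\<lambda>y. norm (w (x, y)) powr p)"
      using w_slice_Lp[OF w] by eventually_elim (rule Lp_fun_integrable)
  qed
  then show ?thesis using m by (simp add: Lp_fun_def)
qed

lemma W1p_add:
  assumes "W1p \<Omega> p a f" "W1p \<Omega> p b h"
  shows "W1p \<Omega> p (\<lambda>x. a x + b x) (\<lambda>x. f x + h x)"
proof -
  have La: "Lp_fun MO p a" and Lb: "Lp_fun MO p b" and Lf: "Lp_fun MO p f" and Lh: "Lp_fun MO p h"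
    using assms by (auto simp: W1p_def)
  note int = Lp_fun_imp_integrable[OF finite_measure_MO _ p0(3)]
  have L: "Lp_fun MO p (\<lambda>x. a x + b x)" "Lp_fun MO p (\<lambda>x. f x + h x)"
    by (intro Lp_fun_add La Lb Lf Lh p0)+
  have "(LINT x|MO. (a x + b x) * partial_deriv i \<phi> x) = - (LINT x|MO. (f x + h x) $ i * \<phi> x)" if \<phi>: "test_fun \<Omega> \<phi>" for i \<phi>
  proof -
    obtain B where B: "\<And>x. \<bar>\<phi> x\<bar> \<le> B" using test_fun_bounded[OF \<phi>] by metis
    obtain B' where B': "\<And>x. \<bar>partial_deriv i \<phi> x\<bar> \<le> B'" using test_fun_bounded[OF test_fun_partial_deriv[OF \<phi>]] by metis
    note m = test_fun_measurable_MO[OF \<phi>] test_fun_measurable_MO[OF test_fun_partial_deriv[OF \<phi>], of i]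
    note I = integrable_mult_bounded(1)[OF int[OF La] m(2) B'] integrable_mult_bounded(1)[OF int[OF Lb] m(2) B']
      integrable_mult_bounded(1)[OF int[OF Lp_fun_vec_nth[OF Lf p0(1)]] m(1) B]
      integrable_mult_bounded(1)[OF int[OF Lp_fun_vec_nth[OF Lh p0(1)]] m(1) B]
    have "(LINT x|MO. (a x + b x) * partial_deriv i \<phi> x) = (LINT x|MO. a x * partial_deriv i \<phi> x) + (LINT x|MO. b x * partial_deriv i \<phi> x)"
      unfolding distrib_right using I by simp
    also have "\<dots> = - (LINT x|MO. f x $ i * \<phi> x) + - (LINT x|MO. h x $ i * \<phi> x)"
      using assms \<phi> by (simp add: W1p_def weak_gradient_def)
    also have "\<dots> = - (LINT x|MO. (f x + h x) $ i * \<phi> x)"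
      unfolding vector_add_component distrib_right using I by simp
    finally show ?thesis .
  qed
  then show ?thesis
    unfolding W1p_def weak_gradient_def using L locally_integrable_onI[OF int[OF L(1)]] locally_integrable_onI[OF int[OF L(2)]] by blast
qed

definition grad :: "(real^'n \<Rightarrow> real) \<Rightarrow> real^'n \<Rightarrow> real^'n" where
  "grad U x = (\<chi> i. partial_deriv i U x)"

text \<open>The product \<open>U x * \<phi> x\<close> has compact support, so its derivative
  integrates to zero, which is the weak gradient identity.\<close>

lemma test_fun_W1p:
  assumes U: "test_fun \<Omega> U"
  shows "W1p \<Omega> p U (grad U)"
proof -
  note int = Lp_fun_imp_integrable[OF finite_measure_MO _ p0(3)]
  have L: "Lp_fun MO p U" using test_fun_Lp_fun[OF U \<Omega> p0(1)] .
  have Lg: "Lp_fun MO p (grad U)"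
    by (rule Lp_fun_vecI) (unfold grad_def vec_lambda_beta, intro test_fun_Lp_fun[OF test_fun_partial_deriv[OF U] \<Omega> p0(1)], rule p0)
  have "(LINT x|MO. U x * partial_deriv i \<phi> x) = - (LINT x|MO. grad U x $ i * \<phi> x)" if \<phi>: "test_fun \<Omega> \<phi>" for i \<phi>
  proof -
    have toL: "(LINT x|MO. \<theta> x) = (LINT x|lborel. \<theta> x)" if \<theta>: "test_fun \<Omega> \<theta>" for \<theta>
      by (intro integral_lebesgue_on_eq_lborel smooth_fun_measurable test_funD(1)[OF \<theta>] \<Omega>_lebesgue test_funD(2)[OF \<theta>])
    have t1: "test_fun \<Omega> (\<lambda>x. U x * partial_deriv i \<phi> x)" by (intro test_fun_mult_smooth test_fun_partial_deriv \<phi> test_funD(1)[OF U])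
    have t2: "test_fun \<Omega> (\<lambda>x. partial_deriv i U x * \<phi> x)" by (intro test_fun_mult_smooth smooth_fun_partial_deriv \<phi> test_funD(1)[OF U])
    have "0 = (LINT x|lborel. partial_deriv i (\<lambda>x. U x * \<phi> x) x)"
      using integral_partial_deriv_eq_0[OF test_fun_mult_smooth[OF \<phi> test_funD(1)[OF U]]] by simp
    also have "\<dots> = (LINT x|lborel. U x * partial_deriv i \<phi> x + partial_deriv i U x * \<phi> x)"
      by (simp only: partial_deriv_mult[OF test_funD(1)[OF U] test_funD(1)[OF \<phi>]])
    also have "\<dots> = (LINT x|lborel. U x * partial_deriv i \<phi> x) + (LINT x|lborel. partial_deriv i U x * \<phi> x)"
      by (intro Bochner_Integration.integral_add test_fun_integrable[OF t1] test_fun_integrable[OF t2])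
    finally show ?thesis using toL[OF t1] toL[OF t2] by (simp add: grad_def)
  qed
  then show ?thesis
    unfolding W1p_def weak_gradient_def using L Lg locally_integrable_onI[OF int[OF L]] locally_integrable_onI[OF int[OF Lg]] by blast
qed

subsection \<open>Correctors\<close>

text \<open>\<open>U j\<close> is a potential of size \<open>eps j\<close> whose gradient is the oscillating field
  \<open>W x (fast j x)\<close> up to an error of size \<open>eps j\<close>.\<close>

definition corrector :: "(real^'n \<Rightarrow> real^'m \<Rightarrow> real^'n) \<Rightarrow> (nat \<Rightarrow> real^'n \<Rightarrow> real) \<Rightarrow> real \<Rightarrow> bool" where
  "corrector W U B \<longleftrightarrow> (\<forall>j. test_fun \<Omega> (U j)) \<and> (\<forall>j x. \<bar>U j x\<bar> \<le> B * eps j) \<and>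
     (\<forall>j x i. \<bar>partial_deriv i (U j) x - W x (fast j x) $ i\<bar> \<le> B * eps j) \<and>
     (\<forall>y. (\<lambda>x. W x y) \<in> borel_measurable borel) \<and>
     (\<forall>x. continuous_on UNIV (W x) \<and> periodic_cell (W x)) \<and> (\<forall>x y. norm (W x y) \<le> B)"

lemma corrector_zero: "corrector (\<lambda>x y. 0) (\<lambda>j x. 0) 0"
  by (auto simp: corrector_def test_fun_0 partial_deriv_const periodic_cell_def)

lemma corrector_add:
  assumes "corrector W1 U1 B1" "corrector W2 U2 B2"
  shows "corrector (\<lambda>x y. W1 x y + W2 x y) (\<lambda>j x. U1 j x + U2 j x) (B1 + B2)"
proof -
  have t: "test_fun \<Omega> (U1 j)" "test_fun \<Omega> (U2 j)" for j using assms by (auto simp: corrector_def)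
  have "\<bar>U1 j x + U2 j x\<bar> \<le> (B1 + B2) * eps j" for j x
    using assms unfolding corrector_def distrib_right by (intro order.trans[OF abs_triangle_ineq add_mono]) auto
  moreover have "\<bar>partial_deriv i (\<lambda>x. U1 j x + U2 j x) x - (W1 x (fast j x) + W2 x (fast j x)) $ i\<bar> \<le> (B1 + B2) * eps j" for j x i
  proof -
    have eq: "partial_deriv i (\<lambda>x. U1 j x + U2 j x) x - (W1 x (fast j x) + W2 x (fast j x)) $ i =
      (partial_deriv i (U1 j) x - W1 x (fast j x) $ i) + (partial_deriv i (U2 j) x - W2 x (fast j x) $ i)"
      by (simp add: partial_deriv_add[OF test_funD(1)[OF t(1)] test_funD(1)[OF t(2)]])
    have "\<bar>partial_deriv i (U1 j) x - W1 x (fast j x) $ i\<bar> \<le> B1 * eps j" "\<bar>partial_deriv i (U2 j) x - W2 x (fast j x) $ i\<bar> \<le> B2 * eps j"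
      using assms by (auto simp: corrector_def)
    then show ?thesis unfolding eq distrib_right by (rule order.trans[OF abs_triangle_ineq add_mono])
  qed
  moreover have "norm (W1 x y + W2 x y) \<le> B1 + B2" for x y
    using assms unfolding corrector_def by (intro order.trans[OF norm_triangle_ineq add_mono]) auto
  moreover have "periodic_cell (\<lambda>y. W1 x y + W2 x y)" for x
    using assms unfolding corrector_def periodic_cell_def by simp
  ultimately show ?thesis
    using assms t unfolding corrector_def
    by (auto intro!: test_fun_add borel_measurable_add continuous_on_add)
qed

text \<open>Integrating the mode gives the potential a factor \<open>eps j / (2 * pi)\<close>. It
  cancels the frequency that appears when the phase is differentiated, leaving
  \<open>\<rho>\<close>, while it keeps the terms with derivatives of \<open>a\<close> small.
  Frequency zero is included: there \<open>\<rho> = 0\<close> and the field vanishes.\<close>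

lemma corrector_monomial:
  assumes a: "test_fun \<Omega> a" and k: "int_vec k"
  shows "\<exists>U B. corrector (\<lambda>x y. (a x * cos (2 * pi * (k \<bullet> y))) *\<^sub>R (transpose R *v k)) U B"
    and "\<exists>U B. corrector (\<lambda>x y. (a x * sin (2 * pi * (k \<bullet> y))) *\<^sub>R (transpose R *v k)) U B"
proof -
  define \<rho> where "\<rho> = transpose R *v k"
  define r where "r j = (1 / eps j) *\<^sub>R ((2 * pi) *\<^sub>R \<rho>)" for j
  have cs: "cos (2 * pi * (k \<bullet> fast j x)) = cos (r j \<bullet> x)" "sin (2 * pi * (k \<bullet> fast j x)) = sin (r j \<bullet> x)" for j x
    unfolding r_def \<rho>_def by (rule cos_sin_fast)+
  have ri: "eps j / (2 * pi) * r j $ i = \<rho> $ i" for j i using eps(1)[of j] by (simp add: r_def)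
  obtain B0 where B0: "B0 > 0" "\<And>x. \<bar>a x\<bar> \<le> B0" using test_fun_bounded[OF a] by metis
  have "\<forall>i. \<exists>B>0. \<forall>x. \<bar>partial_deriv i a x\<bar> \<le> B"
    using test_fun_bounded[OF test_fun_partial_deriv[OF a]] by metis
  then obtain b where b: "\<And>i. b i > 0" "\<And>i x. \<bar>partial_deriv i a x\<bar> \<le> b i" by metis
  \<comment> \<open>One constant meets all requirements: \<open>B0\<close> for the potential,
    \<open>b i\<close> for the gradient error in each coordinate, and the last term for the
    field.\<close>
  define B where "B = B0 + (\<Sum>i\<in>UNIV. b i) + B0 * norm \<rho>"
  have b_le: "b i \<le> B" for i
  proof -
    have "b i \<le> (\<Sum>i\<in>UNIV. b i)" using b(1) by (intro member_le_sum) (auto intro: less_imp_le)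
    moreover have "0 \<le> B0 * norm \<rho>" using B0(1) by simp
    ultimately show ?thesis using B0(1) unfolding B_def by linarith
  qed
  have sb: "0 \<le> (\<Sum>i\<in>UNIV. b i)" using b(1) by (intro sum_nonneg) (auto intro: less_imp_le)
  have B0_le: "B0 \<le> B" "B0 * norm \<rho> \<le> B"
    using sb B0(1) by (auto simp: B_def)
  have e: "0 < eps j / (2 * pi)" "eps j / (2 * pi) \<le> eps j" for j
  proof -
    show "0 < eps j / (2 * pi)" using eps(1)[of j] by simp
    have "eps j * 1 \<le> eps j * (2 * pi)" using eps(1)[of j] pi_gt3 by (intro mult_left_mono) auto
    then show "eps j / (2 * pi) \<le> eps j" by (simp add: field_simps)
  qed
  have small: "\<bar>eps j / (2 * pi) * (t * s)\<bar> \<le> B * eps j" if "\<bar>t\<bar> \<le> 1" "\<bar>s\<bar> \<le> B" for t s j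
  proof -
    have "\<bar>t * s\<bar> \<le> 1 * B" unfolding abs_mult using that by (intro mult_mono) auto
    then have "(eps j / (2 * pi)) * \<bar>t * s\<bar> \<le> eps j * B" using e[of j] eps(1)[of j] by (intro mult_mono) auto
    moreover have "\<bar>eps j / (2 * pi) * (t * s)\<bar> = (eps j / (2 * pi)) * \<bar>t * s\<bar>"
      using e(1)[of j] by (simp only: abs_mult abs_of_pos)
    ultimately show ?thesis by (simp only: mult.commute)
  qed
  have am: "a \<in> borel_measurable borel" using smooth_fun_measurable[OF test_funD(1)[OF a]] .
  have bnd: "norm ((a x * t) *\<^sub>R \<rho>) \<le> B" if "\<bar>t\<bar> \<le> 1" for x t
  proof -
    have "\<bar>a x * t\<bar> \<le> B0 * 1" unfolding abs_mult using B0 that by (intro mult_mono) auto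
    then have "\<bar>a x * t\<bar> * norm \<rho> \<le> B0 * norm \<rho>" by (intro mult_right_mono) auto
    then show ?thesis using B0_le(2) by simp
  qed
  have aB: "\<bar>a x\<bar> \<le> B" "\<bar>partial_deriv i a x\<bar> \<le> B" for x i
    using B0(2)[of x] B0_le(1) b(2)[of i x] b_le[of i] by linarith+
  define Uc where "Uc j x = (eps j / (2 * pi)) * (sin (r j \<bullet> x) * a x)" for j x
  have "corrector (\<lambda>x y. (a x * cos (2 * pi * (k \<bullet> y))) *\<^sub>R \<rho>) Uc B"
    unfolding corrector_def
  proof (intro conjI allI)
    have t: "test_fun \<Omega> (\<lambda>x. sin (r j \<bullet> x) * a x)" for j by (intro test_fun_mult_smooth a smooth_fun_sin)
    show "test_fun \<Omega> (Uc j)" for j unfolding Uc_def by (intro test_fun_mult_smooth t smooth_fun_const)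
    show "\<bar>Uc j x\<bar> \<le> B * eps j" for j x unfolding Uc_def using aB by (intro small) auto
    show "\<bar>partial_deriv i (Uc j) x - ((a x * cos (2 * pi * (k \<bullet> fast j x))) *\<^sub>R \<rho>) $ i\<bar> \<le> B * eps j" for j x i
    proof -
      have "partial_deriv i (Uc j) x = (eps j / (2 * pi)) * (sin (r j \<bullet> x) * partial_deriv i a x + cos (r j \<bullet> x) * r j $ i * a x)"
        unfolding Uc_def partial_deriv_cmult[OF test_funD(1)[OF t]] partial_deriv_mult[OF smooth_fun_sin test_funD(1)[OF a]] partial_deriv_sin ..
      also have "\<dots> = (eps j / (2 * pi)) * (sin (r j \<bullet> x) * partial_deriv i a x) + (eps j / (2 * pi) * r j $ i) * (a x * cos (r j \<bullet> x))"
        by (simp add: algebra_simps)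
      finally have "partial_deriv i (Uc j) x - ((a x * cos (2 * pi * (k \<bullet> fast j x))) *\<^sub>R \<rho>) $ i = (eps j / (2 * pi)) * (sin (r j \<bullet> x) * partial_deriv i a x)"
        unfolding ri cs by simp
      then show ?thesis using small[of "sin (r j \<bullet> x)" "partial_deriv i a x" j] aB by simp
    qed
    show "(\<lambda>x. (a x * cos (2 * pi * (k \<bullet> y))) *\<^sub>R \<rho>) \<in> borel_measurable borel" for y using am by measurable
    show "continuous_on UNIV (\<lambda>y. (a x * cos (2 * pi * (k \<bullet> y))) *\<^sub>R \<rho>)" for x by (intro continuous_intros)
    show "periodic_cell (\<lambda>y. (a x * cos (2 * pi * (k \<bullet> y))) *\<^sub>R \<rho>)" for x
      using periodic_cell_cos[OF k] unfolding periodic_cell_def by simp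
    show "norm ((a x * cos (2 * pi * (k \<bullet> y))) *\<^sub>R \<rho>) \<le> B" for x y by (rule bnd) simp
  qed
  then show "\<exists>U B. corrector (\<lambda>x y. (a x * cos (2 * pi * (k \<bullet> y))) *\<^sub>R (transpose R *v k)) U B" unfolding \<rho>_def by blast
  define Us where "Us j x = (eps j / (2 * pi)) * ((-1) * cos (r j \<bullet> x) * a x)" for j x
  have "corrector (\<lambda>x y. (a x * sin (2 * pi * (k \<bullet> y))) *\<^sub>R \<rho>) Us B"
    unfolding corrector_def
  proof (intro conjI allI)
    have sm: "smooth_fun (\<lambda>x. (-1) * cos (r j \<bullet> x))" for j by (intro smooth_fun_cmult smooth_fun_cos)
    have t: "test_fun \<Omega> (\<lambda>x. (-1) * cos (r j \<bullet> x) * a x)" for j by (rule test_fun_mult_smooth[OF a sm])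
    show "test_fun \<Omega> (Us j)" for j unfolding Us_def by (rule test_fun_mult_smooth[OF t smooth_fun_const])
    show "\<bar>Us j x\<bar> \<le> B * eps j" for j x unfolding Us_def using aB by (intro small) auto
    show "\<bar>partial_deriv i (Us j) x - ((a x * sin (2 * pi * (k \<bullet> fast j x))) *\<^sub>R \<rho>) $ i\<bar> \<le> B * eps j" for j x i
    proof -
      have "partial_deriv i (Us j) x = (eps j / (2 * pi)) * ((-1) * cos (r j \<bullet> x) * partial_deriv i a x + ((-1) * (- sin (r j \<bullet> x) * r j $ i)) * a x)"
        unfolding Us_def partial_deriv_cmult[OF test_funD(1)[OF t]] partial_deriv_mult[OF sm test_funD(1)[OF a]]
          partial_deriv_cmult[OF smooth_fun_cos] partial_deriv_cos ..
      also have "\<dots> = (eps j / (2 * pi)) * ((- cos (r j \<bullet> x)) * partial_deriv i a x) + (eps j / (2 * pi) * r j $ i) * (a x * sin (r j \<bullet> x))"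
        by (simp add: algebra_simps)
      finally have "partial_deriv i (Us j) x - ((a x * sin (2 * pi * (k \<bullet> fast j x))) *\<^sub>R \<rho>) $ i = (eps j / (2 * pi)) * ((- cos (r j \<bullet> x)) * partial_deriv i a x)"
        unfolding ri cs by simp
      then show ?thesis using small[of "- cos (r j \<bullet> x)" "partial_deriv i a x" j] aB by simp
    qed
    show "(\<lambda>x. (a x * sin (2 * pi * (k \<bullet> y))) *\<^sub>R \<rho>) \<in> borel_measurable borel" for y using am by measurable
    show "continuous_on UNIV (\<lambda>y. (a x * sin (2 * pi * (k \<bullet> y))) *\<^sub>R \<rho>)" for x by (intro continuous_intros)
    show "periodic_cell (\<lambda>y. (a x * sin (2 * pi * (k \<bullet> y))) *\<^sub>R \<rho>)" for x
      using periodic_cell_sin[OF k] unfolding periodic_cell_def by simp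
    show "norm ((a x * sin (2 * pi * (k \<bullet> y))) *\<^sub>R \<rho>) \<le> B" for x y by (rule bnd) simp
  qed
  then show "\<exists>U B. corrector (\<lambda>x y. (a x * sin (2 * pi * (k \<bullet> y))) *\<^sub>R (transpose R *v k)) U B" unfolding \<rho>_def by blast
qed

lemma corrector_joint_measurable:
  assumes W: "corrector W U B"
  shows "(\<lambda>z. W (fst z) (snd z)) \<in> borel_measurable PM"
proof (rule Caratheodory_measurable[where F="\<lambda>z. W (fst z)" and g=snd, OF _ _ snd_PM])
  show "(\<lambda>z. W (fst z) v) \<in> borel_measurable PM" for v
  proof -
    have "(\<lambda>x. W x v) \<in> borel_measurable borel" using W by (simp add: corrector_def)
    from measurable_compose[OF fst_PM borel_measurable_lebesgue_onI[OF this]] show ?thesis .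
  qed
qed (use W in \<open>auto simp: corrector_def\<close>)

lemma corrector_Lp:
  assumes W: "corrector W U B"
  shows "Lp_fun PM p (\<lambda>z. W (fst z) (snd z))"
  by (rule Lp_fun_bounded[OF finite_measure_PM corrector_joint_measurable[OF W], where B=B])
     (use W p0 in \<open>auto simp: corrector_def\<close>)

text \<open>The \<open>L^p\<close> closure of the fields that gradients realise up to an error of
  size \<open>eps j\<close>. The recovery sequence is built from this property of \<open>w\<close>
  alone.\<close>

definition corrector_approximable :: "((real^'n) \<times> (real^'m) \<Rightarrow> real^'n) \<Rightarrow> bool" where
  "corrector_approximable V \<longleftrightarrow> Lp_fun PM p V \<and>
     (\<forall>e>0. \<exists>W U B. corrector W U B \<and> (LINT z|PM. norm (V z - W (fst z) (snd z)) powr p) < e)"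

lemma corrector_approximable_closed:
  assumes V: "Lp_fun PM p V"
    and approx: "\<And>e. e > 0 \<Longrightarrow> \<exists>V'. corrector_approximable V' \<and> (LINT z|PM. norm (V z - V' z) powr p) < e"
  shows "corrector_approximable V"
  unfolding corrector_approximable_def
proof (intro conjI allI impI V)
  fix e :: real assume "e > 0"
  define d where "d = e / (2 * 2 powr p)"
  have d: "d > 0" using \<open>e > 0\<close> by (simp add: d_def)
  obtain V' where V': "corrector_approximable V'" "(LINT z|PM. norm (V z - V' z) powr p) < d"
    using approx[OF d] by blast
  obtain W U B where W: "corrector W U B" "(LINT z|PM. norm (V' z - W (fst z) (snd z)) powr p) < d"
    using V'(1) d unfolding corrector_approximable_def by blast
  have V'L: "Lp_fun PM p V'" using V'(1) by (simp add: corrector_approximable_def)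
  have "(LINT z|PM. norm (V z - W (fst z) (snd z)) powr p) = (LINT z|PM. norm ((V z - V' z) + (V' z - W (fst z) (snd z))) powr p)"
    by simp
  also have "\<dots> \<le> 2 powr p * ((LINT z|PM. norm (V z - V' z) powr p) + (LINT z|PM. norm (V' z - W (fst z) (snd z)) powr p))"
    by (intro integral_powr_add_le Lp_fun_diff V V'L corrector_Lp[OF W(1)] p0)
  also have "\<dots> < 2 powr p * (d + d)" using V'(2) W(2) by (intro mult_strict_left_mono) auto
  also have "\<dots> = e" by (simp add: d_def)
  finally show "\<exists>W U B. corrector W U B \<and> (LINT z|PM. norm (V z - W (fst z) (snd z)) powr p) < e" using W(1) by blast
qed

lemma corrector_approximable_add:
  assumes V1: "corrector_approximable V1" and V2: "corrector_approximable V2"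
  shows "corrector_approximable (\<lambda>z. V1 z + V2 z)"
  unfolding corrector_approximable_def
proof (intro conjI allI impI)
  have L: "Lp_fun PM p V1" "Lp_fun PM p V2" using assms by (auto simp: corrector_approximable_def)
  show "Lp_fun PM p (\<lambda>z. V1 z + V2 z)" by (intro Lp_fun_add L p0)
  fix e :: real assume "e > 0"
  define d where "d = e / (2 * 2 powr p)"
  have d: "d > 0" using \<open>e > 0\<close> by (simp add: d_def)
  obtain W U B where W: "corrector W U B" "(LINT z|PM. norm (V1 z - W (fst z) (snd z)) powr p) < d"
    using V1 d unfolding corrector_approximable_def by blast
  obtain W' U' B' where W': "corrector W' U' B'" "(LINT z|PM. norm (V2 z - W' (fst z) (snd z)) powr p) < d"
    using V2 d unfolding corrector_approximable_def by blast
  have "(LINT z|PM. norm (V1 z + V2 z - (W (fst z) (snd z) + W' (fst z) (snd z))) powr p) = (LINT z|PM. norm ((V1 z - W (fst z) (snd z)) + (V2 z - W' (fst z) (snd z))) powr p)"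
    by (simp add: algebra_simps)
  also have "\<dots> \<le> 2 powr p * ((LINT z|PM. norm (V1 z - W (fst z) (snd z)) powr p) + (LINT z|PM. norm (V2 z - W' (fst z) (snd z)) powr p))"
    by (intro integral_powr_add_le Lp_fun_diff L corrector_Lp[OF W(1)] corrector_Lp[OF W'(1)] p0)
  also have "\<dots> < 2 powr p * (d + d)" using W(2) W'(2) by (intro mult_strict_left_mono) auto
  also have "\<dots> = e" by (simp add: d_def)
  finally show "\<exists>W U B. corrector W U B \<and> (LINT z|PM. norm (V1 z + V2 z - W (fst z) (snd z)) powr p) < e"
    using corrector_add[OF W(1) W'(1)] by blast
qed

lemma corrector_approximable_cong_AE:
  assumes V': "corrector_approximable V'" and V: "V \<in> borel_measurable PM" and ae: "AE z in PM. V z = V' z"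
  shows "corrector_approximable V"
  unfolding corrector_approximable_def
proof (intro conjI allI impI)
  have V'L: "Lp_fun PM p V'" using V' by (simp add: corrector_approximable_def)
  note V'm = Lp_fun_measurable[OF V'L]
  show "Lp_fun PM p V" by (rule Lp_fun_mono[OF V'L V]) (use ae p0 in \<open>auto elim: eventually_mono\<close>)
  fix e :: real assume "e > 0"
  then obtain W U B where W: "corrector W U B" "(LINT z|PM. norm (V' z - W (fst z) (snd z)) powr p) < e"
    using V' unfolding corrector_approximable_def by blast
  have "(LINT z|PM. norm (V z - W (fst z) (snd z)) powr p) = (LINT z|PM. norm (V' z - W (fst z) (snd z)) powr p)"
  proof (rule integral_cong_AE)
    show "(\<lambda>z. norm (V z - W (fst z) (snd z)) powr p) \<in> borel_measurable PM"
      "(\<lambda>z. norm (V' z - W (fst z) (snd z)) powr p) \<in> borel_measurable PM"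
      using V V'm corrector_joint_measurable[OF W(1)] by measurable
    show "AE z in PM. norm (V z - W (fst z) (snd z)) powr p = norm (V' z - W (fst z) (snd z)) powr p"
      using ae by eventually_elim simp
  qed
  then have "(LINT z|PM. norm (V z - W (fst z) (snd z)) powr p) < e" using W(2) by simp
  then show "\<exists>W U B. corrector W U B \<and> (LINT z|PM. norm (V z - W (fst z) (snd z)) powr p) < e" using W(1) by blast
qed

text \<open>A coefficient in \<open>L^p\<close> is close to a test function, and multiplying the
  difference by the bounded mode costs only the factor \<open>norm \<rho> powr p\<close>.\<close>

lemma corrector_approximable_monomial:
  fixes f :: "real^'m \<Rightarrow> real"
  assumes a: "Lp_fun MO p a"
    and f: "f \<in> borel_measurable borel" "\<And>y. \<bar>f y\<bar> \<le> 1"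
    and corr: "\<And>\<psi>. test_fun \<Omega> \<psi> \<Longrightarrow> \<exists>U B. corrector (\<lambda>x y. (\<psi> x * f y) *\<^sub>R \<rho>) U B"
  shows "corrector_approximable (\<lambda>z. (a (fst z) * f (snd z)) *\<^sub>R \<rho>)"
proof -
  have fm: "(\<lambda>z. f (snd z)) \<in> borel_measurable PM" by (rule measurable_compose[OF snd_PM f(1)])
  have m: "(\<lambda>z. (b (fst z) * f (snd z)) *\<^sub>R \<rho>) \<in> borel_measurable PM" if "b \<in> borel_measurable MO" for b
    using fm measurable_compose[OF fst_PM that] by measurable
  have le: "norm ((b (fst z) * f (snd z)) *\<^sub>R \<rho>) powr p \<le> norm \<rho> powr p * \<bar>b (fst z)\<bar> powr p" for b and z :: "(real^'n) \<times> (real^'m)"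
  proof -
    have "\<bar>b (fst z)\<bar> * \<bar>f (snd z)\<bar> * norm \<rho> \<le> \<bar>b (fst z)\<bar> * 1 * norm \<rho>"
      using f(2) by (intro mult_right_mono mult_left_mono) auto
    then have "norm ((b (fst z) * f (snd z)) *\<^sub>R \<rho>) \<le> norm \<rho> * \<bar>b (fst z)\<bar>" by (simp add: abs_mult mult.commute)
    then have "norm ((b (fst z) * f (snd z)) *\<^sub>R \<rho>) powr p \<le> (norm \<rho> * \<bar>b (fst z)\<bar>) powr p"
      using p0 by (intro powr_mono2) auto
    then show ?thesis by (simp add: powr_mult)
  qed
  have L: "Lp_fun PM p (\<lambda>z. (b (fst z) * f (snd z)) *\<^sub>R \<rho>)"
    "(LINT z|PM. norm ((b (fst z) * f (snd z)) *\<^sub>R \<rho>) powr p) \<le> norm \<rho> powr p * (LINT x|MO. \<bar>b x\<bar> powr p)"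
    if b: "Lp_fun MO p b" for b
  proof -
    note bi = Lp_fun_integrable[OF b, unfolded real_norm_def]
    note mb = m[OF Lp_fun_measurable[OF b]]
    have i: "integrable PM (\<lambda>z. norm \<rho> powr p * \<bar>b (fst z)\<bar> powr p)" using PM_fst(1)[OF bi] by simp
    have i2: "integrable PM (\<lambda>z. norm ((b (fst z) * f (snd z)) *\<^sub>R \<rho>) powr p)"
    proof (rule Bochner_Integration.integrable_bound[OF i])
      show "(\<lambda>z. norm ((b (fst z) * f (snd z)) *\<^sub>R \<rho>) powr p) \<in> borel_measurable PM"
      proof -
        have "(\<lambda>z. norm (h z) powr p) \<in> borel_measurable PM" if "h \<in> borel_measurable PM" for h :: "_ \<Rightarrow> real^'n"
          using that by measurable
        from this[OF mb] show ?thesis .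
      qed
      show "AE z in PM. norm (norm ((b (fst z) * f (snd z)) *\<^sub>R \<rho>) powr p) \<le> norm (norm \<rho> powr p * \<bar>b (fst z)\<bar> powr p)"
        using le[of b] by (intro AE_I2) (simp only: real_norm_def abs_of_nonneg powr_ge_zero mult_nonneg_nonneg)
    qed
    then show "Lp_fun PM p (\<lambda>z. (b (fst z) * f (snd z)) *\<^sub>R \<rho>)" using mb unfolding Lp_fun_def by blast
    have "(LINT z|PM. norm ((b (fst z) * f (snd z)) *\<^sub>R \<rho>) powr p) \<le> (LINT z|PM. norm \<rho> powr p * \<bar>b (fst z)\<bar> powr p)"
      by (rule integral_mono[OF i2 i]) (rule le)
    then show "(LINT z|PM. norm ((b (fst z) * f (snd z)) *\<^sub>R \<rho>) powr p) \<le> norm \<rho> powr p * (LINT x|MO. \<bar>b x\<bar> powr p)"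
      using PM_fst(2)[OF bi] by simp
  qed
  show ?thesis
    unfolding corrector_approximable_def
  proof (intro conjI allI impI L(1)[OF a])
    fix e :: real assume "e > 0"
    define d where "d = e / (norm \<rho> powr p + 1)"
    have pos: "norm \<rho> powr p + 1 > 0" by (simp add: add_nonneg_pos)
    have d: "d > 0" using \<open>e > 0\<close> pos by (simp add: d_def)
    obtain \<psi> where \<psi>: "test_fun \<Omega> \<psi>" "(LINT x|MO. \<bar>a x - \<psi> x\<bar> powr p) < d"
      using test_fun_denseE[OF \<Omega> p0(2) a d] by metis
    obtain U B where W: "corrector (\<lambda>x y. (\<psi> x * f y) *\<^sub>R \<rho>) U B" using corr[OF \<psi>(1)] by blast
    have "Lp_fun MO p (\<lambda>x. a x - \<psi> x)" by (intro Lp_fun_diff a test_fun_Lp_fun[OF \<psi>(1) \<Omega>] p0)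
    from L(2)[OF this]
    have "(LINT z|PM. norm ((a (fst z) * f (snd z)) *\<^sub>R \<rho> - (\<psi> (fst z) * f (snd z)) *\<^sub>R \<rho>) powr p) \<le> norm \<rho> powr p * (LINT x|MO. \<bar>a x - \<psi> x\<bar> powr p)"
      by (simp add: left_diff_distrib scaleR_left_diff_distrib)
    also have "\<dots> \<le> norm \<rho> powr p * d" using \<psi>(2) by (intro mult_left_mono) auto
    also have "\<dots> < (norm \<rho> powr p + 1) * d" using d by (simp add: algebra_simps)
    also have "\<dots> = e" using pos by (simp add: d_def)
    finally show "\<exists>W U B. corrector W U B \<and> (LINT z|PM. norm ((a (fst z) * f (snd z)) *\<^sub>R \<rho> - W (fst z) (snd z)) powr p) < e"
      using W by blast
  qed
qed

section \<open>Approximation of fields whose Fourier moments are parallel to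
  \<open>transpose R *v k\<close>\<close>

context
  fixes w
  assumes w: "product_Lp w"
    and moments: "AE x in MO. \<forall>k. int_vec k \<longrightarrow> (\<exists>\<alpha> \<beta>. \<forall>i. fcos (\<lambda>y. w (x, y) $ i) k = \<alpha> * (transpose R *v k) $ i \<and>
        fsin (\<lambda>y. w (x, y) $ i) k = \<beta> * (transpose R *v k) $ i)"
begin

text \<open>Recovers the proportionality factor from moments parallel to
  \<open>transpose R *v k\<close>, in a form measurable in \<open>x\<close>. If that vector is 0,
  division by zero gives 0, which is harmless because the coefficient always multiplies the same
  vector.\<close>

definition coeff_cos :: "real^'m \<Rightarrow> real^'n \<Rightarrow> real" where
  "coeff_cos k x = (\<Sum>l\<in>UNIV. (transpose R *v k) $ l * fcos (\<lambda>y. w (x, y) $ l) k) / ((transpose R *v k) \<bullet> (transpose R *v k))"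

definition coeff_sin :: "real^'m \<Rightarrow> real^'n \<Rightarrow> real" where
  "coeff_sin k x = (\<Sum>l\<in>UNIV. (transpose R *v k) $ l * fsin (\<lambda>y. w (x, y) $ l) k) / ((transpose R *v k) \<bullet> (transpose R *v k))"

lemma coeff_Lp: "Lp_fun MO p (coeff_cos k)" "Lp_fun MO p (coeff_sin k)"
proof -
  have c: "Lp_fun MO p (\<lambda>x. fcos (\<lambda>y. w (x, y) $ i) k)" and s: "Lp_fun MO p (\<lambda>x. fsin (\<lambda>y. w (x, y) $ i) k)" for i
    unfolding fcos_def fsin_def by (intro w_moment_Lp[OF w]; simp)+
  have gen: "Lp_fun MO p (\<lambda>x. (\<Sum>l\<in>UNIV. (transpose R *v k) $ l * a l x) / ((transpose R *v k) \<bullet> (transpose R *v k)))"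
    if a: "\<And>l. Lp_fun MO p (a l)" for a :: "'n \<Rightarrow> real^'n \<Rightarrow> real"
  proof -
    have "Lp_fun MO p (\<lambda>x. \<Sum>l\<in>UNIV. (transpose R *v k) $ l * a l x)"
      using Lp_fun_scaleR[OF a] p0 by (intro Lp_fun_sum) auto
    from Lp_fun_scaleR[OF this, of "1 / ((transpose R *v k) \<bullet> (transpose R *v k))"] show ?thesis by simp
  qed
  show "Lp_fun MO p (coeff_cos k)" "Lp_fun MO p (coeff_sin k)"
    unfolding coeff_cos_def[abs_def] coeff_sin_def[abs_def] by (intro gen c s)+
qed

lemma moments_coeff:
  "AE x in MO. \<forall>k i. int_vec k \<longrightarrow> fcos (\<lambda>y. w (x, y) $ i) k = coeff_cos k x * (transpose R *v k) $ i \<and>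
     fsin (\<lambda>y. w (x, y) $ i) k = coeff_sin k x * (transpose R *v k) $ i"
  using moments
proof eventually_elim
  case (elim x)
  show ?case
  proof (intro allI impI)
    fix k i assume "int_vec (k::real^'m)"
    define \<rho> where "\<rho> = transpose R *v k"
    obtain \<alpha> \<beta> where ab: "\<And>i. fcos (\<lambda>y. w (x, y) $ i) k = \<alpha> * \<rho> $ i" "\<And>i. fsin (\<lambda>y. w (x, y) $ i) k = \<beta> * \<rho> $ i"
      using elim \<open>int_vec k\<close> unfolding \<rho>_def by blast
    have "(\<Sum>l\<in>UNIV. \<rho> $ l * (t * \<rho> $ l)) = t * (\<rho> \<bullet> \<rho>)" for t
      by (simp add: inner_vec_def sum_distrib_left mult_ac)
    then have "coeff_cos k x = \<alpha> * (\<rho> \<bullet> \<rho>) / (\<rho> \<bullet> \<rho>)" "coeff_sin k x = \<beta> * (\<rho> \<bullet> \<rho>) / (\<rho> \<bullet> \<rho>)"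
      unfolding coeff_cos_def coeff_sin_def \<rho>_def[symmetric] ab by simp_all
    then have "\<alpha> * \<rho> $ i = coeff_cos k x * \<rho> $ i" "\<beta> * \<rho> $ i = coeff_sin k x * \<rho> $ i"
      by (cases "\<rho> = 0"; simp)+
    then show "fcos (\<lambda>y. w (x, y) $ i) k = coeff_cos k x * (transpose R *v k) $ i \<and>
     fsin (\<lambda>y. w (x, y) $ i) k = coeff_sin k x * (transpose R *v k) $ i"
      unfolding ab \<rho>_def[symmetric] by simp
  qed
qed

definition smoothed :: "(real^'m \<Rightarrow> real) \<Rightarrow> (real^'n) \<times> (real^'m) \<Rightarrow> real^'n" where
  "smoothed K z = (\<chi> i. cell_conv K (\<lambda>y. w (fst z, y) $ i) (snd z))"

lemma smoothed_measurable:
  assumes K: "trig_poly K"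
  shows "smoothed K \<in> borel_measurable PM"
proof (rule borel_measurable_vecI)
  fix i
  have wm: "(\<lambda>z. w z $ i) \<in> borel_measurable borel" by (rule borel_measurable_vec_nth[OF w_meas[OF w]])
  have idm: "(\<lambda>x. x) \<in> borel_measurable MO" by (rule borel_measurable_lebesgue_onI) simp
  have f1: "(\<lambda>t. fst (fst t)) \<in> borel_measurable (PM \<Otimes>\<^sub>M cell_measure)"
    by (rule measurable_compose[OF measurable_fst], rule measurable_compose[OF fst_PM idm])
  have f2: "(\<lambda>t. snd (fst t)) \<in> borel_measurable (PM \<Otimes>\<^sub>M cell_measure)"
    by (rule measurable_compose[OF measurable_fst snd_PM])
  have f3: "snd \<in> borel_measurable (PM \<Otimes>\<^sub>M cell_measure)"
    by (rule measurable_compose[OF measurable_snd]) (auto intro: cell_measurableI)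
  have "(\<lambda>t. K (snd (fst t) - snd t) * w (fst (fst t), snd t) $ i) \<in> borel_measurable (PM \<Otimes>\<^sub>M cell_measure)"
    by (intro borel_measurable_times borel_measurable_pairI[OF wm f1 f3] measurable_compose[OF borel_measurable_diff[OF f2 f3] trig_poly_measurable[OF K]])
  then have "(\<lambda>z. LINT y|cell_measure. K (snd z - y) * w (fst z, y) $ i) \<in> borel_measurable PM"
    by (intro sigma_finite_measure.borel_measurable_lebesgue_integral[OF sigma_finite_cell]) (simp add: case_prod_beta)
  then show "(\<lambda>z. smoothed K z $ i) \<in> borel_measurable PM" by (simp add: smoothed_def cell_conv_def)
qed

lemma w_component_integrable:
  "AE x in MO. \<forall>i. integrable cell_measure (\<lambda>y. w (x, y) $ i)"
  using w_slice_Lp[OF w]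
proof eventually_elim
  case (elim x)
  then show ?case using Lp_fun_imp_integrable[OF finite_measure_cell Lp_fun_vec_nth[OF elim p0(1)] p0(3)] by blast
qed

text \<open>A monomial kernel retains only the frequency \<open>k\<close> of each slice, and its
  moments are multiples of \<open>transpose R *v k\<close>. So the smoothed field is a sum of two
  approximable modes, almost everywhere: the slice must be integrable and its moments
  parallel.\<close>

lemma smoothed_approximable:
  assumes "trig_poly K"
  shows "corrector_approximable (smoothed K)"
  using assms
proof (induction rule: trig_poly.induct)
  case (cos k c)
  let ?\<rho> = "transpose R *v k"
  have Lc: "Lp_fun MO p (\<lambda>x. c * coeff_cos k x)" and Ls: "Lp_fun MO p (\<lambda>x. c * coeff_sin k x)"
    using Lp_fun_scaleR[OF coeff_Lp(1)] Lp_fun_scaleR[OF coeff_Lp(2)] by auto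
  have "corrector_approximable (\<lambda>z. ((c * coeff_cos k (fst z)) * cos (2 * pi * (k \<bullet> snd z))) *\<^sub>R ?\<rho> + ((c * coeff_sin k (fst z)) * sin (2 * pi * (k \<bullet> snd z))) *\<^sub>R ?\<rho>)"
    by (intro corrector_approximable_add corrector_approximable_monomial[OF Lc, where f="\<lambda>y. cos (2 * pi * (k \<bullet> y))"]
        corrector_approximable_monomial[OF Ls, where f="\<lambda>y. sin (2 * pi * (k \<bullet> y))"] corrector_monomial cos) auto
  moreover have "AE z in PM. smoothed (\<lambda>u. c * cos (2 * pi * (k \<bullet> u))) z =
      ((c * coeff_cos k (fst z)) * cos (2 * pi * (k \<bullet> snd z))) *\<^sub>R ?\<rho> + ((c * coeff_sin k (fst z)) * sin (2 * pi * (k \<bullet> snd z))) *\<^sub>R ?\<rho>"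
    using AE_PM_fst[OF w_component_integrable] AE_PM_fst[OF moments_coeff]
  proof eventually_elim
    case (elim z)
    have m: "fcos (\<lambda>y. w (fst z, y) $ i) k = coeff_cos k (fst z) * ?\<rho> $ i" "fsin (\<lambda>y. w (fst z, y) $ i) k = coeff_sin k (fst z) * ?\<rho> $ i" for i
      using elim(2) cos by auto
    have i: "integrable cell_measure (\<lambda>y. w (fst z, y) $ i)" for i using elim(1) by blast
    show ?case
      unfolding vec_eq_iff smoothed_def vec_lambda_beta cell_conv_cos[OF i] m by (simp add: algebra_simps)
  qed
  ultimately show ?case by (rule corrector_approximable_cong_AE[OF _ smoothed_measurable[OF trig_poly.cos[OF cos]]])
next
  case (sin k c)
  let ?\<rho> = "transpose R *v k"
  have Lc: "Lp_fun MO p (\<lambda>x. c * coeff_cos k x)" and Ls: "Lp_fun MO p (\<lambda>x. - c * coeff_sin k x)"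
    using Lp_fun_scaleR[OF coeff_Lp(1), where c=c] Lp_fun_scaleR[OF coeff_Lp(2), where c="-c"] by auto
  have "corrector_approximable (\<lambda>z. ((c * coeff_cos k (fst z)) * sin (2 * pi * (k \<bullet> snd z))) *\<^sub>R ?\<rho> + ((- c * coeff_sin k (fst z)) * cos (2 * pi * (k \<bullet> snd z))) *\<^sub>R ?\<rho>)"
    by (intro corrector_approximable_add corrector_approximable_monomial[OF Lc, where f="\<lambda>y. sin (2 * pi * (k \<bullet> y))"]
        corrector_approximable_monomial[OF Ls, where f="\<lambda>y. cos (2 * pi * (k \<bullet> y))"] corrector_monomial sin) auto
  moreover have "AE z in PM. smoothed (\<lambda>u. c * sin (2 * pi * (k \<bullet> u))) z =
      ((c * coeff_cos k (fst z)) * sin (2 * pi * (k \<bullet> snd z))) *\<^sub>R ?\<rho> + ((- c * coeff_sin k (fst z)) * cos (2 * pi * (k \<bullet> snd z))) *\<^sub>R ?\<rho>"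
    using AE_PM_fst[OF w_component_integrable] AE_PM_fst[OF moments_coeff]
  proof eventually_elim
    case (elim z)
    have m: "fcos (\<lambda>y. w (fst z, y) $ i) k = coeff_cos k (fst z) * ?\<rho> $ i" "fsin (\<lambda>y. w (fst z, y) $ i) k = coeff_sin k (fst z) * ?\<rho> $ i" for i
      using elim(2) sin by auto
    have i: "integrable cell_measure (\<lambda>y. w (fst z, y) $ i)" for i using elim(1) by blast
    show ?case
      unfolding vec_eq_iff smoothed_def vec_lambda_beta cell_conv_sin[OF i] m by (simp add: algebra_simps)
  qed
  ultimately show ?case by (rule corrector_approximable_cong_AE[OF _ smoothed_measurable[OF trig_poly.sin[OF sin]]])
next
  case (add f g)
  have "AE z in PM. smoothed (\<lambda>u. f u + g u) z = smoothed f z + smoothed g z"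
    using AE_PM_fst[OF w_component_integrable]
  proof eventually_elim
    case (elim z)
    have i: "integrable cell_measure (\<lambda>y. w (fst z, y) $ i)" for i using elim by blast
    show ?case by (simp add: vec_eq_iff smoothed_def cell_conv_add[OF add.hyps i])
  qed
  then show ?case
    by (rule corrector_approximable_cong_AE[OF corrector_approximable_add[OF add.IH] smoothed_measurable[OF trig_poly.add[OF add.hyps]]])
qed

text \<open>For almost every \<open>x\<close> the approximate identity converges in
  \<open>y\<close>; the bound on the smoothing error that is uniform in \<open>N\<close> gives a
  majorant integrable in \<open>x\<close>.\<close>

lemma smoothed_component_tendsto:
  "(\<lambda>N. LINT z|PM. \<bar>smoothed (peak_kernel N) z $ i - w z $ i\<bar> powr p) \<longlonglongrightarrow> 0"
proof -
  interpret pair_sigma_finite MO "cell_measure :: (real^'m) measure" by (rule pair_PM)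
  have wL: "Lp_fun PM p w" by (rule Lp_fun_product_Lp[OF w])
  have sL: "Lp_fun PM p (smoothed (peak_kernel N))" for N
    using smoothed_approximable[OF trig_poly_peak_kernel] by (simp add: corrector_approximable_def)
  have I: "integrable PM (\<lambda>z. \<bar>smoothed (peak_kernel N) z $ i - w z $ i\<bar> powr p)" for N
    using Lp_fun_integrable[OF Lp_fun_diff[OF Lp_fun_vec_nth[OF sL p0(1), of N i] Lp_fun_vec_nth[OF wL p0(1), of i] p0(1)]] by simp
  define h where "h N x = (LINT y|cell_measure. \<bar>cell_conv (peak_kernel N) (\<lambda>y. w (x, y) $ i) y - w (x, y) $ i\<bar> powr p)" for N x
  have h: "h N x = (LINT y|cell_measure. \<bar>smoothed (peak_kernel N) (x, y) $ i - w (x, y) $ i\<bar> powr p)" for N x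
    by (simp add: h_def smoothed_def)
  have hi: "integrable MO (h N)" for N unfolding h using integrable_fst'[OF I] .
  have eq: "(LINT z|PM. \<bar>smoothed (peak_kernel N) z $ i - w z $ i\<bar> powr p) = (LINT x|MO. h N x)" for N
    unfolding h using integral_fst'[OF I[of N]] by simp
  have "(\<lambda>N. LINT x|MO. h N x) \<longlonglongrightarrow> (LINT x|MO. 0)"
  proof (rule integral_dominated_convergence[where w="\<lambda>x. 2 powr p * 2 * (LINT y|cell_measure. norm (w (x, y)) powr p)"])
    show "h N \<in> borel_measurable MO" for N using hi by auto
    show "integrable MO (\<lambda>x. 2 powr p * 2 * (LINT y|cell_measure. norm (w (x, y)) powr p))"
      using w_slice_integrable[OF w] by simp
    show "AE x in MO. (\<lambda>N. h N x) \<longlonglongrightarrow> 0"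
      using w_slice_Lp[OF w]
    proof eventually_elim
      case (elim x)
      show ?case unfolding h_def by (rule cell_conv_Lp_tendsto[OF p Lp_fun_vec_nth[OF elim p0(1)]])
    qed
    show "AE x in MO. norm (h N x) \<le> 2 powr p * 2 * (LINT y|cell_measure. norm (w (x, y)) powr p)" for N
      using w_slice_Lp[OF w]
    proof eventually_elim
      case (elim x)
      note L = Lp_fun_vec_nth[OF elim p0(1), of i]
      have "h N x \<le> 2 powr p * 2 * (LINT y|cell_measure. \<bar>w (x, y) $ i\<bar> powr p)"
        unfolding h_def by (rule cell_conv_Lp_bound[OF p L])
      also have "\<dots> \<le> 2 powr p * 2 * (LINT y|cell_measure. norm (w (x, y)) powr p)"
        using Lp_fun_integrable[OF L] Lp_fun_integrable[OF elim] component_le_norm_cart p0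
        by (intro mult_left_mono integral_mono powr_mono2) auto
      finally have "h N x \<le> 2 powr p * 2 * (LINT y|cell_measure. norm (w (x, y)) powr p)" .
      moreover have "h N x \<ge> 0" unfolding h_def by (intro integral_nonneg_AE) auto
      ultimately show ?case by simp
    qed
  qed auto
  then show ?thesis by (simp add: eq)
qed

theorem moments_parallel_corrector_approximable: "corrector_approximable w"
proof (rule corrector_approximable_closed)
  show wL: "Lp_fun PM p w" by (rule Lp_fun_product_Lp[OF w])
  fix e :: real assume "e > 0"
  have sL: "Lp_fun PM p (smoothed (peak_kernel N))" for N
    using smoothed_approximable[OF trig_poly_peak_kernel] by (simp add: corrector_approximable_def)
  have cI: "integrable PM (\<lambda>z. \<bar>smoothed (peak_kernel N) z $ i - w z $ i\<bar> powr p)" for N i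
    using Lp_fun_integrable[OF Lp_fun_diff[OF Lp_fun_vec_nth[OF sL p0(1), of N i] Lp_fun_vec_nth[OF wL p0(1), of i] p0(1)]] by simp
  have "(\<lambda>N. real CARD('n) powr p * (\<Sum>i\<in>UNIV. LINT z|PM. \<bar>smoothed (peak_kernel N) z $ i - w z $ i\<bar> powr p)) \<longlonglongrightarrow> real CARD('n) powr p * (\<Sum>i\<in>(UNIV::'n set). 0)"
    by (intro tendsto_intros smoothed_component_tendsto)
  then have "\<forall>\<^sub>F N in sequentially. real CARD('n) powr p * (\<Sum>i\<in>UNIV. LINT z|PM. \<bar>smoothed (peak_kernel N) z $ i - w z $ i\<bar> powr p) < e"
    using \<open>e > 0\<close> by (intro order_tendstoD(2)[where y=0]) auto
  then obtain N where N: "real CARD('n) powr p * (\<Sum>i\<in>UNIV. LINT z|PM. \<bar>smoothed (peak_kernel N) z $ i - w z $ i\<bar> powr p) < e"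
    by (meson eventually_sequentially order_refl)
  have "(LINT z|PM. norm (w z - smoothed (peak_kernel N) z) powr p) \<le> (LINT z|PM. real CARD('n) powr p * (\<Sum>i\<in>UNIV. \<bar>smoothed (peak_kernel N) z $ i - w z $ i\<bar> powr p))"
  proof (rule integral_mono)
    show "integrable PM (\<lambda>z. norm (w z - smoothed (peak_kernel N) z) powr p)"
      by (rule Lp_fun_integrable[OF Lp_fun_diff[OF wL sL p0(1)]])
    show "integrable PM (\<lambda>z. real CARD('n) powr p * (\<Sum>i\<in>UNIV. \<bar>smoothed (peak_kernel N) z $ i - w z $ i\<bar> powr p))"
      by (intro integrable_mult_right Bochner_Integration.integrable_sum cI)
    show "norm (w z - smoothed (peak_kernel N) z) powr p \<le> real CARD('n) powr p * (\<Sum>i\<in>UNIV. \<bar>smoothed (peak_kernel N) z $ i - w z $ i\<bar> powr p)" for z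
      using norm_powr_le_sum[OF p0(1), of "smoothed (peak_kernel N) z - w z"] by (simp add: norm_minus_commute)
  qed
  also have "\<dots> = real CARD('n) powr p * (\<Sum>i\<in>UNIV. LINT z|PM. \<bar>smoothed (peak_kernel N) z $ i - w z $ i\<bar> powr p)"
    using cI by (simp add: Bochner_Integration.integral_sum)
  finally have "(LINT z|PM. norm (w z - smoothed (peak_kernel N) z) powr p) < e" using N by linarith
  then show "\<exists>V'. corrector_approximable V' \<and> (LINT z|PM. norm (w z - V' z) powr p) < e"
    using smoothed_approximable[OF trig_poly_peak_kernel] by blast
qed

end

end

subsection \<open>Recovery sequences\<close>

context oscillation_Lp
begin

lemma two_scale_testD:
  fixes \<phi> :: "real^'n \<Rightarrow> ((real^'m) \<Rightarrow>\<^sub>C (real^'n))"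
  assumes "two_scale_test \<Omega> q \<phi>"
  shows "Lp_fun MO q \<phi>" "periodic_cell (apply_bcontfun (\<phi> x))" "integrable MO (\<lambda>x. norm (\<phi> x))"
proof -
  show L: "Lp_fun MO q \<phi>" and "periodic_cell (apply_bcontfun (\<phi> x))"
    using assms by (auto simp: two_scale_test_def)
  have "(\<lambda>x. norm (\<phi> x)) \<in> borel_measurable MO"
    by (rule measurable_compose[OF Lp_fun_measurable[OF L]])
       (intro borel_measurable_continuous_onI continuous_intros)
  then have "Lp_fun MO q (\<lambda>x. norm (\<phi> x))" using L by (simp add: Lp_fun_def)
  moreover have "q \<ge> 1" using p by simp
  ultimately show "integrable MO (\<lambda>x. norm (\<phi> x))" by (rule Lp_fun_imp_integrable[OF finite_measure_MO])
qed

lemma two_scale_test_fast_measurable: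
  fixes \<phi> :: "real^'n \<Rightarrow> ((real^'m) \<Rightarrow>\<^sub>C (real^'n))"
  assumes "two_scale_test \<Omega> q \<phi>"
  shows "(\<lambda>x. apply_bcontfun (\<phi> x) (fast j x)) \<in> borel_measurable MO"
  by (rule Caratheodory_measurable[OF two_scale_test_measurable(1)[OF assms] _ fast_measurable]) auto

text \<open>By Cauchy-Schwarz the pairing is a Caratheodory integrand with majorant
  \<open>b x * norm (\<phi> x)\<close>. Letting the bound depend on \<open>x\<close> admits the
  unbounded slow gradient as well as corrector fields.\<close>

lemma mean_value_inner_test:
  fixes \<phi> :: "real^'n \<Rightarrow> ((real^'m) \<Rightarrow>\<^sub>C (real^'n))"
  assumes \<phi>: "two_scale_test \<Omega> q \<phi>"
    and V: "\<And>y. (\<lambda>x. V x y) \<in> borel_measurable MO" "\<And>x. continuous_on UNIV (V x)" "\<And>x. periodic_cell (V x)"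
      "\<And>x y. norm (V x y) \<le> b x"
    and b: "integrable MO (\<lambda>x. b x * norm (\<phi> x))"
  shows "(\<lambda>j. LINT x|MO. V x (fast j x) \<bullet> apply_bcontfun (\<phi> x) (fast j x)) \<longlonglongrightarrow>
      (LINT x|MO. LINT y|cell_measure. V x y \<bullet> apply_bcontfun (\<phi> x) y)"
    and "integrable MO (\<lambda>x. V x (fast j x) \<bullet> apply_bcontfun (\<phi> x) (fast j x))"
proof -
  let ?F = "\<lambda>x y. V x y \<bullet> apply_bcontfun (\<phi> x) y"
  have le: "\<bar>?F x y\<bar> \<le> b x * norm (\<phi> x)" for x y
  proof -
    have "\<bar>?F x y\<bar> \<le> norm (V x y) * norm (apply_bcontfun (\<phi> x) y)" by (rule Cauchy_Schwarz_ineq2)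
    also have "\<dots> \<le> b x * norm (\<phi> x)"
      by (intro mult_mono V(4) norm_bounded order.trans[OF norm_ge_zero V(4)]) auto
    finally show ?thesis .
  qed
  have F: "caratheodory ?F (\<lambda>x. b x * norm (\<phi> x))"
    unfolding caratheodory_def
  proof (intro conjI allI ballI le b)
    show "(\<lambda>x. ?F x y) \<in> borel_measurable MO" for y
      by (intro borel_measurable_inner V(1) two_scale_test_measurable(1)[OF \<phi>])
    show "continuous_on UNIV (?F x)" for x by (intro continuous_on_inner V(2)) auto
    show "periodic_cell (?F x)" for x
      using V(3)[of x] two_scale_testD(2)[OF \<phi>, of x] by (simp add: periodic_cell_def)
  qed
  show "(\<lambda>j. LINT x|MO. ?F x (fast j x)) \<longlonglongrightarrow> (LINT x|MO. LINT y|cell_measure. ?F x y)"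
    by (rule mean_value_tendsto[OF F])
  show "integrable MO (\<lambda>x. ?F x (fast j x))" by (rule F_fast_integrable[OF F])
qed

lemma corrector_nonneg: "corrector W U B \<Longrightarrow> 0 \<le> B"
  using order.trans[OF norm_ge_zero, of "W 0 0" B] by (simp add: corrector_def)

lemma corrector_fast_error:
  assumes W: "corrector W U B"
  shows "norm (grad (U j) x - W x (fast j x)) \<le> real CARD('n) * (B * eps j)"
proof -
  have "norm (grad (U j) x - W x (fast j x)) \<le> (\<Sum>i\<in>UNIV. \<bar>(grad (U j) x - W x (fast j x)) $ i\<bar>)" by (rule norm_le_l1_cart)
  also have "\<dots> \<le> (\<Sum>i\<in>(UNIV::'n set). B * eps j)"
    using W by (intro sum_mono) (auto simp: grad_def corrector_def)
  finally show ?thesis by simp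
qed

lemma corrector_fast_Lp:
  assumes W: "corrector W U B"
  shows "Lp_fun MO p (\<lambda>x. W x (fast j x))"
proof (rule Lp_fun_bounded[OF finite_measure_MO, where B=B])
  show "(\<lambda>x. W x (fast j x)) \<in> borel_measurable MO"
  proof (rule Caratheodory_measurable[OF _ _ fast_measurable])
    show "(\<lambda>x. W x v) \<in> borel_measurable MO" for v
      using W by (intro borel_measurable_lebesgue_onI) (simp add: corrector_def)
  qed (use W in \<open>simp add: corrector_def\<close>)
qed (use W p0 in \<open>auto simp: corrector_def\<close>)

lemma corrector_grad_Lp:
  assumes W: "corrector W U B"
  shows "Lp_fun MO p (grad (U j))" "Lp_fun MO p (U j)"
  using test_fun_W1p[of "U j"] W by (auto simp: corrector_def W1p_def)

text \<open>The gradient differs from \<open>W x (fast j x)\<close> by a multiple of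
  \<open>eps j\<close> uniformly in \<open>x\<close>, and \<open>norm (\<phi> x)\<close> is
  integrable; so the limit is that of the field, given by the mean value property.\<close>

lemma corrector_two_scale:
  fixes \<phi> :: "real^'n \<Rightarrow> ((real^'m) \<Rightarrow>\<^sub>C (real^'n))"
  assumes W: "corrector W U B" and \<phi>: "two_scale_test \<Omega> q \<phi>"
  shows "(\<lambda>j. LINT x|MO. grad (U j) x \<bullet> apply_bcontfun (\<phi> x) (fast j x)) \<longlonglongrightarrow>
      (LINT z|PM. W (fst z) (snd z) \<bullet> apply_bcontfun (\<phi> (fst z)) (snd z))"
proof -
  interpret pair_sigma_finite MO "cell_measure :: (real^'m) measure" by (rule pair_PM)
  note N = two_scale_testD(3)[OF \<phi>]
  have Wf: "\<And>y. (\<lambda>x. W x y) \<in> borel_measurable MO" "\<And>x. continuous_on UNIV (W x)" "\<And>x. periodic_cell (W x)" "\<And>x y. norm (W x y) \<le> B"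
    using W by (auto simp: corrector_def intro!: borel_measurable_lebesgue_onI)
  have BN: "integrable MO (\<lambda>x. B * norm (\<phi> x))" using N by simp
  note M = mean_value_inner_test[OF \<phi> Wf BN]
  have pm: "(\<lambda>z. W (fst z) (snd z) \<bullet> apply_bcontfun (\<phi> (fst z)) (snd z)) \<in> borel_measurable PM"
    by (intro borel_measurable_inner corrector_joint_measurable[OF W] two_scale_test_measurable(2)[OF \<phi>])
  have pi: "integrable PM (\<lambda>z. W (fst z) (snd z) \<bullet> apply_bcontfun (\<phi> (fst z)) (snd z))"
  proof (rule Bochner_Integration.integrable_bound[OF PM_fst(1)[OF BN] pm], rule AE_I2)
    fix z :: "(real^'n) \<times> (real^'m)"
    have "\<bar>W (fst z) (snd z) \<bullet> apply_bcontfun (\<phi> (fst z)) (snd z)\<bar> \<le> norm (W (fst z) (snd z)) * norm (apply_bcontfun (\<phi> (fst z)) (snd z))"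
      by (rule Cauchy_Schwarz_ineq2)
    also have "\<dots> \<le> B * norm (\<phi> (fst z))"
      by (intro mult_mono Wf(4) norm_bounded order.trans[OF norm_ge_zero Wf(4)]) auto
    finally show "norm (W (fst z) (snd z) \<bullet> apply_bcontfun (\<phi> (fst z)) (snd z)) \<le> norm (B * norm (\<phi> (fst z)))" by simp
  qed
  have lim: "(\<lambda>j. LINT x|MO. W x (fast j x) \<bullet> apply_bcontfun (\<phi> x) (fast j x)) \<longlonglongrightarrow>
      (LINT z|PM. W (fst z) (snd z) \<bullet> apply_bcontfun (\<phi> (fst z)) (snd z))"
    using M(1) integral_fst'[OF pi] by simp
  let ?r = "\<lambda>j x. (grad (U j) x - W x (fast j x)) \<bullet> apply_bcontfun (\<phi> x) (fast j x)"
  have r_le: "\<bar>?r j x\<bar> \<le> (real CARD('n) * (B * eps j)) * norm (\<phi> x)" for j x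
  proof -
    have "\<bar>?r j x\<bar> \<le> norm (grad (U j) x - W x (fast j x)) * norm (apply_bcontfun (\<phi> x) (fast j x))"
      by (rule Cauchy_Schwarz_ineq2)
    also have "\<dots> \<le> (real CARD('n) * (B * eps j)) * norm (\<phi> x)"
      by (intro mult_mono corrector_fast_error[OF W] norm_bounded order.trans[OF norm_ge_zero corrector_fast_error[OF W]]) auto
    finally show ?thesis .
  qed
  have rm: "?r j \<in> borel_measurable MO" for j
    by (intro borel_measurable_inner borel_measurable_diff Lp_fun_measurable[OF corrector_grad_Lp(1)[OF W]]
        Lp_fun_measurable[OF corrector_fast_Lp[OF W]] two_scale_test_fast_measurable[OF \<phi>])
  have ri: "integrable MO (?r j)" for j
    by (rule Bochner_Integration.integrable_bound[of _ "\<lambda>x. (real CARD('n) * (B * eps j)) * norm (\<phi> x)"])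
       (use N rm r_le in \<open>auto intro!: AE_I2 order.trans[OF r_le abs_ge_self]\<close>)
  have "(\<lambda>j. LINT x|MO. ?r j x) \<longlonglongrightarrow> 0"
  proof (rule Lim_null_comparison)
    show "\<forall>\<^sub>F j in sequentially. norm (LINT x|MO. ?r j x) \<le> (real CARD('n) * (B * eps j)) * (LINT x|MO. norm (\<phi> x))"
    proof (rule always_eventually, rule allI)
      fix j
      have "norm (LINT x|MO. ?r j x) \<le> (LINT x|MO. norm (?r j x))" by (rule integral_norm_bound)
      also have "\<dots> \<le> (LINT x|MO. (real CARD('n) * (B * eps j)) * norm (\<phi> x))"
        by (rule integral_mono[OF integrable_norm[OF ri]]) (use N r_le in auto)
      finally show "norm (LINT x|MO. ?r j x) \<le> (real CARD('n) * (B * eps j)) * (LINT x|MO. norm (\<phi> x))" by simp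
    qed
    have "(\<lambda>j. (real CARD('n) * (B * eps j)) * (LINT x|MO. norm (\<phi> x))) \<longlonglongrightarrow> (real CARD('n) * (B * 0)) * (LINT x|MO. norm (\<phi> x))"
      by (intro tendsto_intros eps)
    then show "(\<lambda>j. (real CARD('n) * (B * eps j)) * (LINT x|MO. norm (\<phi> x))) \<longlonglongrightarrow> 0" by simp
  qed
  from tendsto_add[OF lim this]
  have "(\<lambda>j. (LINT x|MO. W x (fast j x) \<bullet> apply_bcontfun (\<phi> x) (fast j x)) + (LINT x|MO. ?r j x)) \<longlonglongrightarrow>
      (LINT z|PM. W (fst z) (snd z) \<bullet> apply_bcontfun (\<phi> (fst z)) (snd z))" by simp
  moreover have "(LINT x|MO. W x (fast j x) \<bullet> apply_bcontfun (\<phi> x) (fast j x)) + (LINT x|MO. ?r j x) =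
      (LINT x|MO. grad (U j) x \<bullet> apply_bcontfun (\<phi> x) (fast j x))" for j
    by (subst Bochner_Integration.integral_add[OF M(2) ri, symmetric]) (simp add: inner_diff_left)
  ultimately show ?thesis by simp
qed

text \<open>The mean value property is applied to the p-th power of
  \<open>norm (W1 x y - W2 x y)\<close>: it turns the distance of two fields on the product into an
  asymptotic bound for their gradients. One half of \<open>\<delta>\<close> absorbs this
  convergence, the other the gradient errors of order \<open>eps j\<close>.\<close>

lemma corrector_grad_diff:
  assumes W1: "corrector W1 U1 B1" and W2: "corrector W2 U2 B2" and "\<delta> > 0"
  shows "\<forall>\<^sub>F j in sequentially. (LINT x|MO. norm (grad (U1 j) x - grad (U2 j) x) powr p) \<le>
     2 powr p * ((LINT z|PM. norm (W1 (fst z) (snd z) - W2 (fst z) (snd z)) powr p) + \<delta>)"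
proof -
  interpret pair_sigma_finite MO "cell_measure :: (real^'m) measure" by (rule pair_PM)
  define F where "F x y = norm (W1 x y - W2 x y) powr p" for x y
  note B0 = corrector_nonneg[OF W1] corrector_nonneg[OF W2]
  have bnd: "norm (W1 x y - W2 x y) \<le> B1 + B2" for x y
    using W1 W2 by (intro order.trans[OF norm_triangle_ineq4 add_mono]) (auto simp: corrector_def)
  have F: "caratheodory F (\<lambda>x. (B1 + B2) powr p)"
    unfolding caratheodory_def
  proof (intro conjI allI ballI)
    have m: "(\<lambda>x. W1 x y) \<in> borel_measurable MO" "(\<lambda>x. W2 x y) \<in> borel_measurable MO" for y
      using W1 W2 by (auto simp: corrector_def intro!: borel_measurable_lebesgue_onI)
    show "(\<lambda>x. F x y) \<in> borel_measurable MO" for y unfolding F_def using m[of y] by measurable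
    show "continuous_on UNIV (F x)" for x
      unfolding F_def using W1 W2 p0 by (intro continuous_on_powr' continuous_intros) (auto simp: corrector_def)
    show "periodic_cell (F x)" for x using W1 W2 by (simp add: F_def corrector_def periodic_cell_def)
    show "\<bar>F x y\<bar> \<le> (B1 + B2) powr p" for x y unfolding F_def using bnd p0 by (simp add: powr_mono2)
    show "integrable MO (\<lambda>x. (B1 + B2) powr p)" by (rule finite_measure.integrable_const[OF finite_measure_MO])
  qed
  have Fi: "integrable PM (\<lambda>z. F (fst z) (snd z))"
    using Lp_fun_integrable[OF Lp_fun_diff[OF corrector_Lp[OF W1] corrector_Lp[OF W2] p0(1)]] by (simp add: F_def)
  have lim: "(\<lambda>j. LINT x|MO. F x (fast j x)) \<longlonglongrightarrow> (LINT z|PM. F (fst z) (snd z))"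
    using mean_value_tendsto[OF F] integral_fst'[OF Fi] by simp
  define c where "c j = real CARD('n) * (B1 * eps j) + real CARD('n) * (B2 * eps j)" for j
  have "c \<longlonglongrightarrow> real CARD('n) * (B1 * 0) + real CARD('n) * (B2 * 0)" unfolding c_def by (intro tendsto_intros eps)
  then have c_lim: "c \<longlonglongrightarrow> 0" by simp
  have c0: "c j \<ge> 0" for j unfolding c_def using B0 eps(1)[of j] by simp
  have "(\<lambda>j. c j powr p * measure MO (space MO)) \<longlonglongrightarrow> 0 powr p * measure MO (space MO)"
    using p0 c0 by (intro tendsto_mult tendsto_powr' c_lim tendsto_const) auto
  then have "(\<lambda>j. c j powr p * measure MO (space MO)) \<longlonglongrightarrow> 0" by simp
  then have ev2: "\<forall>\<^sub>F j in sequentially. c j powr p * measure MO (space MO) < \<delta> / 2"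
    using \<open>\<delta> > 0\<close> by (intro order_tendstoD(2)[where y=0]) auto
  have ev1: "\<forall>\<^sub>F j in sequentially. (LINT x|MO. F x (fast j x)) < (LINT z|PM. F (fst z) (snd z)) + \<delta> / 2"
    using \<open>\<delta> > 0\<close> by (intro order_tendstoD(2)[OF lim]) auto
  from ev1 ev2 show ?thesis
  proof eventually_elim
    case (elim j)
    define f where "f x = W1 x (fast j x) - W2 x (fast j x)" for x
    define e where "e x = (grad (U1 j) x - W1 x (fast j x)) - (grad (U2 j) x - W2 x (fast j x))" for x
    have fL: "Lp_fun MO p f" unfolding f_def by (intro Lp_fun_diff corrector_fast_Lp[OF W1] corrector_fast_Lp[OF W2] p0)
    have eL: "Lp_fun MO p e" unfolding e_def
      by (intro Lp_fun_diff corrector_fast_Lp[OF W1] corrector_fast_Lp[OF W2] corrector_grad_Lp(1)[OF W1] corrector_grad_Lp(1)[OF W2] p0)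
    have e_le: "norm (e x) \<le> c j" for x
      unfolding e_def c_def
      by (intro order.trans[OF norm_triangle_ineq4 add_mono] corrector_fast_error[OF W1] corrector_fast_error[OF W2])
    have "(LINT x|MO. norm (e x) powr p) \<le> (LINT x|MO. c j powr p)"
      using Lp_fun_integrable[OF eL] finite_measure.integrable_const[OF finite_measure_MO] e_le p0
      by (intro integral_mono powr_mono2) auto
    then have eI: "(LINT x|MO. norm (e x) powr p) < \<delta> / 2" using elim(2) by (simp add: mult.commute)
    have "(LINT x|MO. norm (grad (U1 j) x - grad (U2 j) x) powr p) = (LINT x|MO. norm (f x + e x) powr p)"
      by (simp add: f_def e_def)
    also have "\<dots> \<le> 2 powr p * ((LINT x|MO. norm (f x) powr p) + (LINT x|MO. norm (e x) powr p))"
      by (rule integral_powr_add_le[OF fL eL p0(1)])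
    also have "\<dots> \<le> 2 powr p * ((LINT z|PM. F (fst z) (snd z)) + \<delta>)"
    proof (rule mult_left_mono)
      have "(LINT x|MO. norm (f x) powr p) = (LINT x|MO. F x (fast j x))" by (simp add: f_def F_def)
      then show "(LINT x|MO. norm (f x) powr p) + (LINT x|MO. norm (e x) powr p) \<le> (LINT z|PM. F (fst z) (snd z)) + \<delta>"
        using elim(1) eI by linarith
    qed simp
    finally show ?case by (simp add: F_def)
  qed
qed

theorem sufficiency:
  assumes w: "corrector_approximable w" and v0: "W1p \<Omega> p v0 g0"
  shows "\<exists>u g. (\<forall>j. W1p \<Omega> p (u j) (g j)) \<and> (\<exists>C. \<forall>j. W1p_norm_pow \<Omega> p (u j) (g j) \<le> C) \<and>
     (\<forall>\<phi>. two_scale_test \<Omega> q \<phi> \<longrightarrow>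
       (\<lambda>j. LINT x|MO. g j x \<bullet> apply_bcontfun (\<phi> x) (fast j x)) \<longlonglongrightarrow>
       (LINT x|MO. LINT y|cell_measure. g0 x \<bullet> apply_bcontfun (\<phi> x) y) + (LINT z|PM. w z \<bullet> apply_bcontfun (\<phi> (fst z)) (snd z)))"
proof -
  have wL: "Lp_fun PM p w" using w by (simp add: corrector_approximable_def)
  have "\<exists>t. corrector (fst t) (fst (snd t)) (snd (snd t)) \<and> (LINT z|PM. norm (w z - fst t (fst z) (snd z)) powr p) < 1 / real (Suc N)" for N
  proof -
    have "1 / real (Suc N) > 0" by simp
    then obtain W U B where WUB: "corrector W U B" "(LINT z|PM. norm (w z - W (fst z) (snd z)) powr p) < 1 / real (Suc N)"
      using w unfolding corrector_approximable_def by blast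
    show ?thesis by (rule exI[of _ "(W, U, B)"]) (use WUB in simp)
  qed
  then have "\<forall>N. \<exists>t. corrector (fst t) (fst (snd t)) (snd (snd t)) \<and> (LINT z|PM. norm (w z - fst t (fst z) (snd z)) powr p) < 1 / real (Suc N)"
    by blast
  from choice[OF this] obtain t where t: "\<forall>N. corrector (fst (t N)) (fst (snd (t N))) (snd (snd (t N))) \<and> (LINT z|PM. norm (w z - fst (t N) (fst z) (snd z)) powr p) < 1 / real (Suc N)"
    by blast
  define W' where "W' N = fst (t N)" for N
  define U' where "U' N = fst (snd (t N))" for N
  define B' where "B' N = snd (snd (t N))" for N
  have c': "corrector (W' N) (U' N) (B' N)" "(LINT z|PM. norm (w z - W' N (fst z) (snd z)) powr p) < 1 / real (Suc N)" for N
    using t unfolding W'_def U'_def B'_def by blast+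
  \<comment> \<open>The zero corrector at stage 0 is admissible for every \<open>j\<close>, and
    comparing the other stages with it bounds their gradients uniformly.\<close>
  define W where "W N = (if N = 0 then (\<lambda>x y. 0) else W' N)" for N
  define U where "U N = (if N = 0 then (\<lambda>j x. 0) else U' N)" for N
  define B where "B N = (if N = 0 then 0 else B' N)" for N
  have cor: "corrector (W N) (U N) (B N)" for N using c'(1)[of N] corrector_zero by (simp add: W_def U_def B_def)
  have close: "(LINT z|PM. norm (w z - W N (fst z) (snd z)) powr p) < 1 / real (Suc N)" if "N > 0" for N
    using c'(2)[of N] that by (simp add: W_def)
  note WL = corrector_Lp[OF cor] and gL = corrector_grad_Lp[OF cor]
  have grad0: "grad (U 0 j) x = 0" for j x by (simp add: grad_def U_def partial_deriv_const vec_eq_iff)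
  \<comment> \<open>The inner \<open>2 powr p * 2\<close> comes from passing through
    \<open>w\<close> with two errors of at most \<open>1 / real (Suc M)\<close>, the one from the
    slack \<open>1 / real (Suc N)\<close>, and the outer power from comparing gradients instead of
    fields.\<close>
  define c where "c = 2 powr p * (2 powr p * 2 + 1)"
  have c0: "c > 0" by (simp add: c_def add_nonneg_pos)
  have dist: "2 powr p * ((LINT z|PM. norm (W N (fst z) (snd z) - W M (fst z) (snd z)) powr p) + 1 / real (Suc N)) \<le> c / real (Suc M)"
    if "0 < M" "M \<le> N" for N M
  proof -
    have le: "1 / real (Suc N) \<le> 1 / real (Suc M)" using that by (simp add: field_simps)
    have "(LINT z|PM. norm (W N (fst z) (snd z) - W M (fst z) (snd z)) powr p) = (LINT z|PM. norm ((W N (fst z) (snd z) - w z) + (w z - W M (fst z) (snd z))) powr p)"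
      by simp
    also have "\<dots> \<le> 2 powr p * ((LINT z|PM. norm (W N (fst z) (snd z) - w z) powr p) + (LINT z|PM. norm (w z - W M (fst z) (snd z)) powr p))"
      by (intro integral_powr_add_le Lp_fun_diff WL wL p0)
    also have "\<dots> \<le> 2 powr p * (1 / real (Suc M) + 1 / real (Suc M))"
    proof (rule mult_left_mono[OF add_mono])
      show "(LINT z|PM. norm (W N (fst z) (snd z) - w z) powr p) \<le> 1 / real (Suc M)"
        using close[of N] that le unfolding norm_minus_commute[of "W N _ _"] by linarith
      show "(LINT z|PM. norm (w z - W M (fst z) (snd z)) powr p) \<le> 1 / real (Suc M)"
        using close[of M] that by linarith
    qed simp
    finally have "(LINT z|PM. norm (W N (fst z) (snd z) - W M (fst z) (snd z)) powr p) + 1 / real (Suc N) \<le> 2 powr p * (1 / real (Suc M) + 1 / real (Suc M)) + 1 / real (Suc M)"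
      using le by linarith
    then have "2 powr p * ((LINT z|PM. norm (W N (fst z) (snd z) - W M (fst z) (snd z)) powr p) + 1 / real (Suc N)) \<le> 2 powr p * (2 powr p * (1 / real (Suc M) + 1 / real (Suc M)) + 1 / real (Suc M))"
      by (intro mult_left_mono) auto
    also have "\<dots> = c * (1 / real (Suc M))" unfolding c_def by (simp only: distrib_right distrib_left mult.assoc mult_2 mult_1)
    finally show ?thesis by simp
  qed
  define A where "A = (LINT z|PM. norm (w z) powr p)"
  have A0: "A \<ge> 0" unfolding A_def by (intro integral_nonneg_AE) auto
  have W_bound: "(LINT z|PM. norm (W N (fst z) (snd z)) powr p) \<le> 2 powr p * (1 + A)" for N
  proof (cases "N = 0")
    case True
    then show ?thesis using A0 by (simp add: W_def)
  next
    case False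
    have "1 / real (Suc N) \<le> 1" by simp
    then have 1: "(LINT z|PM. norm (W N (fst z) (snd z) - w z) powr p) \<le> 1"
      using close[of N] False unfolding norm_minus_commute[of "W N _ _"] by linarith
    have "(LINT z|PM. norm (W N (fst z) (snd z)) powr p) = (LINT z|PM. norm ((W N (fst z) (snd z) - w z) + w z) powr p)" by simp
    also have "\<dots> \<le> 2 powr p * ((LINT z|PM. norm (W N (fst z) (snd z) - w z) powr p) + A)"
      unfolding A_def by (intro integral_powr_add_le Lp_fun_diff WL wL p0)
    also have "\<dots> \<le> 2 powr p * (1 + A)" using 1 by (intro mult_left_mono) auto
    finally show ?thesis .
  qed
  \<comment> \<open>Stage \<open>N\<close> is admissible at \<open>j\<close> when its gradient is
    already comparable in \<open>L^p\<close> with those of all earlier stages and its potential is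
    bounded. No test field occurs, so one diagonal choice serves all of them.\<close>
  define Q where "Q N j \<longleftrightarrow> (\<forall>M\<le>N. (LINT x|MO. norm (grad (U N j) x - grad (U M j) x) powr p) \<le>
        2 powr p * ((LINT z|PM. norm (W N (fst z) (snd z) - W M (fst z) (snd z)) powr p) + 1 / real (Suc N)))
      \<and> (LINT x|MO. \<bar>U N j x\<bar> powr p) \<le> 1" for N j
  have Q0: "Q 0 j" for j by (simp add: Q_def U_def)
  have Q_ev: "\<forall>\<^sub>F j in sequentially. Q N j" for N
  proof -
    have "\<forall>\<^sub>F j in sequentially. \<forall>M\<in>{..N}. (LINT x|MO. norm (grad (U N j) x - grad (U M j) x) powr p) \<le>
        2 powr p * ((LINT z|PM. norm (W N (fst z) (snd z) - W M (fst z) (snd z)) powr p) + 1 / real (Suc N))"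
      by (intro eventually_ball_finite ballI corrector_grad_diff[OF cor cor]) auto
    moreover have "\<forall>\<^sub>F j in sequentially. (LINT x|MO. \<bar>U N j x\<bar> powr p) \<le> 1"
    proof -
      note B0 = corrector_nonneg[OF cor[of N]]
      have "(\<lambda>j. B N * eps j) \<longlonglongrightarrow> B N * 0" by (intro tendsto_intros eps)
      then have "(\<lambda>j. (B N * eps j) powr p * measure MO (space MO)) \<longlonglongrightarrow> 0 powr p * measure MO (space MO)"
        using p0 B0 eps(1) by (intro tendsto_mult tendsto_powr' tendsto_const) (auto simp: less_imp_le)
      then have "\<forall>\<^sub>F j in sequentially. (B N * eps j) powr p * measure MO (space MO) < 1"
        by (intro order_tendstoD(2)[where y="0 powr p * measure MO (space MO)"]) auto
      then show ?thesis
      proof eventually_elim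
        case (elim j)
        have "(LINT x|MO. \<bar>U N j x\<bar> powr p) \<le> (LINT x|MO. (B N * eps j) powr p)"
          using Lp_fun_integrable[OF gL(2), of N j] finite_measure.integrable_const[OF finite_measure_MO] cor[of N] p0
          by (intro integral_mono powr_mono2) (auto simp: corrector_def)
        then show ?case using elim by (simp add: mult.commute)
      qed
    qed
    ultimately show ?thesis by eventually_elim (auto simp: Q_def)
  qed
  \<comment> \<open>The cap by \<open>j\<close> makes the set finite and stage 0 makes it nonempty.
    Each fixed stage is admissible for all large \<open>j\<close>, so \<open>nn j\<close> tends to
    infinity.\<close>
  define nn where "nn j = Max {N. N \<le> j \<and> Q N j}" for j
  have fin: "finite {N. N \<le> j \<and> Q N j}" for j by simp
  have nnQ: "Q (nn j) j" for j
    using Max_in[OF fin, of j] Q0[of j] unfolding nn_def by blast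
  have nn_ev: "\<forall>\<^sub>F j in sequentially. M \<le> nn j" for M
    using Q_ev[of M] eventually_ge_at_top[of M]
    by eventually_elim (auto simp: nn_def intro: Max_ge[OF fin])
  define u where "u j x = v0 x + U (nn j) j x" for j x
  define g where "g j x = g0 x + grad (U (nn j) j) x" for j x
  have v0L: "Lp_fun MO p v0" and g0L: "Lp_fun MO p g0" using v0 by (auto simp: W1p_def)
  have Wug: "W1p \<Omega> p (u j) (g j)" for j
    unfolding u_def g_def using cor[of "nn j"] by (intro W1p_add v0 test_fun_W1p) (auto simp: corrector_def)
  have bound: "W1p_norm_pow \<Omega> p (u j) (g j) \<le> 2 powr p * ((LINT x|MO. \<bar>v0 x\<bar> powr p) + 1) +
      2 powr p * ((LINT x|MO. norm (g0 x) powr p) + 2 powr p * (2 powr p * (1 + A) + 1))" for j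
  proof -
    have "(LINT x|MO. \<bar>u j x\<bar> powr p) \<le> 2 powr p * ((LINT x|MO. \<bar>v0 x\<bar> powr p) + (LINT x|MO. \<bar>U (nn j) j x\<bar> powr p))"
      using integral_powr_add_le[OF v0L gL(2)[of "nn j" j] p0(1)] by (simp add: u_def)
    also have "\<dots> \<le> 2 powr p * ((LINT x|MO. \<bar>v0 x\<bar> powr p) + 1)"
      using nnQ[of j] by (intro mult_left_mono) (auto simp: Q_def)
    finally have 1: "(LINT x|MO. \<bar>u j x\<bar> powr p) \<le> 2 powr p * ((LINT x|MO. \<bar>v0 x\<bar> powr p) + 1)" .
    have "(LINT x|MO. norm (grad (U (nn j) j) x - grad (U 0 j) x) powr p) \<le> 2 powr p * ((LINT z|PM. norm (W (nn j) (fst z) (snd z) - W 0 (fst z) (snd z)) powr p) + 1 / real (Suc (nn j)))"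
      using nnQ[of j] by (simp add: Q_def)
    also have "\<dots> \<le> 2 powr p * (2 powr p * (1 + A) + 1)"
      using W_bound[of "nn j"] by (intro mult_left_mono add_mono) (auto simp: W_def)
    finally have 2: "(LINT x|MO. norm (grad (U (nn j) j) x) powr p) \<le> 2 powr p * (2 powr p * (1 + A) + 1)" by (simp add: grad0)
    have "(LINT x|MO. norm (g j x) powr p) \<le> 2 powr p * ((LINT x|MO. norm (g0 x) powr p) + (LINT x|MO. norm (grad (U (nn j) j) x) powr p))"
      unfolding g_def by (rule integral_powr_add_le[OF g0L gL(1) p0(1)])
    also have "\<dots> \<le> 2 powr p * ((LINT x|MO. norm (g0 x) powr p) + 2 powr p * (2 powr p * (1 + A) + 1))"
      using 2 by (intro mult_left_mono) auto
    finally show ?thesis using 1 unfolding W1p_norm_pow_def by linarith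
  qed
  have conv: "(\<lambda>j. LINT x|MO. g j x \<bullet> apply_bcontfun (\<phi> x) (fast j x)) \<longlonglongrightarrow>
       (LINT x|MO. LINT y|cell_measure. g0 x \<bullet> apply_bcontfun (\<phi> x) y) + (LINT z|PM. w z \<bullet> apply_bcontfun (\<phi> (fst z)) (snd z))"
    if \<phi>: "two_scale_test \<Omega> q \<phi>" for \<phi>
  proof -
    note \<phi>L = two_scale_testD(1)[OF \<phi>]
    have \<phi>fm: "(\<lambda>x. apply_bcontfun (\<phi> x) (fast j x)) \<in> borel_measurable MO" for j by (rule two_scale_test_fast_measurable[OF \<phi>])
    have g0b: "integrable MO (\<lambda>x. norm (g0 x) * norm (\<phi> x))" by (rule Lp_fun_mult(1)[OF g0L \<phi>L p])
    have G: "(\<lambda>j. LINT x|MO. g0 x \<bullet> apply_bcontfun (\<phi> x) (fast j x)) \<longlonglongrightarrow> (LINT x|MO. LINT y|cell_measure. g0 x \<bullet> apply_bcontfun (\<phi> x) y)"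
      and Gi: "integrable MO (\<lambda>x. g0 x \<bullet> apply_bcontfun (\<phi> x) (fast j x))" for j
      using mean_value_inner_test[OF \<phi>, of "\<lambda>x y. g0 x" "\<lambda>x. norm (g0 x)"] g0b Lp_fun_measurable[OF g0L]
      by (auto simp: periodic_cell_def)
    have pair_bound: "integrable MO (\<lambda>x. h x \<bullet> apply_bcontfun (\<phi> x) (fast j x))"
      "t > 0 \<Longrightarrow> \<bar>LINT x|MO. h x \<bullet> apply_bcontfun (\<phi> x) (fast j x)\<bar> \<le> t powr p * (LINT x|MO. norm (h x) powr p) + t powr - q * (LINT x|MO. norm (\<phi> x) powr q)"
      if h: "Lp_fun MO p h" for h j t
    proof -
      have le: "\<bar>h x \<bullet> apply_bcontfun (\<phi> x) (fast j x)\<bar> \<le> norm (h x) * norm (\<phi> x)" for x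
        by (rule order.trans[OF Cauchy_Schwarz_ineq2]) (intro mult_left_mono norm_bounded norm_ge_zero)
      note mi = Lp_fun_mult(1)[OF h \<phi>L p]
      show i: "integrable MO (\<lambda>x. h x \<bullet> apply_bcontfun (\<phi> x) (fast j x))"
        by (rule Bochner_Integration.integrable_bound[OF mi])
           (use le Lp_fun_measurable[OF h] \<phi>fm in \<open>auto intro!: borel_measurable_inner\<close>)
      assume t: "t > 0"
      have "\<bar>LINT x|MO. h x \<bullet> apply_bcontfun (\<phi> x) (fast j x)\<bar> \<le> (LINT x|MO. \<bar>h x \<bullet> apply_bcontfun (\<phi> x) (fast j x)\<bar>)" by (rule integral_abs_bound)
      also have "\<dots> \<le> (LINT x|MO. norm (h x) * norm (\<phi> x))" by (rule integral_mono[OF integrable_abs[OF i] mi le])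
      also have "\<dots> \<le> t powr p * (LINT x|MO. norm (h x) powr p) + t powr - q * (LINT x|MO. norm (\<phi> x) powr q)"
        by (rule Lp_fun_mult(2)[OF h \<phi>L p t])
      finally show "\<bar>LINT x|MO. h x \<bullet> apply_bcontfun (\<phi> x) (fast j x)\<bar> \<le> t powr p * (LINT x|MO. norm (h x) powr p) + t powr - q * (LINT x|MO. norm (\<phi> x) powr q)" .
    qed
    define Aq where "Aq = (LINT x|MO. norm (\<phi> x) powr q)"
    have Aq0: "Aq \<ge> 0" unfolding Aq_def by (intro integral_nonneg_AE) auto
    have \<phi>PL: "Lp_fun PM q (\<lambda>z. \<phi> (fst z))"
      using PM_fst(1)[OF Lp_fun_integrable[OF \<phi>L]] measurable_compose[OF fst_PM Lp_fun_measurable[OF \<phi>L]] by (simp add: Lp_fun_def)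
    have \<phi>PA: "(LINT z|PM. norm (\<phi> (fst z)) powr q) = Aq"
      unfolding Aq_def by (rule PM_fst(2)[OF Lp_fun_integrable[OF \<phi>L]])
    have PM_bound: "integrable PM (\<lambda>z. h z \<bullet> apply_bcontfun (\<phi> (fst z)) (snd z))"
      "t > 0 \<Longrightarrow> \<bar>LINT z|PM. h z \<bullet> apply_bcontfun (\<phi> (fst z)) (snd z)\<bar> \<le> t powr p * (LINT z|PM. norm (h z) powr p) + t powr - q * Aq"
      if h: "Lp_fun PM p h" for h t
    proof -
      have le: "\<bar>h z \<bullet> apply_bcontfun (\<phi> (fst z)) (snd z)\<bar> \<le> norm (h z) * norm (\<phi> (fst z))" for z
        by (rule order.trans[OF Cauchy_Schwarz_ineq2]) (intro mult_left_mono norm_bounded norm_ge_zero)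
      note mi = Lp_fun_mult(1)[OF h \<phi>PL p]
      have m: "(\<lambda>z. h z \<bullet> apply_bcontfun (\<phi> (fst z)) (snd z)) \<in> borel_measurable PM"
        by (intro borel_measurable_inner Lp_fun_measurable[OF h] two_scale_test_measurable(2)[OF \<phi>])
      show i: "integrable PM (\<lambda>z. h z \<bullet> apply_bcontfun (\<phi> (fst z)) (snd z))"
      proof (rule Bochner_Integration.integrable_bound[OF mi m], rule AE_I2)
        show "norm (h z \<bullet> apply_bcontfun (\<phi> (fst z)) (snd z)) \<le> norm (norm (h z) * norm (\<phi> (fst z)))" for z
          using le[of z] by simp
      qed
      assume t: "t > 0"
      have "\<bar>LINT z|PM. h z \<bullet> apply_bcontfun (\<phi> (fst z)) (snd z)\<bar> \<le> (LINT z|PM. \<bar>h z \<bullet> apply_bcontfun (\<phi> (fst z)) (snd z)\<bar>)" by (rule integral_abs_bound)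
      also have "\<dots> \<le> (LINT z|PM. norm (h z) * norm (\<phi> (fst z)))" by (rule integral_mono[OF integrable_abs[OF i] mi le])
      also have "\<dots> \<le> t powr p * (LINT z|PM. norm (h z) powr p) + t powr - q * (LINT z|PM. norm (\<phi> (fst z)) powr q)"
        by (rule Lp_fun_mult(2)[OF h \<phi>PL p t])
      finally show "\<bar>LINT z|PM. h z \<bullet> apply_bcontfun (\<phi> (fst z)) (snd z)\<bar> \<le> t powr p * (LINT z|PM. norm (h z) powr p) + t powr - q * Aq"
        unfolding \<phi>PA .
    qed
    have main: "(\<lambda>j. LINT x|MO. grad (U (nn j) j) x \<bullet> apply_bcontfun (\<phi> x) (fast j x)) \<longlonglongrightarrow> (LINT z|PM. w z \<bullet> apply_bcontfun (\<phi> (fst z)) (snd z))"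
    proof (rule LIMSEQ_I)
      fix e :: real assume "e > 0"
      \<comment> \<open>Young's parameter is large enough to make the term with the test field at
        most \<open>e / 8\<close>. Afterwards \<open>M\<close> is taken so large that
        \<open>t powr p\<close> times the distances beyond stage \<open>M\<close> is at most
        \<open>e / 8\<close>; the numerator \<open>c + 1\<close> covers the distance of gradients
        and that of \<open>W M\<close> to \<open>w\<close>.\<close>
      define t where "t = (8 * (Aq + 1) / e) powr (1 / q)"
      have t: "t > 0" using Aq0 \<open>e > 0\<close> by (auto simp: t_def)
      have "t powr q = 8 * (Aq + 1) / e" using Aq0 \<open>e > 0\<close> p by (simp add: t_def powr_powr)
      then have tq: "t powr - q = e / (8 * (Aq + 1))" by (simp add: powr_minus)
      have tA: "t powr - q * Aq \<le> e / 8"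
      proof -
        have "t powr - q * Aq \<le> t powr - q * (Aq + 1)" by (intro mult_left_mono) auto
        also have "\<dots> = e / 8" unfolding tq using Aq0 by (simp add: field_simps)
        finally show ?thesis .
      qed
      have "(\<lambda>M. t powr p * ((c + 1) / real (Suc M))) \<longlonglongrightarrow> t powr p * 0"
        by (intro tendsto_mult tendsto_const LIMSEQ_Suc lim_const_over_n)
      then have "\<forall>\<^sub>F M in sequentially. t powr p * ((c + 1) / real (Suc M)) < e / 8"
        using \<open>e > 0\<close> by (intro order_tendstoD(2)[where y="t powr p * 0"]) auto
      from eventually_conj[OF this eventually_gt_at_top[of 0]]
      obtain M where M: "M > 0" "t powr p * ((c + 1) / real (Suc M)) < e / 8"
        using eventually_happens sequentially_bot by blast
      have tc: "t powr p * (c / real (Suc M)) \<le> e / 8" "t powr p * (1 / real (Suc M)) \<le> e / 8"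
      proof -
        have "t powr p * (c / real (Suc M)) \<le> t powr p * ((c + 1) / real (Suc M))" "t powr p * (1 / real (Suc M)) \<le> t powr p * ((c + 1) / real (Suc M))"
          using c0 by (intro mult_left_mono divide_right_mono; simp)+
        then show "t powr p * (c / real (Suc M)) \<le> e / 8" "t powr p * (1 / real (Suc M)) \<le> e / 8" using M(2) by linarith+
      qed
      have III: "\<bar>LINT z|PM. (W M (fst z) (snd z) - w z) \<bullet> apply_bcontfun (\<phi> (fst z)) (snd z)\<bar> \<le> e / 4"
      proof -
        have "\<bar>LINT z|PM. (W M (fst z) (snd z) - w z) \<bullet> apply_bcontfun (\<phi> (fst z)) (snd z)\<bar> \<le> t powr p * (LINT z|PM. norm (W M (fst z) (snd z) - w z) powr p) + t powr - q * Aq"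
          by (rule PM_bound(2)[OF Lp_fun_diff[OF WL wL p0(1)] t])
        also have "t powr p * (LINT z|PM. norm (W M (fst z) (snd z) - w z) powr p) \<le> t powr p * (1 / real (Suc M))"
          using close[OF M(1)] unfolding norm_minus_commute[of "W M _ _"] by (intro mult_left_mono) auto
        finally show ?thesis using tc(2) tA by linarith
      qed
      have split3: "(LINT z|PM. (W M (fst z) (snd z) - w z) \<bullet> apply_bcontfun (\<phi> (fst z)) (snd z)) =
          (LINT z|PM. W M (fst z) (snd z) \<bullet> apply_bcontfun (\<phi> (fst z)) (snd z)) - (LINT z|PM. w z \<bullet> apply_bcontfun (\<phi> (fst z)) (snd z))"
        unfolding inner_diff_left by (intro Bochner_Integration.integral_diff PM_bound(1) WL wL)
      have ev: "\<forall>\<^sub>F j in sequentially. norm ((LINT x|MO. grad (U M j) x \<bullet> apply_bcontfun (\<phi> x) (fast j x)) - (LINT z|PM. W M (fst z) (snd z) \<bullet> apply_bcontfun (\<phi> (fst z)) (snd z))) < e / 4"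
        using LIMSEQ_D[OF corrector_two_scale[OF cor[of M] \<phi>], of "e/4"] \<open>e > 0\<close> by (auto simp: eventually_sequentially)
      have "\<forall>\<^sub>F j in sequentially. norm ((LINT x|MO. grad (U (nn j) j) x \<bullet> apply_bcontfun (\<phi> x) (fast j x)) - (LINT z|PM. w z \<bullet> apply_bcontfun (\<phi> (fst z)) (snd z))) < e"
        using ev nn_ev[of M]
      proof eventually_elim
        case (elim j)
        have "(LINT x|MO. norm (grad (U (nn j) j) x - grad (U M j) x) powr p) \<le> c / real (Suc M)"
          using nnQ[of j] elim(2) order.trans[OF _ dist[OF M(1) elim(2)]] unfolding Q_def by blast
        then have "t powr p * (LINT x|MO. norm (grad (U (nn j) j) x - grad (U M j) x) powr p) \<le> t powr p * (c / real (Suc M))"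
          by (intro mult_left_mono) auto
        then have I: "\<bar>LINT x|MO. (grad (U (nn j) j) x - grad (U M j) x) \<bullet> apply_bcontfun (\<phi> x) (fast j x)\<bar> \<le> e / 4"
          using pair_bound(2)[OF Lp_fun_diff[OF gL(1) gL(1) p0(1)] t, of "nn j" j M j j] tc(1) tA unfolding Aq_def by linarith
        have "(LINT x|MO. (grad (U (nn j) j) x - grad (U M j) x) \<bullet> apply_bcontfun (\<phi> x) (fast j x)) =
            (LINT x|MO. grad (U (nn j) j) x \<bullet> apply_bcontfun (\<phi> x) (fast j x)) - (LINT x|MO. grad (U M j) x \<bullet> apply_bcontfun (\<phi> x) (fast j x))"
          unfolding inner_diff_left by (intro Bochner_Integration.integral_diff pair_bound(1) gL)
        then show ?case using I III split3 elim(1) \<open>e > 0\<close> unfolding real_norm_def by linarith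
      qed
      then show "\<exists>no. \<forall>j\<ge>no. norm ((LINT x|MO. grad (U (nn j) j) x \<bullet> apply_bcontfun (\<phi> x) (fast j x)) - (LINT z|PM. w z \<bullet> apply_bcontfun (\<phi> (fst z)) (snd z))) < e"
        by (simp add: eventually_sequentially)
    qed
    have "(LINT x|MO. g j x \<bullet> apply_bcontfun (\<phi> x) (fast j x)) = (LINT x|MO. g0 x \<bullet> apply_bcontfun (\<phi> x) (fast j x)) + (LINT x|MO. grad (U (nn j) j) x \<bullet> apply_bcontfun (\<phi> x) (fast j x))" for j
      unfolding g_def inner_add_left by (intro Bochner_Integration.integral_add Gi pair_bound(1) gL)
    then show ?thesis using tendsto_add[OF G main] by simp
  qed
  show ?thesis using Wug bound conv by blast
qed

section \<open>Passing from the given decomposition to Borel representatives\<close>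

lemma AE_lebesgue_on_product:
  assumes "AE z in lebesgue_on S. P z"
  shows "AE x in MO. AE y in lebesgue_on unit_cell. P (x, y)"
proof -
  have "AE z in lebesgue. z \<in> S \<longrightarrow> P z" using assms S_lebesgue by (subst (asm) AE_restrict_space_iff) auto
  then have "AE z in lborel \<Otimes>\<^sub>M lborel. z \<in> S \<longrightarrow> P z" unfolding lborel_prod by (simp add: AE_completion_iff)
  from lborel_pair.AE_pair[OF this]
  have "AE x in MO. AE y in lborel. (x, y) \<in> S \<longrightarrow> P (x, y)"
    by (rule AE_lborel_imp_lebesgue_on[OF _ \<Omega>_lebesgue])
  then show ?thesis
    using AE_space
  proof eventually_elim
    case (elim x)
    from AE_completion[OF elim(1)] elim(2) show ?case
      by (subst AE_restrict_space_iff) auto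
  qed
qed

lemma AE_lebesgue_on_cell:
  assumes "AE y in lebesgue_on unit_cell. P y"
  shows "AE y in (cell_measure :: (real^'m) measure). P y"
proof -
  have "AE y in lebesgue. y \<in> unit_cell \<longrightarrow> P y" using assms by (subst (asm) AE_restrict_space_iff) auto
  then have "AE y in lborel. y \<in> unit_cell \<longrightarrow> P y" by (simp add: AE_completion_iff)
  then show ?thesis by (subst AE_restrict_space_iff) auto
qed

text \<open>Almost every slice of \<open>v1\<close> agrees almost everywhere with that of
  \<open>w\<close>, so both have the same Fourier coefficients. Real and imaginary parts of
  \<open>lam k\<close> then give the two factors, with a sign change for the sine.\<close>

lemma G_R_moments:
  assumes w: "product_Lp w" and G: "AE x in MO. v1 x \<in> G_R p R"
    and ae: "AE x in MO. AE y in lebesgue_on unit_cell. v1 x y = w (x, y)"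
  shows "AE x in MO. \<forall>k. int_vec k \<longrightarrow> (\<exists>\<alpha> \<beta>. \<forall>i. fcos (\<lambda>y. w (x, y) $ i) k = \<alpha> * (transpose R *v k) $ i \<and>
        fsin (\<lambda>y. w (x, y) $ i) k = \<beta> * (transpose R *v k) $ i)"
  using w_slice_Lp[OF w] G ae
proof eventually_elim
  case (elim x)
  have wi: "integrable cell_measure (\<lambda>y. w (x, y) $ i)" for i
    using Lp_fun_imp_integrable[OF finite_measure_cell Lp_fun_vec_nth[OF elim(1) p0(1)] p0(3)] .
  obtain lam :: "real^'m \<Rightarrow> complex" where lam: "\<And>k. int_vec k \<Longrightarrow> fourier_coeff (v1 x) k = (\<chi> i. lam k * complex_of_real ((transpose R *v k) $ i))"
    using elim(2) unfolding G_R_def by blast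
  have v1m: "v1 x \<in> borel_measurable (lebesgue_on unit_cell)" using elim(2) by (simp add: G_R_def Lp_fun_def)
  have wm: "(\<lambda>y. w (x, y)) \<in> borel_measurable (lebesgue_on unit_cell)"
    using borel_measurable_pairI[OF w_meas[OF w], of "\<lambda>y. x" borel "\<lambda>y. y"] by (intro borel_measurable_lebesgue_onI) simp
  have em: "(\<lambda>y. complex_of_real (h y $ i) * exp (- (2 * pi * \<i>) * complex_of_real (k \<bullet> y))) \<in> borel_measurable (lebesgue_on unit_cell)"
    if "h \<in> borel_measurable (lebesgue_on unit_cell)" for h :: "real^'m \<Rightarrow> real^'n" and k i
  proof (rule borel_measurable_times)
    show "(\<lambda>y. complex_of_real (h y $ i)) \<in> borel_measurable (lebesgue_on unit_cell)"
      using borel_measurable_vec_nth[OF that, of i] by measurable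
    show "(\<lambda>y. exp (- (2 * pi * \<i>) * complex_of_real (k \<bullet> y))) \<in> borel_measurable (lebesgue_on unit_cell)"
      by (intro borel_measurable_lebesgue_onI borel_measurable_continuous_onI continuous_intros)
  qed
  have four: "fourier_coeff (v1 x) k = fourier_coeff (\<lambda>y. w (x, y)) k" for k
    unfolding fourier_coeff_def
  proof (rule vec_eq_iff[THEN iffD2], rule allI, unfold vec_lambda_beta)
    fix i
    show "(LINT y|lebesgue_on unit_cell. complex_of_real (v1 x y $ i) * exp (- (2 * pi * \<i>) * complex_of_real (k \<bullet> y))) =
        (LINT y|lebesgue_on unit_cell. complex_of_real (w (x, y) $ i) * exp (- (2 * pi * \<i>) * complex_of_real (k \<bullet> y)))"
      by (rule integral_cong_AE[OF em[OF v1m] em[OF wm]]) (use elim(3) in \<open>auto elim: eventually_mono\<close>)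
  qed
  show ?case
  proof (intro allI impI)
    fix k :: "real^'m" assume k: "int_vec k"
    have "Complex (fcos (\<lambda>y. w (x, y) $ i) k) (- fsin (\<lambda>y. w (x, y) $ i) k) = lam k * complex_of_real ((transpose R *v k) $ i)" for i
      using lam[OF k] unfolding four fourier_coeff_eq[OF wi] by (simp add: vec_eq_iff)
    then have e: "fcos (\<lambda>y. w (x, y) $ i) k = Re (lam k) * (transpose R *v k) $ i" "- fsin (\<lambda>y. w (x, y) $ i) k = Im (lam k) * (transpose R *v k) $ i" for i
      by (simp_all add: complex_eq_iff)
    have "fsin (\<lambda>y. w (x, y) $ i) k = - Im (lam k) * (transpose R *v k) $ i" for i
      using e(2)[of i] by (simp only: mult_minus_left minus_equation_iff)
    with e(1) have "fcos (\<lambda>y. w (x, y) $ i) k = Re (lam k) * (transpose R *v k) $ i \<and> fsin (\<lambda>y. w (x, y) $ i) k = - Im (lam k) * (transpose R *v k) $ i" for i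
      by blast
    then show "\<exists>\<alpha> \<beta>. \<forall>i. fcos (\<lambda>y. w (x, y) $ i) k = \<alpha> * (transpose R *v k) $ i \<and> fsin (\<lambda>y. w (x, y) $ i) k = \<beta> * (transpose R *v k) $ i"
      by blast
  qed
qed

end

theorem theorem1p4:
  fixes \<Omega> :: "(real^'n) set" and p :: real and R :: "real^'n^'m"
    and eps :: "nat \<Rightarrow> real" and v :: "real^'n \<Rightarrow> real^'m \<Rightarrow> real^'n"
  assumes "open \<Omega>" and "bounded \<Omega>"
    and "CARD('n) < CARD('m)"
    and "1 < p"
    and "\<forall>k::real^'m. int_vec k \<and> k \<noteq> 0 \<longrightarrow> transpose R *v k \<noteq> 0"
    and "\<forall>j. 0 < eps j" and "eps \<longlonglongrightarrow> 0"
    and "Lp_fun (lebesgue_on (\<Omega> \<times> unit_cell)) p (\<lambda>z. v (fst z) (snd z))"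
  shows "(\<exists>u g. (\<forall>j. W1p \<Omega> p (u j) (g j)) \<and> (\<exists>C. \<forall>j. W1p_norm_pow \<Omega> p (u j) (g j) \<le> C)
              \<and> R_two_scale_conv \<Omega> p R eps g v)
    \<longleftrightarrow>
    (\<exists>v0 g0 v1. W1p \<Omega> p v0 g0
       \<and> Lp_fun (lebesgue_on (\<Omega> \<times> unit_cell)) p (\<lambda>z. v1 (fst z) (snd z))
       \<and> (AE x in lebesgue_on \<Omega>. v1 x \<in> G_R p R)
       \<and> (AE z in lebesgue_on (\<Omega> \<times> unit_cell). v (fst z) (snd z) = g0 (fst z) + v1 (fst z) (snd z)))"
proof -
  interpret oscillation_Lp \<Omega> R eps p
    by (intro oscillation_Lp.intro oscillation.intro oscillation_Lp_axioms.intro) (use assms in auto)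
  \<comment> \<open>From here on \<open>v\<close> is represented by a Borel field, in terms of which
    two-scale convergence is restated; the original field returns only through almost everywhere
    equality.\<close>
  obtain w where w: "product_Lp w" and wv: "AE z in lebesgue_on (\<Omega> \<times> unit_cell). v (fst z) (snd z) = w z"
    and wv': "AE x in lebesgue_on \<Omega>. AE y in lebesgue_on unit_cell. v x y = w (x, y)"
    using product_Lp_representative[OF assms(8)] .
  note conv_iff = R_two_scale_conv_representative[OF w wv']
  show ?thesis
  proof
    assume "\<exists>u g. (\<forall>j. W1p \<Omega> p (u j) (g j)) \<and> (\<exists>C. \<forall>j. W1p_norm_pow \<Omega> p (u j) (g j) \<le> C) \<and> R_two_scale_conv \<Omega> p R eps g v"
    then obtain u g C where W: "\<And>j. W1p \<Omega> p (u j) (g j)" and C: "\<And>j. W1p_norm_pow \<Omega> p (u j) (g j) \<le> C"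
      and conv: "R_two_scale_conv \<Omega> p R eps g v" by blast
    obtain v0 g0 v1 where "W1p \<Omega> p v0 g0" "Lp_fun (lebesgue_on (\<Omega> \<times> unit_cell)) p (\<lambda>z. v1 (fst z) (snd z))"
      "AE x in lebesgue_on \<Omega>. v1 x \<in> G_R p R" and eq: "\<forall>z\<in>\<Omega> \<times> unit_cell. w z = g0 (fst z) + v1 (fst z) (snd z)"
      using necessity[where u=u and g=g and C=C, OF W C w] conv unfolding conv_iff by blast
    moreover have "AE z in lebesgue_on (\<Omega> \<times> unit_cell). v (fst z) (snd z) = g0 (fst z) + v1 (fst z) (snd z)"
      using wv AE_space
    proof eventually_elim
      case (elim z)
      have "z \<in> \<Omega> \<times> unit_cell" using elim(2) by simp
      with eq have "w z = g0 (fst z) + v1 (fst z) (snd z)" by blast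
      then show ?case using elim(1) by simp
    qed
    ultimately show "\<exists>v0 g0 v1. W1p \<Omega> p v0 g0
       \<and> Lp_fun (lebesgue_on (\<Omega> \<times> unit_cell)) p (\<lambda>z. v1 (fst z) (snd z))
       \<and> (AE x in lebesgue_on \<Omega>. v1 x \<in> G_R p R)
       \<and> (AE z in lebesgue_on (\<Omega> \<times> unit_cell). v (fst z) (snd z) = g0 (fst z) + v1 (fst z) (snd z))" by blast
  next
    assume "\<exists>v0 g0 v1. W1p \<Omega> p v0 g0
       \<and> Lp_fun (lebesgue_on (\<Omega> \<times> unit_cell)) p (\<lambda>z. v1 (fst z) (snd z))
       \<and> (AE x in lebesgue_on \<Omega>. v1 x \<in> G_R p R)
       \<and> (AE z in lebesgue_on (\<Omega> \<times> unit_cell). v (fst z) (snd z) = g0 (fst z) + v1 (fst z) (snd z))"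
    then obtain v0 g0 v1 where v0: "W1p \<Omega> p v0 g0" and v1L: "Lp_fun (lebesgue_on (\<Omega> \<times> unit_cell)) p (\<lambda>z. v1 (fst z) (snd z))"
      and v1G: "AE x in lebesgue_on \<Omega>. v1 x \<in> G_R p R"
      and eq: "AE z in lebesgue_on (\<Omega> \<times> unit_cell). v (fst z) (snd z) = g0 (fst z) + v1 (fst z) (snd z)" by (elim exE conjE) rule
    obtain w1 where w1: "product_Lp w1" and "AE z in lebesgue_on (\<Omega> \<times> unit_cell). v1 (fst z) (snd z) = w1 z" and v1w1: "AE x in lebesgue_on \<Omega>. AE y in lebesgue_on unit_cell. v1 x y = w1 (x, y)"
      using product_Lp_representative[OF v1L] .
    have capp: "corrector_approximable w1"
      by (rule moments_parallel_corrector_approximable[OF w1 G_R_moments[OF w1 v1G v1w1]])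
    obtain u g where ug: "\<And>j. W1p \<Omega> p (u j) (g j)" "\<exists>C. \<forall>j. W1p_norm_pow \<Omega> p (u j) (g j) \<le> C"
      and lim: "\<And>\<phi>. two_scale_test \<Omega> (p / (p - 1)) \<phi> \<Longrightarrow>
       (\<lambda>j. LINT x|lebesgue_on \<Omega>. g j x \<bullet> apply_bcontfun (\<phi> x) (fast j x)) \<longlonglongrightarrow>
       (LINT x|lebesgue_on \<Omega>. LINT y|cell_measure. g0 x \<bullet> apply_bcontfun (\<phi> x) y) + (LINT z|(lebesgue_on \<Omega> \<Otimes>\<^sub>M cell_measure). w1 z \<bullet> apply_bcontfun (\<phi> (fst z)) (snd z))"
      using sufficiency[OF capp v0] by blast
    \<comment> \<open>The decomposition holds almost everywhere on the product set; for almost every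
      \<open>x\<close> it becomes an identity between slices of the Borel representatives for almost
      every \<open>y\<close>.\<close>
    have slices: "AE x in lebesgue_on \<Omega>. AE y in cell_measure. w (x, y) = g0 x + w1 (x, y)"
      using wv' v1w1 AE_lebesgue_on_product[OF eq]
    proof eventually_elim
      case (elim x)
      from elim have "AE y in lebesgue_on unit_cell. w (x, y) = g0 x + w1 (x, y)"
        by eventually_elim simp
      then show ?case by (rule AE_lebesgue_on_cell)
    qed
    \<comment> \<open>The constructed sequence has as its limit a sum of an iterated and a product
      integral. Fubini's theorem joins them, and the identity of slices turns the integrand into
      that of \<open>w\<close>.\<close>
    have "(LINT x|lebesgue_on \<Omega>. LINT y|cell_measure. g0 x \<bullet> apply_bcontfun (\<phi> x) y) + (LINT z|(lebesgue_on \<Omega> \<Otimes>\<^sub>M cell_measure). w1 z \<bullet> apply_bcontfun (\<phi> (fst z)) (snd z))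
       = (LINT x|lebesgue_on \<Omega>. LINT y|cell_measure. w (x, y) \<bullet> apply_bcontfun (\<phi> x) y)"
      if \<phi>: "two_scale_test \<Omega> (p / (p - 1)) \<phi>" for \<phi> :: "real^'n \<Rightarrow> ((real^'m) \<Rightarrow>\<^sub>C (real^'n))"
    proof -
      interpret P: pair_sigma_finite "lebesgue_on \<Omega>" "cell_measure :: (real^'m) measure" by (rule pair_PM)
      let ?\<Phi> = "\<lambda>x. apply_bcontfun (\<phi> x)"
      have g0L: "Lp_fun (lebesgue_on \<Omega>) p g0" using v0 by (simp add: W1p_def)
      note \<phi>L = two_scale_testD(1)[OF \<phi>]
      have \<phi>P: "Lp_fun (lebesgue_on \<Omega> \<Otimes>\<^sub>M (cell_measure :: (real^'m) measure)) (p / (p - 1)) (\<lambda>z. \<phi> (fst z))"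
        using PM_fst(1)[OF Lp_fun_integrable[OF \<phi>L]] measurable_compose[OF fst_PM Lp_fun_measurable[OF \<phi>L]] by (simp add: Lp_fun_def)
      have int: "integrable (lebesgue_on \<Omega> \<Otimes>\<^sub>M cell_measure) (\<lambda>z. h z \<bullet> ?\<Phi> (fst z) (snd z))"
        if h: "Lp_fun (lebesgue_on \<Omega> \<Otimes>\<^sub>M cell_measure) p h" for h
      proof (rule Bochner_Integration.integrable_bound[OF Lp_fun_mult(1)[OF h \<phi>P assms(4)]])
        show "(\<lambda>z. h z \<bullet> ?\<Phi> (fst z) (snd z)) \<in> borel_measurable (lebesgue_on \<Omega> \<Otimes>\<^sub>M cell_measure)"
          by (intro borel_measurable_inner Lp_fun_measurable[OF h] two_scale_test_measurable(2)[OF \<phi>])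
        have "\<bar>h z \<bullet> ?\<Phi> (fst z) (snd z)\<bar> \<le> norm (h z) * norm (\<phi> (fst z))" for z
          by (rule order.trans[OF Cauchy_Schwarz_ineq2]) (intro mult_left_mono norm_bounded norm_ge_zero)
        then show "AE z in lebesgue_on \<Omega> \<Otimes>\<^sub>M cell_measure. norm (h z \<bullet> ?\<Phi> (fst z) (snd z)) \<le> norm (norm (h z) * norm (\<phi> (fst z)))"
          by (intro AE_I2) simp
      qed
      have g0P: "Lp_fun (lebesgue_on \<Omega> \<Otimes>\<^sub>M (cell_measure :: (real^'m) measure)) p (\<lambda>z. g0 (fst z))"
        using PM_fst(1)[OF Lp_fun_integrable[OF g0L]] measurable_compose[OF fst_PM Lp_fun_measurable[OF g0L]] by (simp add: Lp_fun_def)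
      note ig = int[OF g0P] and iw1 = int[OF Lp_fun_product_Lp[OF w1]] and iw = int[OF Lp_fun_product_Lp[OF w]]
      have "(LINT x|lebesgue_on \<Omega>. LINT y|cell_measure. g0 x \<bullet> ?\<Phi> x y) = (LINT z|(lebesgue_on \<Omega> \<Otimes>\<^sub>M (cell_measure :: (real^'m) measure)). g0 (fst z) \<bullet> ?\<Phi> (fst z) (snd z))"
        using P.integral_fst'[OF ig] by simp
      moreover have "(LINT x|lebesgue_on \<Omega>. LINT y|cell_measure. w (x, y) \<bullet> ?\<Phi> x y) = (LINT x|lebesgue_on \<Omega>. LINT y|cell_measure. (g0 x + w1 (x, y)) \<bullet> ?\<Phi> x y)"
      proof (rule integral_cong_AE)
        show "(\<lambda>x. LINT y|cell_measure. w (x, y) \<bullet> ?\<Phi> x y) \<in> borel_measurable (lebesgue_on \<Omega>)"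
          using borel_measurable_integrable[OF P.integrable_fst'[OF iw]] by simp
        show "(\<lambda>x. LINT y|cell_measure. (g0 x + w1 (x, y)) \<bullet> ?\<Phi> x y) \<in> borel_measurable (lebesgue_on \<Omega>)"
          using borel_measurable_integrable[OF P.integrable_fst'[OF Bochner_Integration.integrable_add[OF ig iw1]]] by (simp add: inner_add_left)
        show "AE x in lebesgue_on \<Omega>. (LINT y|cell_measure. w (x, y) \<bullet> ?\<Phi> x y) = (LINT y|cell_measure. (g0 x + w1 (x, y)) \<bullet> ?\<Phi> x y)"
          using slices
        proof eventually_elim
          case (elim x)
          show ?case
          proof (rule integral_cong_AE)
            show "(\<lambda>y. w (x, y) \<bullet> ?\<Phi> x y) \<in> borel_measurable cell_measure"
              by (intro borel_measurable_inner w_slice_measurable[OF w] two_scale_test_measurable(3)[OF \<phi>])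
            show "(\<lambda>y. (g0 x + w1 (x, y)) \<bullet> ?\<Phi> x y) \<in> borel_measurable cell_measure"
              by (intro borel_measurable_inner borel_measurable_add borel_measurable_const w_slice_measurable[OF w1] two_scale_test_measurable(3)[OF \<phi>])
            show "AE y in cell_measure. w (x, y) \<bullet> ?\<Phi> x y = (g0 x + w1 (x, y)) \<bullet> ?\<Phi> x y"
              using elim by eventually_elim simp
          qed
        qed
      qed
      moreover have "(LINT x|lebesgue_on \<Omega>. LINT y|cell_measure. (g0 x + w1 (x, y)) \<bullet> ?\<Phi> x y) =
          (LINT z|(lebesgue_on \<Omega> \<Otimes>\<^sub>M cell_measure). g0 (fst z) \<bullet> ?\<Phi> (fst z) (snd z) + w1 z \<bullet> ?\<Phi> (fst z) (snd z))"
        using P.integral_fst'[OF Bochner_Integration.integrable_add[OF ig iw1]] by (simp add: inner_add_left)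
      ultimately show ?thesis using ig iw1 by simp
    qed
    then have "R_two_scale_conv \<Omega> p R eps g v" unfolding conv_iff using lim by simp
    then show "\<exists>u g. (\<forall>j. W1p \<Omega> p (u j) (g j)) \<and> (\<exists>C. \<forall>j. W1p_norm_pow \<Omega> p (u j) (g j) \<le> C) \<and> R_two_scale_conv \<Omega> p R eps g v"
      using ug by blast
  qed
qed

end
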